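(* Let $p$ be an odd prime and $G$ a non-abelian nested GVZ $p$-group of order at most $p^5$. Then the nilpotency class $c(G)$ of $G$ lies in $\{2,3\}$. Moreover: (1) If $c(G)=2$, let $p^m$ and $p^n$ be the exponents of $G/G'$ and $Z(G)$. Then \[\mathbb{Q}G\cong\bigoplus_{\lambda=0}^{m}a_{p^\lambda}\mathbb{Q}(\zeta_{p^\lambda})\bigoplus_{\lambda=1}^{n}(b_{p^\lambda}-c_{p^\lambda})M_{|G/Z(G)|^{1/2}}(\mathbb{Q}(\zeta_{p^\lambda})),\] where $a_{p^\lambda},b_{p^\lambda},c_{p^\lambda}$ are the numbers of cyclic subgroups of order $p^\lambda$ of $G/G'$, $Z(G)$ and $Z(G)/G'$, respectively. (2) If $c(G)=3$, let $p^m$ be the exponent of $G/G'$. Then \[\mathbb{Q}G\cong\bigoplus_{\lambda=0}^{m}a_{p^\lambda}\mathbb{Q}(\zeta_{p^\lambda})\oplus p\,M_p(\mathbb{Q}(\zeta_p))\oplus M_{p^2}(\mathbb{Q}(\zeta_p)),\] where $a_{p^\lambda}$ is the number of cyclic subgroups of order $p^\lambda$ of $G/G'$.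
   Context: A nested GVZ-group is a group $G$ in which every irreducible complex character $\chi$ vanishes outside $Z(\chi)=\{g:|\chi(g)|=\chi(1)\}$ and the subgroups $Z(\chi)$ are totally ordered by inclusion. $G'$ is the commutator subgroup. $\zeta_m$ is a primitive $m$-th root of unity ($\zeta_1=1$), $M_k(K)$ the $k\times k$ matrix algebra over $K$, $c\,A$ the direct sum of $c$ copies of $A$. *)

theory Defs
  imports "HOL-Algebra.Algebra" "HOL-Computational_Algebra.Polynomial" "Jordan_Normal_Form.Matrix"
begin

definition grp_center :: "('a, 'b) monoid_scheme \<Rightarrow> 'a set" where
  "grp_center G = {z \<in> carrier G. \<forall>g \<in> carrier G. z \<otimes>\<^bsub>G\<^esub> g = g \<otimes>\<^bsub>G\<^esub> z}"

text \<open>Commutator subgroup G' = derived G (carrier G) (HOL-Algebra).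
  Lower central series: gamma_1 = G is lcs G 0, gamma_(i+1) = [gamma_i, G] is lcs G i.\<close>
fun lcs :: "('a, 'b) monoid_scheme \<Rightarrow> nat \<Rightarrow> 'a set" where
  "lcs G 0 = carrier G"
| "lcs G (Suc i) = generate G (\<Union>x \<in> lcs G i. \<Union>y \<in> carrier G.
      {x \<otimes>\<^bsub>G\<^esub> y \<otimes>\<^bsub>G\<^esub> inv\<^bsub>G\<^esub> x \<otimes>\<^bsub>G\<^esub> inv\<^bsub>G\<^esub> y})"

definition nil_class :: "('a, 'b) monoid_scheme \<Rightarrow> nat" where
  "nil_class G = (LEAST c. lcs G c = {\<one>\<^bsub>G\<^esub>})"

definition grp_exponent :: "('a, 'b) monoid_scheme \<Rightarrow> nat" where
  "grp_exponent G = (LEAST e. 0 < e \<and> (\<forall>x \<in> carrier G. x [^]\<^bsub>G\<^esub> e = \<one>\<^bsub>G\<^esub>))"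

definition num_cyclic_subgroups :: "('a, 'b) monoid_scheme \<Rightarrow> nat \<Rightarrow> nat" where
  "num_cyclic_subgroups K k =
     card {H. (\<exists>x \<in> carrier K. H = generate K {x}) \<and> card H = k}"

definition mat_trace :: "complex mat \<Rightarrow> complex" where
  "mat_trace A = (\<Sum>i < dim_row A. A $$ (i, i))"

definition is_rep :: "('a, 'b) monoid_scheme \<Rightarrow> nat \<Rightarrow> ('a \<Rightarrow> complex mat) \<Rightarrow> bool" where
  "is_rep G d \<rho> \<longleftrightarrow>
     (\<forall>g \<in> carrier G. \<rho> g \<in> carrier_mat d d) \<and>
     (\<forall>g \<in> carrier G. \<forall>h \<in> carrier G. \<rho> (g \<otimes>\<^bsub>G\<^esub> h) = \<rho> g * \<rho> h) \<and>
     \<rho> \<one>\<^bsub>G\<^esub> = 1\<^sub>m d"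

definition invariant_subspace :: "('a, 'b) monoid_scheme \<Rightarrow> nat \<Rightarrow> ('a \<Rightarrow> complex mat) \<Rightarrow> complex vec set \<Rightarrow> bool" where
  "invariant_subspace G d \<rho> W \<longleftrightarrow>
     W \<subseteq> carrier_vec d \<and> 0\<^sub>v d \<in> W \<and>
     (\<forall>v \<in> W. \<forall>w \<in> W. v + w \<in> W) \<and>
     (\<forall>c. \<forall>v \<in> W. c \<cdot>\<^sub>v v \<in> W) \<and>
     (\<forall>g \<in> carrier G. \<forall>v \<in> W. \<rho> g *\<^sub>v v \<in> W)"

definition irreducible_rep :: "('a, 'b) monoid_scheme \<Rightarrow> nat \<Rightarrow> ('a \<Rightarrow> complex mat) \<Rightarrow> bool" where
  "irreducible_rep G d \<rho> \<longleftrightarrow> is_rep G d \<rho> \<and> 0 < d \<and>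
     (\<forall>W. invariant_subspace G d \<rho> W \<longrightarrow> W = {0\<^sub>v d} \<or> W = carrier_vec d)"

definition irr_chars :: "('a, 'b) monoid_scheme \<Rightarrow> ('a \<Rightarrow> complex) set" where
  "irr_chars G = {\<chi>. \<exists>d \<rho>. irreducible_rep G d \<rho> \<and>
       \<chi> = (\<lambda>g. if g \<in> carrier G then mat_trace (\<rho> g) else 0)}"

definition char_center :: "('a, 'b) monoid_scheme \<Rightarrow> ('a \<Rightarrow> complex) \<Rightarrow> 'a set" where
  "char_center G \<chi> = {g \<in> carrier G. cmod (\<chi> g) = cmod (\<chi> \<one>\<^bsub>G\<^esub>)}"

definition nested_GVZ :: "('a, 'b) monoid_scheme \<Rightarrow> bool" where
  "nested_GVZ G \<longleftrightarrow>
     (\<forall>\<chi> \<in> irr_chars G. \<forall>g \<in> carrier G - char_center G \<chi>. \<chi> g = 0) \<and>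
     (\<forall>\<chi> \<in> irr_chars G. \<forall>\<psi> \<in> irr_chars G.
        char_center G \<chi> \<subseteq> char_center G \<psi> \<or> char_center G \<psi> \<subseteq> char_center G \<chi>)"

definition group_alg :: "('a, 'b) monoid_scheme \<Rightarrow> ('a \<Rightarrow> rat) set" where
  "group_alg G = {f. \<forall>x. x \<notin> carrier G \<longrightarrow> f x = 0}"

definition ga_mult :: "('a, 'b) monoid_scheme \<Rightarrow> ('a \<Rightarrow> rat) \<Rightarrow> ('a \<Rightarrow> rat) \<Rightarrow> ('a \<Rightarrow> rat)" where
  "ga_mult G f h = (\<lambda>x. if x \<in> carrier G
      then (\<Sum>y \<in> carrier G. f y * h (inv\<^bsub>G\<^esub> y \<otimes>\<^bsub>G\<^esub> x)) else 0)"

definition zeta :: "nat \<Rightarrow> complex" where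
  "zeta m = cis (2 * pi / real m)"

definition cyclo_field :: "nat \<Rightarrow> complex set" where
  "cyclo_field m = {x. \<exists>q :: rat poly. x = poly (map_poly of_rat q) (zeta m)}"

text \<open>A block (k, m) stands for M_k(Q(zeta_m)); a list of blocks stands for their direct sum,
  whose elements are lists of matrices with componentwise operations.\<close>
definition block_sum :: "(nat \<times> nat) list \<Rightarrow> complex mat list set" where
  "block_sum bs = {As. length As = length bs \<and>
     (\<forall>i < length bs. As ! i \<in> carrier_mat (fst (bs ! i)) (fst (bs ! i)) \<and>
        (\<forall>r < fst (bs ! i). \<forall>s < fst (bs ! i). As ! i $$ (r, s) \<in> cyclo_field (snd (bs ! i))))}"

definition QG_iso_blocks :: "('a, 'b) monoid_scheme \<Rightarrow> (nat \<times> nat) list \<Rightarrow> bool" where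
  "QG_iso_blocks G bs \<longleftrightarrow> (\<exists>\<phi>. bij_betw \<phi> (group_alg G) (block_sum bs) \<and>
     (\<forall>f \<in> group_alg G. \<forall>h \<in> group_alg G.
        \<phi> (\<lambda>x. f x + h x) = map2 (+) (\<phi> f) (\<phi> h) \<and>
        \<phi> (ga_mult G f h) = map2 (*) (\<phi> f) (\<phi> h)) \<and>
     (\<forall>q. \<forall>f \<in> group_alg G. \<phi> (\<lambda>x. q * f x) = map (\<lambda>A. of_rat q \<cdot>\<^sub>m A) (\<phi> f)))"

end

theory Submission
  imports Defs "HOL-Number_Theory.Totient" "Jordan_Normal_Form.Char_Poly" "HOL-Computational_Algebra.Polynomial_Factorial"
begin

text \<open>Representations over cyclotomic fields whose squared degrees, weighted by the field degrees, add up to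
  \<open>|G|\<close> and whose traced characters, weighted by the degrees, add up to the regular character
  define an isomorphism from \<open>\<rat>G\<close> onto the corresponding sum of matrix blocks. The linear characters of \<open>G/G'\<close> and the characters of
  \<open>Z(G)\<close> that are nontrivial on \<open>G' \<inter> Z(G)\<close>, taken up to Galois conjugacy, provide them: each of the latter
  extends, without enlarging its field of values, to a subgroup from which the extension induces a
  character vanishing outside \<open>Z(G)\<close>. In class three the remaining blocks come from \<open>G/Z(G)\<close>.

  That the groups have the required shape follows from two facts: the nested GVZ property passes to
  quotients, and it forces a nonabelian \<open>p\<close>-group with an abelian subgroup of index \<open>p\<close> to have
  center of index \<open>p\<^sup>2\<close>. Hence either \<open>G'\<close> is central of order \<open>p\<close> and \<open>G/Z(G)\<close> has order \<open>p\<^sup>2\<close> or \<open>p\<^sup>4\<close>,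
  or \<open>|G| = p\<^sup>5\<close>, \<open>|Z(G)| = p\<close> and \<open>G/Z(G)\<close> is of the former kind with center of order \<open>p\<^sup>2\<close>.\<close>

section \<open>Irreducibility of cyclotomic polynomials of prime power order\<close>

text \<open>\<open>QG_iso_blocks\<close> asks for an explicit bijection, so Wedderburn theory is
  replaced by a count. The regular character recovers each coefficient of an element of the group
  algebra from the traces of its images, which gives injectivity; the target has rational dimension
  equal to the sum of \<open>k^2 * totient m\<close>, so injectivity forces surjectivity. This needs
  the exact degree of the cyclotomic field over the rationals and a well-defined field trace, hence
  the irreducibility proved here. The obstacle is rationality: a character with values in a
  cyclotomic field must be afforded by matrices over that very field. For \<open>p = 2\<close> this
  fails, since the rational group algebra of the quaternion group contains a division algebra;
  oddness enters where a \<open>p\<close>-th root of a character value has to be found in the same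
  field. The numbers of blocks of degree \<open>p\<close> and \<open>p^2\<close> in class three
  count Galois orbits of length \<open>p - 1\<close> on sets of \<open>p^2 - p\<close> and
  \<open>p - 1\<close> central characters.\<close>

lemma eisenstein_factor:
  fixes f g h :: "int poly" and p :: int
  assumes p: "Factorial_Ring.prime p" and f: "f = g * h"
    and lead: "Polynomial.lead_coeff f = 1"
    and dvd: "\<And>i. i < Polynomial.degree f \<Longrightarrow> p dvd Polynomial.coeff f i"
    and h0: "\<not> p dvd Polynomial.coeff h 0"
  shows "Polynomial.degree h = 0"
proof -
  have nz: "f \<noteq> 0" "g \<noteq> 0" "h \<noteq> 0" using lead f by auto
  have "Polynomial.lead_coeff g * Polynomial.lead_coeff h = 1"
    using lead f by (simp add: lead_coeff_mult)
  then have "\<not> p dvd Polynomial.lead_coeff g"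
    by (metis dvd_mult2 not_prime_unit p)
  \<comment> \<open>The lowest coefficient of \<open>g\<close> not divisible by \<open>p\<close>.
    Modulo \<open>p\<close>, coefficient \<open>i\<close> of \<open>f\<close> reduces to the nonzero
    product of this coefficient with \<open>coeff h 0\<close>, so \<open>i\<close> is not below the
    degree of \<open>f\<close>; as \<open>i \<le> degree g\<close>, nothing is left for the degree
    of \<open>h\<close>.\<close>
  then obtain i where i: "\<not> p dvd Polynomial.coeff g i" "\<And>j. j < i \<Longrightarrow> p dvd Polynomial.coeff g j"
    using exists_least_iff[of "\<lambda>i. \<not> p dvd Polynomial.coeff g i"] by auto
  have "i \<le> Polynomial.degree g" using i(1) by (metis dvd_0_right le_degree)
  have "Polynomial.coeff f i = (\<Sum>j<i. Polynomial.coeff g j * Polynomial.coeff h (i - j)) + Polynomial.coeff g i * Polynomial.coeff h 0"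
    by (simp add: f coeff_mult lessThan_Suc_atMost[symmetric])
  moreover have "p dvd (\<Sum>j<i. Polynomial.coeff g j * Polynomial.coeff h (i - j))"
    by (intro dvd_sum) (auto intro: i(2) dvd_mult2)
  moreover have "\<not> p dvd Polynomial.coeff g i * Polynomial.coeff h 0"
    using p i(1) h0 prime_dvd_mult_iff by blast
  ultimately have "\<not> p dvd Polynomial.coeff f i" by (simp add: dvd_add_right_iff)
  then have "Polynomial.degree f \<le> i" using dvd not_le by blast
  moreover have "Polynomial.degree f = Polynomial.degree g + Polynomial.degree h"
    using nz by (simp add: f degree_mult_eq)
  ultimately show ?thesis using \<open>i \<le> Polynomial.degree g\<close> by simp
qed

text \<open>Since \<open>p^2\<close> does not divide the product of the two constant coefficients,
  \<open>p\<close> misses one of them, and \<open>eisenstein_factor\<close> applies to the factor it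
  belongs to, after exchanging \<open>g\<close> and \<open>h\<close> if necessary.\<close>

lemma eisenstein:
  fixes f g h :: "int poly" and p :: int
  assumes p: "Factorial_Ring.prime p" and f: "f = g * h"
    and lead: "Polynomial.lead_coeff f = 1"
    and dvd: "\<And>i. i < Polynomial.degree f \<Longrightarrow> p dvd Polynomial.coeff f i"
    and sq: "\<not> p\<^sup>2 dvd Polynomial.coeff f 0"
  shows "Polynomial.degree g = 0 \<or> Polynomial.degree h = 0"
proof -
  have "\<not> (p dvd Polynomial.coeff g 0 \<and> p dvd Polynomial.coeff h 0)"
    using sq by (auto simp: f coeff_mult power2_eq_square intro: mult_dvd_mono)
  then show ?thesis
    using eisenstein_factor[OF p f lead dvd] eisenstein_factor[OF p, of f h g] f lead dvd
    by (auto simp: mult.commute)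
qed

text \<open>Gauss's lemma: contents multiply, so the content of \<open>h\<close> is \<open>c\<close>
  up to sign and can be cancelled. This removes the multiplier that pseudo-division over the
  integers introduces.\<close>

lemma primitive_int_factor:
  fixes f q h :: "int poly"
  assumes "Polynomial.smult c f = q * h" "c \<noteq> 0" "content f = 1" "content q = 1"
  shows "\<exists>h'. f = q * h'"
proof -
  have "content h = normalize c"
    using arg_cong[OF assms(1), of content] assms(3,4) by (simp add: content_mult)
  then have "c dvd content h" by simp
  then obtain h' where "h = Polynomial.smult c h'"
    by (auto simp: const_poly_dvd_iff_dvd_content[symmetric] elim!: dvdE)
  then have "Polynomial.smult c f = Polynomial.smult c (q * h')" using assms(1) by simp
  then show ?thesis using assms(2) by (metis smult_cancel)
qed

section \<open>Frobenius congruences modulo \<open>p\<close>\<close>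

lemma poly_cong_mod_pow:
  fixes a b c :: "int poly"
  assumes "c dvd a - b"
  shows "c dvd a ^ n - b ^ n"
proof (induction n)
  case (Suc n)
  have "a ^ Suc n - b ^ Suc n = (a - b) * a ^ n + b * (a ^ n - b ^ n)" by (simp add: algebra_simps)
  then show ?case using assms Suc by (simp add: dvd_add)
qed simp

lemma freshman_dream:
  fixes a b :: "int poly"
  assumes p: "Factorial_Ring.prime (p::nat)"
  shows "of_nat p dvd (a + b) ^ p - (a ^ p + b ^ p)"
proof -
  have p0: "p > 0" using p prime_gt_0_nat by blast
  have "(a + b) ^ p = (\<Sum>k\<le>p. of_nat (p choose k) * a ^ k * b ^ (p - k))" by (rule binomial_ring)
  also have "{..p} = insert 0 (insert p {0<..<p})" using p0 by auto
  also have "(\<Sum>k\<in>insert 0 (insert p {0<..<p}). of_nat (p choose k) * a ^ k * b ^ (p - k))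
    = b ^ p + a ^ p + (\<Sum>k\<in>{0<..<p}. of_nat (p choose k) * a ^ k * b ^ (p - k))"
    using p0 by simp
  finally have "(a + b) ^ p - (a ^ p + b ^ p) = (\<Sum>k\<in>{0<..<p}. of_nat (p choose k) * a ^ k * b ^ (p - k))"
    by simp
  moreover have "of_nat p dvd (of_nat (p choose k) :: int poly)" if "k \<in> {0<..<p}" for k
  proof -
    have "p dvd p choose k" using that p by (intro dvd_choose_prime) auto
    then obtain c where "p choose k = p * c" by blast
    then show ?thesis by simp
  qed
  ultimately show ?thesis by (auto intro!: dvd_sum dvd_mult2)
qed

text \<open>Each step raises the previous congruence to the \<open>p\<close>-th power and applies
  \<open>freshman_dream\<close> once more. It supplies the divisibility of the lower coefficients in
  Eisenstein's criterion after the shift \<open>X -> X + 1\<close>.\<close>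

lemma freshman_dream_X:
  assumes p: "Factorial_Ring.prime (p::nat)"
  shows "of_nat p dvd [:1, 1:] ^ (p ^ k) - (Polynomial.monom 1 (p ^ k) + 1 :: int poly)"
proof (induction k)
  case 0
  then show ?case by (simp add: Polynomial.monom_altdef one_pCons)
next
  case (Suc k)
  let ?m = "Polynomial.monom 1 (p ^ k) :: int poly"
  have "of_nat p dvd ([:1, 1:] ^ (p ^ k)) ^ p - (?m + 1) ^ p"
    using Suc by (rule poly_cong_mod_pow)
  moreover have "of_nat p dvd (?m + 1) ^ p - (?m ^ p + 1 ^ p)"
    using p by (rule freshman_dream)
  ultimately have "of_nat p dvd (([:1, 1:] ^ (p ^ k)) ^ p - (?m + 1) ^ p) + ((?m + 1) ^ p - (?m ^ p + 1 ^ p))"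
    by (rule dvd_add)
  then have "of_nat p dvd ([:1, 1:] ^ (p ^ k)) ^ p - (?m ^ p + 1)" by (simp only: diff_add_cancel add_diff_eq power_one)
  then show ?case
    by (simp only: power_mult[symmetric] Polynomial.monom_power power_one power_Suc mult.commute[of "p ^ k"])
qed

text \<open>The \<open>p^l\<close>-th cyclotomic polynomial, as the geometric sum for
  \<open>(X^(p^l) - 1) / (X^(p^(l-1)) - 1)\<close>. For \<open>l = 0\<close> it is
  \<open>X - 1\<close>, given separately because \<open>l - 1\<close> is truncated there and the sum
  would be a different polynomial.\<close>

definition cyc_poly :: "nat \<Rightarrow> nat \<Rightarrow> int poly" where
  "cyc_poly p l = (if l = 0 then [:-1, 1:] else (\<Sum>i<p. Polynomial.monom 1 (i * p ^ (l - 1))))"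

lemma totient_prime_power_pos:
  assumes "Factorial_Ring.prime (p::nat)" "l > 0"
  shows "totient (p ^ l) + p ^ (l - 1) = p ^ l"
proof -
  have "totient (p ^ l) = p ^ (l - 1) * (p - 1)" using assms by (simp add: totient_prime_power)
  moreover have "p > 0" using assms prime_gt_0_nat by blast
  ultimately show ?thesis using assms(2)
    by (cases l) (auto simp: algebra_simps)
qed

lemma cyc_poly_mult:
  assumes "l > 0"
  shows "cyc_poly p l * (Polynomial.monom 1 (p ^ (l - 1)) - 1) = Polynomial.monom 1 (p ^ l) - 1"
proof -
  let ?x = "Polynomial.monom 1 (p ^ (l - 1)) :: int poly"
  have "cyc_poly p l = (\<Sum>i<p. ?x ^ i)" using assms
    by (simp add: cyc_poly_def Polynomial.monom_power mult.commute)
  then have "cyc_poly p l * (?x - 1) = ?x ^ p - 1" by (simp add: power_diff_1_eq mult.commute)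
  also have "?x ^ p = Polynomial.monom 1 (p ^ l)" using assms
    by (cases l) (simp_all add: Polynomial.monom_power mult.commute)
  finally show ?thesis .
qed

lemma degree_monom_minus_one:
  assumes "n > 0"
  shows "Polynomial.degree (Polynomial.monom 1 n - 1 :: int poly) = n"
    and "Polynomial.lead_coeff (Polynomial.monom 1 n - 1 :: int poly) = 1"
proof -
  have "Polynomial.degree (- 1 + Polynomial.monom 1 n :: int poly) = Polynomial.degree (Polynomial.monom 1 n :: int poly)"
    using assms by (intro degree_add_eq_right) (simp add: Polynomial.degree_monom_eq)
  then show d: "Polynomial.degree (Polynomial.monom 1 n - 1 :: int poly) = n"
    by (simp add: Polynomial.degree_monom_eq)
  show "Polynomial.lead_coeff (Polynomial.monom 1 n - 1 :: int poly) = 1"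
    unfolding d using assms by (simp add: one_pCons coeff_pCons split: nat.split)
qed

lemma cyc_poly_monic:
  assumes p: "Factorial_Ring.prime (p::nat)"
  shows "Polynomial.degree (cyc_poly p l) = totient (p ^ l)" and "Polynomial.lead_coeff (cyc_poly p l) = 1"
proof -
  have p0: "p > 0" using p prime_gt_0_nat by blast
  have "Polynomial.degree (cyc_poly p l) = totient (p ^ l) \<and> Polynomial.lead_coeff (cyc_poly p l) = 1"
  proof (cases "l = 0")
    case False
    then have l: "l > 0" by simp
    have pos: "p ^ (l - 1) > 0" "p ^ l > 0" using p0 by simp_all
    note m = cyc_poly_mult[OF l, of p]
    have nz: "cyc_poly p l \<noteq> 0" using m degree_monom_minus_one(1)[OF pos(2)] pos(2) by auto
    have nz': "Polynomial.monom 1 (p ^ (l - 1)) - (1 :: int poly) \<noteq> 0" using degree_monom_minus_one(1)[OF pos(1)] pos(1)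
      by (metis degree_0 less_irrefl)
    have "Polynomial.degree (cyc_poly p l) + p ^ (l - 1) = p ^ l"
      using arg_cong[OF m, of Polynomial.degree] degree_monom_minus_one(1)[OF pos(1)] degree_monom_minus_one(1)[OF pos(2)]
        degree_mult_eq[OF nz nz'] by simp
    moreover have "Polynomial.lead_coeff (cyc_poly p l) = 1"
      using arg_cong[OF m, of Polynomial.lead_coeff] degree_monom_minus_one(2)[OF pos(1)] degree_monom_minus_one(2)[OF pos(2)]
      by (simp only: lead_coeff_mult mult_1_right)
    ultimately show ?thesis using totient_prime_power_pos[OF p l] by simp
  qed (simp add: cyc_poly_def)
  then show "Polynomial.degree (cyc_poly p l) = totient (p ^ l)" and "Polynomial.lead_coeff (cyc_poly p l) = 1"
    by auto
qed

text \<open>Eisenstein's criterion after \<open>X -> X + 1\<close>. Shifting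
  \<open>cyc_poly_mult\<close> and applying the Frobenius congruences gives
  \<open>F * X^P = X^(p^l)\<close> modulo \<open>p\<close>, so \<open>F\<close> is a power of
  \<open>X\<close> modulo \<open>p\<close>; its constant coefficient is the value \<open>p\<close>
  of the cyclotomic polynomial at 1.\<close>

lemma cyc_poly_factor:
  assumes p: "Factorial_Ring.prime (p::nat)" and l: "l > 0" and fac: "cyc_poly p l = g * h"
  shows "Polynomial.degree g = 0 \<or> Polynomial.degree h = 0"
proof -
  define P where "P = p ^ (l - 1)"
  define F where "F = cyc_poly p l \<circ>\<^sub>p [:1, 1:]"
  have p0: "p > 0" using p prime_gt_0_nat by blast
  have pl: "p ^ l = p * P" using l by (cases l) (auto simp: P_def)
  have deg: "Polynomial.degree F = totient (p ^ l)"
    by (simp add: F_def cyc_poly_monic(1)[OF p])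
  have dP: "Polynomial.degree F + P = p ^ l"
    using totient_prime_power_pos[OF p l] deg P_def by simp
  have lead: "Polynomial.lead_coeff F = 1"
    unfolding F_def by (subst lead_coeff_comp) (simp_all add: cyc_poly_monic(2)[OF p])
  obtain u where u: "[:1, 1:] ^ P = Polynomial.monom 1 P + 1 + of_nat p * (u :: int poly)"
    using freshman_dream_X[OF p, of "l - 1"] unfolding P_def by (metis dvdE diff_add_cancel add.commute)
  obtain v where v: "[:1, 1:] ^ (p ^ l) = Polynomial.monom 1 (p ^ l) + 1 + of_nat p * (v :: int poly)"
    using freshman_dream_X[OF p, of l] by (metis dvdE diff_add_cancel add.commute)
  have X: "Polynomial.monom 1 n \<circ>\<^sub>p [:1, 1:] = ([:1, 1:] ^ n :: int poly)" for n
    by (simp add: monom_altdef pcompose_smult pcompose_hom.hom_power pcompose_pCons)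
  have "(cyc_poly p l * (Polynomial.monom 1 P - 1)) \<circ>\<^sub>p [:1, 1:] = (Polynomial.monom 1 (p ^ l) - 1) \<circ>\<^sub>p [:1, 1:]"
    using cyc_poly_mult[OF l, of p] P_def by simp
  then have "F * ([:1, 1:] ^ P - 1) = [:1, 1:] ^ (p ^ l) - 1"
    by (simp add: pcompose_mult pcompose_diff X F_def pcompose_1)
  then have "F * Polynomial.monom 1 P = Polynomial.monom 1 (p ^ l) + of_nat p * (v - F * u)"
    unfolding u v by (simp add: algebra_simps)
  \<comment> \<open>Reading off coefficient \<open>i + P\<close> amounts to dividing by
    \<open>X^P\<close>; below the degree of \<open>F\<close> the monomial \<open>X^(p^l)\<close>
    does not contribute, because \<open>degree F + P = p^l\<close>.\<close>
  then have eq: "Polynomial.coeff (F * Polynomial.monom 1 P) (i + P) = Polynomial.coeff (Polynomial.monom 1 (p ^ l) + of_nat p * (v - F * u)) (i + P)" for i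
    by simp
  have dvd: "int p dvd Polynomial.coeff F i" if "i < Polynomial.degree F" for i
  proof -
    have "i + P \<noteq> p ^ l" using that dP by simp
    then have "Polynomial.coeff F i = int p * Polynomial.coeff (v - F * u) (i + P)"
      using eq[of i] by (simp add: mult.commute[of F] coeff_monom_mult of_nat_poly)
    then show ?thesis by simp
  qed
  have "Polynomial.coeff F 0 = poly (cyc_poly p l) 1"
    by (simp add: F_def poly_0_coeff_0[symmetric] poly_pcompose)
  also have "\<dots> = int p" using l by (simp add: cyc_poly_def poly_sum poly_monom)
  finally have F0: "Polynomial.coeff F 0 = int p" .
  have pp: "Factorial_Ring.prime (int p)" using p by simp
  have "\<not> (int p)\<^sup>2 dvd int p"
    using p by (metis F0 not_prime_unit power2_eq_square pp prime_gt_0_int dvd_mult_cancel_left mult.right_neutral mult_cancel_left less_irrefl)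
  then have "Polynomial.degree (g \<circ>\<^sub>p [:1, 1:]) = 0 \<or> Polynomial.degree (h \<circ>\<^sub>p [:1, 1:]) = 0"
    using pp lead dvd F0
    by (intro eisenstein[of "int p" F]) (simp_all add: F_def fac pcompose_mult)
  then show ?thesis by simp
qed

text \<open>A nonzero integer polynomial of least degree with root \<open>x\<close> divides a
  constant multiple of the cyclotomic polynomial, since the pseudo-remainder also vanishes at
  \<open>x\<close>. Passing to the primitive part removes the constant, and
  \<open>cyc_poly_factor\<close> leaves only the full degree.\<close>

lemma int_poly_min_degree:
  fixes x :: complex
  assumes p: "Factorial_Ring.prime (p::nat)" and l: "l > 0"
    and root: "poly (map_poly of_int (cyc_poly p l)) x = 0"
    and f: "poly (map_poly of_int f) x = 0" "f \<noteq> 0"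
  shows "totient (p ^ l) \<le> Polynomial.degree f"
proof -
  let ?S = "\<lambda>f :: int poly. f \<noteq> 0 \<and> poly (map_poly of_int f) x = 0"
  obtain q0 where q0: "?S q0" "\<And>g. ?S g \<Longrightarrow> Polynomial.degree q0 \<le> Polynomial.degree g"
    using ex_has_least_nat[of ?S f Polynomial.degree] f by blast
  define q where "q = primitive_part q0"
  have q0q: "q0 = Polynomial.smult (content q0) q" by (simp add: q_def)
  have c0: "content q0 \<noteq> 0" using q0(1) by simp
  have q: "q \<noteq> 0" "content q = 1" using q0(1) by (auto simp: q_def)
  have dq: "Polynomial.degree q = Polynomial.degree q0" by (simp add: q_def)
  have "poly (map_poly of_int q0) x = of_int (content q0) * poly (map_poly of_int q) x"
    by (subst q0q) (simp add: hom_distribs)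
  then have qx: "poly (map_poly of_int q) x = 0" using q0(1) c0 by simp
  obtain a h where ah: "a \<noteq> 0" "Polynomial.smult a (cyc_poly p l) = q * h + pseudo_mod (cyc_poly p l) q"
    using pseudo_mod(1)[OF q(1)] by blast
  have "poly (map_poly of_int (Polynomial.smult a (cyc_poly p l))) x = poly (map_poly of_int (q * h + pseudo_mod (cyc_poly p l) q)) x"
    using ah(2) by simp
  then have "poly (map_poly of_int (pseudo_mod (cyc_poly p l) q)) x = 0"
    using root qx by (simp add: hom_distribs)
  then have "pseudo_mod (cyc_poly p l) q = 0"
    using pseudo_mod(2)[OF q(1), of "cyc_poly p l"] q0(2)[of "pseudo_mod (cyc_poly p l) q"] dq
    by (metis not_le)
  then have sm: "Polynomial.smult a (cyc_poly p l) = q * h" using ah by simp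
  have "content (cyc_poly p l) dvd 1"
    using content_dvd_coeff[of "cyc_poly p l" "Polynomial.degree (cyc_poly p l)"] cyc_poly_monic(2)[OF p, of l] by simp
  then have "content (cyc_poly p l) = 1" by (metis is_unit_normalize normalize_content)
  then obtain h' where h': "cyc_poly p l = q * h'"
    using primitive_int_factor[OF sm ah(1) _ q(2)] by blast
  have "Polynomial.degree q \<noteq> 0"
  proof
    assume "Polynomial.degree q = 0"
    then obtain c where "q = [:c:]" by (rule degree_eq_zeroE)
    then show False using qx q(1) by simp
  qed
  then have "Polynomial.degree h' = 0" using cyc_poly_factor[OF p l h'] by simp
  moreover have "h' \<noteq> 0" using h' cyc_poly_monic(2)[OF p, of l] by auto
  ultimately have "totient (p ^ l) = Polynomial.degree q"
    using cyc_poly_monic(1)[OF p, of l] h' q(1) by (simp add: degree_mult_eq)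
  then show ?thesis using q0(2)[of f] f dq by simp
qed

lemma rat_poly_clear_denominators:
  fixes q :: "rat poly"
  shows "\<exists>(c::int) f. c \<noteq> 0 \<and> map_poly of_int f = Polynomial.smult (of_int c) q"
proof (induction q)
  case 0
  have "map_poly of_int 0 = Polynomial.smult (of_int 1) (0 :: rat poly)" by simp
  then show ?case by (metis one_neq_zero)
next
  case (pCons a q)
  then obtain c f where cf: "c \<noteq> 0" "map_poly of_int f = Polynomial.smult (of_int c) q" by blast
  obtain x y where xy: "a = of_int x / of_int y" "y > 0" 
    by (metis quotient_of_div quotient_of_denom_pos surj_pair)
  have "map_poly of_int (pCons (x * c) (Polynomial.smult y f)) = Polynomial.smult (of_int (c * y)) (pCons a q)"
    using xy cf by (simp add: hom_distribs mult.commute)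
  moreover have "c * y \<noteq> 0" using cf xy by simp
  ultimately show ?case by blast
qed

text \<open>Linear independence over the rationals of the powers of \<open>x\<close> below
  \<open>totient (p^l)\<close>, on which uniqueness of coordinates in the cyclotomic field rests.
  Clearing denominators leads to \<open>int_poly_min_degree\<close>; for \<open>l = 0\<close> the
  polynomial is constant.\<close>

lemma rat_poly_eq_0_if_root:
  fixes x :: complex and q :: "rat poly"
  assumes p: "Factorial_Ring.prime (p::nat)"
    and root: "poly (map_poly of_int (cyc_poly p l)) x = 0"
    and q: "poly (map_poly of_rat q) x = 0" "Polynomial.degree q < totient (p ^ l)"
  shows "q = 0"
proof (rule ccontr)
  assume q0: "q \<noteq> 0"
  obtain c f where cf: "c \<noteq> (0::int)" "map_poly of_int f = Polynomial.smult (of_int c) q"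
    using rat_poly_clear_denominators by blast
  have "Polynomial.degree f = Polynomial.degree (map_poly of_int f :: rat poly)" by simp
  also have "\<dots> = Polynomial.degree q" using cf by simp
  finally have df: "Polynomial.degree f = Polynomial.degree q" .
  have "map_poly of_rat (map_poly of_int f) = (map_poly of_int f :: complex poly)"
    by (intro poly_eqI) simp
  then have "poly (map_poly of_int f) x = (of_rat (of_int c) * poly (map_poly of_rat q) x :: complex)"
    using cf by (metis of_rat_hom.map_poly_hom_smult poly_smult)
  then have fx: "poly (map_poly of_int f) x = 0" using q by simp
  have f0: "f \<noteq> 0" using cf q0 by auto
  show False
  proof (cases "l = 0")
    case True
    then have "Polynomial.degree q = 0" using q by simp
    then obtain c where "q = [:c:]" by (rule degree_eq_zeroE)
    then show False using q(1) q0 by simp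
  next
    case False
    then show False using int_poly_min_degree[OF p _ root fx f0] df q by simp
  qed
qed

section \<open>Coordinates and traces in cyclotomic fields\<close>

interpretation of_rat_poly_hom: map_poly_idom_hom "of_rat :: rat \<Rightarrow> complex" ..

lemma zeta_power: "zeta m ^ k = cis (2 * pi * real k / real m)"
  by (simp add: zeta_def DeMoivre mult_ac)

lemma zeta_power_eq_1_iff:
  assumes "m > 0"
  shows "zeta m ^ k = 1 \<longleftrightarrow> m dvd k"
proof
  assume "zeta m ^ k = 1"
  then have "cos (2 * pi * real k / real m) = 1" unfolding zeta_power by (simp add: complex_eq_iff)
  then obtain n :: int where "2 * pi * real k / real m = of_int n * 2 * pi"
    unfolding cos_one_2pi_int by blast
  then have "real k = of_int n * real m" using assms by (simp add: field_simps)
  then have "int k = n * int m" by (metis of_int_eq_iff of_int_mult of_int_of_nat_eq)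
  then show "m dvd k" by (metis dvd_triv_right int_dvd_int_iff)
next
  assume "m dvd k"
  then obtain c where "k = m * c" by blast
  then have "zeta m ^ k = (zeta m ^ m) ^ c" by (simp add: power_mult)
  moreover have "zeta m ^ m = 1" using assms by (simp add: zeta_power)
  ultimately show "zeta m ^ k = 1" by simp
qed

lemma root_of_unity_eq_zeta_power:
  assumes "m > 0" "x ^ m = 1"
  obtains j where "x = zeta m ^ j"
proof -
  have "x \<in> (\<lambda>k. cis (2 * pi * real k / real m)) ` {..<m}"
    using bij_betw_roots_unity[OF assms(1)] assms(2) by (auto simp: bij_betw_def)
  then show thesis using that by (auto simp: zeta_power)
qed

abbreviation rat_eval :: "rat poly \<Rightarrow> complex \<Rightarrow> complex" where
  "rat_eval q x \<equiv> poly (map_poly of_rat q) x"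

text \<open>For \<open>l > 0\<close> a power of \<open>zeta\<close> with exponent prime to
  \<open>p\<close> is a root of \<open>X^(p^l) - 1\<close> but not of the cofactor
  \<open>X^(p^(l-1)) - 1\<close>. All Galois conjugates are thus roots, so conjugation can be
  defined by evaluating polynomials.\<close>

lemma cyc_poly_zeta_root:
  assumes p: "Factorial_Ring.prime (p::nat)" and j: "coprime j (p ^ l)"
  shows "poly (map_poly of_int (cyc_poly p l)) (zeta (p ^ l) ^ j) = 0"
proof (cases "l = 0")
  case True
  then show ?thesis by (simp add: cyc_poly_def zeta_def)
next
  case False
  then have l: "l > 0" by simp
  have p0: "p > 1" using p prime_gt_1_nat by blast
  let ?x = "zeta (p ^ l) ^ j"
  have "poly (map_poly of_int (cyc_poly p l * (Polynomial.monom 1 (p ^ (l - 1)) - 1))) ?x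
    = poly (map_poly of_int (Polynomial.monom 1 (p ^ l) - 1)) ?x"
    by (simp only: cyc_poly_mult[OF l, of p])
  then have eq: "poly (map_poly of_int (cyc_poly p l)) ?x * (?x ^ (p ^ (l - 1)) - 1) = ?x ^ (p ^ l) - 1"
    by (simp add: hom_distribs poly_monom)
  have "?x ^ (p ^ l) = 1" using p0 by (simp add: power_mult[symmetric] zeta_power_eq_1_iff)
  moreover have "?x ^ (p ^ (l - 1)) \<noteq> 1"
  proof
    assume "?x ^ (p ^ (l - 1)) = 1"
    then have "p ^ l dvd j * p ^ (l - 1)" using p0 by (simp add: power_mult[symmetric] zeta_power_eq_1_iff)
    then have "p ^ l dvd p ^ (l - 1)" using j by (metis coprime_commute coprime_dvd_mult_right_iff)
    then show False using p0 l by (metis diff_less less_one nat_dvd_not_less not_gr_zero power_strict_increasing zero_less_power less_trans)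
  qed
  ultimately show ?thesis using eq by simp
qed

lemma zeta_in_cyclo_field: "zeta m ^ j \<in> cyclo_field m"
  unfolding cyclo_field_def by (intro CollectI exI[of _ "Polynomial.monom 1 j"]) (simp add: poly_monom)

lemma cyclo_field_add: "x \<in> cyclo_field m \<Longrightarrow> y \<in> cyclo_field m \<Longrightarrow> x + y \<in> cyclo_field m"
  unfolding cyclo_field_def
  by (clarsimp, rule_tac x="q + qa" in exI) (simp add: hom_distribs)

lemma cyclo_field_mult: "x \<in> cyclo_field m \<Longrightarrow> y \<in> cyclo_field m \<Longrightarrow> x * y \<in> cyclo_field m"
  unfolding cyclo_field_def
  by (clarsimp, rule_tac x="q * qa" in exI) (simp add: hom_distribs)

lemma cyclo_field_of_rat: "of_rat c \<in> cyclo_field m"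
  unfolding cyclo_field_def by (intro CollectI exI[of _ "[:c:]"]) (simp add: hom_distribs)

lemma cyclo_field_0: "0 \<in> cyclo_field m"
  using cyclo_field_of_rat[of 0] by simp

lemma cyclo_field_sum: "(\<And>i. i \<in> I \<Longrightarrow> f i \<in> cyclo_field m) \<Longrightarrow> sum f I \<in> cyclo_field m"
  by (induction I rule: infinite_finite_induct) (auto intro: cyclo_field_add cyclo_field_0)

text \<open>Coordinates in the power basis of the cyclotomic field, kept as a polynomial so that its
  value at \<open>zeta m ^ j\<close> is a Galois conjugate of \<open>x\<close>.\<close>

definition cyc_coord :: "nat \<Rightarrow> complex \<Rightarrow> rat poly" where
  "cyc_coord m x = (THE q. x = rat_eval q (zeta m) \<and> (q = 0 \<or> Polynomial.degree q < totient m))"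

text \<open>The field trace from the cyclotomic field to the rationals, as the sum of all Galois
  conjugates; the Galois group is indexed by \<open>totatives m\<close>.\<close>

definition cyc_trace :: "nat \<Rightarrow> complex \<Rightarrow> complex" where
  "cyc_trace m x = (\<Sum>j\<in>totatives m. rat_eval (cyc_coord m x) (zeta m ^ j))"

context
  fixes p l m :: nat
  assumes p: "Factorial_Ring.prime p" and m: "m = p ^ l"
begin

lemma totient_pos: "totient m > 0"
  using p m prime_gt_0_nat by (simp add: totient_gt_0_iff)

lemma cyc_coord_unique:
  assumes "Polynomial.degree q < totient m" "Polynomial.degree q' < totient m"
    "rat_eval q (zeta m) = rat_eval q' (zeta m)"
  shows "q = q'"
proof -
  have "rat_eval (q - q') (zeta m) = 0" using assms by (simp add: hom_distribs)
  moreover have "Polynomial.degree (q - q') < totient m" using assms by (metis degree_diff_less)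
  moreover have "poly (map_poly of_int (cyc_poly p l)) (zeta m) = 0"
    using cyc_poly_zeta_root[OF p, of 1 l] m by simp
  ultimately have "q - q' = 0" using rat_poly_eq_0_if_root[OF p] m by blast
  then show ?thesis by simp
qed

lemma cyc_coord_eqI:
  assumes "Polynomial.degree q < totient m" "x = rat_eval q (zeta m)"
  shows "cyc_coord m x = q"
  unfolding cyc_coord_def
proof (rule the_equality)
  fix q' assume "x = rat_eval q' (zeta m) \<and> (q' = 0 \<or> Polynomial.degree q' < totient m)"
  then show "q' = q" using cyc_coord_unique[of q' q] assms totient_pos by auto
qed (use assms in auto)

text \<open>Division by the cyclotomic polynomial turns any polynomial expression into the
  coordinate polynomial and changes no value at a conjugate of \<open>zeta m\<close>. Conjugates and
  traces may therefore be read off from any expression, whatever its degree.\<close>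

lemma cyc_coord_rat_eval:
  obtains r where "r = cyc_coord m (rat_eval q (zeta m))" "Polynomial.degree r < totient m"
    "\<And>j. coprime j m \<Longrightarrow> rat_eval r (zeta m ^ j) = rat_eval q (zeta m ^ j)"
proof -
  define c where "c = (map_poly of_int (cyc_poly p l) :: rat poly)"
  define r where "r = q mod c"
  have c: "Polynomial.degree c = totient m" "c \<noteq> 0"
    using cyc_poly_monic[OF p, of l] totient_pos m by (auto simp: c_def)
  have d: "Polynomial.degree r < totient m"
    using degree_mod_less[OF c(2), of q] c totient_pos unfolding r_def by auto
  have ev: "rat_eval r (zeta m ^ j) = rat_eval q (zeta m ^ j)" if "coprime j m" for j
  proof -
    have "map_poly of_rat c = (map_poly of_int (cyc_poly p l) :: complex poly)"
      unfolding c_def by (intro poly_eqI) simp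
    then have "rat_eval c (zeta m ^ j) = 0" using cyc_poly_zeta_root[OF p] that m by simp
    moreover have "q = q div c * c + r" by (simp add: r_def)
    then have "rat_eval q (zeta m ^ j) = rat_eval (q div c * c + r) (zeta m ^ j)" by simp
    ultimately show ?thesis by (simp add: hom_distribs)
  qed
  have "cyc_coord m (rat_eval q (zeta m)) = r"
    using d ev[of 1] by (intro cyc_coord_eqI) auto
  then show thesis using that d ev by blast
qed

lemma cyc_coord:
  assumes "x \<in> cyclo_field m"
  shows "Polynomial.degree (cyc_coord m x) < totient m" "rat_eval (cyc_coord m x) (zeta m) = x"
proof -
  obtain q where q: "x = rat_eval q (zeta m)" using assms unfolding cyclo_field_def by blast
  show "Polynomial.degree (cyc_coord m x) < totient m" "rat_eval (cyc_coord m x) (zeta m) = x"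
    using cyc_coord_rat_eval[of q] q by (metis coprime_1_left power_one_right)+
qed

lemma cyc_coord_add:
  assumes "x \<in> cyclo_field m" "y \<in> cyclo_field m"
  shows "cyc_coord m (x + y) = cyc_coord m x + cyc_coord m y"
  using cyc_coord[OF assms(1)] cyc_coord[OF assms(2)]
  by (intro cyc_coord_eqI) (auto simp: hom_distribs intro: degree_add_less)

lemma cyc_coord_scale:
  assumes "x \<in> cyclo_field m"
  shows "cyc_coord m (of_rat c * x) = Polynomial.smult c (cyc_coord m x)"
  using cyc_coord[OF assms]
  by (intro cyc_coord_eqI) (use totient_pos in \<open>auto simp: hom_distribs intro: le_less_trans[OF degree_smult_le]\<close>)

lemma cyc_trace_rat_eval: "cyc_trace m (rat_eval q (zeta m)) = (\<Sum>j\<in>totatives m. rat_eval q (zeta m ^ j))"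
proof -
  obtain r where "r = cyc_coord m (rat_eval q (zeta m))"
    "\<And>j. coprime j m \<Longrightarrow> rat_eval r (zeta m ^ j) = rat_eval q (zeta m ^ j)"
    using cyc_coord_rat_eval[of q] by metis
  then show ?thesis unfolding cyc_trace_def by (intro sum.cong) (auto simp: totatives_def)
qed

lemma cyc_trace_add:
  assumes "x \<in> cyclo_field m" "y \<in> cyclo_field m"
  shows "cyc_trace m (x + y) = cyc_trace m x + cyc_trace m y"
  unfolding cyc_trace_def cyc_coord_add[OF assms] by (simp add: hom_distribs sum.distrib)

lemma cyc_trace_scale:
  assumes "x \<in> cyclo_field m"
  shows "cyc_trace m (of_rat c * x) = of_rat c * cyc_trace m x"
  unfolding cyc_trace_def cyc_coord_scale[OF assms] by (simp add: hom_distribs sum_distrib_left)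

lemma cyc_trace_sum:
  assumes "finite I" "\<And>i. i \<in> I \<Longrightarrow> f i \<in> cyclo_field m"
  shows "cyc_trace m (sum f I) = (\<Sum>i\<in>I. cyc_trace m (f i))"
  using assms
proof (induction I rule: finite_induct)
  case empty
  show ?case using cyc_trace_scale[OF cyclo_field_0, of 0] by simp
next
  case (insert i I)
  then show ?case by (simp add: cyc_trace_add cyclo_field_sum)
qed

lemma cyc_trace_root_of_unity:
  assumes "x ^ m = 1"
  shows "cyc_trace m x = (\<Sum>j\<in>totatives m. x ^ j)"
proof -
  have "m > 0" using p m prime_gt_0_nat by simp
  then obtain k where k: "x = zeta m ^ k" using assms by (rule root_of_unity_eq_zeta_power)
  have "cyc_trace m x = (\<Sum>j\<in>totatives m. rat_eval (Polynomial.monom 1 k) (zeta m ^ j))"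
    using cyc_trace_rat_eval[of "Polynomial.monom 1 k"] k by (simp add: poly_monom)
  then show ?thesis by (simp add: k poly_monom power_mult[symmetric] mult.commute)
qed

lemma rat_eval_altdef:
  assumes "Polynomial.degree q < n"
  shows "rat_eval q x = (\<Sum>a<n. of_rat (Polynomial.coeff q a) * x ^ a)"
proof -
  have "rat_eval q x = (\<Sum>a\<le>Polynomial.degree q. of_rat (Polynomial.coeff q a) * x ^ a)"
    by (simp add: poly_altdef)
  also have "\<dots> = (\<Sum>a<n. of_rat (Polynomial.coeff q a) * x ^ a)"
    using assms by (intro sum.mono_neutral_left) (auto simp: coeff_eq_0)
  finally show ?thesis .
qed

lemma cyc_coord_expansion:
  assumes "x \<in> cyclo_field m"
  shows "x = (\<Sum>a<totient m. of_rat (Polynomial.coeff (cyc_coord m x) a) * zeta m ^ a)"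
  using cyc_coord[OF assms] rat_eval_altdef by metis

end

section \<open>Rational group algebras as sums of matrix blocks\<close>

text \<open>A square matrix without kernel is invertible. The index sets stay abstract because the
  unknowns will be indexed by group elements and the equations by rational coordinates of matrix
  entries; enumerations of both sets produce an actual matrix.\<close>

lemma square_system_solvable:
  fixes M :: "'j \<Rightarrow> 'i \<Rightarrow> 'f :: field"
  assumes I: "finite I" and J: "finite J" and card: "card I = card J"
    and inj: "\<And>f. (\<And>j. j \<in> J \<Longrightarrow> (\<Sum>i\<in>I. M j i * f i) = 0) \<Longrightarrow> \<forall>i\<in>I. f i = 0"
  shows "\<exists>f. (\<forall>i. i \<notin> I \<longrightarrow> f i = 0) \<and> (\<forall>j\<in>J. (\<Sum>i\<in>I. M j i * f i) = b j)"
proof -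
  define n where "n = card I"
  obtain e where e: "bij_betw e {0..<n} I" using ex_bij_betw_nat_finite[OF I] n_def by blast
  obtain e' where e': "bij_betw e' {0..<n} J" using ex_bij_betw_nat_finite[OF J] n_def card by metis
  define d where "d = the_inv_into {0..<n} e"
  have de: "d (e c) = c" if "c < n" for c
    using e that by (simp add: d_def the_inv_into_f_f bij_betw_def)
  define A where "A = mat n n (\<lambda>(r, c). M (e' r) (e c))"
  have A: "A \<in> carrier_mat n n" by (simp add: A_def)
  have Av: "(A *\<^sub>v v) $ r = (\<Sum>i\<in>I. M (e' r) i * v $ (d i))" if "v \<in> carrier_vec n" "r < n" for v r
  proof -
    have "(A *\<^sub>v v) $ r = (\<Sum>c\<in>{0..<n}. M (e' r) (e c) * v $ c)"
      using that by (simp add: A_def scalar_prod_def)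
    also have "\<dots> = (\<Sum>c\<in>{0..<n}. M (e' r) (e c) * v $ (d (e c)))"
      by (intro sum.cong) (auto simp: de)
    also have "\<dots> = (\<Sum>i\<in>I. M (e' r) i * v $ (d i))"
      using e by (rule sum.reindex_bij_betw)
    finally show ?thesis .
  qed
  have J_e': "\<exists>r<n. j = e' r" if "j \<in> J" for j
    using e' that by (auto simp: bij_betw_def)
  have "det A \<noteq> 0"
  proof
    assume "det A = 0"
    then obtain v where v: "v \<in> carrier_vec n" "v \<noteq> 0\<^sub>v n" "A *\<^sub>v v = 0\<^sub>v n"
      using det_0_iff_vec_prod_zero_field[OF A] by blast
    have "(\<Sum>i\<in>I. M j i * v $ (d i)) = 0" if "j \<in> J" for j
      using J_e'[OF that] Av[OF v(1)] v(3) by fastforce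
    then have "\<forall>i\<in>I. v $ (d i) = 0" by (rule inj)
    then have "v $ c = 0" if "c < n" for c
      using that e de by (metis atLeastLessThan_iff bij_betwE zero_le)
    then have "v = 0\<^sub>v n" using v(1) by (intro eq_vecI) auto
    then show False using v(2) by simp
  qed
  then obtain B where B: "B \<in> carrier_mat n n" "A * B = 1\<^sub>m n"
    using det_non_zero_imp_unit[OF A] by (auto simp: Units_def ring_mat_def)
  define v where "v = B *\<^sub>v vec n (\<lambda>r. b (e' r))"
  have v: "v \<in> carrier_vec n" using B by (simp add: v_def)
  have "A *\<^sub>v v = vec n (\<lambda>r. b (e' r))"
    unfolding v_def using A B by (simp flip: assoc_mult_mat_vec)
  then have "(\<Sum>i\<in>I. M j i * v $ (d i)) = b j" if "j \<in> J" for j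
    using J_e'[OF that] Av[OF v] by fastforce
  then have "\<forall>j\<in>J. (\<Sum>i\<in>I. M j i * (if i \<in> I then v $ (d i) else 0)) = b j" by simp
  then show ?thesis by (intro exI[of _ "\<lambda>i. if i \<in> I then v $ (d i) else 0"]) simp
qed

definition cyclo_rep :: "('a, 'b) monoid_scheme \<Rightarrow> nat \<Rightarrow> nat \<Rightarrow> ('a \<Rightarrow> complex mat) \<Rightarrow> bool" where
  "cyclo_rep G k m \<rho> \<longleftrightarrow> is_rep G k \<rho> \<and>
     (\<forall>g\<in>carrier G. \<forall>r<k. \<forall>s<k. \<rho> g $$ (r, s) \<in> cyclo_field m)"

lemma mat_trace_mult:
  assumes "A \<in> carrier_mat k k" "B \<in> carrier_mat k k"
  shows "mat_trace (A * B) = (\<Sum>r<k. \<Sum>s<k. A $$ (r, s) * B $$ (s, r))"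
  using assms by (auto simp: mat_trace_def scalar_prod_def atLeast0LessThan intro!: sum.cong)

lemma mat_trace_mult_commute:
  assumes "A \<in> carrier_mat k k" "B \<in> carrier_mat k k"
  shows "mat_trace (A * B) = mat_trace (B * A)"
  unfolding mat_trace_mult[OF assms] mat_trace_mult[OF assms(2,1)]
  by (subst sum.swap) (simp add: mult.commute)

lemma (in group) sum_left_translate:
  assumes "y \<in> carrier G"
  shows "(\<Sum>x\<in>carrier G. F (inv y \<otimes> x) x) = (\<Sum>z\<in>carrier G. F z (y \<otimes> z))"
  using assms
  by (intro sum.reindex_bij_witness[of _ "\<lambda>z. y \<otimes> z" "\<lambda>x. inv y \<otimes> x"])
     (auto simp: m_assoc[symmetric])

lemma (in group) group_algebra_matrix_mult:
  fixes f h :: "'a \<Rightarrow> rat" and \<rho> :: "'a \<Rightarrow> complex mat" and k :: nat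
  defines "R \<equiv> \<lambda>f. mat k k (\<lambda>(r, s). \<Sum>g\<in>carrier G. of_rat (f g) * \<rho> g $$ (r, s))"
  assumes rep: "is_rep G k \<rho>"
  shows "R (ga_mult G f h) = R f * R h"
proof (rule eq_matI)
  fix r s assume "r < dim_row (R f * R h)" "s < dim_col (R f * R h)"
  then have rs: "r < k" "s < k" by (simp_all add: R_def)
  have ent: "\<rho> (y \<otimes> z) $$ (r, s) = (\<Sum>t<k. \<rho> y $$ (r, t) * \<rho> z $$ (t, s))"
    if "y \<in> carrier G" "z \<in> carrier G" for y z
  proof -
    have "\<rho> (y \<otimes> z) = \<rho> y * \<rho> z" "\<rho> y \<in> carrier_mat k k" "\<rho> z \<in> carrier_mat k k"
      using rep that by (auto simp: is_rep_def)
    then show ?thesis using rs by (simp add: scalar_prod_def atLeast0LessThan)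
  qed
  have "R (ga_mult G f h) $$ (r, s)
    = (\<Sum>x\<in>carrier G. \<Sum>y\<in>carrier G. of_rat (f y) * of_rat (h (inv y \<otimes> x)) * \<rho> x $$ (r, s))"
    using rs by (simp add: R_def ga_mult_def of_rat_sum of_rat_mult sum_distrib_right)
  also have "\<dots> = (\<Sum>y\<in>carrier G. \<Sum>x\<in>carrier G. of_rat (f y) * of_rat (h (inv y \<otimes> x)) * \<rho> x $$ (r, s))"
    by (rule sum.swap)
  also have "\<dots> = (\<Sum>y\<in>carrier G. \<Sum>z\<in>carrier G. of_rat (f y) * of_rat (h z) * \<rho> (y \<otimes> z) $$ (r, s))"
    by (intro sum.cong refl sum_left_translate)
  also have "\<dots> = (\<Sum>y\<in>carrier G. \<Sum>z\<in>carrier G. \<Sum>t<k. (of_rat (f y) * \<rho> y $$ (r, t)) * (of_rat (h z) * \<rho> z $$ (t, s)))"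
    by (intro sum.cong refl) (simp add: ent sum_distrib_left mult_ac)
  also have "\<dots> = (\<Sum>t<k. \<Sum>y\<in>carrier G. \<Sum>z\<in>carrier G. (of_rat (f y) * \<rho> y $$ (r, t)) * (of_rat (h z) * \<rho> z $$ (t, s)))"
    by (subst sum.swap, subst (2) sum.swap) (rule refl)
  also have "\<dots> = (R f * R h) $$ (r, s)"
    using rs by (simp add: R_def scalar_prod_def atLeast0LessThan sum_product)
  finally show "R (ga_mult G f h) $$ (r, s) = (R f * R h) $$ (r, s)" .
qed (simp_all add: R_def)

text \<open>By \<open>reg\<close>, \<open>|G|\<close> times the coefficient of \<open>f\<close> at
  \<open>h\<close> is a sum of field traces of traces of \<open>\<rho> (inv h)\<close> times the
  image of \<open>f\<close>, weighted by the degrees. So an element with zero images is zero. By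
  \<open>dim\<close> the target has as many rational coordinates as there are group elements, and
  injectivity yields surjectivity.\<close>

lemma (in group) QG_iso_blocksI:
  fixes xs :: "(nat \<times> nat \<times> ('a \<Rightarrow> complex mat)) list"
  assumes fin: "finite (carrier G)" and p: "Factorial_Ring.prime (p::nat)"
    and reps: "\<And>k m \<rho>. (k, m, \<rho>) \<in> set xs \<Longrightarrow> (\<exists>l. m = p ^ l) \<and> cyclo_rep G k m \<rho>"
    and dim: "(\<Sum>(k, m, \<rho>)\<leftarrow>xs. k\<^sup>2 * totient m) = card (carrier G)"
    and reg: "\<And>g. g \<in> carrier G \<Longrightarrow> (\<Sum>(k, m, \<rho>)\<leftarrow>xs. of_nat k * cyc_trace m (mat_trace (\<rho> g)))
      = (if g = \<one> then of_nat (card (carrier G)) else 0)"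
  shows "QG_iso_blocks G (map (\<lambda>(k, m, \<rho>). (k, m)) xs)"
proof -
  define n where "n = length xs"
  define K where "K = (\<lambda>i. fst (xs ! i))"
  define C where "C = (\<lambda>i. fst (snd (xs ! i)))"
  define \<rho> where "\<rho> = (\<lambda>i. snd (snd (xs ! i)))"
  have xs_i: "xs ! i = (K i, C i, \<rho> i)" for i by (simp add: K_def C_def \<rho>_def)
  have Cp: "\<exists>l. C i = p ^ l" and cr: "cyclo_rep G (K i) (C i) (\<rho> i)" if "i < n" for i
    using reps[of "K i" "C i" "\<rho> i"] nth_mem[of i xs] that xs_i n_def by auto
  have rep: "is_rep G (K i) (\<rho> i)" if "i < n" for i using cr[OF that] by (simp add: cyclo_rep_def)
  have cyc: "\<rho> i g $$ (r, s) \<in> cyclo_field (C i)" if "i < n" "g \<in> carrier G" "r < K i" "s < K i" for i g r s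
    using cr[OF that(1)] that by (simp add: cyclo_rep_def)
  define E where "E = (\<lambda>i f r s. \<Sum>g\<in>carrier G. of_rat (f g :: rat) * \<rho> i g $$ (r, s))"
  define R where "R = (\<lambda>i f. mat (K i) (K i) (\<lambda>(r, s). E i f r s))"
  define \<phi> where "\<phi> = (\<lambda>f. map (\<lambda>i. R i f) [0..<n])"
  have E_cyc: "E i f r s \<in> cyclo_field (C i)" if "i < n" "r < K i" "s < K i" for i f r s
    unfolding E_def using that by (intro cyclo_field_sum cyclo_field_mult cyclo_field_of_rat cyc)
  have E_inj: "f h = 0" if zero: "\<And>i r s. i < n \<Longrightarrow> r < K i \<Longrightarrow> s < K i \<Longrightarrow> E i f r s = 0" and h: "h \<in> carrier G" for f h
  proof -
    \<comment> \<open>The trace of \<open>\<rho> (inv h) * \<rho> g\<close> is bilinear in the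
      matrix entries, so summing it against \<open>f\<close> leaves a combination of the entries
      \<open>E i f s r\<close>, all zero by assumption; \<open>cyc_trace\<close> is linear over the
      rationals and keeps it zero.\<close>
    have "0 = (\<Sum>g\<in>carrier G. of_rat (f g) * (of_nat (K i) * cyc_trace (C i) (mat_trace (\<rho> i (inv h \<otimes> g)))))" if i: "i < n" for i
    proof -
      obtain l where l: "C i = p ^ l" using Cp[OF i] by blast
      have carr: "\<rho> i g \<in> carrier_mat (K i) (K i)" if "g \<in> carrier G" for g
        using rep[OF i] that by (simp add: is_rep_def)
      have tr: "mat_trace (\<rho> i (inv h \<otimes> g)) = (\<Sum>r<K i. \<Sum>s<K i. \<rho> i (inv h) $$ (r, s) * \<rho> i g $$ (s, r))"
        if "g \<in> carrier G" for g
        using rep[OF i] that h by (simp add: is_rep_def mat_trace_mult[of _ "K i"])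
      have trc: "mat_trace (\<rho> i (inv h \<otimes> g)) \<in> cyclo_field (C i)" if "g \<in> carrier G" for g
        unfolding tr[OF that] using that i h by (intro cyclo_field_sum cyclo_field_mult cyc) auto
      have "(\<Sum>g\<in>carrier G. of_rat (f g) * mat_trace (\<rho> i (inv h \<otimes> g)))
        = (\<Sum>g\<in>carrier G. \<Sum>r<K i. \<Sum>s<K i. \<rho> i (inv h) $$ (r, s) * (of_rat (f g) * \<rho> i g $$ (s, r)))"
        by (intro sum.cong refl) (simp add: tr sum_distrib_left mult_ac)
      also have "\<dots> = (\<Sum>r<K i. \<Sum>s<K i. \<Sum>g\<in>carrier G. \<rho> i (inv h) $$ (r, s) * (of_rat (f g) * \<rho> i g $$ (s, r)))"
        by (subst sum.swap, subst (2) sum.swap) (rule refl)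
      also have "\<dots> = (\<Sum>r<K i. \<Sum>s<K i. \<rho> i (inv h) $$ (r, s) * E i f s r)"
        by (simp add: E_def sum_distrib_left)
      also have "\<dots> = 0" using zero i by simp
      finally have "cyc_trace (C i) (\<Sum>g\<in>carrier G. of_rat (f g) * mat_trace (\<rho> i (inv h \<otimes> g))) = cyc_trace (C i) (of_rat 0 * 0)"
        by simp
      also have "\<dots> = 0" using cyc_trace_scale[OF p l cyclo_field_0, of 0] by simp
      finally have "0 = (\<Sum>g\<in>carrier G. of_rat (f g) * cyc_trace (C i) (mat_trace (\<rho> i (inv h \<otimes> g))))"
        using fin by (simp add: cyc_trace_sum[OF p l] cyc_trace_scale[OF p l] trc cyclo_field_mult cyclo_field_of_rat)
      then have "of_nat (K i) * 0 = of_nat (K i) * (\<Sum>g\<in>carrier G. of_rat (f g) * cyc_trace (C i) (mat_trace (\<rho> i (inv h \<otimes> g))))"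
        by simp
      then show ?thesis by (simp add: sum_distrib_left mult_ac)
    qed
    then have "0 = (\<Sum>i<n. \<Sum>g\<in>carrier G. of_rat (f g) * (of_nat (K i) * cyc_trace (C i) (mat_trace (\<rho> i (inv h \<otimes> g)))))"
      by simp
    also have "\<dots> = (\<Sum>g\<in>carrier G. of_rat (f g) * (\<Sum>i<n. of_nat (K i) * cyc_trace (C i) (mat_trace (\<rho> i (inv h \<otimes> g)))))"
      by (subst sum.swap) (simp add: sum_distrib_left)
    \<comment> \<open>The weighted traces add up to the regular character at
      \<open>inv h * g\<close>, which singles out \<open>g = h\<close>.\<close>
    also have "\<dots> = (\<Sum>g\<in>carrier G. of_rat (f g) * (if g = h then of_nat (card (carrier G)) else 0))"
    proof (intro sum.cong refl arg_cong2[of _ _ _ _ "(*)"])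
      fix g assume g: "g \<in> carrier G"
      have "inv h \<otimes> g = \<one> \<longleftrightarrow> g = h" using g h by (metis inv_closed inv_equality inv_inv l_inv)
      then show "(\<Sum>i<n. of_nat (K i) * cyc_trace (C i) (mat_trace (\<rho> i (inv h \<otimes> g)))) = (if g = h then of_nat (card (carrier G)) else 0)"
        using reg[of "inv h \<otimes> g"] g h
        by (simp add: sum_list_sum_nth xs_i n_def atLeast0LessThan case_prod_unfold)
    qed
    also have "\<dots> = of_rat (f h) * of_nat (card (carrier G))"
      using fin h by (simp add: sum.delta if_distrib cong: if_cong)
    finally show ?thesis using fin h by auto
  qed
  have sub: "E i (\<lambda>x. f x - h x) r s = E i f r s - E i h r s" for i f h r s
    by (simp add: E_def of_rat_diff algebra_simps sum_subtractf)
  have inj: "inj_on \<phi> (group_alg G)"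
  proof (rule inj_onI)
    fix f h assume fh: "f \<in> group_alg G" "h \<in> group_alg G" "\<phi> f = \<phi> h"
    have Req: "R i f = R i h" if "i < n" for i
      using arg_cong[OF fh(3), of "\<lambda>l. l ! i"] that by (simp add: \<phi>_def)
    have "E i f r s = E i h r s" if "i < n" "r < K i" "s < K i" for i r s
      using arg_cong[OF Req[OF that(1)], of "\<lambda>A. A $$ (r, s)"] that by (simp add: R_def)
    then have "f g - h g = 0" if "g \<in> carrier G" for g
      using E_inj[of "\<lambda>x. f x - h x" g] that by (simp add: sub)
    then have "f g = h g" for g
      using fh(1,2) by (cases "g \<in> carrier G") (auto simp: group_alg_def)
    then show "f = h" by (rule ext)
  qed
  have bs: "block_sum (map (\<lambda>(k, m, \<rho>). (k, m)) xs) = {As. length As = n \<and>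
     (\<forall>i<n. As ! i \<in> carrier_mat (K i) (K i) \<and> (\<forall>r<K i. \<forall>s<K i. As ! i $$ (r, s) \<in> cyclo_field (C i)))}"
    by (simp add: block_sum_def n_def xs_i)
  have sur: "\<phi> ` group_alg G = block_sum (map (\<lambda>(k, m, \<rho>). (k, m)) xs)"
  proof
    show "\<phi> ` group_alg G \<subseteq> block_sum (map (\<lambda>(k, m, \<rho>). (k, m)) xs)"
      unfolding bs using E_cyc by (auto simp: \<phi>_def R_def)
  next
    show "block_sum (map (\<lambda>(k, m, \<rho>). (k, m)) xs) \<subseteq> \<phi> ` group_alg G"
    proof
      fix As assume As: "As \<in> block_sum (map (\<lambda>(k, m, \<rho>). (k, m)) xs)"
      \<comment> \<open>\<open>J\<close> lists the rational coordinates of the target: block, row,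
        column and power of \<open>zeta\<close>. \<open>M\<close> is the matrix of the map in these
        coordinates, and \<open>b\<close> holds the coordinates of the prescribed image.\<close>
      define J where "J = (SIGMA i:{..<n}. {..<K i} \<times> {..<K i} \<times> {..<totient (C i)})"
      define M where "M = (\<lambda>(i, r, s, a) g. Polynomial.coeff (cyc_coord (C i) (\<rho> i g $$ (r, s))) a)"
      define b where "b = (\<lambda>(i, r, s, a). Polynomial.coeff (cyc_coord (C i) (As ! i $$ (r, s))) a)"
      have coord_E: "(\<Sum>g\<in>carrier G. M (i, r, s, a) g * f g) = Polynomial.coeff (cyc_coord (C i) (E i f r s)) a"
        if i: "i < n" "r < K i" "s < K i" for i r s a f
      proof -
        obtain l where l: "C i = p ^ l" using Cp[OF i(1)] by blast
        \<comment> \<open>Rational linearity of coordinates, by induction over sets of group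
          elements, exhibits each coordinate of a matrix entry as a linear form in
          \<open>f\<close>.\<close>
        have "cyc_coord (C i) (\<Sum>g\<in>S. of_rat (f g) * \<rho> i g $$ (r, s)) = (\<Sum>g\<in>S. Polynomial.smult (f g) (cyc_coord (C i) (\<rho> i g $$ (r, s))))"
          if "finite S" "S \<subseteq> carrier G" for S
          using that
        proof (induction S rule: finite_induct)
          case empty
          show ?case using cyc_coord_scale[OF p l cyclo_field_0, of 0] by simp
        next
          case (insert g S)
          then show ?case using i
            by (simp add: cyc_coord_add[OF p l] cyc_coord_scale[OF p l] cyclo_field_sum cyclo_field_mult cyclo_field_of_rat cyc subset_iff)
        qed
        from this[OF fin order_refl] show ?thesis
          by (simp add: E_def M_def coeff_sum mult.commute)
      qed
      have cJ: "card (carrier G) = card J"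
        using dim by (simp add: J_def card_SigmaI card_cartesian_product sum_list_sum_nth xs_i n_def atLeast0LessThan power2_eq_square mult.assoc)
      have fJ: "finite J" by (auto simp: J_def)
      have "\<exists>f. (\<forall>i. i \<notin> carrier G \<longrightarrow> f i = 0) \<and> (\<forall>j\<in>J. (\<Sum>i\<in>carrier G. M j i * f i) = b j)"
      proof (rule square_system_solvable[OF fin fJ cJ])
        fix f assume z: "\<And>j. j \<in> J \<Longrightarrow> (\<Sum>i\<in>carrier G. M j i * f i) = 0"
        have "E i f r s = 0" if i: "i < n" "r < K i" "s < K i" for i r s
        proof -
          obtain l where l: "C i = p ^ l" using Cp[OF i(1)] by blast
          have "Polynomial.coeff (cyc_coord (C i) (E i f r s)) a = 0" if "a < totient (C i)" for a
            using z[of "(i, r, s, a)"] coord_E[OF i] i that by (simp add: J_def)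
          then show ?thesis using cyc_coord_expansion[OF p l E_cyc[OF i], of f] by simp
        qed
        then show "\<forall>g\<in>carrier G. f g = 0" using E_inj by blast
      qed
      then obtain f where f: "\<And>g. g \<notin> carrier G \<Longrightarrow> f g = 0" "\<And>j. j \<in> J \<Longrightarrow> (\<Sum>i\<in>carrier G. M j i * f i) = b j"
        by blast
      have "E i f r s = As ! i $$ (r, s)" if i: "i < n" "r < K i" "s < K i" for i r s
      proof -
        obtain l where l: "C i = p ^ l" using Cp[OF i(1)] by blast
        have a: "As ! i $$ (r, s) \<in> cyclo_field (C i)" using As i unfolding bs by simp
        have "Polynomial.coeff (cyc_coord (C i) (E i f r s)) a = Polynomial.coeff (cyc_coord (C i) (As ! i $$ (r, s))) a"
          if "a < totient (C i)" for a
          using f(2)[of "(i, r, s, a)"] coord_E[OF i] i that by (simp add: J_def b_def)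
        then show ?thesis
          using cyc_coord_expansion[OF p l E_cyc[OF i], of f] cyc_coord_expansion[OF p l a]
          by (metis (no_types, lifting) lessThan_iff sum.cong)
      qed
      then have "\<phi> f = As"
        using As unfolding bs by (intro nth_equalityI) (auto simp: \<phi>_def R_def intro!: eq_matI)
      then show "As \<in> \<phi> ` group_alg G" using f(1) by (auto simp: group_alg_def)
    qed
  qed
  have Rm: "R i (ga_mult G f h) = R i f * R i h" if "i < n" for i f h
    using group_algebra_matrix_mult[OF rep[OF that], of f h] by (simp add: R_def E_def)
  have "\<phi> (\<lambda>x. f x + h x) = map2 (+) (\<phi> f) (\<phi> h)" for f h
    by (intro nth_equalityI) (auto simp: \<phi>_def R_def E_def of_rat_add distrib_right sum.distrib)
  moreover have "\<phi> (ga_mult G f h) = map2 (*) (\<phi> f) (\<phi> h)" for f h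
    by (intro nth_equalityI) (auto simp: \<phi>_def Rm)
  moreover have "\<phi> (\<lambda>x. q * f x) = map (\<lambda>A. of_rat q \<cdot>\<^sub>m A) (\<phi> f)" for q f
    by (intro nth_equalityI) (auto simp: \<phi>_def R_def E_def of_rat_mult sum_distrib_left mult.assoc)
  ultimately show ?thesis
    unfolding QG_iso_blocks_def using inj sur by (intro exI[of _ \<phi>]) (simp add: bij_betw_def)
qed

section \<open>Linear characters of subgroups\<close>

lemma complex_nth_root_exists:
  assumes "n > 0"
  shows "\<exists>c :: complex. c ^ n = a"
proof -
  have "rcis (root n (cmod a)) (Arg a / real n) ^ n = rcis (cmod a) (Arg a)"
    using assms by (simp add: DeMoivre2)
  then show ?thesis by (metis rcis_cmod_Arg)
qed

text \<open>Each fibre of \<open>f\<close> is a right coset of \<open>K\<close>. Asking for this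
  instead of a homomorphism lets one lemma serve power maps, commutator maps, coset projections and
  conjugation orbits.\<close>

lemma (in group) card_fibres:
  assumes fin: "finite (carrier G)" and K: "subgroup K G"
    and f: "\<And>x y. x \<in> carrier G \<Longrightarrow> y \<in> carrier G \<Longrightarrow> f x = f y \<longleftrightarrow> x \<otimes> inv y \<in> K"
  shows "card (carrier G) = card (f ` carrier G) * card K"
proof -
  have "card {x \<in> carrier G. f x = v} = card K" if v: "v \<in> f ` carrier G" for v
  proof -
    obtain y where y: "y \<in> carrier G" "v = f y" using v by blast
    have "{x \<in> carrier G. f x = v} = (\<lambda>k. k \<otimes> y) ` K"
    proof (intro equalityI subsetI)
      fix x assume "x \<in> {x \<in> carrier G. f x = v}"
      then have "x \<in> carrier G" "x \<otimes> inv y \<in> K" using y f by auto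
      moreover have "x = (x \<otimes> inv y) \<otimes> y" using \<open>x \<in> carrier G\<close> y by (simp add: m_assoc)
      ultimately show "x \<in> (\<lambda>k. k \<otimes> y) ` K" by blast
    next
      fix x assume "x \<in> (\<lambda>k. k \<otimes> y) ` K"
      then obtain k where k: "k \<in> K" "x = k \<otimes> y" by blast
      have kc: "k \<in> carrier G" by (rule subgroup.mem_carrier[OF K k(1)])
      have "x \<otimes> inv y = k" using k y kc by (simp add: m_assoc)
      then show "x \<in> {x \<in> carrier G. f x = v}" using k(1) f[of x y] k(2) kc y by simp
    qed
    moreover have "inj_on (\<lambda>k. k \<otimes> y) K"
      using y K subgroup.mem_carrier[OF K] by (auto intro!: inj_onI)
    ultimately show ?thesis by (simp add: card_image)
  qed
  then have "(\<Sum>v\<in>f ` carrier G. \<Sum>x\<in>{x \<in> carrier G. f x = v}. 1) = (\<Sum>v\<in>f ` carrier G. card K)"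
    by (intro sum.cong) auto
  moreover have "(\<Sum>x\<in>carrier G. 1) = (\<Sum>v\<in>f ` carrier G. \<Sum>x\<in>{x \<in> carrier G. f x = v}. 1 :: nat)"
    using fin by (rule sum.image_gen)
  ultimately show ?thesis by simp
qed

lemma (in group) finite_subgroupI:
  assumes fin: "finite (carrier G)" and A: "A \<subseteq> carrier G" "\<one> \<in> A"
    and cl: "\<And>a b. a \<in> A \<Longrightarrow> b \<in> A \<Longrightarrow> a \<otimes> b \<in> A"
  shows "subgroup A G"
proof (rule subgroupI)
  fix a assume a: "a \<in> A"
  then have ac: "a \<in> carrier G" using A by blast
  have pw: "a [^] n \<in> A" for n :: nat by (induction n) (simp_all add: A(2) cl a)
  have "Coset.order G > 0" using fin by (simp add: order_gt_0_iff_finite)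
  then have "a [^] (Coset.order G - 1) \<otimes> a = \<one>"
    using pow_order_eq_1[OF ac] ac by (metis Suc_pred' nat_pow_Suc)
  then have "inv a = a [^] (Coset.order G - 1)" using ac inv_equality by simp
  then show "inv a \<in> A" using pw by simp
qed (use assms in auto)

text \<open>Linear characters of \<open>W\<close> that are trivial on \<open>N\<close>, extended by
  zero. The extension makes equality of characters equality of functions and spares case
  distinctions in induced matrices. With \<open>N = {\<one>}\<close> the condition on
  \<open>N\<close> serves to exclude the zero function.\<close>

definition lin_chars :: "('a, 'b) monoid_scheme \<Rightarrow> 'a set \<Rightarrow> 'a set \<Rightarrow> ('a \<Rightarrow> complex) set" where
  "lin_chars G W N = {\<theta>. (\<forall>x\<in>W. \<forall>y\<in>W. \<theta> (x \<otimes>\<^bsub>G\<^esub> y) = \<theta> x * \<theta> y) \<and> (\<forall>x\<in>N. \<theta> x = 1) \<and> (\<forall>x. x \<notin> W \<longrightarrow> \<theta> x = 0)}"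

lemma lin_charsD:
  assumes "\<theta> \<in> lin_chars G W N"
  shows "x \<in> W \<Longrightarrow> y \<in> W \<Longrightarrow> \<theta> (x \<otimes>\<^bsub>G\<^esub> y) = \<theta> x * \<theta> y"
    and "x \<in> N \<Longrightarrow> \<theta> x = 1" and "x \<notin> W \<Longrightarrow> \<theta> x = 0"
  using assms by (simp_all add: lin_chars_def)

lemma lin_chars_mono: "M \<subseteq> N \<Longrightarrow> lin_chars G W N \<subseteq> lin_chars G W M"
  unfolding lin_chars_def by blast

context group
begin

lemma lin_chars_one:
  assumes "subgroup W G" "\<theta> \<in> lin_chars G W N" "\<one> \<in> N"
  shows "\<theta> \<one> = 1"
  using lin_charsD(2)[OF assms(2,3)] .

lemma lin_chars_pow:
  assumes "subgroup W G" "\<theta> \<in> lin_chars G W N" "\<one> \<in> N" "x \<in> W"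
  shows "\<theta> (x [^] (n::nat)) = \<theta> x ^ n"
proof (induction n)
  case (Suc n)
  have "x [^] n \<in> W" using assms subgroup_int_pow_closed[OF assms(1,4), of "int n"]
    by (simp add: int_pow_int)
  then show ?case using Suc assms(4) lin_charsD(1)[OF assms(2)] by simp
qed (use lin_chars_one[OF assms(1-3)] in simp)

lemma lin_chars_root_of_unity:
  assumes "subgroup W G" "\<theta> \<in> lin_chars G W N" "\<one> \<in> N" "x \<in> W"
  shows "\<theta> x ^ card (carrier G) = 1"
  using lin_chars_pow[OF assms, of "card (carrier G)"] lin_chars_one[OF assms(1-3)]
    pow_order_eq_1[of x] subgroup.mem_carrier[OF assms(1,4)] by (simp add: Coset.order_def)

lemma lin_chars_nz:
  assumes "subgroup W G" "\<theta> \<in> lin_chars G W N" "\<one> \<in> N" "x \<in> W"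
  shows "\<theta> x \<noteq> 0"
proof -
  have "\<theta> x * \<theta> (inv x) = 1"
    using lin_charsD(1)[OF assms(2), of x "inv x"] assms subgroup.m_inv_closed[OF assms(1,4)]
      subgroup.mem_carrier[OF assms(1,4)] lin_chars_one[OF assms(1-3)] by simp
  then show ?thesis by auto
qed

lemma lin_chars_inv:
  assumes "subgroup W G" "\<theta> \<in> lin_chars G W N" "\<one> \<in> N" "x \<in> W"
  shows "\<theta> (inv x) = inverse (\<theta> x)"
proof -
  have "\<theta> x * \<theta> (inv x) = 1"
    using lin_charsD(1)[OF assms(2), of x "inv x"] assms subgroup.m_inv_closed[OF assms(1,4)]
      subgroup.mem_carrier[OF assms(1,4)] lin_chars_one[OF assms(1-3)] by simp
  then show ?thesis by (metis inverse_unique)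
qed

lemma lin_chars_norm:
  assumes "finite (carrier G)" "subgroup W G" "\<theta> \<in> lin_chars G W N" "\<one> \<in> N" "x \<in> W"
  shows "cmod (\<theta> x) = 1"
proof -
  have "cmod (\<theta> x) ^ card (carrier G) = 1"
    using lin_chars_root_of_unity[OF assms(2-5)] by (metis norm_one norm_power)
  moreover have "card (carrier G) > 0" using assms(1) by (simp add: card_gt_0_iff carrier_not_empty)
  ultimately show ?thesis using power_eq_imp_eq_base[of "cmod (\<theta> x)" "card (carrier G)" 1] by simp
qed

lemma finite_lin_chars:
  assumes "finite (carrier G)" "subgroup W G" "\<one> \<in> N"
  shows "finite (lin_chars G W N)"
proof (rule finite_subset)
  have c: "card (carrier G) > 0" using assms(1) by (simp add: card_gt_0_iff carrier_not_empty)
  show "lin_chars G W N \<subseteq> {f. \<forall>x. (x \<in> W \<longrightarrow> f x \<in> {z. z ^ card (carrier G) = 1}) \<and> (x \<notin> W \<longrightarrow> f x = 0)}"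
    using lin_chars_root_of_unity[OF assms(2) _ assms(3)] by (auto dest: lin_charsD(3))
  show "finite {f. \<forall>x. (x \<in> W \<longrightarrow> f x \<in> {z::complex. z ^ card (carrier G) = 1}) \<and> (x \<notin> W \<longrightarrow> f x = 0)}"
    using c assms(1) finite_subset[OF subgroup.subset[OF assms(2)]]
    by (intro finite_set_of_finite_funs finite_roots_unity) auto
qed

text \<open>\<open>n\<close> is the least positive exponent that brings \<open>x\<close> into
  \<open>W\<close>; division with remainder shows that all such exponents are its multiples.\<close>

lemma relative_order:
  assumes fin: "finite (carrier G)" and W: "subgroup W G" and x: "x \<in> carrier G"
  obtains n :: nat where "n > 0" "\<And>i::nat. x [^] i \<in> W \<longleftrightarrow> n dvd i"
proof -
  define n where "n = (LEAST n::nat. n > 0 \<and> x [^] n \<in> W)"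
  have "Coset.order G > 0 \<and> x [^] Coset.order G \<in> W"
    using fin pow_order_eq_1[OF x] W by (simp add: order_gt_0_iff_finite subgroup.one_closed)
  then have n: "n > 0" "x [^] n \<in> W" unfolding n_def by (metis (mono_tags, lifting) LeastI)+
  have least: "x [^] i \<notin> W" if "0 < i" "i < n" for i
    using not_less_Least[of i "\<lambda>n. n > 0 \<and> x [^] n \<in> W"] that n_def by blast
  have nq: "x [^] (n * q) \<in> W" for q
    using subgroup_int_pow_closed[OF W n(2), of "int q"] x by (simp add: int_pow_int nat_pow_pow)
  have "x [^] i \<in> W \<longleftrightarrow> n dvd i" for i
  proof
    assume i: "x [^] i \<in> W"
    have "x [^] i = x [^] (n * (i div n)) \<otimes> x [^] (i mod n)"
      using x by (simp add: nat_pow_mult)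
    then have "x [^] (i mod n) = inv (x [^] (n * (i div n))) \<otimes> x [^] i"
      using x by (simp add: m_assoc[symmetric])
    then have "x [^] (i mod n) \<in> W" using i nq W by (simp add: subgroup.m_closed subgroup.m_inv_closed)
    then show "n dvd i" using least[of "i mod n"] n(1) by (auto simp: dvd_eq_mod_eq_0)
  next
    assume "n dvd i"
    then show "x [^] i \<in> W" using nq by auto
  qed
  then show thesis using that n(1) by blast
qed

text \<open>As \<open>x\<close> commutes with \<open>W\<close>, every element of the generated
  subgroup is \<open>w * x^i\<close>, and two such expressions differ by moving a power of
  \<open>x^n\<close> into \<open>W\<close>. Hence any \<open>n\<close>-th root \<open>c\<close> of
  the value at \<open>x^n\<close> is admissible; leaving its choice open allows an arbitrary complex
  root, a root in the same cyclotomic field, or 1.\<close>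

lemma lin_chars_extend_step:
  assumes fin: "finite (carrier G)" and W: "subgroup W G" and lam: "\<theta> \<in> lin_chars G W {\<one>}"
    and x: "x \<in> carrier G" and comm: "\<And>w. w \<in> W \<Longrightarrow> x \<otimes> w = w \<otimes> x"
    and n: "n > 0" "\<And>i::nat. x [^] i \<in> W \<longleftrightarrow> n dvd i" and c: "c ^ n = \<theta> (x [^] n)"
  obtains A \<mu> where "subgroup A G" "W \<subseteq> A" "x \<in> A" "card A = n * card W"
    "A = {w \<otimes> x [^] i | w i. w \<in> W \<and> i \<in> (UNIV :: nat set)}"
    "\<mu> \<in> lin_chars G A {\<one>}" "\<And>w. w \<in> W \<Longrightarrow> \<mu> w = \<theta> w" "\<mu> x = c"
    "\<And>w i. w \<in> W \<Longrightarrow> \<mu> (w \<otimes> x [^] (i::nat)) = \<theta> w * c ^ i"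
proof -
  define A where "A = {w \<otimes> x [^] i | w i. w \<in> W \<and> i \<in> (UNIV :: nat set)}"
  note Wc = subgroup.mem_carrier[OF W]
  have one: "\<one> \<in> W" by (rule subgroup.one_closed[OF W])
  have comm': "x [^] (i::nat) \<otimes> w = w \<otimes> x [^] i" if w: "w \<in> W" for i w
  proof (induction i)
    case (Suc i)
    have "x [^] Suc i \<otimes> w = x [^] i \<otimes> (x \<otimes> w)" using x Wc[OF w] by (simp add: m_assoc)
    also have "\<dots> = (x [^] i \<otimes> w) \<otimes> x" using x Wc[OF w] comm[OF w] by (simp add: m_assoc)
    finally show ?case using Suc x Wc[OF w] by (simp add: m_assoc)
  qed (use Wc[OF w] in simp)
  have mult: "(w \<otimes> x [^] i) \<otimes> (w' \<otimes> x [^] j) = (w \<otimes> w') \<otimes> x [^] (i + j)"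
    if "w \<in> W" "w' \<in> W" for w w' and i j :: nat
  proof -
    have "(w \<otimes> x [^] i) \<otimes> (w' \<otimes> x [^] j) = w \<otimes> (x [^] i \<otimes> w') \<otimes> x [^] j"
      using that Wc x by (simp add: m_assoc)
    then show ?thesis using that Wc x by (simp add: comm' m_assoc nat_pow_mult)
  qed
  have Asub: "subgroup A G"
  proof (rule finite_subgroupI[OF fin])
    show "A \<subseteq> carrier G" using Wc x unfolding A_def by auto
    have "\<one> = \<one> \<otimes> x [^] (0::nat)" by simp
    then show "\<one> \<in> A" unfolding A_def using one by blast
    fix a b assume "a \<in> A" "b \<in> A"
    then show "a \<otimes> b \<in> A" unfolding A_def using mult subgroup.m_closed[OF W] by fastforce
  qed
  \<comment> \<open>Comparing two expressions puts \<open>x^(j - i)\<close> into \<open>W\<close>,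
    so \<open>j - i\<close> is a multiple of \<open>n\<close> and the difference is absorbed by a
    power of \<open>x^n\<close>.\<close>
  have wd: "j - i = n * ((j - i) div n) \<and> w = w' \<otimes> (x [^] n) [^] ((j - i) div n)"
    if "w \<in> W" "w' \<in> W" "w \<otimes> x [^] i = w' \<otimes> x [^] j" "i \<le> j" for w w' and i j :: nat
  proof -
    have "w' \<otimes> x [^] j = (w' \<otimes> x [^] (j - i)) \<otimes> x [^] i"
      using that Wc x by (simp add: m_assoc nat_pow_mult)
    then have eq: "w = w' \<otimes> x [^] (j - i)" using that Wc x by (metis m_closed nat_pow_closed right_cancel)
    then have "x [^] (j - i) = inv w' \<otimes> w" using that Wc x by (simp add: inv_solve_left)
    then have "x [^] (j - i) \<in> W" using that W by (simp add: subgroup.m_closed subgroup.m_inv_closed)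
    then have "n dvd j - i" using n(2) by blast
    then have "j - i = n * ((j - i) div n)" by simp
    then show ?thesis using eq x by (metis nat_pow_pow)
  qed
  have wd2: "\<theta> w * c ^ i = \<theta> w' * c ^ j"
    if h: "w \<in> W" "w' \<in> W" "w \<otimes> x [^] i = w' \<otimes> x [^] j" "i \<le> j" for w w' and i j :: nat
  proof -
    let ?t = "(j - i) div n"
    have xn: "x [^] n \<in> W" using n(2) by simp
    have t: "j - i = n * ?t" "w = w' \<otimes> (x [^] n) [^] ?t" using wd[OF h] by auto
    have "(x [^] n) [^] ?t \<in> W" using subgroup_int_pow_closed[OF W xn, of "int ?t"] by (simp add: int_pow_int)
    then have "\<theta> w = \<theta> w' * \<theta> (x [^] n) ^ ?t"
      using lin_charsD(1)[OF lam h(2), of "(x [^] n) [^] ?t"] lin_chars_pow[OF W lam _ xn, of ?t] t(2) by simp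
    then have "\<theta> w * c ^ i = \<theta> w' * c ^ (n * ?t + i)" using c by (simp add: power_mult power_add)
    moreover have "n * ?t + i = j" using t(1) h(4) by linarith
    ultimately show ?thesis by simp
  qed
  have wd3: "\<theta> w * c ^ i = \<theta> w' * c ^ j"
    if h: "w \<in> W" "w' \<in> W" "w \<otimes> x [^] i = w' \<otimes> x [^] j" for w w' and i j :: nat
    using wd2[OF h] wd2[OF h(2,1) h(3)[symmetric]] by (cases "i \<le> j") auto
  define \<mu> where "\<mu> = (\<lambda>y. if y \<in> A then (THE v. \<exists>w\<in>W. \<exists>i::nat. y = w \<otimes> x [^] i \<and> v = \<theta> w * c ^ i) else 0)"
  have mu: "\<mu> (w \<otimes> x [^] i) = \<theta> w * c ^ i" if "w \<in> W" for w and i :: nat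
  proof -
    have "w \<otimes> x [^] i \<in> A" using that A_def by blast
    moreover have "(THE v. \<exists>w'\<in>W. \<exists>j::nat. w \<otimes> x [^] i = w' \<otimes> x [^] j \<and> v = \<theta> w' * c ^ j) = \<theta> w * c ^ i"
    proof (rule the_equality)
      fix v assume "\<exists>w'\<in>W. \<exists>j::nat. w \<otimes> x [^] i = w' \<otimes> x [^] j \<and> v = \<theta> w' * c ^ j"
      then obtain w' j where "w' \<in> W" "w \<otimes> x [^] i = w' \<otimes> x [^] (j::nat)" "v = \<theta> w' * c ^ j" by blast
      then show "v = \<theta> w * c ^ i" using wd3[OF that, of w' i j] by simp
    qed (use that in blast)
    ultimately show ?thesis by (simp add: \<mu>_def)
  qed
  have mu_W: "\<mu> w = \<theta> w" if "w \<in> W" for w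
    using mu[OF that, of 0] Wc[OF that] by simp
  have mu_x: "\<mu> x = c"
    using mu[OF one, of 1] x lin_chars_one[OF W lam] by simp
  have mu_char: "\<mu> \<in> lin_chars G A {\<one>}"
    unfolding lin_chars_def
  proof (intro CollectI conjI ballI allI impI)
    fix y z assume "y \<in> A" "z \<in> A"
    then obtain w i w' j where yz: "w \<in> W" "w' \<in> W" "y = w \<otimes> x [^] (i::nat)" "z = w' \<otimes> x [^] (j::nat)"
      unfolding A_def by blast
    then have "\<mu> (y \<otimes> z) = \<theta> (w \<otimes> w') * c ^ (i + j)"
      using mult mu[of "w \<otimes> w'" "i + j"] subgroup.m_closed[OF W] by simp
    then show "\<mu> (y \<otimes> z) = \<mu> y * \<mu> z"
      using yz mu lin_charsD(1)[OF lam] by (simp add: power_add)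
  qed (use mu_W[OF one] lin_chars_one[OF W lam] in \<open>auto simp: \<mu>_def\<close>)
  \<comment> \<open>Exponents can be reduced modulo \<open>n\<close>, after which the expression is
    unique; this gives the order of \<open>A\<close>.\<close>
  have "A = (\<lambda>(w, i). w \<otimes> x [^] i) ` (W \<times> {..<n})"
  proof (intro equalityI subsetI)
    fix a assume "a \<in> A"
    then obtain w i where a: "w \<in> W" "a = w \<otimes> x [^] (i::nat)" unfolding A_def by blast
    have "x [^] i = x [^] (n * (i div n)) \<otimes> x [^] (i mod n)" using x by (simp add: nat_pow_mult)
    then have "a = (w \<otimes> x [^] (n * (i div n))) \<otimes> x [^] (i mod n)" using a x Wc by (simp add: m_assoc)
    moreover have "w \<otimes> x [^] (n * (i div n)) \<in> W" using a n(2) subgroup.m_closed[OF W] by simp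
    ultimately show "a \<in> (\<lambda>(w, i). w \<otimes> x [^] i) ` (W \<times> {..<n})" using n(1) by force
  qed (auto simp: A_def)
  moreover have "inj_on (\<lambda>(w, i). w \<otimes> x [^] i) (W \<times> {..<n})"
  proof -
    have le: "w = w' \<and> i = j" if h: "w \<in> W" "w' \<in> W" "w \<otimes> x [^] i = w' \<otimes> x [^] j" "i \<le> j" "j < n" for w w' and i j :: nat
    proof -
      have "(j - i) div n = 0" using h(5) by simp
      then show ?thesis using wd[OF h(1-4)] h Wc by simp
    qed
    show ?thesis
    proof (rule inj_onI)
      fix a b assume "a \<in> W \<times> {..<n}" "b \<in> W \<times> {..<n}" "(case a of (w, i) \<Rightarrow> w \<otimes> x [^] i) = (case b of (w, i) \<Rightarrow> w \<otimes> x [^] i)"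
      then have ab: "fst a \<in> W" "fst b \<in> W" "snd a < n" "snd b < n" "fst a \<otimes> x [^] snd a = fst b \<otimes> x [^] snd b"
        by (auto simp: case_prod_unfold)
      show "a = b"
      proof (cases "snd a \<le> snd b")
        case True
        then show ?thesis using le[OF ab(1,2,5) True ab(4)] by (simp add: prod_eq_iff)
      next
        case False
        then show ?thesis using le[OF ab(2,1) ab(5)[symmetric] _ ab(3)] by (simp add: prod_eq_iff)
      qed
    qed
  qed
  ultimately have "card A = n * card W" by (simp add: card_image card_cartesian_product)
  moreover have "W \<subseteq> A"
  proof
    fix w assume w: "w \<in> W"
    then have "w = w \<otimes> x [^] (0::nat)" using Wc by simp
    then show "w \<in> A" unfolding A_def using w by blast
  qed
  moreover have "x \<in> A"
  proof -
    have "x = \<one> \<otimes> x [^] (1::nat)" using x by simp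
    then show ?thesis unfolding A_def using one by blast
  qed
  ultimately show thesis using that[OF Asub _ _ _ A_def mu_char mu_W mu_x mu] by blast
qed

text \<open>Translating the summation by \<open>y\<close> multiplies the sum by
  \<open>\<theta> y\<close>, which differs from 1.\<close>

lemma lin_chars_sum_eq_0:
  assumes W: "subgroup W G" and lam: "\<theta> \<in> lin_chars G W N" and y: "y \<in> W" "\<theta> y \<noteq> 1"
  shows "(\<Sum>x\<in>W. \<theta> x) = 0"
proof -
  have yc: "y \<in> carrier G" "inv y \<in> W" using subgroup.mem_carrier[OF W] y W by (auto intro: subgroup.m_inv_closed)
  have c: "inv y \<otimes> (y \<otimes> x) = x" "y \<otimes> (inv y \<otimes> x) = x" if "x \<in> W" for x
    using yc(1) subgroup.mem_carrier[OF W that] by (simp_all add: m_assoc[symmetric])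
  have "(\<Sum>x\<in>W. \<theta> x) = (\<Sum>x\<in>W. \<theta> (y \<otimes> x))"
    by (rule sum.reindex_bij_witness[of _ "\<lambda>x. y \<otimes> x" "\<lambda>x. inv y \<otimes> x"])
       (simp_all add: c yc y subgroup.m_closed[OF W])
  also have "\<dots> = \<theta> y * (\<Sum>x\<in>W. \<theta> x)"
    using lin_charsD(1)[OF lam y(1)] by (simp add: sum_distrib_left)
  finally show ?thesis using y(2) by (metis mult_cancel_right1)
qed

lemma lin_chars_mult:
  assumes "\<theta> \<in> lin_chars G W N" "\<mu> \<in> lin_chars G W N"
  shows "(\<lambda>x. \<theta> x * \<mu> x) \<in> lin_chars G W N"
  using assms by (simp add: lin_chars_def)

lemma lin_chars_inverse:
  assumes "\<theta> \<in> lin_chars G W N"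
  shows "(\<lambda>x. inverse (\<theta> x)) \<in> lin_chars G W N"
  using assms by (simp add: lin_chars_def)

lemma lin_chars_power:
  assumes "\<theta> \<in> lin_chars G W N" "n > 0"
  shows "(\<lambda>x. \<theta> x ^ n) \<in> lin_chars G W N"
  using assms by (simp add: lin_chars_def power_mult_distrib)

text \<open>The dual argument: multiplication by \<open>\<mu>\<close> permutes the characters and
  multiplies the sum by \<open>\<mu> x\<close>.\<close>

lemma sum_over_lin_chars_eq_0:
  assumes W: "subgroup W G" and N: "\<one> \<in> N" and mu: "\<mu> \<in> lin_chars G W N" and x: "x \<in> W" "\<mu> x \<noteq> 1"
  shows "(\<Sum>\<theta>\<in>lin_chars G W N. \<theta> x) = 0"
proof -
  have nz: "\<mu> y \<noteq> 0" if "y \<in> W" for y using lin_chars_nz[OF W mu N that] .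
  have "(\<Sum>\<theta>\<in>lin_chars G W N. \<theta> x) = (\<Sum>\<theta>\<in>lin_chars G W N. \<mu> x * \<theta> x)"
  proof (rule sum.reindex_bij_witness[of _ "\<lambda>\<theta> y. \<mu> y * \<theta> y" "\<lambda>\<theta> y. inverse (\<mu> y) * \<theta> y"])
    fix \<theta> assume l: "\<theta> \<in> lin_chars G W N"
    show "(\<lambda>y. \<mu> y * \<theta> y) \<in> lin_chars G W N" using lin_chars_mult[OF mu l] .
    show "(\<lambda>y. inverse (\<mu> y) * \<theta> y) \<in> lin_chars G W N" using lin_chars_mult[OF lin_chars_inverse[OF mu] l] .
    have "\<theta> y = 0" if "y \<notin> W" for y using lin_charsD(3)[OF l that] .
    then have "inverse (\<mu> y) * (\<mu> y * \<theta> y) = \<theta> y \<and> \<mu> y * (inverse (\<mu> y) * \<theta> y) = \<theta> y" for y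
      using nz[of y] by (cases "y \<in> W") auto
    then show "(\<lambda>y. inverse (\<mu> y) * (\<mu> y * \<theta> y)) = \<theta>" "(\<lambda>y. \<mu> y * (inverse (\<mu> y) * \<theta> y)) = \<theta>"
      "\<mu> x * (inverse (\<mu> x) * \<theta> x) = \<theta> x"
      by (simp_all only:)
  qed
  also have "\<dots> = \<mu> x * (\<Sum>\<theta>\<in>lin_chars G W N. \<theta> x)"
    by (rule sum_distrib_left[symmetric])
  finally show ?thesis using x(2) by (metis mult_cancel_right1)
qed

end

context comm_group
begin

text \<open>All roots exist in the complex numbers, so \<open>lin_chars_extend_step\<close> applies
  to any element outside \<open>W\<close>; the complement shrinks until the whole group is
  reached.\<close>

lemma lin_chars_extend:
  assumes fin: "finite (carrier G)" and W: "subgroup W G" and lam: "\<theta> \<in> lin_chars G W {\<one>}"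
  shows "\<exists>\<mu>\<in>lin_chars G (carrier G) {\<one>}. \<forall>w\<in>W. \<mu> w = \<theta> w"
  using W lam
proof (induction "card (carrier G) - card W" arbitrary: W \<theta> rule: less_induct)
  case less
  show ?case
  proof (cases "W = carrier G")
    case False
    then obtain x where x: "x \<in> carrier G" "x \<notin> W" using less.prems(1) subgroup.subset by blast
    obtain n where n: "n > 0" "\<And>i::nat. x [^] i \<in> W \<longleftrightarrow> n dvd i"
      using relative_order[OF fin less.prems(1) x(1)] by blast
    have comm: "x \<otimes> w = w \<otimes> x" if "w \<in> W" for w
      using m_comm[OF x(1) subgroup.mem_carrier[OF less.prems(1) that]] .
    obtain c where c: "c ^ n = \<theta> (x [^] n)" using complex_nth_root_exists[OF n(1)] by blast
    obtain A \<mu> where A: "subgroup A G" "W \<subseteq> A" "x \<in> A" "\<mu> \<in> lin_chars G A {\<one>}" "\<And>w. w \<in> W \<Longrightarrow> \<mu> w = \<theta> w"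
      by (rule lin_chars_extend_step[OF fin less.prems x(1) comm n c]) (assumption | rule that)+
    have Ac: "A \<subseteq> carrier G" by (rule subgroup.subset[OF A(1)])
    have "W \<subset> A" using A(2,3) x(2) by blast
    then have "card W < card A" using finite_subset[OF Ac fin] by (rule psubset_card_mono[rotated])
    moreover have "card A \<le> card (carrier G)" using fin Ac by (rule card_mono)
    ultimately have "card (carrier G) - card A < card (carrier G) - card W" by linarith
    then obtain \<nu> where "\<nu> \<in> lin_chars G (carrier G) {\<one>}" "\<forall>w\<in>A. \<nu> w = \<mu> w"
      using less.hyps A(1,4) by blast
    then show ?thesis using A(2,5) by (intro bexI[of _ \<nu>]) auto
  qed (use less.prems in auto)
qed

text \<open>Starting from the trivial subgroup, \<open>x\<close> may be sent to a primitive root of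
  unity of order \<open>ord x\<close>; the character of the cyclic group so obtained
  extends.\<close>

lemma lin_chars_separate:
  assumes fin: "finite (carrier G)" and x: "x \<in> carrier G" "x \<noteq> \<one>"
  shows "\<exists>\<mu>\<in>lin_chars G (carrier G) {\<one>}. \<mu> x \<noteq> 1"
proof -
  have W: "subgroup {\<one>} G" by (rule triv_subgroup)
  define \<theta> where "\<theta> = (\<lambda>y. if y = \<one> then 1 else 0 :: complex)"
  have lam: "\<theta> \<in> lin_chars G {\<one>} {\<one>}" by (auto simp: lin_chars_def \<theta>_def)
  have "ord x \<noteq> 1" "ord x \<ge> 1" using x ord_eq_1 ord_ge_1[OF fin] by auto
  then have o: "ord x > 1" by simp
  have o': "ord x > 0" using o by simp
  have comm: "x \<otimes> w = w \<otimes> x" if "w \<in> {\<one>}" for w using that x by simp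
  have pw: "\<And>i::nat. x [^] i \<in> {\<one>} \<longleftrightarrow> ord x dvd i" using x by (simp add: pow_eq_id)
  have z: "zeta (ord x) ^ ord x = \<theta> (x [^] ord x)"
    using x o by (simp add: \<theta>_def zeta_power_eq_1_iff)
  obtain A \<mu> where A: "subgroup A G" "x \<in> A" "\<mu> \<in> lin_chars G A {\<one>}" "\<mu> x = zeta (ord x)"
    by (rule lin_chars_extend_step[OF fin W lam x(1) comm o' pw z]) (assumption | rule that)+
  have "zeta (ord x) \<noteq> 1" using zeta_power_eq_1_iff[of "ord x" 1] o by simp
  then show ?thesis using lin_chars_extend[OF fin A(1,3)] A(2,4) by metis
qed

lemma sum_over_lin_chars:
  assumes fin: "finite (carrier G)" and x: "x \<in> carrier G"
  shows "(\<Sum>\<theta>\<in>lin_chars G (carrier G) {\<one>}. \<theta> x) = (if x = \<one> then of_nat (card (carrier G)) else 0)"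
    and "card (lin_chars G (carrier G) {\<one>}) = card (carrier G)"
proof -
  let ?X = "lin_chars G (carrier G) {\<one>}"
  have finX: "finite ?X" using finite_lin_chars[OF fin subgroup_self] by simp
  have s: "(\<Sum>\<theta>\<in>?X. \<theta> x) = (if x = \<one> then of_nat (card ?X) else 0)" if x: "x \<in> carrier G" for x
  proof (cases "x = \<one>")
    case True
    have "(\<Sum>\<theta>\<in>?X. \<theta> x) = (\<Sum>\<theta>\<in>?X. 1)"
      by (rule sum.cong[OF refl]) (simp add: True lin_charsD(2)[of _ G "carrier G" "{\<one>}"])
    then show ?thesis using True by simp
  next
    case False
    then show ?thesis using lin_chars_separate[OF fin x] sum_over_lin_chars_eq_0[OF subgroup_self _ _ x] by auto
  qed
  define e where "e = (\<lambda>x. if x \<in> carrier G then 1 else 0 :: complex)"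
  have e: "e \<in> ?X" by (auto simp: lin_chars_def e_def)
  have r: "(\<Sum>x\<in>carrier G. \<theta> x) = (if \<theta> = e then of_nat (card (carrier G)) else 0)" if l: "\<theta> \<in> ?X" for \<theta>
  proof (cases "\<theta> = e")
    case False
    then obtain y where "y \<in> carrier G" "\<theta> y \<noteq> 1"
      using lin_charsD(3)[OF l] unfolding e_def fun_eq_iff by metis
    then show ?thesis using lin_chars_sum_eq_0[OF subgroup_self l] False by simp
  qed (simp add: e_def)
  \<comment> \<open>A double count of all character values: summing over the characters first leaves
    the element \<open>\<one>\<close>, summing over the elements first leaves the trivial character
    \<open>e\<close>.\<close>
  have "of_nat (card ?X) = (\<Sum>x\<in>carrier G. \<Sum>\<theta>\<in>?X. \<theta> x)"
    using fin by (simp add: s)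
  also have "\<dots> = (\<Sum>\<theta>\<in>?X. \<Sum>x\<in>carrier G. \<theta> x)" by (rule sum.swap)
  also have "\<dots> = of_nat (card (carrier G))" using finX e by (simp add: r)
  finally show c: "card ?X = card (carrier G)" using of_nat_eq_iff by blast
  show "(\<Sum>\<theta>\<in>?X. \<theta> x) = (if x = \<one> then of_nat (card (carrier G)) else 0)"
    using s[OF x] c by simp
qed

end

section \<open>Quotients and cyclic subgroups\<close>

lemma (in normal) rcos_eq_iff:
  assumes "x \<in> carrier G" "y \<in> carrier G"
  shows "H #> x = H #> y \<longleftrightarrow> x \<otimes> inv y \<in> H"
proof
  assume "H #> x = H #> y"
  then have "x \<in> H #> y" using rcos_self[OF assms(1) subgroup_axioms] by simp
  then show "x \<otimes> inv y \<in> H" using rcos_module[OF is_group assms(2,1)] by simp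
next
  assume "x \<otimes> inv y \<in> H"
  then have "x \<in> H #> y" using rcos_module[OF is_group assms(2,1)] by simp
  then show "H #> x = H #> y" using repr_independence assms(2) subgroup_axioms by metis
qed

lemma (in normal) rcos_eq_self_iff:
  assumes "x \<in> carrier G"
  shows "H #> x = H \<longleftrightarrow> x \<in> H"
  using rcos_eq_iff[OF assms one_closed] assms subset by simp

lemma (in normal) rcos_mult:
  assumes "x \<in> carrier G" "y \<in> carrier G"
  shows "(H #> x) \<otimes>\<^bsub>G Mod H\<^esub> (H #> y) = H #> (x \<otimes> y)"
  using assms by (simp add: rcos_sum)

definition (in group) inflate :: "'a set \<Rightarrow> ('a set \<Rightarrow> complex) \<Rightarrow> 'a \<Rightarrow> complex" where
  "inflate N \<mu> = (\<lambda>x. if x \<in> carrier G then \<mu> (N #> x) else 0)"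

lemma (in normal) bij_betw_inflate:
  "bij_betw (inflate H) (lin_chars (G Mod H) (carrier (G Mod H)) {H}) (lin_chars G (carrier G) H)"
proof (rule bij_betwI')
  fix \<mu> \<nu> assume mn: "\<mu> \<in> lin_chars (G Mod H) (carrier (G Mod H)) {H}" "\<nu> \<in> lin_chars (G Mod H) (carrier (G Mod H)) {H}"
  have "\<mu> = \<nu>" if eq: "inflate H \<mu> = inflate H \<nu>"
  proof
    fix U show "\<mu> U = \<nu> U"
    proof (cases "U \<in> carrier (G Mod H)")
      case True
      then obtain x where x: "x \<in> carrier G" "U = H #> x" by (auto simp: carrier_FactGroup)
      then show ?thesis using fun_cong[OF eq, of x] by (simp add: inflate_def)
    next
      case False
      then show ?thesis using lin_charsD(3)[OF mn(1)] lin_charsD(3)[OF mn(2)] by simp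
    qed
  qed
  then show "(inflate H \<mu> = inflate H \<nu>) = (\<mu> = \<nu>)" by auto
next
  fix \<mu> assume mu: "\<mu> \<in> lin_chars (G Mod H) (carrier (G Mod H)) {H}"
  have c: "H #> x \<in> carrier (G Mod H)" if "x \<in> carrier G" for x using that by (auto simp: carrier_FactGroup)
  show "inflate H \<mu> \<in> lin_chars G (carrier G) H"
    unfolding lin_chars_def
  proof (intro CollectI conjI ballI allI impI)
    fix x y assume xy: "x \<in> carrier G" "y \<in> carrier G"
    then show "inflate H \<mu> (x \<otimes> y) = inflate H \<mu> x * inflate H \<mu> y"
      using lin_charsD(1)[OF mu c[OF xy(1)] c[OF xy(2)]] rcos_mult[OF xy] by (simp add: inflate_def)
  next
    fix x assume x: "x \<in> H"
    then have "x \<in> carrier G" using subset by blast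
    then show "inflate H \<mu> x = 1" using x rcos_eq_self_iff[of x] lin_charsD(2)[OF mu, of H] by (simp add: inflate_def)
  qed (simp add: inflate_def)
next
  fix \<theta> assume th: "\<theta> \<in> lin_chars G (carrier G) H"
  define \<mu> where "\<mu> = (\<lambda>U. if U \<in> carrier (G Mod H) then \<theta> (SOME x. x \<in> carrier G \<and> U = H #> x) else 0)"
  have mu: "\<mu> (H #> x) = \<theta> x" if x: "x \<in> carrier G" for x
  proof -
    define y where "y = (SOME y. y \<in> carrier G \<and> H #> x = H #> y)"
    have "y \<in> carrier G \<and> H #> x = H #> y" unfolding y_def by (rule someI[of _ x]) (simp add: x)
    then have y: "y \<in> carrier G" "x \<otimes> inv y \<in> H" using rcos_eq_iff[OF x] by auto
    have "x = (x \<otimes> inv y) \<otimes> y" using x y by (simp add: m_assoc)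
    moreover have "\<theta> ((x \<otimes> inv y) \<otimes> y) = \<theta> (x \<otimes> inv y) * \<theta> y"
      by (rule lin_charsD(1)[OF th]) (use x y in simp_all)
    ultimately have "\<theta> x = \<theta> y" using lin_charsD(2)[OF th y(2)] by simp
    moreover have "H #> x \<in> carrier (G Mod H)" using x by (auto simp: carrier_FactGroup)
    ultimately show ?thesis by (simp add: \<mu>_def y_def)
  qed
  have "\<mu> \<in> lin_chars (G Mod H) (carrier (G Mod H)) {H}"
    unfolding lin_chars_def
  proof (intro CollectI conjI ballI allI impI)
    fix U V assume "U \<in> carrier (G Mod H)" "V \<in> carrier (G Mod H)"
    then obtain x y where xy: "x \<in> carrier G" "U = H #> x" "y \<in> carrier G" "V = H #> y"
      by (auto simp: carrier_FactGroup)
    then have "U \<otimes>\<^bsub>G Mod H\<^esub> V = H #> (x \<otimes> y)" using rcos_mult by simp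
    then show "\<mu> (U \<otimes>\<^bsub>G Mod H\<^esub> V) = \<mu> U * \<mu> V"
      using mu[of "x \<otimes> y"] mu[of x] mu[of y] lin_charsD(1)[OF th xy(1,3)] xy by simp
  next
    fix U assume "U \<in> {H}"
    then show "\<mu> U = 1" using mu[OF one_closed] subset lin_charsD(2)[OF th subgroup.one_closed[OF subgroup_axioms]] by simp
  qed (simp add: \<mu>_def)
  moreover have "\<theta> = inflate H \<mu>"
    using mu lin_charsD(3)[OF th] by (intro ext) (simp add: inflate_def)
  ultimately show "\<exists>\<mu>\<in>lin_chars (G Mod H) (carrier (G Mod H)) {H}. \<theta> = inflate H \<mu>" by blast
qed

lemma (in normal) finite_FactGroup: "finite (carrier G) \<Longrightarrow> finite (carrier (G Mod H))"
  by (simp add: carrier_FactGroup)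

lemma (in normal) sum_over_lin_chars_quotient:
  assumes fin: "finite (carrier G)" and comm: "comm_group (G Mod H)" and x: "x \<in> carrier G"
  shows "(\<Sum>\<theta>\<in>lin_chars G (carrier G) H. \<theta> x) = (if x \<in> H then of_nat (card (rcosets H)) else 0)"
    and "card (lin_chars G (carrier G) H) = card (rcosets H)"
proof -
  interpret Q: comm_group "G Mod H" by (rule comm)
  have finQ: "finite (carrier (G Mod H))" by (rule finite_FactGroup[OF fin])
  have cQ: "carrier (G Mod H) = rcosets H" by (simp add: FactGroup_def)
  have Hx: "H #> x \<in> carrier (G Mod H)" using x by (auto simp: carrier_FactGroup)
  have "(\<Sum>\<theta>\<in>lin_chars G (carrier G) H. \<theta> x) = (\<Sum>\<mu>\<in>lin_chars (G Mod H) (carrier (G Mod H)) {H}. inflate H \<mu> x)"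
    by (rule sum.reindex_bij_betw[OF bij_betw_inflate, symmetric])
  also have "\<dots> = (\<Sum>\<mu>\<in>lin_chars (G Mod H) (carrier (G Mod H)) {H}. \<mu> (H #> x))"
    using x by (simp add: inflate_def)
  finally show "(\<Sum>\<theta>\<in>lin_chars G (carrier G) H. \<theta> x) = (if x \<in> H then of_nat (card (rcosets H)) else 0)"
    using Q.sum_over_lin_chars(1)[OF finQ Hx] rcos_eq_self_iff[OF x] cQ by simp
  show "card (lin_chars G (carrier G) H) = card (rcosets H)"
    using bij_betw_same_card[OF bij_betw_inflate] Q.sum_over_lin_chars(2)[OF finQ Hx] cQ by simp
qed

text \<open>Characters killed by \<open>d\<close> are those of the quotient by the subgroup
  \<open>?D\<close> of \<open>d\<close>-th powers, and the index of \<open>?D\<close> is the order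
  of the kernel \<open>?K\<close> of the power map. The count avoids any decomposition into cyclic
  factors.\<close>

lemma (in comm_group) card_lin_chars_exponent:
  assumes fin: "finite (carrier G)"
  shows "card {\<theta> \<in> lin_chars G (carrier G) {\<one>}. \<forall>x\<in>carrier G. \<theta> x ^ d = 1} = card {x \<in> carrier G. x [^] (d::nat) = \<one>}"
proof -
  let ?D = "(\<lambda>x. x [^] d) ` carrier G" and ?K = "{x \<in> carrier G. x [^] d = \<one>}"
  have D: "subgroup ?D G"
  proof (rule finite_subgroupI[OF fin])
    show "\<one> \<in> ?D" using nat_pow_one[of d] by (metis image_eqI one_closed)
    fix a b assume "a \<in> ?D" "b \<in> ?D"
    then show "a \<otimes> b \<in> ?D" by (auto simp: nat_pow_distrib[symmetric])
  qed auto
  have K: "subgroup ?K G"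
    by (rule finite_subgroupI[OF fin]) (auto simp: nat_pow_distrib)
  have "card (carrier G) = card ?D * card ?K"
  proof (rule card_fibres[OF fin K])
    fix x y assume xy: "x \<in> carrier G" "y \<in> carrier G"
    have "(x \<otimes> inv y) [^] d = x [^] d \<otimes> inv (y [^] d)"
      using xy by (simp add: nat_pow_distrib nat_pow_inv)
    moreover have "x [^] d \<otimes> inv (y [^] d) = \<one> \<longleftrightarrow> x [^] d = y [^] d"
      using xy by (metis inv_closed inv_equality inv_inv nat_pow_closed r_inv)
    ultimately show "x [^] d = y [^] d \<longleftrightarrow> x \<otimes> inv y \<in> ?K" using xy by simp
  qed
  moreover have "card (rcosets ?D) * card ?D = card (carrier G)"
    using lagrange[OF D] by (simp add: Coset.order_def)
  moreover have "card ?D > 0"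
    using D finite_subset[OF subgroup.subset[OF D] fin] subgroup.one_closed[OF D] by (auto simp: card_gt_0_iff)
  ultimately have "card ?D * card (rcosets ?D) = card ?D * card ?K" "card ?D \<noteq> 0" by (simp_all add: mult.commute)
  then have c: "card (rcosets ?D) = card ?K" by simp
  interpret D: normal ?D G using D normal_iff_subgroup by blast
  have "{\<theta> \<in> lin_chars G (carrier G) {\<one>}. \<forall>x\<in>carrier G. \<theta> x ^ d = 1} = lin_chars G (carrier G) ?D" (is "?L = ?R")
  proof
    show "?L \<subseteq> ?R"
    proof
      fix \<theta> assume a: "\<theta> \<in> ?L"
      then have th: "\<theta> \<in> lin_chars G (carrier G) {\<one>}" by simp
      have "\<theta> y = 1" if "y \<in> ?D" for y
        using that a lin_chars_pow[OF subgroup_self th] by auto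
      then show "\<theta> \<in> ?R" using th by (simp add: lin_chars_def)
    qed
    show "?R \<subseteq> ?L"
    proof
      fix \<theta> assume a: "\<theta> \<in> ?R"
      have "\<one> \<in> ?D" by (rule subgroup.one_closed[OF D])
      then have th: "\<theta> \<in> lin_chars G (carrier G) {\<one>}" using lin_chars_mono[of "{\<one>}" ?D G "carrier G"] a by blast
      have "\<theta> x ^ d = 1" if "x \<in> carrier G" for x
        using lin_charsD(2)[OF a, of "x [^] d"] that lin_chars_pow[OF subgroup_self th _ that, of d] by simp
      then show "\<theta> \<in> ?L" using th by simp
    qed
  qed
  then show ?thesis
    using D.sum_over_lin_chars_quotient(2)[OF fin abelian_FactGroup[OF D] one_closed] c by simp
qed

lemma (in normal) card_lin_chars_quotient_exponent:
  assumes fin: "finite (carrier G)" and comm: "comm_group (G Mod H)"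
  shows "card {\<theta> \<in> lin_chars G (carrier G) H. \<forall>x\<in>carrier G. \<theta> x ^ d = 1}
    = card {U \<in> carrier (G Mod H). U [^]\<^bsub>G Mod H\<^esub> (d::nat) = \<one>\<^bsub>G Mod H\<^esub>}"
proof -
  interpret Q: comm_group "G Mod H" by (rule comm)
  let ?A = "{\<mu> \<in> lin_chars (G Mod H) (carrier (G Mod H)) {H}. \<forall>U\<in>carrier (G Mod H). \<mu> U ^ d = 1}"
  let ?B = "{\<theta> \<in> lin_chars G (carrier G) H. \<forall>x\<in>carrier G. \<theta> x ^ d = 1}"
  have eq: "(\<forall>U\<in>carrier (G Mod H). \<mu> U ^ d = 1) \<longleftrightarrow> (\<forall>x\<in>carrier G. inflate H \<mu> x ^ d = 1)" for \<mu>
    by (auto simp: carrier_FactGroup inflate_def)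
  have "inflate H ` ?A = ?B"
    using bij_betw_inflate eq by (auto simp: bij_betw_def)
  moreover have "inj_on (inflate H) ?A"
    using bij_betw_inflate by (auto simp: bij_betw_def inj_on_def)
  ultimately have "card ?B = card ?A" using card_image[of "inflate H" ?A] by simp
  then show ?thesis using Q.card_lin_chars_exponent[OF finite_FactGroup[OF fin], of d] by simp
qed

section \<open>Cyclic subgroups of prime power order and the exponent\<close>

lemma (in group) card_ord_eq_num_cyclic_subgroups:
  assumes fin: "finite (carrier G)"
  shows "card {x \<in> carrier G. ord x = k} = num_cyclic_subgroups G k * totient k"
proof -
  let ?S = "{H. (\<exists>x\<in>carrier G. H = generate G {x}) \<and> card H = k}"
  let ?F = "\<lambda>H. {x \<in> carrier G. generate G {x} = H}"
  have finS: "finite ?S"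
    by (rule finite_subset[of _ "(\<lambda>x. generate G {x}) ` carrier G"]) (use fin in auto)
  have F: "card (?F H) = totient k" if H: "H \<in> ?S" for H
  proof -
    obtain a where a: "a \<in> carrier G" "H = generate G {a}" "card H = k" using H by blast
    have o: "ord a = k" using generate_pow_card[OF a(1)] a by simp
    have k: "k \<ge> 1" using ord_ge_1[OF fin a(1)] o by simp
    \<comment> \<open>The generators of a cyclic group of order \<open>k\<close> are the powers of
      one generator with exponent in \<open>totatives k\<close>, so each cyclic subgroup accounts
      for \<open>totient k\<close> elements.\<close>
    have "?F H = (\<lambda>j. a [^] j) ` totatives k"
    proof (intro equalityI subsetI)
      fix x assume "x \<in> ?F H"
      then have x: "x \<in> carrier G" "generate G {x} = generate G {a}" using a by auto
      then have "x \<in> generate G {a}" using generate.incl[of x "{x}"] by blast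
      then obtain i where i: "x = a [^] (i::nat)" using generate_pow_nat[OF a(1)] o k by auto
      \<comment> \<open>The representative of \<open>i\<close> modulo \<open>k\<close> between 1 and
        \<open>k\<close>: \<open>totatives\<close> starts at 1, so the residue 0 is replaced by
        \<open>k\<close>, which matters for \<open>k = 1\<close>.\<close>
      define j where "j = (if i mod k = 0 then k else i mod k)"
      have "j > 0" "j \<le> k" using k by (auto simp: j_def)
      have "[int j = int i] (mod int k)" unfolding cong_int_iff by (auto simp: j_def cong_def)
      then have "int k dvd int j - int i" by (simp add: cong_iff_dvd_diff)
      then have xj: "x = a [^] j" using int_pow_eq[OF a(1), of "int i" "int j"] o i by (simp add: int_pow_int)
      have "ord x = k" using generate_pow_card[OF x(1)] x(2) a by simp
      then have "coprime j k" using pow_ord_eq_ord_iff[OF fin a(1), of j] xj o by simp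
      then show "x \<in> (\<lambda>j. a [^] j) ` totatives k" using xj \<open>j > 0\<close> \<open>j \<le> k\<close> by (auto simp: in_totatives_iff)
    next
      fix x assume "x \<in> (\<lambda>j. a [^] j) ` totatives k"
      then obtain j where j: "j \<in> totatives k" "x = a [^] j" by blast
      then have x: "x \<in> carrier G" using a by simp
      have ox: "ord x = k" using pow_ord_eq_ord_iff[OF fin a(1), of j] j o by (simp add: in_totatives_iff)
      have "x \<in> generate G {a}" using generate_pow_nat[OF a(1)] o k j by auto
      then have "generate G {x} \<subseteq> generate G {a}"
        using generate_subgroup_incl[of "{x}" "generate G {a}"] generate_is_subgroup[of "{a}"] a by simp
      moreover have "finite (generate G {a})" using fin a generate_incl[of "{a}"] by (meson bot_least finite_subset insert_subset)
      moreover have "card (generate G {x}) = card (generate G {a})"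
        using generate_pow_card[OF x] generate_pow_card[OF a(1)] ox o by simp
      ultimately have "generate G {x} = generate G {a}" by (simp add: card_subset_eq)
      then show "x \<in> ?F H" using x a by simp
    qed
    moreover have "inj_on (\<lambda>j. a [^] j) (totatives k)"
      by (rule inj_on_subset[OF ord_inj'[OF a(1)]]) (auto simp: o in_totatives_iff)
    ultimately show ?thesis by (simp add: card_image totient_def)
  qed
  have "{x \<in> carrier G. ord x = k} = (\<Union>H\<in>?S. ?F H)"
    using generate_pow_card by auto
  moreover have "card (\<Union>H\<in>?S. ?F H) = (\<Sum>H\<in>?S. card (?F H))"
    by (rule card_UN_disjoint[OF finS]) (use fin in auto)
  ultimately have "card {x \<in> carrier G. ord x = k} = (\<Sum>H\<in>?S. totient k)"
    using F by simp
  then show ?thesis by (simp add: num_cyclic_subgroups_def)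
qed

lemma (in group) card_torsion_prime_power:
  assumes fin: "finite (carrier G)" and p: "Factorial_Ring.prime (p::nat)"
  shows "card {x \<in> carrier G. x [^] (p ^ Suc l) = \<one>}
    = card {x \<in> carrier G. x [^] (p ^ l) = \<one>} + num_cyclic_subgroups G (p ^ Suc l) * totient (p ^ Suc l)"
proof -
  have "{x \<in> carrier G. x [^] (p ^ Suc l) = \<one>} = {x \<in> carrier G. x [^] (p ^ l) = \<one>} \<union> {x \<in> carrier G. ord x = p ^ Suc l}"
  proof -
    have "ord x dvd p ^ Suc l \<longleftrightarrow> ord x dvd p ^ l \<or> ord x = p ^ Suc l" for x
    proof
      assume "ord x dvd p ^ Suc l"
      then obtain i where i: "i \<le> Suc l" "ord x = p ^ i" using divides_primepow_nat[OF p] by blast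
      then show "ord x dvd p ^ l \<or> ord x = p ^ Suc l" by (cases "i = Suc l") (auto simp: le_imp_power_dvd)
    next
      assume "ord x dvd p ^ l \<or> ord x = p ^ Suc l"
      then show "ord x dvd p ^ Suc l" by (auto intro: dvd_mult)
    qed
    then show ?thesis by (auto simp only: pow_eq_id mem_Collect_eq dvd_refl)
  qed
  moreover have "{x \<in> carrier G. x [^] (p ^ l) = \<one>} \<inter> {x \<in> carrier G. ord x = p ^ Suc l} = {}"
  proof -
    have "\<not> p ^ Suc l dvd p ^ l" using p prime_gt_1_nat[OF p] by (simp add: power_dvd_imp_le dvd_power_iff_le)
    then show ?thesis by (auto simp: pow_eq_id)
  qed
  ultimately show ?thesis
    using fin card_ord_eq_num_cyclic_subgroups[OF fin] by (simp add: card_Un_disjoint)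
qed

lemma (in group) num_cyclic_subgroups_1:
  assumes fin: "finite (carrier G)"
  shows "num_cyclic_subgroups G 1 = 1"
proof -
  have "{x \<in> carrier G. ord x = 1} = {\<one>}" using ord_eq_1 by auto
  then show ?thesis using card_ord_eq_num_cyclic_subgroups[OF fin, of 1] by simp
qed

lemma (in group) grp_exponent_prime_power:
  assumes p: "Factorial_Ring.prime (p::nat)" and card: "card (carrier G) = p ^ k"
  obtains m where "grp_exponent G = p ^ m" "\<And>x. x \<in> carrier G \<Longrightarrow> x [^] (p ^ m) = \<one>"
proof -
  define m where "m = (LEAST m. \<forall>x\<in>carrier G. x [^] (p ^ m) = \<one>)"
  have "\<forall>x\<in>carrier G. x [^] (p ^ k) = \<one>" using pow_order_eq_1 card by (simp add: Coset.order_def)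
  then have m: "\<forall>x\<in>carrier G. x [^] (p ^ m) = \<one>" unfolding m_def by (rule LeastI)
  have least: "m \<le> j" if "\<forall>x\<in>carrier G. x [^] (p ^ j) = \<one>" for j
    unfolding m_def using that by (rule Least_le)
  have "grp_exponent G = p ^ m" unfolding grp_exponent_def
  proof (rule Least_equality)
    show "0 < p ^ m \<and> (\<forall>x\<in>carrier G. x [^] (p ^ m) = \<one>)" using m prime_gt_0_nat[OF p] by simp
    fix e :: nat assume e: "0 < e \<and> (\<forall>x\<in>carrier G. x [^] e = \<one>)"
    \<comment> \<open>An arbitrary exponent \<open>e\<close> is replaced by its gcd with
      \<open>p^m\<close>, which is again an exponent and a power of \<open>p\<close>, hence not
      below \<open>p^m\<close>.\<close>
    have "gcd e (p ^ m) dvd p ^ m" by simp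
    then obtain j where j: "gcd e (p ^ m) = p ^ j" using divides_primepow_nat[OF p] by blast
    have "\<forall>x\<in>carrier G. x [^] (p ^ j) = \<one>"
    proof
      fix x assume x: "x \<in> carrier G"
      then have "ord x dvd e" "ord x dvd p ^ m" using e m pow_eq_id by auto
      then have "ord x dvd p ^ j" using j by (metis gcd_greatest)
      then show "x [^] (p ^ j) = \<one>" using x pow_eq_id by blast
    qed
    then have "p ^ m \<le> p ^ j" using least[of j] prime_gt_0_nat[OF p] by (simp add: power_increasing)
    also have "\<dots> \<le> e" using j e by (metis gcd_le1_nat less_numeral_extra(3))
    finally show "p ^ m \<le> e" .
  qed
  then show thesis using that m by blast
qed

text \<open>The assumptions make \<open>z\<close> a primitive root of order \<open>p^l\<close>, so
  exponents with equal powers differ by a multiple of \<open>p^l\<close>, and the window is too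
  short for a nonzero one. It is the reason why Galois orbits have full length.\<close>

lemma primitive_root_power_eq:
  fixes z :: complex
  assumes p: "Factorial_Ring.prime (p::nat)" and z: "z ^ (p ^ l) = 1" "l > 0 \<Longrightarrow> z ^ (p ^ (l - 1)) \<noteq> 1"
    and eq: "z ^ i = z ^ j" and ij: "i \<le> j" "j < i + p ^ l"
  shows "i = j"
proof (cases "l = 0")
  case False
  have pl: "p ^ l > 0" using prime_gt_0_nat[OF p] by simp
  obtain k where k: "z = zeta (p ^ l) ^ k" using root_of_unity_eq_zeta_power[OF pl z(1)] .
  have "z \<noteq> 0" using z(1) pl by (auto simp: power_0_left)
  moreover have "z ^ j = z ^ i * z ^ (j - i)" using ij(1) by (simp add: power_add[symmetric])
  ultimately have "z ^ (j - i) = 1" using eq by simp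
  then have d: "p ^ l dvd k * (j - i)" using pl by (simp add: k power_mult[symmetric] zeta_power_eq_1_iff)
  have "\<not> p dvd k"
  proof
    assume "p dvd k"
    then have "p * p ^ (l - 1) dvd k * p ^ (l - 1)" by simp
    then have "p ^ l dvd k * p ^ (l - 1)" using False by (metis power_eq_if)
    then show False using z(2) False pl by (simp add: k power_mult[symmetric] zeta_power_eq_1_iff)
  qed
  then have "coprime (p ^ l) k" using p by (simp add: prime_imp_coprime)
  then have "p ^ l dvd j - i" using d by (simp add: coprime_dvd_mult_right_iff)
  then show ?thesis using ij by (auto dest: dvd_imp_le)
qed (use ij in simp)

text \<open>Raising to powers prime to \<open>p^l\<close> is the Galois action on the values. By
  \<open>prim\<close> some value of \<open>\<theta>\<close> is a primitive root, so every orbit has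
  exactly \<open>totient (p^l)\<close> members; removing one orbit after another collects one
  representative of each in \<open>R\<close>.\<close>

lemma power_orbit_representatives:
  fixes U :: "('a \<Rightarrow> complex) set"
  assumes p: "Factorial_Ring.prime (p::nat)" and fin: "finite U"
    and root: "\<And>\<theta> x. \<theta> \<in> U \<Longrightarrow> x \<in> C \<Longrightarrow> \<theta> x ^ (p ^ l) = 1"
    and zero: "\<And>\<theta> x. \<theta> \<in> U \<Longrightarrow> x \<notin> C \<Longrightarrow> \<theta> x = 0"
    and closed: "\<And>\<theta> j. \<theta> \<in> U \<Longrightarrow> coprime j (p ^ l) \<Longrightarrow> j > 0 \<Longrightarrow> (\<lambda>x. \<theta> x ^ j) \<in> U"
    and prim: "\<And>\<theta>. \<theta> \<in> U \<Longrightarrow> \<exists>x\<in>C. l > 0 \<longrightarrow> \<theta> x ^ (p ^ (l - 1)) \<noteq> 1"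
  shows "\<exists>R. set R \<subseteq> U \<and> length R * totient (p ^ l) = card U \<and>
    (\<forall>x\<in>C. (\<Sum>\<theta>\<leftarrow>R. \<Sum>j\<in>totatives (p ^ l). \<theta> x ^ j) = (\<Sum>\<theta>\<in>U. \<theta> x))"
  using fin root zero closed prim
proof (induction "card U" arbitrary: U rule: less_induct)
  case less
  show ?case
  proof (cases "U = {}")
    case True
    then show ?thesis by (intro exI[of _ "[]"]) simp
  next
    case False
    then obtain \<theta> where th: "\<theta> \<in> U" by blast
    let ?m = "p ^ l" and ?T = "totatives (p ^ l)"
    have m0: "?m > 0" using prime_gt_0_nat[OF p] by simp
    define pw where "pw = (\<lambda>j x. \<theta> x ^ j)"
    have pw_X: "pw j \<in> U" if "j \<in> ?T" for j
      unfolding pw_def using less.prems(4)[OF th, of j] that by (simp add: in_totatives_iff)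
    have inj: "inj_on pw ?T"
    proof -
      obtain x where x: "x \<in> C" "l > 0 \<Longrightarrow> \<theta> x ^ (p ^ (l - 1)) \<noteq> 1" using less.prems(5)[OF th] by blast
      have le: "i = j" if "i \<in> ?T" "j \<in> ?T" "pw i = pw j" "i \<le> j" for i j
      proof (rule primitive_root_power_eq[OF p less.prems(2)[OF th x(1)] x(2) _ that(4)])
        show "\<theta> x ^ i = \<theta> x ^ j" using fun_cong[OF that(3), of x] by (simp add: pw_def)
        show "j < i + p ^ l" using that(1,2) by (auto simp: in_totatives_iff)
      qed auto
      show ?thesis
      proof (rule inj_onI)
        fix i j assume "i \<in> ?T" "j \<in> ?T" "pw i = pw j"
        then show "i = j" using le[of i j] le[of j i] by (cases "i \<le> j") auto
      qed
    qed
    let ?O = "pw ` ?T"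
    have O: "?O \<subseteq> U" using pw_X by blast
    have cO: "card ?O = totient ?m" using inj by (simp add: card_image totient_def)
    have "totient ?m > 0" using m0 by simp
    then have lt: "card (U - ?O) < card U" using O cO less.prems(1) by (metis card_Diff_subset card_gt_0_iff card_mono diff_less finite_subset order_less_le_trans)
    have cl: "(\<lambda>x. \<psi> x ^ j) \<in> U - ?O" if psi: "\<psi> \<in> U - ?O" and j: "coprime j ?m" "j > 0" for \<psi> j
    proof -
      have "(\<lambda>x. \<psi> x ^ j) \<notin> ?O"
      proof
        assume "(\<lambda>x. \<psi> x ^ j) \<in> ?O"
        then obtain i where i: "i \<in> ?T" "(\<lambda>x. \<psi> x ^ j) = pw i" by blast
        \<comment> \<open>If the \<open>j\<close>-th power of \<open>\<psi>\<close> lay in the orbit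
          of \<open>\<theta>\<close>, raising to the inverse \<open>j'\<close> of \<open>j\<close>
          modulo \<open>p^l\<close> would bring \<open>\<psi>\<close> itself into it.\<close>
        obtain j' where j': "[j * j' = 1] (mod ?m)" using cong_solve_coprime_nat[OF j(1)] by auto
        \<comment> \<open>The exponent is taken between 1 and \<open>p^l\<close>, never 0: outside
          \<open>C\<close> the functions vanish, and a power with exponent 0 would be 1
          there.\<close>
        define i' where "i' = (if (i * j') mod ?m = 0 then ?m else (i * j') mod ?m)"
        have i'c: "[i' = i * j'] (mod ?m)" by (auto simp: i'_def cong_def)
        have "coprime (j * j') ?m" using j' by (metis cong_imp_coprime cong_sym coprime_1_left)
        then have "coprime j' ?m" by (simp only: coprime_mult_left_iff)
        moreover have "coprime i ?m" using i(1) by (simp only: in_totatives_iff)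
        ultimately have "coprime (i * j') ?m" by (simp only: coprime_mult_left_iff)
        then have "coprime i' ?m" by (rule cong_imp_coprime[OF cong_sym[OF i'c]])
        moreover have "i' > 0" "i' \<le> ?m" using m0 by (simp_all add: i'_def mod_le_divisor)
        ultimately have i'T: "i' \<in> ?T" by (simp only: in_totatives_iff)
        have cong_pow: "z ^ a = z ^ b" if "z ^ ?m = 1" "[a = b] (mod ?m)" for z :: complex and a b
        proof -
          have "z ^ c = z ^ (c mod ?m)" for c
          proof -
            have "z ^ c = z ^ (?m * (c div ?m) + c mod ?m)" by simp
            then show ?thesis using that(1) by (simp only: power_add power_mult power_one mult_1_left)
          qed
          then show ?thesis using that(2) unfolding cong_def by metis
        qed
        have "\<psi> = pw i'"
        proof
          fix x show "\<psi> x = pw i' x"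
          proof (cases "x \<in> C")
            case True
            have r: "\<psi> x ^ ?m = 1" "\<theta> x ^ ?m = 1" using less.prems(2)[OF _ True] psi th by auto
            have "\<psi> x = \<psi> x ^ (j * j')" using cong_pow[OF r(1) j'] by simp
            also have "\<dots> = (\<theta> x ^ i) ^ j'" using fun_cong[OF i(2), of x] by (simp add: power_mult pw_def)
            also have "\<dots> = \<theta> x ^ i'" using cong_pow[OF r(2) i'c] by (simp add: power_mult)
            finally show ?thesis by (simp add: pw_def)
          next
            case False
            have "i' > 0" using i'T by (simp add: in_totatives_iff)
            moreover have "\<psi> x = 0" "\<theta> x = 0" using less.prems(3)[OF _ False] psi th by simp_all
            ultimately show ?thesis by (simp add: pw_def)
          qed
        qed
        then show False using psi i'T by blast
      qed
      then show ?thesis using less.prems(4)[of \<psi> j] psi j by blast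
    qed
    have "\<exists>R. set R \<subseteq> U - ?O \<and> length R * totient ?m = card (U - ?O) \<and>
      (\<forall>x\<in>C. (\<Sum>\<theta>\<leftarrow>R. \<Sum>j\<in>?T. \<theta> x ^ j) = (\<Sum>\<theta>\<in>U - ?O. \<theta> x))"
    proof (rule less.hyps[OF lt])
      show "(\<lambda>x. \<psi> x ^ j) \<in> U - ?O" if "\<psi> \<in> U - ?O" "coprime j ?m" "j > 0" for \<psi> j using cl that .
      show "finite (U - ?O)" using less.prems(1) by simp
      show "\<psi> x ^ ?m = 1" if "\<psi> \<in> U - ?O" "x \<in> C" for \<psi> x
        using less.prems(2)[OF _ that(2), of \<psi>] that(1) by simp
      show "\<psi> x = 0" if "\<psi> \<in> U - ?O" "x \<notin> C" for \<psi> x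
        using less.prems(3)[OF _ that(2), of \<psi>] that(1) by simp
      show "\<exists>x\<in>C. l > 0 \<longrightarrow> \<psi> x ^ (p ^ (l - 1)) \<noteq> 1" if "\<psi> \<in> U - ?O" for \<psi>
        using less.prems(5)[of \<psi>] that by blast
    qed
    then obtain R where R: "set R \<subseteq> U - ?O" "length R * totient ?m = card (U - ?O)"
      "\<And>x. x \<in> C \<Longrightarrow> (\<Sum>\<theta>\<leftarrow>R. \<Sum>j\<in>?T. \<theta> x ^ j) = (\<Sum>\<theta>\<in>U - ?O. \<theta> x)" by blast
    have "set (\<theta> # R) \<subseteq> U" using R(1) th by auto
    moreover have "length (\<theta> # R) * totient ?m = card U"
      using R(2) cO O less.prems(1) card_mono[OF less.prems(1) O] by (simp add: card_Diff_subset finite_subset[OF O])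
    moreover have "(\<Sum>\<theta>\<leftarrow>\<theta> # R. \<Sum>j\<in>?T. \<theta> x ^ j) = (\<Sum>\<theta>\<in>U. \<theta> x)" if x: "x \<in> C" for x
    proof -
      have "(\<Sum>\<psi>\<in>?O. \<psi> x) = (\<Sum>j\<in>?T. \<theta> x ^ j)"
        by (subst sum.reindex[OF inj]) (simp add: pw_def)
      moreover have "(\<Sum>\<psi>\<in>U. \<psi> x) = (\<Sum>\<psi>\<in>U - ?O. \<psi> x) + (\<Sum>\<psi>\<in>?O. \<psi> x)"
        using O less.prems(1) by (rule sum.subset_diff)
      ultimately show ?thesis using R(3)[OF x] by simp
    qed
    ultimately show ?thesis by blast
  qed
qed

section \<open>Induced representations\<close>

lemma (in group) left_transversal_exists:
  assumes fin: "finite (carrier G)" and A: "subgroup A G" and k: "k * card A = card (carrier G)"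
  obtains t :: "nat \<Rightarrow> 'a" where "\<And>j. j < k \<Longrightarrow> t j \<in> carrier G"
    "\<And>g. g \<in> carrier G \<Longrightarrow> \<exists>!j. j < k \<and> inv (t j) \<otimes> g \<in> A"
proof -
  have finA: "finite A" by (rule finite_subset[OF subgroup.subset[OF A] fin])
  then have A0: "card A > 0" using subgroup.one_closed[OF A] by (auto simp: card_gt_0_iff)
  have "card (rcosets A) * card A = k * card A" using lagrange[OF A] k by (simp add: Coset.order_def)
  then have ck: "card (rcosets A) = k" using A0 by simp
  have "rcosets A \<subseteq> Pow (carrier G)" by (rule rcosets_subset_PowG[OF A])
  then have "finite (rcosets A)" using fin finite_subset by blast
  then obtain e where e: "bij_betw e {0..<k} (rcosets A)" using ex_bij_betw_nat_finite ck by metis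
  have "\<exists>s. s \<in> carrier G \<and> e j = A #> s" if "j < k" for j
  proof -
    have "e j \<in> rcosets A" using bij_betwE[OF e] that by simp
    then show ?thesis by (auto simp: RCOSETS_def)
  qed
  then obtain s where s: "\<And>j. j < k \<Longrightarrow> s j \<in> carrier G" "\<And>j. j < k \<Longrightarrow> e j = A #> s j" by metis
  have iff: "s j \<otimes> g \<in> A \<longleftrightarrow> e j = A #> inv g" if j: "j < k" and g: "g \<in> carrier G" for j g
  proof -
    have "s j \<otimes> g \<in> A \<longleftrightarrow> s j \<in> A #> inv g"
      using subgroup.rcos_module[OF A is_group, of "inv g" "s j"] s(1)[OF j] g by simp
    also have "\<dots> \<longleftrightarrow> e j = A #> inv g"
      using repr_independence[OF _ _ A, of "s j" "inv g"] rcos_self[OF s(1)[OF j] A] s(2)[OF j] g by auto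
    finally show ?thesis .
  qed
  \<comment> \<open>Inverses of representatives of the right cosets represent the left
    cosets.\<close>
  have "\<exists>!j. j < k \<and> inv (inv (s j)) \<otimes> g \<in> A" if g: "g \<in> carrier G" for g
  proof -
    have "A #> inv g \<in> rcosets A" using g subgroup.subset[OF A] by (simp add: rcosetsI)
    then have "A #> inv g \<in> e ` {0..<k}" using e by (simp add: bij_betw_def)
    then obtain j where j: "j < k" "e j = A #> inv g" by force
    show ?thesis
    proof (rule ex1I[of _ j])
      show "j < k \<and> inv (inv (s j)) \<otimes> g \<in> A" using j iff[OF j(1) g] s(1)[OF j(1)] by simp
      fix i assume i: "i < k \<and> inv (inv (s i)) \<otimes> g \<in> A"
      then have "e i = e j" using j(2) iff[of i g] g s(1)[of i] by simp
      then show "i = j" using e i j(1) by (auto simp: bij_betw_def inj_on_def)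
    qed
  qed
  then show thesis using that[of "\<lambda>j. inv (s j)"] s(1) by simp
qed

text \<open>The representation induced from \<open>A\<close>, in the basis of cosets
  \<open>t j\<close>. It is monomial: in each column only one \<open>inv (t i) * g * t j\<close>
  lies in \<open>A\<close>, and \<open>\<theta>\<close> is zero at the others.\<close>

definition (in group) ind_rep :: "nat \<Rightarrow> (nat \<Rightarrow> 'a) \<Rightarrow> ('a \<Rightarrow> complex) \<Rightarrow> 'a \<Rightarrow> complex mat" where
  "ind_rep k t \<theta> g = mat k k (\<lambda>(i, j). \<theta> (inv (t i) \<otimes> g \<otimes> t j))"

locale induced_character = group +
  fixes A :: "'a set" and k :: nat and t :: "nat \<Rightarrow> 'a" and \<theta> :: "'a \<Rightarrow> complex"
  assumes A: "subgroup A G"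
    and t: "\<And>j. j < k \<Longrightarrow> t j \<in> carrier G"
    and t1: "\<And>g. g \<in> carrier G \<Longrightarrow> \<exists>!j. j < k \<and> inv (t j) \<otimes> g \<in> A"
    and th: "\<theta> \<in> lin_chars G A {\<one>}"
begin

lemma th_one: "\<theta> \<one> = 1"
  using lin_charsD(2)[OF th] by simp

lemma transversal_eq_iff:
  assumes "i < k" "j < k"
  shows "inv (t i) \<otimes> t j \<in> A \<longleftrightarrow> i = j"
proof -
  have "inv (t j) \<otimes> t j \<in> A" using t[OF assms(2)] subgroup.one_closed[OF A] by simp
  then show ?thesis using t1[OF t[OF assms(2)]] assms by auto
qed

lemma ind_rep_mult:
  assumes g: "g \<in> carrier G" and h: "h \<in> carrier G"
  shows "ind_rep k t \<theta> (g \<otimes> h) = ind_rep k t \<theta> g * ind_rep k t \<theta> h"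
proof (rule eq_matI)
  fix i l assume "i < dim_row (ind_rep k t \<theta> g * ind_rep k t \<theta> h)" "l < dim_col (ind_rep k t \<theta> g * ind_rep k t \<theta> h)"
  then have il: "i < k" "l < k" by (simp_all add: ind_rep_def)
  let ?F = "\<lambda>j. \<theta> (inv (t i) \<otimes> g \<otimes> t j) * \<theta> (inv (t j) \<otimes> h \<otimes> t l)"
  \<comment> \<open>Only the coset of \<open>h * t l\<close> contributes to the matrix product; the
    remaining terms vanish through the zero extension of \<open>\<theta>\<close>.\<close>
  obtain j where j: "j < k" "inv (t j) \<otimes> (h \<otimes> t l) \<in> A" "\<And>j'. j' < k \<Longrightarrow> inv (t j') \<otimes> (h \<otimes> t l) \<in> A \<Longrightarrow> j' = j"
    using t1[of "h \<otimes> t l"] h t[OF il(2)] by auto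
  have zero: "?F j' = 0" if "j' \<in> {..<k} - {j}" for j'
  proof -
    have "inv (t j') \<otimes> h \<otimes> t l \<notin> A" using j(3)[of j'] that h t[OF il(2)] t[of j'] by (auto simp: m_assoc)
    then show ?thesis using lin_charsD(3)[OF th] by simp
  qed
  let ?a = "inv (t i) \<otimes> g \<otimes> t j" and ?b = "inv (t j) \<otimes> h \<otimes> t l"
  have b: "?b \<in> A" using j(1,2) h t[OF il(2)] t[OF j(1)] by (simp add: m_assoc)
  have c: "?a \<in> carrier G" "?b \<in> carrier G" using g h t[OF il(1)] t[OF il(2)] t[OF j(1)] by simp_all
  have "t j \<otimes> (inv (t j) \<otimes> (h \<otimes> t l)) = h \<otimes> t l"
    using h t[OF il(2)] t[OF j(1)] by (simp add: m_assoc[symmetric])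
  then have ab: "?a \<otimes> ?b = inv (t i) \<otimes> (g \<otimes> h) \<otimes> t l"
    using g h t[OF il(1)] t[OF il(2)] t[OF j(1)] by (simp add: m_assoc)
  have "\<theta> (?a \<otimes> ?b) = \<theta> ?a * \<theta> ?b"
  proof (cases "?a \<in> A")
    case True
    then show ?thesis using lin_charsD(1)[OF th True b] by simp
  next
    case False
    have "?a \<otimes> ?b \<notin> A"
    proof
      assume "?a \<otimes> ?b \<in> A"
      then have "?a \<otimes> ?b \<otimes> inv ?b \<in> A" using b A by (simp add: subgroup.m_closed subgroup.m_inv_closed)
      then show False using False c by (simp add: m_assoc)
    qed
    then show ?thesis using False lin_charsD(3)[OF th] by simp
  qed
  then have "ind_rep k t \<theta> (g \<otimes> h) $$ (i, l) = ?F j"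
    using il ab by (simp add: ind_rep_def)
  also have "\<dots> = (\<Sum>j'<k. ?F j')"
    using j(1) zero by (simp add: sum.remove[of _ j] sum.neutral)
  also have "\<dots> = (ind_rep k t \<theta> g * ind_rep k t \<theta> h) $$ (i, l)"
    using il by (simp add: ind_rep_def scalar_prod_def atLeast0LessThan)
  finally show "ind_rep k t \<theta> (g \<otimes> h) $$ (i, l) = (ind_rep k t \<theta> g * ind_rep k t \<theta> h) $$ (i, l)" .
qed (simp_all add: ind_rep_def)

lemma ind_rep_one: "ind_rep k t \<theta> \<one> = 1\<^sub>m k"
proof (rule eq_matI)
  fix i j assume "i < dim_row (1\<^sub>m k :: complex mat)" "j < dim_col (1\<^sub>m k :: complex mat)"
  then have ij: "i < k" "j < k" by simp_all
  then show "ind_rep k t \<theta> \<one> $$ (i, j) = 1\<^sub>m k $$ (i, j)"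
    using transversal_eq_iff[OF ij] lin_charsD(3)[OF th, of "inv (t i) \<otimes> t j"] t[OF ij(1)] t[OF ij(2)] th_one
    by (auto simp: ind_rep_def)
qed (simp_all add: ind_rep_def)

lemma ind_rep_is_rep: "is_rep G k (ind_rep k t \<theta>)"
  unfolding is_rep_def using ind_rep_mult ind_rep_one by (auto simp: ind_rep_def)

lemma ind_rep_cyclo:
  assumes m: "m > 0" and root: "\<And>a. a \<in> A \<Longrightarrow> \<theta> a ^ m = 1"
  shows "cyclo_rep G k m (ind_rep k t \<theta>)"
  unfolding cyclo_rep_def
proof (intro conjI ballI allI impI ind_rep_is_rep)
  fix g r s assume "g \<in> carrier G" "r < k" "s < k"
  have "\<theta> a \<in> cyclo_field m" for a
  proof (cases "a \<in> A")
    case True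
    then obtain j where "\<theta> a = zeta m ^ j" using root_of_unity_eq_zeta_power[OF m root] by metis
    then show ?thesis by (simp add: zeta_in_cyclo_field)
  next
    case False
    then show ?thesis using lin_charsD(3)[OF th] by (simp add: cyclo_field_0)
  qed
  then show "ind_rep k t \<theta> g $$ (r, s) \<in> cyclo_field m"
    using \<open>r < k\<close> \<open>s < k\<close> by (simp add: ind_rep_def)
qed

lemma ind_rep_trace: "mat_trace (ind_rep k t \<theta> g) = (\<Sum>i<k. \<theta> (inv (t i) \<otimes> g \<otimes> t i))"
  by (simp add: mat_trace_def ind_rep_def)

lemma ind_rep_trace_central_mult:
  assumes z: "z \<in> A" "\<And>g. g \<in> carrier G \<Longrightarrow> z \<otimes> g = g \<otimes> z" and g: "g \<in> carrier G"
  shows "mat_trace (ind_rep k t \<theta> (z \<otimes> g)) = \<theta> z * mat_trace (ind_rep k t \<theta> g)"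
  unfolding ind_rep_trace sum_distrib_left
proof (rule sum.cong[OF refl])
  fix i assume "i \<in> {..<k}"
  then have ti: "t i \<in> carrier G" using t by simp
  have zc: "z \<in> carrier G" by (rule subgroup.mem_carrier[OF A z(1)])
  let ?h = "inv (t i) \<otimes> g \<otimes> t i"
  have hc: "?h \<in> carrier G" using g ti by simp
  have "inv (t i) \<otimes> (z \<otimes> g) \<otimes> t i = (inv (t i) \<otimes> z) \<otimes> g \<otimes> t i" using zc g ti by (simp add: m_assoc)
  also have "\<dots> = (z \<otimes> inv (t i)) \<otimes> g \<otimes> t i" using z(2)[of "inv (t i)"] ti by simp
  finally have eq: "inv (t i) \<otimes> (z \<otimes> g) \<otimes> t i = z \<otimes> ?h" using zc g ti by (simp add: m_assoc)
  show "\<theta> (inv (t i) \<otimes> (z \<otimes> g) \<otimes> t i) = \<theta> z * \<theta> ?h"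
  proof (cases "?h \<in> A")
    case True
    then show ?thesis using lin_charsD(1)[OF th z(1)] eq by simp
  next
    case False
    have "z \<otimes> ?h \<notin> A"
    proof
      assume "z \<otimes> ?h \<in> A"
      then have "inv z \<otimes> (z \<otimes> ?h) \<in> A" using z(1) A by (simp add: subgroup.m_closed subgroup.m_inv_closed)
      then show False using False zc hc by (simp add: m_assoc[symmetric] del: m_assoc)
    qed
    then show ?thesis using False eq lin_charsD(3)[OF th] by simp
  qed
qed

lemma ind_rep_trace_central:
  assumes z: "z \<in> A" "\<And>g. g \<in> carrier G \<Longrightarrow> z \<otimes> g = g \<otimes> z"
  shows "mat_trace (ind_rep k t \<theta> z) = of_nat k * \<theta> z"
  using ind_rep_trace_central_mult[OF z one_closed] subgroup.mem_carrier[OF A z(1)]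
  by (simp add: ind_rep_one mat_trace_def)

text \<open>For the central commutator \<open>z = [x, g]\<close> the conjugate of \<open>g\<close>
  by \<open>x\<close> is \<open>z * g\<close>, so the trace at \<open>g\<close> equals
  \<open>\<theta> z\<close> times itself.\<close>

lemma ind_rep_trace_vanish:
  assumes g: "g \<in> carrier G" and x: "x \<in> carrier G"
    and z: "x \<otimes> g \<otimes> inv x \<otimes> inv g \<in> A" "\<And>h. h \<in> carrier G \<Longrightarrow> x \<otimes> g \<otimes> inv x \<otimes> inv g \<otimes> h = h \<otimes> (x \<otimes> g \<otimes> inv x \<otimes> inv g)"
      "\<theta> (x \<otimes> g \<otimes> inv x \<otimes> inv g) \<noteq> 1"
  shows "mat_trace (ind_rep k t \<theta> g) = 0"
proof -
  let ?R = "ind_rep k t \<theta>" and ?z = "x \<otimes> g \<otimes> inv x \<otimes> inv g"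
  have car: "?R h \<in> carrier_mat k k" for h by (simp add: ind_rep_def)
  have "?z \<otimes> g = x \<otimes> g \<otimes> inv x" using g x by (simp add: m_assoc)
  then have "\<theta> ?z * mat_trace (?R g) = mat_trace (?R (x \<otimes> g \<otimes> inv x))"
    using ind_rep_trace_central_mult[OF z(1,2) g] by simp
  also have "\<dots> = mat_trace (?R (x \<otimes> g) * ?R (inv x))" using g x by (simp add: ind_rep_mult)
  also have "\<dots> = mat_trace (?R (inv x) * ?R (x \<otimes> g))" by (rule mat_trace_mult_commute[OF car car])
  also have "\<dots> = mat_trace (?R (inv x \<otimes> (x \<otimes> g)))" using g x by (simp add: ind_rep_mult)
  also have "inv x \<otimes> (x \<otimes> g) = g" using g x by (simp add: m_assoc[symmetric])
  finally show ?thesis using z(3) by (metis mult_cancel_right1)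
qed

end

text \<open>Inducing \<open>\<mu>\<close> gives \<open>k * \<theta>\<close> on the central
  \<open>Z\<close>, while outside \<open>Z\<close> some commutator in \<open>M\<close> is not killed
  by \<open>\<theta>\<close> and forces trace 0; with \<open>\<theta>\<close> extended by zero both
  cases are one formula. The values of \<open>\<mu>\<close> are \<open>m\<close>-th roots of unity,
  which keeps the matrices over the field of \<open>zeta m\<close>.\<close>

lemma (in group) cyclo_rep_of_central_character:
  assumes fin: "finite (carrier G)" and m: "m > 0"
    and Z: "\<And>z g. z \<in> Z \<Longrightarrow> g \<in> carrier G \<Longrightarrow> z \<otimes> g = g \<otimes> z" and M: "M \<subseteq> Z"
    and vanish: "\<And>g. g \<in> carrier G \<Longrightarrow> g \<notin> Z \<Longrightarrow> \<exists>x\<in>carrier G. x \<otimes> g \<otimes> inv x \<otimes> inv g \<in> M - {\<one>}"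
    and th: "\<theta> \<in> lin_chars G Z {\<one>}" "\<And>y. y \<in> M \<Longrightarrow> y \<noteq> \<one> \<Longrightarrow> \<theta> y \<noteq> 1"
    and A: "subgroup A G" "Z \<subseteq> A" "k * card A = card (carrier G)"
    and mu: "\<mu> \<in> lin_chars G A {\<one>}" "\<And>z. z \<in> Z \<Longrightarrow> \<mu> z = \<theta> z" "\<And>a. a \<in> A \<Longrightarrow> \<mu> a ^ m = 1"
  shows "\<exists>\<rho>. cyclo_rep G k m \<rho> \<and> (\<forall>g\<in>carrier G. mat_trace (\<rho> g) = of_nat k * \<theta> g)"
proof -
  obtain t :: "nat \<Rightarrow> 'a" where t: "\<And>j. j < k \<Longrightarrow> t j \<in> carrier G"
    "\<And>g. g \<in> carrier G \<Longrightarrow> \<exists>!j. j < k \<and> inv (t j) \<otimes> g \<in> A"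
    by (rule left_transversal_exists[OF fin A(1,3)]) (assumption | rule that)+
  interpret ind: induced_character G A k t \<mu>
    by (intro induced_character.intro induced_character_axioms.intro is_group A(1) t mu(1))
  have "mat_trace (ind_rep k t \<mu> g) = of_nat k * \<theta> g" if g: "g \<in> carrier G" for g
  proof (cases "g \<in> Z")
    case True
    then have "g \<in> A" using A(2) by blast
    then show ?thesis using ind.ind_rep_trace_central[of g] Z[OF True] mu(2)[OF True] by simp
  next
    case False
    then obtain x where x: "x \<in> carrier G" "x \<otimes> g \<otimes> inv x \<otimes> inv g \<in> M - {\<one>}" using vanish[OF g] by blast
    let ?z = "x \<otimes> g \<otimes> inv x \<otimes> inv g"
    have z: "?z \<in> Z" "?z \<in> A" using x(2) M A(2) by auto
    have "\<mu> ?z \<noteq> 1" using mu(2)[OF z(1)] th(2)[of ?z] x(2) by simp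
    then have "mat_trace (ind_rep k t \<mu> g) = 0"
      using ind.ind_rep_trace_vanish[OF g x(1) z(2) Z[OF z(1)]] by simp
    then show ?thesis using lin_charsD(3)[OF th(1) False] by simp
  qed
  then show ?thesis using ind.ind_rep_cyclo[OF m mu(3)] by blast
qed

text \<open>One representation is kept per Galois orbit. Its weight \<open>k\<close> and the factor
  \<open>k\<close> in its character combine to \<open>k^2\<close>, and the field trace turns a
  representative into the sum over its orbit.\<close>

lemma cyclo_blocks_of_characters:
  fixes p :: nat
  assumes p: "Factorial_Ring.prime p" and m: "m = p ^ l" and fin: "finite U"
    and root: "\<And>\<theta> x. \<theta> \<in> U \<Longrightarrow> x \<in> C \<Longrightarrow> \<theta> x ^ m = 1"
    and zero: "\<And>\<theta> x. \<theta> \<in> U \<Longrightarrow> x \<notin> C \<Longrightarrow> \<theta> x = 0"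
    and closed: "\<And>\<theta> j. \<theta> \<in> U \<Longrightarrow> coprime j m \<Longrightarrow> j > 0 \<Longrightarrow> (\<lambda>x. \<theta> x ^ j) \<in> U"
    and prim: "\<And>\<theta>. \<theta> \<in> U \<Longrightarrow> \<exists>x\<in>C. l > 0 \<longrightarrow> \<theta> x ^ (p ^ (l - 1)) \<noteq> 1"
    and rep: "\<And>\<theta>. \<theta> \<in> U \<Longrightarrow> \<exists>\<rho>. cyclo_rep G k m \<rho> \<and> (\<forall>g\<in>carrier G. mat_trace (\<rho> g) = of_nat k * \<theta> g)"
  shows "\<exists>L. length L * totient m = card U \<and> (\<forall>\<rho>\<in>set L. cyclo_rep G k m \<rho>) \<and>
    (\<forall>g\<in>carrier G. (\<Sum>\<rho>\<leftarrow>L. of_nat k * cyc_trace m (mat_trace (\<rho> g))) = of_nat (k\<^sup>2) * (\<Sum>\<theta>\<in>U. \<theta> g))"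
proof -
  obtain R where R: "set R \<subseteq> U" "length R * totient m = card U"
    "\<And>x. x \<in> C \<Longrightarrow> (\<Sum>\<theta>\<leftarrow>R. \<Sum>j\<in>totatives m. \<theta> x ^ j) = (\<Sum>\<theta>\<in>U. \<theta> x)"
    using power_orbit_representatives[OF p fin, of C l] root zero closed prim m by blast
  obtain F where F: "\<And>\<theta>. \<theta> \<in> U \<Longrightarrow> cyclo_rep G k m (F \<theta>)"
    "\<And>\<theta> g. \<theta> \<in> U \<Longrightarrow> g \<in> carrier G \<Longrightarrow> mat_trace (F \<theta> g) = of_nat k * \<theta> g"
    using rep by metis
  have m0: "m > 0" using m prime_gt_0_nat[OF p] by simp
  have tr: "of_nat k * cyc_trace m (mat_trace (F \<theta> g)) = of_nat (k\<^sup>2) * (if g \<in> C then \<Sum>j\<in>totatives m. \<theta> g ^ j else 0)"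
    if th: "\<theta> \<in> U" and g: "g \<in> carrier G" for \<theta> g
  proof -
    have cf: "\<theta> g \<in> cyclo_field m"
    proof (cases "g \<in> C")
      case True
      obtain j where "\<theta> g = zeta m ^ j" using root_of_unity_eq_zeta_power[OF m0 root[OF th True]] .
      then show ?thesis by (simp add: zeta_in_cyclo_field)
    next
      case False
      then show ?thesis using zero[OF th False] by (simp add: cyclo_field_0)
    qed
    have "cyc_trace m (mat_trace (F \<theta> g)) = of_nat k * cyc_trace m (\<theta> g)"
      using F(2)[OF th g] cyc_trace_scale[OF p m cf, of "of_nat k"] by simp
    moreover have "cyc_trace m (\<theta> g) = (if g \<in> C then \<Sum>j\<in>totatives m. \<theta> g ^ j else 0)"
    proof (cases "g \<in> C")
      case True
      then show ?thesis using cyc_trace_root_of_unity[OF p m root[OF th True]] by simp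
    next
      case False
      then show ?thesis using zero[OF th False] cyc_trace_scale[OF p m cyclo_field_0, of 0] by simp
    qed
    ultimately show ?thesis by (simp add: power2_eq_square mult_ac)
  qed
  have "(\<Sum>\<rho>\<leftarrow>map F R. of_nat k * cyc_trace m (mat_trace (\<rho> g))) = of_nat (k\<^sup>2) * (\<Sum>\<theta>\<in>U. \<theta> g)"
    if g: "g \<in> carrier G" for g
  proof -
    have "(\<Sum>\<rho>\<leftarrow>map F R. of_nat k * cyc_trace m (mat_trace (\<rho> g)))
      = (\<Sum>\<theta>\<leftarrow>R. of_nat (k\<^sup>2) * (if g \<in> C then \<Sum>j\<in>totatives m. \<theta> g ^ j else 0))"
      unfolding map_map comp_def by (intro arg_cong[of _ _ sum_list] map_cong refl) (use R(1) tr g in blast)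
    also have "\<dots> = of_nat (k\<^sup>2) * (\<Sum>\<theta>\<leftarrow>R. if g \<in> C then \<Sum>j\<in>totatives m. \<theta> g ^ j else 0)"
      by (rule sum_list_const_mult)
    also have "(\<Sum>\<theta>\<leftarrow>R. if g \<in> C then \<Sum>j\<in>totatives m. \<theta> g ^ j else 0) = (\<Sum>\<theta>\<in>U. \<theta> g)"
    proof (cases "g \<in> C")
      case True
      then show ?thesis using R(3)[OF True] by simp
    next
      case False
      then show ?thesis using zero[OF _ False] by (simp add: sum_list_triv sum.neutral)
    qed
    finally show ?thesis .
  qed
  then show ?thesis using R F(1) by (intro exI[of _ "map F R"]) auto
qed

section \<open>Galois orbits of characters\<close>

context group
begin

lemma class2_swap:
  assumes "x \<in> carrier G" "y \<in> carrier G" "c \<in> carrier G"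
    and c: "y \<otimes> x = c \<otimes> (x \<otimes> y)" and cy: "c \<otimes> y = y \<otimes> c"
  shows "y [^] n \<otimes> x = c [^] n \<otimes> (x \<otimes> y [^] (n::nat))"
proof (induction n)
  case (Suc n)
  have cn: "y [^] n \<otimes> c = c \<otimes> y [^] n"
  proof (induction n)
    case (Suc n)
    then show ?case using assms by (metis cy m_assoc nat_pow_Suc nat_pow_closed)
  qed (use assms in simp)
  have "y [^] Suc n \<otimes> x = y [^] n \<otimes> (y \<otimes> x)" using assms by (simp add: m_assoc)
  also have "\<dots> = (y [^] n \<otimes> c) \<otimes> (x \<otimes> y)" using assms by (simp add: m_assoc)
  also have "\<dots> = c \<otimes> (y [^] n \<otimes> x) \<otimes> y" using assms cn by (simp add: m_assoc)
  also have "\<dots> = c \<otimes> (c [^] n \<otimes> (x \<otimes> y [^] n)) \<otimes> y" using Suc by simp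
  also have "\<dots> = (c \<otimes> c [^] n) \<otimes> (x \<otimes> (y [^] n \<otimes> y))" using assms by (simp add: m_assoc)
  finally show ?case using assms by (simp add: nat_pow_Suc2[symmetric] del: nat_pow_Suc)
qed (use assms in simp)

text \<open>Passing from \<open>n\<close> to \<open>n + 1\<close> moves the new \<open>x\<close>
  past \<open>n\<close> copies of \<open>y\<close>, and each passage costs one
  \<open>c\<close>.\<close>

lemma class2_pow_mult:
  assumes x: "x \<in> carrier G" and y: "y \<in> carrier G" and c: "c \<in> carrier G"
    and sw: "y \<otimes> x = c \<otimes> (x \<otimes> y)" and cx: "c \<otimes> x = x \<otimes> c" and cy: "c \<otimes> y = y \<otimes> c"
  shows "(x \<otimes> y) [^] n = c [^] (\<Sum>i<n. i) \<otimes> (x [^] n \<otimes> y [^] (n::nat))"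
proof (induction n)
  case (Suc n)
  have cxn: "x [^] n \<otimes> c [^] n = c [^] n \<otimes> x [^] n"
    using group_commutes_pow[OF group_commutes_pow[OF cx c x, symmetric] x nat_pow_closed[OF c]] .
  have "(x \<otimes> y) [^] Suc n = c [^] (\<Sum>i<n. i) \<otimes> (x [^] n \<otimes> y [^] n) \<otimes> (x \<otimes> y)" using Suc by simp
  also have "\<dots> = c [^] (\<Sum>i<n. i) \<otimes> x [^] n \<otimes> (y [^] n \<otimes> x) \<otimes> y" using x y c by (simp add: m_assoc)
  also have "y [^] n \<otimes> x = c [^] n \<otimes> (x \<otimes> y [^] n)" by (rule class2_swap[OF x y c sw cy])
  also have "c [^] (\<Sum>i<n. i) \<otimes> x [^] n \<otimes> (c [^] n \<otimes> (x \<otimes> y [^] n)) \<otimes> y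
    = c [^] (\<Sum>i<n. i) \<otimes> (x [^] n \<otimes> c [^] n) \<otimes> (x \<otimes> (y [^] n \<otimes> y))" using x y c by (simp add: m_assoc)
  also have "\<dots> = (c [^] (\<Sum>i<n. i) \<otimes> c [^] n) \<otimes> ((x [^] n \<otimes> x) \<otimes> (y [^] n \<otimes> y))"
    unfolding cxn using x y c by (simp add: m_assoc)
  also have "c [^] (\<Sum>i<n. i) \<otimes> c [^] n = c [^] (\<Sum>i<Suc n. i)" using c by (simp add: nat_pow_mult)
  finally show ?case by simp
qed simp

lemma class2_pow_mult_odd:
  assumes "x \<in> carrier G" "y \<in> carrier G" "c \<in> carrier G"
    and "y \<otimes> x = c \<otimes> (x \<otimes> y)" "c \<otimes> x = x \<otimes> c" "c \<otimes> y = y \<otimes> c"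
    and n: "odd n" "c [^] n = \<one>"
  shows "(x \<otimes> y) [^] n = x [^] n \<otimes> y [^] (n::nat)"
proof -
  obtain r where r: "n = 2 * r + 1" using n(1) by (rule oddE)
  \<comment> \<open>For odd \<open>n\<close> the sum of the numbers below \<open>n\<close> is a
    multiple of \<open>n\<close>, so the correction is a power of \<open>c^n = \<one>\<close>. This
    is the point where oddness of the prime counts.\<close>
  have "(\<Sum>i<2 * r + 1. i) = (2 * r + 1) * r" by (induction r) auto
  then have "c [^] (\<Sum>i<n. i) = (c [^] n) [^] r" by (simp only: r nat_pow_pow[OF assms(3)])
  then show ?thesis using class2_pow_mult[OF assms(1-6), of n] n assms(1-3) by simp
qed

text \<open>The map \<open>x \<mapsto> \<theta>(x\<^sup>p)\<close> followed by the power \<open>p\<^sup>l\<^sup>-\<^sup>1\<close> is a homomorphism from \<open>H\<close> to the \<open>p\<close>-th roots of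
  unity, because \<open>p\<close> is odd and \<open>H\<close> has class two; an element of its kernel outside \<open>W\<close> admits an
  extension of \<open>\<theta>\<close> without enlarging the field of values.\<close>

lemma lin_chars_extend_same_field:
  assumes fin: "finite (carrier G)" and p: "Factorial_Ring.prime (p::nat)" and odd: "odd p" and l: "l > 0"
    and W: "subgroup W G" and H: "subgroup H G" and WH: "W \<subseteq> H"
    and comm: "\<And>h w. h \<in> H \<Longrightarrow> w \<in> W \<Longrightarrow> h \<otimes> w = w \<otimes> h"
    and pow: "\<And>h. h \<in> H \<Longrightarrow> h [^] p \<in> W"
    and cW: "\<And>x y. x \<in> H \<Longrightarrow> y \<in> H \<Longrightarrow> x \<otimes> y \<otimes> inv x \<otimes> inv y \<in> W"
    and cp: "\<And>x y. x \<in> H \<Longrightarrow> y \<in> H \<Longrightarrow> (x \<otimes> y \<otimes> inv x \<otimes> inv y) [^] p = \<one>"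
    and big: "card H > p * card W"
    and th: "\<theta> \<in> lin_chars G W {\<one>}" and root: "\<And>w. w \<in> W \<Longrightarrow> \<theta> w ^ (p ^ l) = 1"
  obtains x A \<mu> where "x \<in> H" "x \<notin> W" "subgroup A G" "W \<subseteq> A" "A \<subseteq> H" "card A = p * card W" "x \<in> A"
    "A = {w \<otimes> x [^] i | w i. w \<in> W \<and> i \<in> (UNIV :: nat set)}"
    "\<mu> \<in> lin_chars G A {\<one>}" "\<And>w. w \<in> W \<Longrightarrow> \<mu> w = \<theta> w" "\<And>a. a \<in> A \<Longrightarrow> \<mu> a ^ (p ^ l) = 1"
proof -
  have p0: "p > 0" using prime_gt_0_nat[OF p] .
  note Hc = subgroup.mem_carrier[OF H] and Wc = subgroup.mem_carrier[OF W]
  have powW: "w [^] (n::nat) \<in> W" if "w \<in> W" for w n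
    using subgroup_int_pow_closed[OF W that, of "int n"] by (simp add: int_pow_int)
  \<comment> \<open>Commutators of \<open>H\<close> lie in \<open>W\<close>, which \<open>H\<close>
    centralises, and have \<open>p\<close>-th power \<open>\<one>\<close>; with \<open>p\<close> odd
    the \<open>p\<close>-th power map is multiplicative on \<open>H\<close>.\<close>
  have pm: "(x \<otimes> y) [^] p = x [^] p \<otimes> y [^] p" if xy: "x \<in> H" "y \<in> H" for x y
  proof (rule class2_pow_mult_odd)
    let ?c = "y \<otimes> x \<otimes> inv y \<otimes> inv x"
    have c: "?c \<in> W" using cW[OF xy(2,1)] .
    show "x \<in> carrier G" "y \<in> carrier G" "?c \<in> carrier G" using Hc xy by simp_all
    show "y \<otimes> x = ?c \<otimes> (x \<otimes> y)"
    proof -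
      have "inv x \<otimes> (x \<otimes> y) = y" using Hc[OF xy(1)] Hc[OF xy(2)] by (simp add: m_assoc[symmetric])
      then show ?thesis using Hc[OF xy(1)] Hc[OF xy(2)] by (simp add: m_assoc)
    qed
    show "?c \<otimes> x = x \<otimes> ?c" "?c \<otimes> y = y \<otimes> ?c" using comm[OF xy(1) c] comm[OF xy(2) c] by simp_all
    show "?c [^] p = \<one>" using cp[OF xy(2,1)] .
  qed (rule odd)
  define f where "f = (\<lambda>x. \<theta> (x [^] p) ^ (p ^ (l - 1)))"
  have ppl: "p * p ^ (l - 1) = p ^ l" using l by (cases l) auto
  have f_mult: "f (x \<otimes> y) = f x * f y" if "x \<in> H" "y \<in> H" for x y
    using lin_charsD(1)[OF th pow[OF that(1)] pow[OF that(2)]] pm[OF that] by (simp add: f_def power_mult_distrib)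
  have f_W: "f w = 1" if w: "w \<in> W" for w
    using lin_chars_pow[OF W th _ w, of p] root[OF w] ppl by (simp add: f_def power_mult[symmetric])
  have f_root: "f x ^ p = 1" if "x \<in> H" for x
    using root[OF pow[OF that]] ppl by (simp add: f_def power_mult[symmetric] mult.commute)
  have f_one: "f \<one> = 1" using f_W subgroup.one_closed[OF W] by simp
  define K where "K = {x \<in> H. f x = 1}"
  interpret H: group "G\<lparr>carrier := H\<rparr>" by (rule subgroup.subgroup_is_group[OF H is_group])
  have finH: "finite H" by (rule finite_subset[OF subgroup.subset[OF H] fin])
  have invH: "inv\<^bsub>G\<lparr>carrier := H\<rparr>\<^esub> x = inv x" if "x \<in> H" for x
    using m_inv_consistent[OF H that] .
  have K: "subgroup K (G\<lparr>carrier := H\<rparr>)"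
    by (rule H.finite_subgroupI)
       (use finH f_mult f_one subgroup.one_closed[OF H] subgroup.m_closed[OF H] in \<open>simp_all add: K_def subset_eq\<close>)
  have "card (carrier (G\<lparr>carrier := H\<rparr>)) = card (f ` carrier (G\<lparr>carrier := H\<rparr>)) * card K"
  proof (rule H.card_fibres)
    fix x y assume "x \<in> carrier (G\<lparr>carrier := H\<rparr>)" "y \<in> carrier (G\<lparr>carrier := H\<rparr>)"
    then have xy: "x \<in> H" "y \<in> H" by simp_all
    have iy: "inv y \<in> H" using subgroup.m_inv_closed[OF H xy(2)] .
    have "f y * f (inv y) = 1" using f_mult[OF xy(2) iy] Hc[OF xy(2)] f_one by simp
    then have "f x = f y \<longleftrightarrow> f x * f (inv y) = 1"
      by (metis mult.commute mult.left_commute mult.right_neutral)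
    then show "f x = f y \<longleftrightarrow> x \<otimes>\<^bsub>G\<lparr>carrier := H\<rparr>\<^esub> inv\<^bsub>G\<lparr>carrier := H\<rparr>\<^esub> y \<in> K"
      using xy iy f_mult[OF xy(1) iy] subgroup.m_closed[OF H xy(1) iy] by (simp add: K_def invH)
  qed (use finH K in simp_all)
  then have cH: "card H = card (f ` H) * card K" by simp
  \<comment> \<open>There are at most \<open>p\<close> values, so the kernel \<open>K\<close> has at
    least \<open>card H div p\<close> elements, more than \<open>W\<close> by \<open>big\<close>;
    some \<open>x\<close> outside \<open>W\<close> therefore lies in it.\<close>
  have "f ` H \<subseteq> {z. z ^ p = 1}" using f_root by auto
  then have "card (f ` H) \<le> card {z::complex. z ^ p = 1}"
    using p0 by (intro card_mono finite_roots_unity) simp_all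
  also have "\<dots> \<le> p" by (rule card_roots_unity) (use p0 in simp)
  finally have "card H \<le> p * card K" unfolding cH by (rule mult_right_mono) simp
  then have "card W < card K" using big by (meson le_less_trans less_le_trans nat_mult_less_cancel1 p0)
  moreover have "finite K" using finH by (simp add: K_def)
  ultimately have "\<not> K \<subseteq> W" using finite_subset[OF subgroup.subset[OF W] fin] card_mono[of W K] by linarith
  then obtain x where x: "x \<in> H" "f x = 1" "x \<notin> W" by (auto simp: K_def)
  have xc: "x \<in> carrier G" by (rule Hc[OF x(1)])
  obtain n where n: "n > 0" "\<And>i::nat. x [^] i \<in> W \<longleftrightarrow> n dvd i"
    using relative_order[OF fin W xc] by blast
  have "n dvd p" using n(2)[of p] pow[OF x(1)] by simp
  moreover have "n \<noteq> 1" using n(2)[of 1] x(3) xc by auto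
  ultimately have np: "n = p" using p unfolding prime_nat_iff by blast
  have "p ^ (l - 1) > 0" using p0 by simp
  \<comment> \<open>Membership in the kernel makes the value at \<open>x^p\<close> a root of unity
    of order dividing \<open>p^(l-1)\<close>; the same power of \<open>zeta (p^l)\<close> is a
    \<open>p\<close>-th root of it that stays among the \<open>p^l\<close>-th roots of
    unity.\<close>
  then obtain j where j: "\<theta> (x [^] p) = zeta (p ^ (l - 1)) ^ j"
    using root_of_unity_eq_zeta_power x(2) unfolding f_def by blast
  define c where "c = zeta (p ^ l) ^ j"
  have "real p ^ l = real p * real p ^ (l - 1)" using l by (cases l) auto
  then have "zeta (p ^ l) ^ (j * p) = zeta (p ^ (l - 1)) ^ j"
    using p0 by (simp add: zeta_power mult.assoc)
  then have "c ^ p = \<theta> (x [^] p)"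
    by (simp only: c_def j power_mult)
  then have cn: "c ^ n = \<theta> (x [^] n)" using np by simp
  have xw: "x \<otimes> w = w \<otimes> x" if "w \<in> W" for w using comm[OF x(1) that] .
  have cr: "c ^ (p ^ l) = 1"
    using p0 by (simp add: c_def power_mult[symmetric] zeta_power_eq_1_iff)
  obtain A \<mu> where A: "subgroup A G" "W \<subseteq> A" "x \<in> A" "card A = n * card W"
    "A = {w \<otimes> x [^] i | w i. w \<in> W \<and> i \<in> (UNIV :: nat set)}"
    "\<mu> \<in> lin_chars G A {\<one>}" "\<And>w. w \<in> W \<Longrightarrow> \<mu> w = \<theta> w" "\<mu> x = c"
    "\<And>w i. w \<in> W \<Longrightarrow> \<mu> (w \<otimes> x [^] (i::nat)) = \<theta> w * c ^ i"
    by (rule lin_chars_extend_step[OF fin W th xc xw n cn]) (assumption | rule that)+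
  have xH: "x [^] (i::nat) \<in> H" for i
    using subgroup_int_pow_closed[OF H x(1), of "int i"] by (simp add: int_pow_int)
  have "A \<subseteq> H"
  proof
    fix a assume "a \<in> A"
    then obtain w i where a: "w \<in> W" "a = w \<otimes> x [^] (i::nat)" unfolding A(5) by blast
    then have "w \<in> H" using WH by blast
    then show "a \<in> H" using a(2) xH subgroup.m_closed[OF H] by simp
  qed
  moreover have "\<mu> a ^ (p ^ l) = 1" if aA: "a \<in> A" for a
  proof -
    obtain w i where a: "w \<in> W" "a = w \<otimes> x [^] (i::nat)" using aA unfolding A(5) by blast
    have "(c ^ i) ^ (p ^ l) = (c ^ (p ^ l)) ^ i" by (simp only: power_mult[symmetric] mult.commute)
    then have "(c ^ i) ^ (p ^ l) = 1" using cr by simp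
    then show ?thesis using A(9)[OF a(1), of i] root[OF a(1)] a(2) by (simp add: power_mult_distrib)
  qed
  ultimately show thesis using that[OF x(1,3) A(1,2) _ _ A(3,5,6,7)] A(4) np by simp
qed

end

text \<open>The characters in \<open>U\<close> of order exactly \<open>p^l\<close>, whose values
  generate the field of \<open>zeta (p^l)\<close>; for \<open>l = 0\<close> the condition is that
  all values on \<open>C\<close> are 1.\<close>

definition level :: "'a set \<Rightarrow> nat \<Rightarrow> nat \<Rightarrow> ('a \<Rightarrow> complex) set \<Rightarrow> ('a \<Rightarrow> complex) set" where
  "level C p l U = {\<theta> \<in> U. (\<forall>x\<in>C. \<theta> x ^ (p ^ l) = 1) \<and> (l > 0 \<longrightarrow> (\<exists>x\<in>C. \<theta> x ^ (p ^ (l - 1)) \<noteq> 1))}"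

lemma bounded_level_Suc:
  "{\<theta> \<in> U. \<forall>x\<in>C. \<theta> x ^ (p ^ Suc l) = (1::complex)} = {\<theta> \<in> U. \<forall>x\<in>C. \<theta> x ^ (p ^ l) = 1} \<union> level C p (Suc l) U"
  "{\<theta> \<in> U. \<forall>x\<in>C. \<theta> x ^ (p ^ l) = 1} \<inter> level C p (Suc l) U = {}"
proof -
  have "z ^ (p ^ Suc l) = 1" if "z ^ (p ^ l) = 1" for z :: complex
  proof -
    have "z ^ (p ^ Suc l) = (z ^ (p ^ l)) ^ p" by (simp only: power_mult[symmetric] power_Suc mult.commute)
    then show ?thesis using that by simp
  qed
  then show "{\<theta> \<in> U. \<forall>x\<in>C. \<theta> x ^ (p ^ Suc l) = (1::complex)} = {\<theta> \<in> U. \<forall>x\<in>C. \<theta> x ^ (p ^ l) = 1} \<union> level C p (Suc l) U"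
    by (auto simp: level_def simp del: power_Suc)
  show "{\<theta> \<in> U. \<forall>x\<in>C. \<theta> x ^ (p ^ l) = 1} \<inter> level C p (Suc l) U = {}"
    by (auto simp: level_def)
qed

lemma sum_over_levels:
  fixes F :: "('a \<Rightarrow> complex) \<Rightarrow> 'b :: comm_monoid_add"
  assumes "finite U"
  shows "(\<Sum>l\<leftarrow>[0..<n + 1]. sum F (level C p l U)) = sum F {\<theta> \<in> U. \<forall>x\<in>C. \<theta> x ^ (p ^ n) = 1}"
proof (induction n)
  case 0
  show ?case by (simp add: level_def)
next
  case (Suc n)
  have "finite {\<theta> \<in> U. \<forall>x\<in>C. \<theta> x ^ (p ^ n) = 1}" "finite (level C p (Suc n) U)"
    using assms by (simp_all add: level_def)
  then have "sum F {\<theta> \<in> U. \<forall>x\<in>C. \<theta> x ^ (p ^ Suc n) = 1}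
    = sum F {\<theta> \<in> U. \<forall>x\<in>C. \<theta> x ^ (p ^ n) = 1} + sum F (level C p (Suc n) U)"
    unfolding bounded_level_Suc(1) by (rule sum.union_disjoint) (rule bounded_level_Suc(2))
  then show ?case using Suc by (simp add: add.assoc[symmetric] del: power_Suc)
qed

lemma card_bounded_level_Suc:
  assumes "finite U"
  shows "card {\<theta> \<in> U. \<forall>x\<in>C. \<theta> x ^ (p ^ Suc l) = (1::complex)}
    = card {\<theta> \<in> U. \<forall>x\<in>C. \<theta> x ^ (p ^ l) = 1} + card (level C p (Suc l) U)"
  unfolding bounded_level_Suc(1) by (rule card_Un_disjoint) (use assms bounded_level_Suc(2) in \<open>auto simp: level_def\<close>)

lemma coprime_root_of_unity_eq_1:
  fixes w :: complex
  assumes "w ^ n = 1" "w ^ j = 1" "coprime j n"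
  shows "w = 1"
proof -
  obtain i where "[j * i = 1] (mod n)" using cong_solve_coprime_nat[OF assms(3)] by auto
  then obtain a b where "1 + a * n = j * i + b * n" unfolding cong_iff_lin_nat by blast
  then have "1 + n * a = j * i + n * b" by (simp only: mult.commute)
  then have "w ^ (1 + n * a) = w ^ (j * i + n * b)" by simp
  then show ?thesis using assms(1,2) by (simp add: power_add power_mult)
qed

context group
begin

text \<open>Taking differences of the equality \<open>card\<close> at consecutive powers of
  \<open>p\<close> compares characters of exact order with elements of exact order, that is, with
  generators of cyclic subgroups. This is how counts of cyclic subgroups become numbers of
  blocks.\<close>

lemma card_level_lin_chars_of_torsion:
  assumes fin: "finite U" and p: "Factorial_Ring.prime (p::nat)" and K: "group K" "finite (carrier K)"
    and card: "\<And>d::nat. card {\<theta> \<in> U. \<forall>x\<in>C. \<theta> x ^ d = 1} = card {x \<in> carrier K. x [^]\<^bsub>K\<^esub> d = \<one>\<^bsub>K\<^esub>}"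
  shows "card (level C p l U) = num_cyclic_subgroups K (p ^ l) * totient (p ^ l)"
proof (cases l)
  case 0
  interpret K: group K by (rule K(1))
  have "card (level C p 0 U) = card {x \<in> carrier K. x [^]\<^bsub>K\<^esub> (1::nat) = \<one>\<^bsub>K\<^esub>}"
    using card[of 1] by (simp add: level_def)
  also have "{x \<in> carrier K. x [^]\<^bsub>K\<^esub> (1::nat) = \<one>\<^bsub>K\<^esub>} = {\<one>\<^bsub>K\<^esub>}" by auto
  finally show ?thesis using 0 K.num_cyclic_subgroups_1[OF K(2)] by simp
next
  case (Suc l')
  interpret K: group K by (rule K(1))
  show ?thesis using card_bounded_level_Suc[OF fin, of C p l'] card[of "p ^ l'"] card[of "p ^ Suc l'"]
      K.card_torsion_prime_power[OF K(2) p, of l'] Suc by simp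
qed

text \<open>For \<open>l = 0\<close> the only character in the level is trivial, hence fixed by all powers.\<close>

lemma level_power_closed:
  assumes U: "U \<subseteq> lin_chars G C {\<one>}" and p: "Factorial_Ring.prime (p::nat)"
    and closed: "\<And>\<theta> j. \<theta> \<in> U \<Longrightarrow> coprime j p \<Longrightarrow> j > 0 \<Longrightarrow> (\<forall>x\<in>C. \<theta> x ^ (p ^ l) = 1) \<Longrightarrow> (\<lambda>x. \<theta> x ^ j) \<in> U"
    and th: "\<theta> \<in> level C p l U" and j: "coprime j (p ^ l)" "j > 0"
  shows "(\<lambda>x. \<theta> x ^ j) \<in> level C p l U"
proof -
  have thU: "\<theta> \<in> U" and r: "\<And>x. x \<in> C \<Longrightarrow> \<theta> x ^ (p ^ l) = 1" using th by (simp_all add: level_def)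
  have r': "(\<theta> x ^ j) ^ (p ^ l) = 1" if "x \<in> C" for x
  proof -
    have "(\<theta> x ^ j) ^ (p ^ l) = (\<theta> x ^ (p ^ l)) ^ j" by (simp only: power_mult[symmetric] mult.commute)
    then show ?thesis using r[OF that] by simp
  qed
  show ?thesis
  proof (cases "l = 0")
    case True
    have "(\<lambda>x. \<theta> x ^ j) = \<theta>"
    proof
      fix x show "\<theta> x ^ j = \<theta> x"
      proof (cases "x \<in> C")
        case False
        have "\<theta> \<in> lin_chars G C {\<one>}" using U thU by blast
        from lin_charsD(3)[OF this False] show ?thesis using j(2) by simp
      qed (use r True in simp)
    qed
    then show ?thesis using th by simp
  next
    case False
    then have jp: "coprime j p" using j(1) by simp
    obtain x where x: "x \<in> C" "\<theta> x ^ (p ^ (l - 1)) \<noteq> 1" using th False by (auto simp: level_def)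
    have "(\<theta> x ^ (p ^ (l - 1))) ^ p = \<theta> x ^ (p ^ l)"
      using False by (cases l) (simp_all add: power_mult[symmetric] mult.commute)
    then have "(\<theta> x ^ (p ^ (l - 1))) ^ p = 1" using r[OF x(1)] by simp
    \<comment> \<open>The value is a nontrivial \<open>p\<close>-th root of unity, and an exponent
      prime to \<open>p\<close> cannot make it trivial, so the exact order is preserved.\<close>
    then have "(\<theta> x ^ (p ^ (l - 1))) ^ j \<noteq> 1"
      using coprime_root_of_unity_eq_1[OF _ _ jp] x(2) by blast
    then have "(\<theta> x ^ j) ^ (p ^ (l - 1)) \<noteq> 1" by (simp add: power_mult[symmetric] mult.commute)
    moreover have "(\<lambda>x. \<theta> x ^ j) \<in> U" using closed[OF thU jp j(2)] r by blast
    ultimately show ?thesis using x(1) r' by (auto simp: level_def)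
  qed
qed

lemma level_blocks:
  assumes fin: "finite (carrier G)" and C: "subgroup C G" and U: "U \<subseteq> lin_chars G C {\<one>}"
    and p: "Factorial_Ring.prime (p::nat)"
    and closed: "\<And>\<theta> j. \<theta> \<in> U \<Longrightarrow> coprime j p \<Longrightarrow> j > 0 \<Longrightarrow> (\<forall>x\<in>C. \<theta> x ^ (p ^ l) = 1) \<Longrightarrow> (\<lambda>x. \<theta> x ^ j) \<in> U"
    and rep: "\<And>\<theta>. \<theta> \<in> level C p l U \<Longrightarrow> \<exists>\<rho>. cyclo_rep G k (p ^ l) \<rho> \<and> (\<forall>g\<in>carrier G. mat_trace (\<rho> g) = of_nat k * \<theta> g)"
  shows "\<exists>L. length L * totient (p ^ l) = card (level C p l U) \<and> (\<forall>\<rho>\<in>set L. cyclo_rep G k (p ^ l) \<rho>) \<and>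
    (\<forall>g\<in>carrier G. (\<Sum>\<rho>\<leftarrow>L. of_nat k * cyc_trace (p ^ l) (mat_trace (\<rho> g))) = of_nat (k\<^sup>2) * (\<Sum>\<theta>\<in>level C p l U. \<theta> g))"
proof (rule cyclo_blocks_of_characters[OF p refl])
  have "finite U" using finite_subset[OF U finite_lin_chars[OF fin C]] by simp
  then show "finite (level C p l U)" by (simp add: level_def)
  show "\<theta> x ^ (p ^ l) = 1" if "\<theta> \<in> level C p l U" "x \<in> C" for \<theta> x using that by (simp add: level_def)
  show "\<theta> x = 0" if th: "\<theta> \<in> level C p l U" and x: "x \<notin> C" for \<theta> x
  proof -
    have "\<theta> \<in> lin_chars G C {\<one>}" using th U by (auto simp: level_def)
    from lin_charsD(3)[OF this x] show ?thesis .
  qed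
  show "(\<lambda>x. \<theta> x ^ j) \<in> level C p l U" if "\<theta> \<in> level C p l U" "coprime j (p ^ l)" "j > 0" for \<theta> j
    by (rule level_power_closed[OF U p closed that])
  show "\<exists>x\<in>C. l > 0 \<longrightarrow> \<theta> x ^ (p ^ (l - 1)) \<noteq> 1" if "\<theta> \<in> level C p l U" for \<theta>
    using that subgroup.one_closed[OF C] by (cases "l > 0") (auto simp: level_def)
qed (rule rep)

lemma linear_cyclo_rep:
  assumes th: "\<theta> \<in> lin_chars G (carrier G) {\<one>}" and m: "m > 0" and root: "\<And>x. x \<in> carrier G \<Longrightarrow> \<theta> x ^ m = 1"
  shows "\<exists>\<rho>. cyclo_rep G 1 m \<rho> \<and> (\<forall>g\<in>carrier G. mat_trace (\<rho> g) = of_nat 1 * \<theta> g)"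
proof (intro exI conjI ballI)
  let ?\<rho> = "\<lambda>g. mat 1 1 (\<lambda>_. \<theta> g)"
  have cf: "\<theta> g \<in> cyclo_field m" if gG: "g \<in> carrier G" for g
  proof -
    obtain j where "\<theta> g = zeta m ^ j" using root_of_unity_eq_zeta_power[OF m root[OF gG]] .
    then show ?thesis by (simp add: zeta_in_cyclo_field)
  qed
  show "cyclo_rep G 1 m ?\<rho>"
    unfolding cyclo_rep_def is_rep_def
    by (auto simp: cf lin_charsD(1)[OF th] lin_charsD(2)[OF th] scalar_prod_def intro!: eq_matI)
  show "mat_trace (?\<rho> g) = of_nat 1 * \<theta> g" if "g \<in> carrier G" for g
    by (simp add: mat_trace_def)
qed

end

lemma (in normal) linear_blocks:
  assumes fin: "finite (carrier G)" and p: "Factorial_Ring.prime (p::nat)" and comm: "comm_group (G Mod H)"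
  shows "\<exists>L. length L = num_cyclic_subgroups (G Mod H) (p ^ l) \<and>
    length L * totient (p ^ l) = card (level (carrier G) p l (lin_chars G (carrier G) H)) \<and> (\<forall>\<rho>\<in>set L. cyclo_rep G 1 (p ^ l) \<rho>) \<and>
    (\<forall>g\<in>carrier G. (\<Sum>\<rho>\<leftarrow>L. of_nat 1 * cyc_trace (p ^ l) (mat_trace (\<rho> g))) = (\<Sum>\<theta>\<in>level (carrier G) p l (lin_chars G (carrier G) H). \<theta> g))"
proof -
  let ?U = "lin_chars G (carrier G) H"
  have one: "\<one> \<in> H" by (rule subgroup.one_closed[OF subgroup_axioms])
  have U: "?U \<subseteq> lin_chars G (carrier G) {\<one>}" by (rule lin_chars_mono) (use one in simp)
  have finU: "finite ?U" by (rule finite_lin_chars[OF fin subgroup_self one])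
  have p0: "p ^ l > 0" using prime_gt_0_nat[OF p] by simp
  have "\<exists>L. length L * totient (p ^ l) = card (level (carrier G) p l ?U) \<and> (\<forall>\<rho>\<in>set L. cyclo_rep G 1 (p ^ l) \<rho>) \<and>
    (\<forall>g\<in>carrier G. (\<Sum>\<rho>\<leftarrow>L. of_nat 1 * cyc_trace (p ^ l) (mat_trace (\<rho> g))) = of_nat (1\<^sup>2) * (\<Sum>\<theta>\<in>level (carrier G) p l ?U. \<theta> g))"
  proof (rule level_blocks[OF fin subgroup_self U p])
    show "(\<lambda>x. \<theta> x ^ j) \<in> ?U" if "\<theta> \<in> ?U" "j > 0" for \<theta> and j :: nat
      by (rule lin_chars_power[OF that])
    fix \<theta> assume "\<theta> \<in> level (carrier G) p l ?U"
    then have "\<theta> \<in> lin_chars G (carrier G) {\<one>}" "\<And>x. x \<in> carrier G \<Longrightarrow> \<theta> x ^ (p ^ l) = 1" using U by (auto simp: level_def)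
    then show "\<exists>\<rho>. cyclo_rep G 1 (p ^ l) \<rho> \<and> (\<forall>g\<in>carrier G. mat_trace (\<rho> g) = of_nat 1 * \<theta> g)"
      by (rule linear_cyclo_rep[OF _ p0])
  qed
  then obtain L where L: "length L * totient (p ^ l) = card (level (carrier G) p l ?U)" "\<forall>\<rho>\<in>set L. cyclo_rep G 1 (p ^ l) \<rho>"
    "\<forall>g\<in>carrier G. (\<Sum>\<rho>\<leftarrow>L. of_nat 1 * cyc_trace (p ^ l) (mat_trace (\<rho> g))) = of_nat (1\<^sup>2) * (\<Sum>\<theta>\<in>level (carrier G) p l ?U. \<theta> g)"
    by blast
  have "card (level (carrier G) p l ?U) = num_cyclic_subgroups (G Mod H) (p ^ l) * totient (p ^ l)"
    by (rule card_level_lin_chars_of_torsion[OF finU p factorgroup_is_group finite_FactGroup[OF fin] card_lin_chars_quotient_exponent[OF fin comm]])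
  then have "length L = num_cyclic_subgroups (G Mod H) (p ^ l)" using L(1) prime_gt_0_nat[OF p] by auto
  then show ?thesis using L by (intro exI[of _ L]) simp
qed

context group
begin

lemma subgroup_card_dvd:
  assumes K: "subgroup K G" and M: "subgroup M G" and KM: "K \<subseteq> M"
  shows "card K dvd card M"
proof -
  interpret M: group "G\<lparr>carrier := M\<rparr>" by (rule subgroup.subgroup_is_group[OF M is_group])
  have "subgroup K (G\<lparr>carrier := M\<rparr>)" using subgroup_incl[OF K M KM] .
  then have "card (rcosets\<^bsub>G\<lparr>carrier := M\<rparr>\<^esub> K) * card K = card M"
    using M.lagrange by (simp add: Coset.order_def)
  then show ?thesis by (metis dvd_triv_right)
qed

text \<open>The kernel of \<open>\<theta>\<close> in \<open>M\<close> is a subgroup of a group of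
  prime order and not all of it, hence trivial.\<close>

lemma lin_chars_faithful_on_prime_order:
  assumes fin: "finite (carrier G)" and Z: "subgroup Z G" and M: "subgroup M G" "M \<subseteq> Z" "card M = p"
    and p: "Factorial_Ring.prime (p::nat)"
    and th: "\<theta> \<in> lin_chars G Z {\<one>}" "\<theta> \<notin> lin_chars G Z M"
    and y: "y \<in> M" "y \<noteq> \<one>"
  shows "\<theta> y \<noteq> 1"
proof
  assume y1: "\<theta> y = 1"
  let ?K = "{x \<in> M. \<theta> x = 1}"
  have MZ: "x \<in> Z" if "x \<in> M" for x using that M(2) by blast
  have K: "subgroup ?K G"
  proof (rule finite_subgroupI[OF fin])
    show "?K \<subseteq> carrier G" using subgroup.subset[OF M(1)] by blast
    show "\<one> \<in> ?K" using subgroup.one_closed[OF M(1)] lin_charsD(2)[OF th(1)] by simp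
    fix a b assume "a \<in> ?K" "b \<in> ?K"
    then show "a \<otimes> b \<in> ?K" using subgroup.m_closed[OF M(1)] lin_charsD(1)[OF th(1) MZ MZ] by simp
  qed
  have finM: "finite M" by (rule finite_subset[OF subgroup.subset[OF M(1)] fin])
  have "card {\<one>, y} \<le> card ?K"
    using finM y y1 subgroup.one_closed[OF K] by (intro card_mono) auto
  then have "card ?K \<noteq> 1" using y(2) by simp
  moreover have "card ?K dvd p" using subgroup_card_dvd[OF K M(1)] M(3) by auto
  ultimately have "card ?K = card M" using p M(3) unfolding prime_nat_iff by blast
  then have "?K = M" using finM by (intro card_subset_eq) auto
  then have "\<forall>x\<in>M. \<theta> x = 1" by blast
  then show False using th unfolding lin_chars_def by simp
qed

text \<open>The characters of \<open>Z\<close> that are nontrivial on \<open>M\<close> are faithful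
  there, so \<open>vanish\<close> and \<open>ext\<close> feed
  \<open>cyclo_rep_of_central_character\<close>. Keeping \<open>M\<close> separate from
  \<open>Z\<close> serves class two with \<open>M\<close> the commutator subgroup and class three
  with \<open>M\<close> the centre.\<close>

lemma central_blocks:
  assumes fin: "finite (carrier G)" and p: "Factorial_Ring.prime (p::nat)" and l: "l > 0"
    and Zs: "subgroup Z G" and Z: "\<And>z g. z \<in> Z \<Longrightarrow> g \<in> carrier G \<Longrightarrow> z \<otimes> g = g \<otimes> z"
    and M: "subgroup M G" "M \<subseteq> Z" "card M = p"
    and vanish: "\<And>g. g \<in> carrier G \<Longrightarrow> g \<notin> Z \<Longrightarrow> \<exists>x\<in>carrier G. x \<otimes> g \<otimes> inv x \<otimes> inv g \<in> M - {\<one>}"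
    and ext: "\<And>\<theta>. \<theta> \<in> lin_chars G Z {\<one>} \<Longrightarrow> (\<And>z. z \<in> Z \<Longrightarrow> \<theta> z ^ (p ^ l) = 1) \<Longrightarrow>
      \<exists>A \<mu>. subgroup A G \<and> Z \<subseteq> A \<and> k * card A = card (carrier G) \<and> \<mu> \<in> lin_chars G A {\<one>} \<and>
        (\<forall>z\<in>Z. \<mu> z = \<theta> z) \<and> (\<forall>a\<in>A. \<mu> a ^ (p ^ l) = 1)"
  defines "U \<equiv> lin_chars G Z {\<one>} - lin_chars G Z M"
  shows "\<exists>L. length L * totient (p ^ l) = card (level Z p l U) \<and> (\<forall>\<rho>\<in>set L. cyclo_rep G k (p ^ l) \<rho>) \<and>
    (\<forall>g\<in>carrier G. (\<Sum>\<rho>\<leftarrow>L. of_nat k * cyc_trace (p ^ l) (mat_trace (\<rho> g))) = of_nat (k\<^sup>2) * (\<Sum>\<theta>\<in>level Z p l U. \<theta> g))"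
proof (rule level_blocks[OF fin Zs _ p])
  show "U \<subseteq> lin_chars G Z {\<one>}" by (auto simp: U_def)
  show "(\<lambda>x. \<theta> x ^ j) \<in> U" if th: "\<theta> \<in> U" and j: "coprime j p" "j > 0" and r: "\<forall>x\<in>Z. \<theta> x ^ (p ^ l) = 1" for \<theta> j
  proof -
    have th1: "\<theta> \<in> lin_chars G Z {\<one>}" "\<theta> \<notin> lin_chars G Z M" using th by (simp_all add: U_def)
    have "\<not> (\<forall>y\<in>M. \<theta> y = 1)" using th1 unfolding lin_chars_def by simp
    then obtain y where y: "y \<in> M" "\<theta> y \<noteq> 1" by blast
    have "\<theta> y ^ (p ^ l) = 1" using r y(1) M(2) by blast
    then have "\<theta> y ^ j \<noteq> 1" using coprime_root_of_unity_eq_1[of "\<theta> y" "p ^ l" j] y(2) j by auto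
    then have "(\<lambda>x. \<theta> x ^ j) \<notin> lin_chars G Z M" using lin_charsD(2)[of "\<lambda>x. \<theta> x ^ j" G Z M y] y(1) by auto
    then show ?thesis using lin_chars_power[OF th1(1) j(2)] by (simp add: U_def)
  qed
  fix \<theta> assume "\<theta> \<in> level Z p l U"
  then have th: "\<theta> \<in> lin_chars G Z {\<one>}" "\<theta> \<notin> lin_chars G Z M" "\<And>z. z \<in> Z \<Longrightarrow> \<theta> z ^ (p ^ l) = 1"
    by (auto simp: level_def U_def)
  obtain A \<mu> where A: "subgroup A G" "Z \<subseteq> A" "k * card A = card (carrier G)" "\<mu> \<in> lin_chars G A {\<one>}"
    "\<And>z. z \<in> Z \<Longrightarrow> \<mu> z = \<theta> z" "\<And>a. a \<in> A \<Longrightarrow> \<mu> a ^ (p ^ l) = 1"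
    using ext[OF th(1,3)] by blast
  have p0: "p ^ l > 0" using prime_gt_0_nat[OF p] by simp
  show "\<exists>\<rho>. cyclo_rep G k (p ^ l) \<rho> \<and> (\<forall>g\<in>carrier G. mat_trace (\<rho> g) = of_nat k * \<theta> g)"
    by (rule cyclo_rep_of_central_character[OF fin p0 Z M(2) vanish th(1)
          lin_chars_faithful_on_prime_order[OF fin Zs M p th(1,2)] A(1,2,3,4,5,6)])
qed

end

section \<open>Commutator subgroup of prime order\<close>

context group
begin

lemma center_subgroup: "subgroup (grp_center G) G"
proof (rule subgroupI)
  show "grp_center G \<subseteq> carrier G" by (auto simp: grp_center_def)
  show "grp_center G \<noteq> {}" using one_closed by (force simp: grp_center_def)
  fix a assume a: "a \<in> grp_center G"
  then have ac: "a \<in> carrier G" by (simp add: grp_center_def)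
  have "inv a \<otimes> g = g \<otimes> inv a" if g: "g \<in> carrier G" for g
  proof -
    have "a \<otimes> g = g \<otimes> a" using a g by (simp add: grp_center_def)
    then have "inv a \<otimes> (a \<otimes> g) \<otimes> inv a = inv a \<otimes> (g \<otimes> a) \<otimes> inv a" by simp
    moreover have "inv a \<otimes> (a \<otimes> g) \<otimes> inv a = g \<otimes> inv a" using ac g by (simp add: m_assoc[symmetric])
    moreover have "inv a \<otimes> (g \<otimes> a) \<otimes> inv a = inv a \<otimes> g" using ac g by (simp add: m_assoc)
    ultimately show ?thesis by simp
  qed
  then show "inv a \<in> grp_center G" using ac by (simp add: grp_center_def)
next
  fix a b assume a: "a \<in> grp_center G" and b: "b \<in> grp_center G"
  then have c: "a \<in> carrier G" "b \<in> carrier G" by (simp_all add: grp_center_def)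
  have "a \<otimes> b \<otimes> g = g \<otimes> (a \<otimes> b)" if g: "g \<in> carrier G" for g
  proof -
    have ag: "a \<otimes> g = g \<otimes> a" "b \<otimes> g = g \<otimes> b" using a b g by (simp_all add: grp_center_def)
    have "a \<otimes> b \<otimes> g = a \<otimes> (g \<otimes> b)" using c g ag by (simp add: m_assoc)
    also have "\<dots> = g \<otimes> (a \<otimes> b)" using c g ag(1) by (simp add: m_assoc[symmetric])
    finally show ?thesis .
  qed
  then show "a \<otimes> b \<in> grp_center G" using c by (simp add: grp_center_def)
qed

lemma center_commutes: "z \<in> grp_center G \<Longrightarrow> g \<in> carrier G \<Longrightarrow> z \<otimes> g = g \<otimes> z"
  by (simp add: grp_center_def)

lemma commutator_in_derived:
  assumes "x \<in> carrier G" "y \<in> carrier G"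
  shows "x \<otimes> y \<otimes> inv x \<otimes> inv y \<in> derived G (carrier G)"
  unfolding derived_def using assms by (intro generate.incl) blast

lemma commutator_eq_one_iff:
  assumes "x \<in> carrier G" "y \<in> carrier G"
  shows "x \<otimes> y \<otimes> inv x \<otimes> inv y = \<one> \<longleftrightarrow> x \<otimes> y = y \<otimes> x"
proof -
  have "x \<otimes> y = (x \<otimes> y \<otimes> inv x \<otimes> inv y) \<otimes> (y \<otimes> x)"
  proof -
    have "inv y \<otimes> (y \<otimes> x) = x" using assms by (simp add: m_assoc[symmetric])
    then show ?thesis using assms by (simp add: m_assoc)
  qed
  then show ?thesis using assms by (metis inv_closed l_one m_closed r_cancel_one)
qed

text \<open>For a central commutator, \<open>[x^n, g] = [x, g]^n\<close> by
  \<open>class2_swap\<close>.\<close>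

lemma pow_commutes_of_commutator:
  assumes x: "x \<in> carrier G" and g: "g \<in> carrier G"
    and c: "x \<otimes> g \<otimes> inv x \<otimes> inv g \<in> grp_center G" "(x \<otimes> g \<otimes> inv x \<otimes> inv g) [^] (n::nat) = \<one>"
  shows "x [^] n \<otimes> g = g \<otimes> x [^] n"
proof -
  let ?c = "x \<otimes> g \<otimes> inv x \<otimes> inv g"
  have "inv g \<otimes> (g \<otimes> x) = x" using x g by (simp add: m_assoc[symmetric])
  then have sw: "x \<otimes> g = ?c \<otimes> (g \<otimes> x)" using x g by (simp add: m_assoc)
  have cc: "?c \<in> carrier G" using x g by simp
  have "x [^] n \<otimes> g = ?c [^] n \<otimes> (g \<otimes> x [^] n)"
    by (rule class2_swap[OF g x cc sw center_commutes[OF c(1) x]])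
  then show ?thesis using c(2) x g by simp
qed

definition centralizer :: "'a \<Rightarrow> 'a set" where
  "centralizer x = {g \<in> carrier G. g \<otimes> x = x \<otimes> g}"

lemma centralizer_subgroup:
  assumes fin: "finite (carrier G)" and x: "x \<in> carrier G"
  shows "subgroup (centralizer x) G"
proof (rule finite_subgroupI[OF fin])
  fix a b assume "a \<in> centralizer x" "b \<in> centralizer x"
  then have ab: "a \<in> carrier G" "b \<in> carrier G" "a \<otimes> x = x \<otimes> a" "b \<otimes> x = x \<otimes> b" by (simp_all add: centralizer_def)
  have "a \<otimes> b \<otimes> x = a \<otimes> (x \<otimes> b)" using ab x by (simp add: m_assoc)
  also have "\<dots> = x \<otimes> (a \<otimes> b)" using ab(1-3) x by (simp add: m_assoc[symmetric])
  finally show "a \<otimes> b \<in> centralizer x" using ab by (simp add: centralizer_def)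
qed (use x in \<open>auto simp: centralizer_def\<close>)

text \<open>Orbit counting: the conjugates of \<open>x\<close> under \<open>S\<close> inject into
  \<open>P\<close> by right multiplication with \<open>inv x\<close>, and the fibres of conjugation
  are cosets of the stabiliser.\<close>

lemma card_centralizer_in_subgroup_bound:
  assumes fin: "finite (carrier G)" and x: "x \<in> carrier G" and S: "subgroup S G"
    and P: "P \<subseteq> carrier G" "\<And>g. g \<in> S \<Longrightarrow> g \<otimes> x \<otimes> inv g \<otimes> inv x \<in> P"
  shows "card S \<le> card P * card (centralizer x \<inter> S)"
proof -
  define f where "f = (\<lambda>g. inv g \<otimes> x \<otimes> g)"
  interpret S: group "G\<lparr>carrier := S\<rparr>" by (rule subgroup.subgroup_is_group[OF S is_group])
  have finS: "finite S" by (rule finite_subset[OF subgroup.subset[OF S] fin])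
  note Sc = subgroup.mem_carrier[OF S]
  have C: "subgroup (centralizer x \<inter> S) G"
    by (rule subgroups_Inter_pair[OF centralizer_subgroup[OF fin x] S])
  have "card (carrier (G\<lparr>carrier := S\<rparr>)) = card (f ` carrier (G\<lparr>carrier := S\<rparr>)) * card (centralizer x \<inter> S)"
  proof (rule S.card_fibres)
    show "finite (carrier (G\<lparr>carrier := S\<rparr>))" using finS by simp
    show "subgroup (centralizer x \<inter> S) (G\<lparr>carrier := S\<rparr>)" by (rule subgroup_incl[OF C S]) blast
    fix g h assume "g \<in> carrier (G\<lparr>carrier := S\<rparr>)" "h \<in> carrier (G\<lparr>carrier := S\<rparr>)"
    then have gS: "g \<in> S" "h \<in> S" by simp_all
    have g: "g \<in> carrier G" and h: "h \<in> carrier G" using gS Sc by blast+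
    have "f g = f h \<longleftrightarrow> g \<otimes> (inv g \<otimes> x \<otimes> g) \<otimes> inv h = g \<otimes> (inv h \<otimes> x \<otimes> h) \<otimes> inv h"
      using g h x unfolding f_def by (metis inv_closed l_cancel m_closed r_cancel)
    also have "g \<otimes> (inv g \<otimes> x \<otimes> g) \<otimes> inv h = x \<otimes> (g \<otimes> inv h)"
    proof -
      have "g \<otimes> (inv g \<otimes> (x \<otimes> (g \<otimes> inv h))) = x \<otimes> (g \<otimes> inv h)" using g h x by (simp add: m_assoc[symmetric])
      then show ?thesis using g h x by (simp add: m_assoc)
    qed
    also have "g \<otimes> (inv h \<otimes> x \<otimes> h) \<otimes> inv h = g \<otimes> inv h \<otimes> x" using g h x by (simp add: m_assoc)
    finally show "f g = f h \<longleftrightarrow> g \<otimes>\<^bsub>G\<lparr>carrier := S\<rparr>\<^esub> inv\<^bsub>G\<lparr>carrier := S\<rparr>\<^esub> h \<in> centralizer x \<inter> S"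
      using g h gS subgroup.m_closed[OF S gS(1) subgroup.m_inv_closed[OF S gS(2)]]
      by (auto simp: centralizer_def m_inv_consistent[OF S])
  qed
  then have "card S = card (f ` S) * card (centralizer x \<inter> S)" by simp
  moreover have "card (f ` S) \<le> card P"
  proof (rule card_inj_on_le[of "\<lambda>y. y \<otimes> inv x"])
    have fc: "f g \<in> carrier G" if "g \<in> S" for g using Sc[OF that] x by (simp add: f_def)
    show "inj_on (\<lambda>y. y \<otimes> inv x) (f ` S)"
    proof (rule inj_onI)
      fix a b assume "a \<in> f ` S" "b \<in> f ` S" and eq: "a \<otimes> inv x = b \<otimes> inv x"
      then have "a \<in> carrier G" "b \<in> carrier G" using fc by blast+
      then show "a = b" using eq x by simp
    qed
    show "(\<lambda>y. y \<otimes> inv x) ` f ` S \<subseteq> P"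
    proof
      fix y assume "y \<in> (\<lambda>y. y \<otimes> inv x) ` f ` S"
      then obtain g where g: "g \<in> S" "y = f g \<otimes> inv x" by blast
      then show "y \<in> P" using P(2)[OF subgroup.m_inv_closed[OF S g(1)]] Sc[OF g(1)] by (simp add: f_def)
    qed
    show "finite P" using P(1) fin finite_subset by blast
  qed
  ultimately show ?thesis by simp
qed

lemma card_centralizer_bound:
  assumes fin: "finite (carrier G)" and x: "x \<in> carrier G"
    and P: "P \<subseteq> carrier G" "\<And>g. g \<in> carrier G \<Longrightarrow> g \<otimes> x \<otimes> inv g \<otimes> inv x \<in> P"
  shows "card (carrier G) \<le> card P * card (centralizer x)"
proof -
  have "centralizer x \<inter> carrier G = centralizer x" by (auto simp: centralizer_def)
  then show ?thesis using card_centralizer_in_subgroup_bound[OF fin x subgroup_self P] by simp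
qed

lemma center_subset_centralizer: "x \<in> carrier G \<Longrightarrow> grp_center G \<subseteq> centralizer x"
  by (auto simp: grp_center_def centralizer_def)

lemma subgroup_prime_pow_eq_one:
  assumes N: "subgroup N G" "card N = p" and c: "c \<in> N"
  shows "c [^] p = \<one>"
proof -
  interpret N: group "G\<lparr>carrier := N\<rparr>" by (rule subgroup.subgroup_is_group[OF N(1) is_group])
  have "c [^]\<^bsub>G\<lparr>carrier := N\<rparr>\<^esub> card N = \<one>" using N.pow_order_eq_1[of c] c by (simp add: Coset.order_def)
  then show ?thesis using N(2) by (simp add: nat_pow_consistent[symmetric])
qed

text \<open>\<open>A\<close> has the same index over the centre as in \<open>G\<close>, namely
  \<open>k\<close>, and is reached by one extension step for \<open>k = p\<close> and by two for
  \<open>k = p^2\<close>. The second step takes place in the centralizer of the first new element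
  \<open>x\<close>, which centralises the first \<open>A\<close>, so that
  \<open>lin_chars_extend_same_field\<close> applies again.\<close>

lemma lin_chars_extend_class2:
  assumes fin: "finite (carrier G)" and p: "Factorial_Ring.prime (p::nat)" and odd: "odd p" and l: "l > 0"
    and N: "subgroup N G" "card N = p" "N \<subseteq> grp_center G"
    and com: "\<And>x y. x \<in> carrier G \<Longrightarrow> y \<in> carrier G \<Longrightarrow> x \<otimes> y \<otimes> inv x \<otimes> inv y \<in> N"
    and k: "k = p \<or> k = p\<^sup>2" "card (carrier G) = k\<^sup>2 * card (grp_center G)"
    and th: "\<theta> \<in> lin_chars G (grp_center G) {\<one>}" and root: "\<And>z. z \<in> grp_center G \<Longrightarrow> \<theta> z ^ (p ^ l) = 1"
  shows "\<exists>A \<mu>. subgroup A G \<and> grp_center G \<subseteq> A \<and> k * card A = card (carrier G) \<and> \<mu> \<in> lin_chars G A {\<one>} \<and>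
        (\<forall>z\<in>grp_center G. \<mu> z = \<theta> z) \<and> (\<forall>a\<in>A. \<mu> a ^ (p ^ l) = 1)"
proof -
  let ?Z = "grp_center G"
  note Zs = center_subgroup
  have p1: "p > 1" using prime_gt_1_nat[OF p] .
  have finZ: "finite ?Z" by (rule finite_subset[OF subgroup.subset[OF Zs] fin])
  have Z0: "card ?Z > 0" using finZ subgroup.one_closed[OF Zs] by (auto simp: card_gt_0_iff)
  have cp: "(x \<otimes> y \<otimes> inv x \<otimes> inv y) [^] p = \<one>" if "x \<in> carrier G" "y \<in> carrier G" for x y
    by (rule subgroup_prime_pow_eq_one[OF N(1,2) com[OF that]])
  have cZ: "x \<otimes> y \<otimes> inv x \<otimes> inv y \<in> ?Z" if "x \<in> carrier G" "y \<in> carrier G" for x y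
    using com[OF that] N(3) by blast
  have pZ: "x [^] p \<in> ?Z" if x: "x \<in> carrier G" for x
  proof -
    have "x [^] p \<otimes> g = g \<otimes> x [^] p" if "g \<in> carrier G" for g
      by (rule pow_commutes_of_commutator[OF x that cZ[OF x that] cp[OF x that]])
    then show ?thesis using x by (simp add: grp_center_def)
  qed
  have zc: "h \<otimes> w = w \<otimes> h" if "h \<in> carrier G" "w \<in> ?Z" for h w
    using center_commutes[OF that(2,1)] by simp
  have "p * card ?Z < k\<^sup>2 * card ?Z"
  proof -
    have "p < p\<^sup>2" using p1 by (simp add: power2_eq_square)
    moreover have "p\<^sup>2 \<le> k\<^sup>2" using k(1) p1 by (auto intro: power_mono simp: power2_eq_square)
    ultimately have "p < k\<^sup>2" by (rule less_le_trans)
    then show ?thesis using Z0 by simp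
  qed
  then have big: "card (carrier G) > p * card ?Z" using k(2) by simp
  obtain x A \<mu> where A: "x \<in> carrier G" "x \<notin> ?Z" "subgroup A G" "?Z \<subseteq> A" "A \<subseteq> carrier G" "card A = p * card ?Z" "x \<in> A"
    "A = {w \<otimes> x [^] i | w i. w \<in> ?Z \<and> i \<in> (UNIV :: nat set)}"
    "\<mu> \<in> lin_chars G A {\<one>}" "\<And>w. w \<in> ?Z \<Longrightarrow> \<mu> w = \<theta> w" "\<And>a. a \<in> A \<Longrightarrow> \<mu> a ^ (p ^ l) = 1"
    by (rule lin_chars_extend_same_field[OF fin p odd l Zs subgroup_self subgroup.subset[OF Zs] zc pZ cZ cp big th root])
       (assumption | rule that)+
  show ?thesis
  proof (cases "k = p")
    case True
    then show ?thesis using A k(2) by (intro exI[of _ A] exI[of _ \<mu>]) (simp add: power2_eq_square)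
  next
    case False
    then have kk: "k = p\<^sup>2" using k(1) by simp
    let ?H = "centralizer x"
    have H: "subgroup ?H G" by (rule centralizer_subgroup[OF fin A(1)])
    have Hc: "h \<in> carrier G" if "h \<in> ?H" for h using that by (simp add: centralizer_def)
    have ZH: "?Z \<subseteq> ?H" by (rule center_subset_centralizer[OF A(1)])
    have xiH: "x [^] (i::nat) \<in> ?H" for i
      using A(1) by (simp add: centralizer_def nat_pow_comm pow_mult_distrib group_commutes_pow)
    have AH: "A \<subseteq> ?H"
    proof
      fix a assume "a \<in> A"
      then obtain w i where a: "w \<in> ?Z" "a = w \<otimes> x [^] (i::nat)" unfolding A(8) by blast
      then have "w \<in> ?H" using ZH by blast
      then show "a \<in> ?H" using a(2) xiH subgroup.m_closed[OF H] by simp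
    qed
    have comm: "h \<otimes> a = a \<otimes> h" if h: "h \<in> ?H" and a: "a \<in> A" for h a
    proof -
      obtain w i where wi: "w \<in> ?Z" "a = w \<otimes> x [^] (i::nat)" using a unfolding A(8) by blast
      have wc: "w \<in> carrier G" using wi(1) by (simp add: grp_center_def)
      have hx: "h \<otimes> x = x \<otimes> h" using h by (simp add: centralizer_def)
      have "x [^] i \<otimes> h = h \<otimes> x [^] i" by (rule group_commutes_pow[OF hx[symmetric] A(1) Hc[OF h]])
      moreover have "w \<otimes> h = h \<otimes> w" by (rule center_commutes[OF wi(1) Hc[OF h]])
      ultimately show ?thesis using wi(2) wc A(1) Hc[OF h] by (metis m_assoc nat_pow_closed)
    qed
    have Ncar: "N \<subseteq> carrier G" by (rule subgroup.subset[OF N(1)])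
    \<comment> \<open>Commutators with \<open>x\<close> lie in \<open>N\<close> of order
      \<open>p\<close>, so the centralizer has index at most \<open>p\<close> and order at least
      \<open>p^3 * card ?Z\<close>, more than the bound \<open>p * card A = p^2 * card ?Z\<close>
      that the second step requires.\<close>
    have "card (carrier G) \<le> p * card ?H"
      using card_centralizer_bound[OF fin A(1) Ncar com[OF _ A(1)]] N(2) by simp
    then have "p * (p ^ 3 * card ?Z) \<le> p * card ?H"
      using k(2) kk by (simp add: power_mult[symmetric] eval_nat_numeral mult_ac)
    then have "p ^ 3 * card ?Z \<le> card ?H" using p1 by simp
    moreover have "p * card A < p ^ 3 * card ?Z"
      using A(6) Z0 p1 by (simp add: eval_nat_numeral)
    ultimately have big2: "card ?H > p * card A" by linarith
    obtain x' A' \<mu>' where A': "x' \<in> ?H" "x' \<notin> A" "subgroup A' G" "A \<subseteq> A'" "A' \<subseteq> ?H" "card A' = p * card A" "x' \<in> A'"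
      "A' = {w \<otimes> x' [^] i | w i. w \<in> A \<and> i \<in> (UNIV :: nat set)}"
      "\<mu>' \<in> lin_chars G A' {\<one>}" "\<And>w. w \<in> A \<Longrightarrow> \<mu>' w = \<mu> w" "\<And>a. a \<in> A' \<Longrightarrow> \<mu>' a ^ (p ^ l) = 1"
    proof (rule lin_chars_extend_same_field[OF fin p odd l A(3) H AH comm _ _ _ big2 A(9,11)])
      show "h [^] p \<in> A" if "h \<in> ?H" for h using pZ[OF Hc[OF that]] A(4) by blast
      show "x \<otimes> y \<otimes> inv x \<otimes> inv y \<in> A" if "x \<in> ?H" "y \<in> ?H" for x y
        using cZ[OF Hc[OF that(1)] Hc[OF that(2)]] A(4) by blast
      show "(x \<otimes> y \<otimes> inv x \<otimes> inv y) [^] p = \<one>" if "x \<in> ?H" "y \<in> ?H" for x y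
        using cp[OF Hc[OF that(1)] Hc[OF that(2)]] .
    qed (assumption | rule that)+
    have "k * card A' = card (carrier G)"
      using A'(6) A(6) k(2) kk by (simp add: eval_nat_numeral)
    moreover have "?Z \<subseteq> A'" using A(4) A'(4) by blast
    moreover have "\<mu>' z = \<theta> z" if "z \<in> ?Z" for z using A'(10)[of z] A(10)[OF that] A(4) that by auto
    ultimately show ?thesis using A'(3,9,11) by blast
  qed
qed

lemma class2_vanishing:
  assumes N: "\<And>x y. x \<in> carrier G \<Longrightarrow> y \<in> carrier G \<Longrightarrow> x \<otimes> y \<otimes> inv x \<otimes> inv y \<in> N"
    and g: "g \<in> carrier G" "g \<notin> grp_center G"
  shows "\<exists>x\<in>carrier G. x \<otimes> g \<otimes> inv x \<otimes> inv g \<in> N - {\<one>}"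
proof -
  obtain x where x: "x \<in> carrier G" "g \<otimes> x \<noteq> x \<otimes> g" using g by (auto simp: grp_center_def)
  then have "x \<otimes> g \<otimes> inv x \<otimes> inv g \<noteq> \<one>" using commutator_eq_one_iff[OF x(1) g(1)] by auto
  then show ?thesis using N[OF x(1) g(1)] x(1) by blast
qed

lemma comm_group_subgroup:
  assumes Z: "subgroup Z G" "\<And>x y. x \<in> Z \<Longrightarrow> y \<in> Z \<Longrightarrow> x \<otimes> y = y \<otimes> x"
  shows "comm_group (G\<lparr>carrier := Z\<rparr>)"
  by (rule group.group_comm_groupI[OF subgroup.subgroup_is_group[OF Z(1) is_group]]) (use Z(2) in simp)

lemma lin_chars_subgroup_eq: "lin_chars (G\<lparr>carrier := Z\<rparr>) W N = lin_chars G W N"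
  by (simp add: lin_chars_def)

text \<open>The difference of the regular characters of \<open>Z\<close> and of \<open>Z/M\<close>;
  the zero extension makes the formula valid for every \<open>g\<close>.\<close>

lemma sum_over_nontrivial_chars:
  assumes fin: "finite (carrier G)" and Z: "subgroup Z G" "\<And>x y. x \<in> Z \<Longrightarrow> y \<in> Z \<Longrightarrow> x \<otimes> y = y \<otimes> x"
    and M: "subgroup M G" "M \<subseteq> Z"
  defines "U \<equiv> lin_chars G Z {\<one>} - lin_chars G Z M"
  shows "(\<Sum>\<theta>\<in>U. \<theta> g) = (if g = \<one> then of_nat (card Z) else 0) - (if g \<in> M then of_nat (card Z div card M) else 0)"
    and "card U = card Z - card Z div card M"
proof -
  let ?K = "G\<lparr>carrier := Z\<rparr>"
  interpret K: comm_group ?K by (rule comm_group_subgroup[OF Z])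
  have finZ: "finite Z" by (rule finite_subset[OF subgroup.subset[OF Z(1)] fin])
  have oneM: "\<one> \<in> M" by (rule subgroup.one_closed[OF M(1)])
  have oneZ: "\<one> \<in> Z" by (rule subgroup.one_closed[OF Z(1)])
  have MK: "subgroup M ?K" by (rule subgroup_incl[OF M(1) Z(1) M(2)])
  interpret M: normal M ?K by (rule K.subgroup_imp_normal[OF MK])
  have cM: "card (rcosets\<^bsub>?K\<^esub> M) = card Z div card M"
  proof -
    have "card (rcosets\<^bsub>?K\<^esub> M) * card M = card Z" using K.lagrange[OF MK] by (simp add: Coset.order_def)
    moreover have "card M > 0" using oneM finite_subset[OF M(2) finZ] by (auto simp: card_gt_0_iff)
    ultimately show ?thesis by (metis nonzero_mult_div_cancel_right less_irrefl)
  qed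
  have sub: "lin_chars G Z M \<subseteq> lin_chars G Z {\<one>}" by (rule lin_chars_mono) (use oneM in simp)
  have fin1: "finite (lin_chars G Z {\<one>})" by (rule finite_lin_chars[OF fin Z(1)]) simp
  have e: "lin_chars ?K Z W = lin_chars G Z W" for W by (rule lin_chars_subgroup_eq)
  have "card (lin_chars G Z {\<one>}) = card Z" "card (lin_chars G Z M) = card Z div card M"
    using K.sum_over_lin_chars(2)[of \<one>] M.sum_over_lin_chars_quotient(2)[OF _ K.abelian_FactGroup[OF MK], of \<one>] finZ oneZ cM
    by (simp_all add: e)
  then show "card U = card Z - card Z div card M"
    using card_Diff_subset[OF finite_subset[OF sub fin1] sub] by (simp add: U_def)
  have "(\<Sum>\<theta>\<in>lin_chars G Z {\<one>}. \<theta> g) = (if g = \<one> then of_nat (card Z) else 0)"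
    "(\<Sum>\<theta>\<in>lin_chars G Z M. \<theta> g) = (if g \<in> M then of_nat (card Z div card M) else 0)"
  proof -
    have z: "\<theta> g = 0" if "\<theta> \<in> lin_chars G Z W" "g \<notin> Z" for \<theta> W
      using lin_charsD(3)[OF that] .
    show "(\<Sum>\<theta>\<in>lin_chars G Z {\<one>}. \<theta> g) = (if g = \<one> then of_nat (card Z) else 0)"
    proof (cases "g \<in> Z")
      case True
      then show ?thesis using K.sum_over_lin_chars(1)[of g] finZ by (simp add: e)
    next
      case False
      then show ?thesis using z[OF _ False, of _ "{\<one>}"] oneZ by (auto intro: sum.neutral)
    qed
    show "(\<Sum>\<theta>\<in>lin_chars G Z M. \<theta> g) = (if g \<in> M then of_nat (card Z div card M) else 0)"
    proof (cases "g \<in> Z")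
      case True
      then show ?thesis using M.sum_over_lin_chars_quotient(1)[OF _ K.abelian_FactGroup[OF MK], of g] finZ cM by (simp add: e)
    next
      case False
      then have "g \<notin> M" using M(2) by blast
      then show ?thesis using z[OF _ False, of _ M] by (auto intro: sum.neutral)
    qed
  qed
  then show "(\<Sum>\<theta>\<in>U. \<theta> g) = (if g = \<one> then of_nat (card Z) else 0) - (if g \<in> M then of_nat (card Z div card M) else 0)"
    unfolding U_def by (simp only: sum_diff[OF fin1 sub])
qed

end

text \<open>Turns the lists of representations at the levels \<open>l\<close> into the triples
  expected by \<open>QG_iso_blocksI\<close>; their order reproduces that of the block list in the
  theorem.\<close>

definition tag_blocks :: "nat \<Rightarrow> nat \<Rightarrow> (nat \<Rightarrow> ('a \<Rightarrow> complex mat) list) \<Rightarrow> nat list \<Rightarrow> (nat \<times> nat \<times> ('a \<Rightarrow> complex mat)) list" where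
  "tag_blocks k p L ls = concat (map (\<lambda>l. map (\<lambda>\<rho>. (k, p ^ l, \<rho>)) (L l)) ls)"

lemma tag_blocks_types:
  "map (\<lambda>(k, m, \<rho>). (k, m)) (tag_blocks k p L ls) = concat (map (\<lambda>l. replicate (length (L l)) (k, p ^ l)) ls)"
  by (induction ls) (simp_all add: tag_blocks_def comp_def map_replicate_const)

lemma tag_blocks_sum:
  "(\<Sum>b\<leftarrow>tag_blocks k p L ls. f b) = (\<Sum>l\<leftarrow>ls. \<Sum>\<rho>\<leftarrow>L l. f (k, p ^ l, \<rho>))"
  by (induction ls) (simp_all add: tag_blocks_def comp_def)

lemma tag_blocks_dim:
  "(\<Sum>(k, m, \<rho>)\<leftarrow>tag_blocks k p L ls. k\<^sup>2 * totient m) = k\<^sup>2 * (\<Sum>l\<leftarrow>ls. length (L l) * totient (p ^ l))"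
  unfolding tag_blocks_sum by (simp add: sum_list_triv sum_list_const_mult[symmetric] mult_ac)

lemma set_tag_blocks:
  "(k', m, \<rho>) \<in> set (tag_blocks k p L ls) \<longleftrightarrow> k' = k \<and> (\<exists>l\<in>set ls. m = p ^ l \<and> \<rho> \<in> set (L l))"
  by (auto simp: tag_blocks_def)

section \<open>Assembling the blocks in class two\<close>

context group
begin

lemma class2_nonlinear_blocks:
  assumes fin: "finite (carrier G)" and p: "Factorial_Ring.prime (p::nat)" and odd: "odd p" and l: "l > 0"
    and N: "subgroup N G" "card N = p" "N \<subseteq> grp_center G"
    and com: "\<And>x y. x \<in> carrier G \<Longrightarrow> y \<in> carrier G \<Longrightarrow> x \<otimes> y \<otimes> inv x \<otimes> inv y \<in> N"
    and k: "k = p \<or> k = p\<^sup>2" "card (carrier G) = k\<^sup>2 * card (grp_center G)"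
  defines "U \<equiv> lin_chars G (grp_center G) {\<one>} - lin_chars G (grp_center G) N"
  shows "\<exists>L. length L * totient (p ^ l) = card (level (grp_center G) p l U) \<and> (\<forall>\<rho>\<in>set L. cyclo_rep G k (p ^ l) \<rho>) \<and>
    (\<forall>g\<in>carrier G. (\<Sum>\<rho>\<leftarrow>L. of_nat k * cyc_trace (p ^ l) (mat_trace (\<rho> g))) = of_nat (k\<^sup>2) * (\<Sum>\<theta>\<in>level (grp_center G) p l U. \<theta> g))"
  unfolding U_def
  by (rule central_blocks[OF fin p l center_subgroup center_commutes N(1,3,2) class2_vanishing[OF com]
        lin_chars_extend_class2[OF fin p odd l N com k]])

text \<open>Since \<open>p^m\<close> is the exponent of the abelianization, the levels 0 to
  \<open>m\<close> exhaust its characters; the dimensions then add up to its order and the traces to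
  its regular character.\<close>

lemma linear_blocks_derived:
  assumes fin: "finite (carrier G)" and p: "Factorial_Ring.prime (p::nat)" and card: "card (carrier G) = p ^ e"
  defines "N \<equiv> derived G (carrier G)"
  obtains m L where "grp_exponent (G Mod N) = p ^ m"
    "\<And>l. length (L l) = num_cyclic_subgroups (G Mod N) (p ^ l)"
    "\<And>l \<rho>. \<rho> \<in> set (L l) \<Longrightarrow> cyclo_rep G 1 (p ^ l) \<rho>"
    "(\<Sum>l\<leftarrow>[0..<m + 1]. length (L l) * totient (p ^ l)) = card (rcosets N)"
    "\<And>g. g \<in> carrier G \<Longrightarrow> (\<Sum>l\<leftarrow>[0..<m + 1]. \<Sum>\<rho>\<leftarrow>L l. of_nat 1 * cyc_trace (p ^ l) (mat_trace (\<rho> g)))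
       = (if g \<in> N then of_nat (card (rcosets N)) else 0)"
proof -
  interpret N: normal N G unfolding N_def by (rule derived_is_normal[OF normal_self])
  have comm: "comm_group (G Mod N)" unfolding N_def by (rule derived_quot_is_comm_group)
  interpret Q: comm_group "G Mod N" by (rule comm)
  let ?U = "lin_chars G (carrier G) N"
  have finU: "finite ?U" by (rule finite_lin_chars[OF fin subgroup_self subgroup.one_closed[OF N.subgroup_axioms]])
  have "card (rcosets N) * card N = p ^ e"
    using lagrange[OF N.subgroup_axioms] card by (simp add: Coset.order_def)
  then have "card (rcosets N) dvd p ^ e" by (metis dvd_triv_left)
  then obtain e' where "card (rcosets N) = p ^ e'" using divides_primepow_nat[OF p] by blast
  then have "card (carrier (G Mod N)) = p ^ e'" by (simp add: FactGroup_def)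
  then obtain m where m: "grp_exponent (G Mod N) = p ^ m" "\<And>x. x \<in> carrier (G Mod N) \<Longrightarrow> x [^]\<^bsub>G Mod N\<^esub> (p ^ m) = \<one>\<^bsub>G Mod N\<^esub>"
    using Q.grp_exponent_prime_power[OF p] by blast
  have all: "{\<theta> \<in> ?U. \<forall>x\<in>carrier G. \<theta> x ^ (p ^ m) = 1} = ?U"
  proof -
    have "\<theta> x ^ (p ^ m) = 1" if th: "\<theta> \<in> ?U" and x: "x \<in> carrier G" for \<theta> x
    proof -
      have "N #> x \<in> carrier (G Mod N)" using x by (auto simp: carrier_FactGroup)
      then have "N #> (x [^] (p ^ m)) = N" using m(2)[of "N #> x"] N.FactGroup_pow[OF x] by simp
      then have "x [^] (p ^ m) \<in> N" using N.rcos_eq_self_iff x by simp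
      then show ?thesis
        using lin_charsD(2)[OF th] lin_chars_pow[OF subgroup_self th subgroup.one_closed[OF N.subgroup_axioms] x] by metis
    qed
    then show ?thesis by blast
  qed
  have "\<forall>l. \<exists>L. length L = num_cyclic_subgroups (G Mod N) (p ^ l) \<and>
    length L * totient (p ^ l) = card (level (carrier G) p l ?U) \<and> (\<forall>\<rho>\<in>set L. cyclo_rep G 1 (p ^ l) \<rho>) \<and>
    (\<forall>g\<in>carrier G. (\<Sum>\<rho>\<leftarrow>L. of_nat 1 * cyc_trace (p ^ l) (mat_trace (\<rho> g))) = (\<Sum>\<theta>\<in>level (carrier G) p l ?U. \<theta> g))"
    using N.linear_blocks[OF fin p comm] by blast
  then obtain L where L: "\<And>l. length (L l) = num_cyclic_subgroups (G Mod N) (p ^ l)"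
    "\<And>l. length (L l) * totient (p ^ l) = card (level (carrier G) p l ?U)"
    "\<And>l \<rho>. \<rho> \<in> set (L l) \<Longrightarrow> cyclo_rep G 1 (p ^ l) \<rho>"
    "\<And>l g. g \<in> carrier G \<Longrightarrow> (\<Sum>\<rho>\<leftarrow>L l. of_nat 1 * cyc_trace (p ^ l) (mat_trace (\<rho> g))) = (\<Sum>\<theta>\<in>level (carrier G) p l ?U. \<theta> g)"
    by metis
  have "(\<Sum>l\<leftarrow>[0..<m + 1]. length (L l) * totient (p ^ l)) = (\<Sum>l\<leftarrow>[0..<m + 1]. \<Sum>\<theta>\<in>level (carrier G) p l ?U. 1)"
    by (simp only: L(2) card_eq_sum)
  also have "\<dots> = card ?U" by (simp only: sum_over_levels[OF finU] all card_eq_sum)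
  also have "\<dots> = card (rcosets N)" by (rule N.sum_over_lin_chars_quotient(2)[OF fin comm one_closed])
  finally have dim: "(\<Sum>l\<leftarrow>[0..<m + 1]. length (L l) * totient (p ^ l)) = card (rcosets N)" .
  have tr: "(\<Sum>l\<leftarrow>[0..<m + 1]. \<Sum>\<rho>\<leftarrow>L l. of_nat 1 * cyc_trace (p ^ l) (mat_trace (\<rho> g)))
       = (if g \<in> N then of_nat (card (rcosets N)) else 0)" if g: "g \<in> carrier G" for g
    unfolding L(4)[OF g] sum_over_levels[OF finU] all by (rule N.sum_over_lin_chars_quotient(1)[OF fin comm g])
  show thesis by (rule that[OF m(1) L(1,3) dim tr])
qed

text \<open>With \<open>1_N\<close> the indicator of \<open>G'\<close> and \<open>delta\<close> that
  of the identity, the linear blocks contribute \<open>|G/G'| 1_N\<close> and the others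
  \<open>k^2 (|Z| delta - |Z/G'| 1_N)\<close>. As \<open>|G| = k^2 |Z|\<close>, the terms in
  \<open>1_N\<close> cancel and the regular character remains; its value at the identity is the
  dimension count.\<close>

theorem class2_decomposition:
  assumes fin: "finite (carrier G)" and p: "Factorial_Ring.prime (p::nat)" and odd: "odd p"
    and card: "card (carrier G) = p ^ e"
    and N: "card (derived G (carrier G)) = p" "derived G (carrier G) \<subseteq> grp_center G"
    and k: "k = p \<or> k = p\<^sup>2" "card (carrier G) = k\<^sup>2 * card (grp_center G)"
  shows "\<exists>m n k. grp_exponent (G Mod derived G (carrier G)) = p ^ m
            \<and> grp_exponent (G\<lparr>carrier := grp_center G\<rparr>) = p ^ n
            \<and> k ^ 2 = card (rcosets\<^bsub>G\<^esub> grp_center G)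
            \<and> QG_iso_blocks G
                (concat (map (\<lambda>l. replicate
                    (num_cyclic_subgroups (G Mod derived G (carrier G)) (p ^ l)) (1, p ^ l)) [0..<m+1])
                 @ concat (map (\<lambda>l. replicate
                    (num_cyclic_subgroups (G\<lparr>carrier := grp_center G\<rparr>) (p ^ l)
                     - num_cyclic_subgroups (G\<lparr>carrier := grp_center G\<rparr> Mod derived G (carrier G)) (p ^ l))
                    (k, p ^ l)) [1..<n+1]))"
proof -
  let ?N = "derived G (carrier G)" and ?Z = "grp_center G"
  let ?K = "G\<lparr>carrier := ?Z\<rparr>"
  have p0: "p > 0" using prime_gt_0_nat[OF p] .
  note Zs = center_subgroup
  have Zc: "x \<otimes> y = y \<otimes> x" if "x \<in> ?Z" "y \<in> ?Z" for x y
    using center_commutes[OF that(1)] subgroup.mem_carrier[OF Zs that(2)] by blast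
  have Ns: "subgroup ?N G" by (rule derived_is_subgroup[OF order_refl])
  have finZ: "finite ?Z" by (rule finite_subset[OF subgroup.subset[OF Zs] fin])
  have Z0: "card ?Z > 0" using finZ subgroup.one_closed[OF Zs] by (auto simp: card_gt_0_iff)
  have lagN: "card (rcosets ?N) * p = card (carrier G)"
    using lagrange[OF Ns] N(1) by (simp add: Coset.order_def)
  have lagZ: "card (rcosets ?Z) * card ?Z = card (carrier G)"
    using lagrange[OF Zs] by (simp add: Coset.order_def)
  then have kZ: "k\<^sup>2 = card (rcosets ?Z)" using k(2) Z0 by simp
  have "p dvd card ?Z" using subgroup_card_dvd[OF Ns Zs N(2)] N(1) by simp
  then obtain z where z: "card ?Z = p * z" by blast
  have cN: "card (rcosets ?N) = k\<^sup>2 * z"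
    using lagN k(2) z p0 by simp
  obtain m L1 where L1: "grp_exponent (G Mod ?N) = p ^ m"
    "\<And>l. length (L1 l) = num_cyclic_subgroups (G Mod ?N) (p ^ l)"
    "\<And>l \<rho>. \<rho> \<in> set (L1 l) \<Longrightarrow> cyclo_rep G 1 (p ^ l) \<rho>"
    "(\<Sum>l\<leftarrow>[0..<m + 1]. length (L1 l) * totient (p ^ l)) = card (rcosets ?N)"
    "\<And>g. g \<in> carrier G \<Longrightarrow> (\<Sum>l\<leftarrow>[0..<m + 1]. \<Sum>\<rho>\<leftarrow>L1 l. of_nat 1 * cyc_trace (p ^ l) (mat_trace (\<rho> g)))
       = (if g \<in> ?N then of_nat (card (rcosets ?N)) else 0)"
    by (rule linear_blocks_derived[OF fin p card]) (assumption | rule that)+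
  interpret K: comm_group ?K by (rule comm_group_subgroup[OF Zs Zc])
  have NK: "subgroup ?N ?K" by (rule subgroup_incl[OF Ns Zs N(2)])
  interpret NK: normal ?N ?K by (rule K.subgroup_imp_normal[OF NK])
  have "card ?Z dvd p ^ e" using lagZ card by (metis dvd_triv_right)
  then obtain e' where "card ?Z = p ^ e'" using divides_primepow_nat[OF p] by blast
  then obtain n where n: "grp_exponent ?K = p ^ n" "\<And>x. x \<in> ?Z \<Longrightarrow> x [^]\<^bsub>?K\<^esub> (p ^ n) = \<one>"
    using K.grp_exponent_prime_power[OF p, of e'] by auto
  define U where "U = lin_chars G ?Z {\<one>} - lin_chars G ?Z ?N"
  have fin1: "finite (lin_chars G ?Z {\<one>})" by (rule finite_lin_chars[OF fin Zs]) simp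
  then have finU: "finite U" by (simp add: U_def)
  have sub: "lin_chars G ?Z ?N \<subseteq> lin_chars G ?Z {\<one>}"
    by (rule lin_chars_mono) (use subgroup.one_closed[OF Ns] in simp)
  have finN: "finite (lin_chars G ?Z ?N)" by (rule finite_subset[OF sub fin1])
  have all: "{\<theta> \<in> U. \<forall>x\<in>?Z. \<theta> x ^ (p ^ n) = 1} = U"
  proof -
    have "\<theta> x ^ (p ^ n) = 1" if th: "\<theta> \<in> U" and x: "x \<in> ?Z" for \<theta> x
    proof -
      have t: "\<theta> \<in> lin_chars G ?Z {\<one>}" using th by (simp add: U_def)
      have "x [^] (p ^ n) = \<one>" using n(2)[OF x] by (simp add: nat_pow_consistent[symmetric])
      then show ?thesis using lin_chars_pow[OF Zs t _ x, of "p ^ n"] lin_charsD(2)[OF t, of \<one>] by simp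
    qed
    then show ?thesis by blast
  qed
  \<comment> \<open>A character nontrivial on \<open>G'\<close> is not trivial, so nothing sits at
    level 0 and the second list of blocks starts at 1.\<close>
  have level0: "level ?Z p 0 U = {}"
    by (auto simp: level_def U_def lin_chars_def dest: subsetD[OF N(2)])
  have upt: "[0..<n + 1] = 0 # [1..<n + 1]" by (simp add: upt_conv_Cons)
  have sumU: "(\<Sum>l\<leftarrow>[1..<n + 1]. sum F (level ?Z p l U)) = sum F U" for F :: "('a \<Rightarrow> complex) \<Rightarrow> 'c :: comm_monoid_add"
  proof -
    have "(\<Sum>l\<leftarrow>[0..<n + 1]. sum F (level ?Z p l U)) = sum F U"
      by (simp only: sum_over_levels[OF finU] all)
    then show ?thesis unfolding upt by (simp add: level0)
  qed
  have "\<forall>l. \<exists>L. l > 0 \<longrightarrow> length L * totient (p ^ l) = card (level ?Z p l U) \<and> (\<forall>\<rho>\<in>set L. cyclo_rep G k (p ^ l) \<rho>) \<and>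
    (\<forall>g\<in>carrier G. (\<Sum>\<rho>\<leftarrow>L. of_nat k * cyc_trace (p ^ l) (mat_trace (\<rho> g))) = of_nat (k\<^sup>2) * (\<Sum>\<theta>\<in>level ?Z p l U. \<theta> g))"
    using class2_nonlinear_blocks[OF fin p odd _ Ns N(1,2) commutator_in_derived k] unfolding U_def by blast
  then obtain L2 where L2: "\<And>l. l > 0 \<Longrightarrow> length (L2 l) * totient (p ^ l) = card (level ?Z p l U)"
    "\<And>l \<rho>. l > 0 \<Longrightarrow> \<rho> \<in> set (L2 l) \<Longrightarrow> cyclo_rep G k (p ^ l) \<rho>"
    "\<And>l g. l > 0 \<Longrightarrow> g \<in> carrier G \<Longrightarrow> (\<Sum>\<rho>\<leftarrow>L2 l. of_nat k * cyc_trace (p ^ l) (mat_trace (\<rho> g))) = of_nat (k\<^sup>2) * (\<Sum>\<theta>\<in>level ?Z p l U. \<theta> g)"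
    by metis
  have len2: "length (L2 l) = num_cyclic_subgroups ?K (p ^ l) - num_cyclic_subgroups (?K Mod ?N) (p ^ l)" if l: "l > 0" for l
  proof -
    have e: "lin_chars ?K ?Z W = lin_chars G ?Z W" for W by (rule lin_chars_subgroup_eq)
    have 1: "card (level ?Z p l (lin_chars G ?Z {\<one>})) = num_cyclic_subgroups ?K (p ^ l) * totient (p ^ l)"
    proof (rule card_level_lin_chars_of_torsion[OF fin1 p K.is_group])
      show "finite (carrier ?K)" using finZ by simp
      show "card {\<theta> \<in> lin_chars G ?Z {\<one>}. \<forall>x\<in>?Z. \<theta> x ^ d = 1} = card {x \<in> carrier ?K. x [^]\<^bsub>?K\<^esub> d = \<one>\<^bsub>?K\<^esub>}" for d :: nat
        using K.card_lin_chars_exponent[of d] finZ by (simp add: e)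
    qed
    have 2: "card (level ?Z p l (lin_chars G ?Z ?N)) = num_cyclic_subgroups (?K Mod ?N) (p ^ l) * totient (p ^ l)"
    proof (rule card_level_lin_chars_of_torsion[OF finN p NK.factorgroup_is_group NK.finite_FactGroup])
      show "finite (carrier ?K)" using finZ by simp
      show "card {\<theta> \<in> lin_chars G ?Z ?N. \<forall>x\<in>?Z. \<theta> x ^ d = 1} = card {x \<in> carrier (?K Mod ?N). x [^]\<^bsub>?K Mod ?N\<^esub> d = \<one>\<^bsub>?K Mod ?N\<^esub>}" for d :: nat
        using NK.card_lin_chars_quotient_exponent[OF _ K.abelian_FactGroup[OF NK], of d] finZ by (simp add: e)
    qed
    \<comment> \<open>Exact order depends on the character alone, so the levels of \<open>U\<close>
      are differences of levels and the counts of cyclic subgroups of \<open>Z\<close> and of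
      \<open>Z/G'\<close> subtract; inclusion of the levels makes the subtraction of natural numbers
      exact.\<close>
    have "level ?Z p l U = level ?Z p l (lin_chars G ?Z {\<one>}) - level ?Z p l (lin_chars G ?Z ?N)"
      by (auto simp: level_def U_def)
    moreover have "level ?Z p l (lin_chars G ?Z ?N) \<subseteq> level ?Z p l (lin_chars G ?Z {\<one>})"
      using sub by (auto simp: level_def)
    moreover have "finite (level ?Z p l (lin_chars G ?Z ?N))" using finN by (simp add: level_def)
    ultimately have "card (level ?Z p l U) = card (level ?Z p l (lin_chars G ?Z {\<one>})) - card (level ?Z p l (lin_chars G ?Z ?N))"
      by (simp add: card_Diff_subset)
    then have "length (L2 l) * totient (p ^ l) = (num_cyclic_subgroups ?K (p ^ l) - num_cyclic_subgroups (?K Mod ?N) (p ^ l)) * totient (p ^ l)"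
      using L2(1)[OF l] 1 2 by (simp add: diff_mult_distrib)
    then show ?thesis using p0 by simp
  qed
  let ?xs = "tag_blocks 1 p L1 [0..<m + 1] @ tag_blocks k p L2 [1..<n + 1]"
  have types: "map (\<lambda>(k, m, \<rho>). (k, m)) ?xs = concat (map (\<lambda>l. replicate
                    (num_cyclic_subgroups (G Mod ?N) (p ^ l)) (1, p ^ l)) [0..<m+1])
                 @ concat (map (\<lambda>l. replicate (num_cyclic_subgroups ?K (p ^ l) - num_cyclic_subgroups (?K Mod ?N) (p ^ l))
                    (k, p ^ l)) [1..<n+1])"
    unfolding map_append tag_blocks_types L1(2)
    by (intro arg_cong2[of _ _ _ _ "(@)"] refl arg_cong[of _ _ concat] map_cong) (use len2 in auto)
  have "QG_iso_blocks G (map (\<lambda>(k, m, \<rho>). (k, m)) ?xs)"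
  proof (rule QG_iso_blocksI[OF fin p])
    fix k' m' \<rho> assume "(k', m', \<rho>) \<in> set ?xs"
    then show "(\<exists>l. m' = p ^ l) \<and> cyclo_rep G k' m' \<rho>"
      using L1(3) L2(2) by (auto simp: set_tag_blocks)
  next
    have "(\<Sum>l\<leftarrow>[1..<n + 1]. length (L2 l) * totient (p ^ l)) = (\<Sum>l\<leftarrow>[1..<n + 1]. \<Sum>\<theta>\<in>level ?Z p l U. 1)"
      by (intro arg_cong[of _ _ sum_list] map_cong refl) (use L2(1) in auto)
    also have "\<dots> = card U" by (simp only: sumU card_eq_sum)
    also have "\<dots> = card ?Z - card ?Z div p"
      unfolding U_def using sum_over_nontrivial_chars(2)[OF fin Zs Zc Ns N(2)] N(1) by simp
    finally have d2: "(\<Sum>l\<leftarrow>[1..<n + 1]. length (L2 l) * totient (p ^ l)) = p * z - z" using z p0 by simp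
    have "z \<le> p * z" using p0 by simp
    then have "k\<^sup>2 * z + k\<^sup>2 * (p * z - z) = k\<^sup>2 * (p * z)" by (simp add: distrib_left[symmetric] del: distrib_left)
    then show "(\<Sum>(k, m, \<rho>)\<leftarrow>?xs. k\<^sup>2 * totient m) = card (carrier G)"
      unfolding map_append sum_list_append tag_blocks_dim d2 L1(4) cN using k(2) z by simp
  next
    fix g assume g: "g \<in> carrier G"
    have "(\<Sum>l\<leftarrow>[1..<n + 1]. \<Sum>\<rho>\<leftarrow>L2 l. of_nat k * cyc_trace (p ^ l) (mat_trace (\<rho> g)))
      = (\<Sum>l\<leftarrow>[1..<n + 1]. of_nat (k\<^sup>2) * (\<Sum>\<theta>\<in>level ?Z p l U. \<theta> g))"
      by (intro arg_cong[of _ _ sum_list] map_cong refl) (use L2(3)[OF _ g] in auto)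
    also have "\<dots> = of_nat (k\<^sup>2) * (\<Sum>\<theta>\<in>U. \<theta> g)" by (simp only: sum_list_const_mult sumU)
    also have "(\<Sum>\<theta>\<in>U. \<theta> g) = (if g = \<one> then of_nat (p * z) else 0) - (if g \<in> ?N then of_nat z else 0)"
      unfolding U_def using sum_over_nontrivial_chars(1)[OF fin Zs Zc Ns N(2)] N(1) z p0 by simp
    finally have t2: "(\<Sum>l\<leftarrow>[1..<n + 1]. \<Sum>\<rho>\<leftarrow>L2 l. of_nat k * cyc_trace (p ^ l) (mat_trace (\<rho> g)))
      = of_nat (k\<^sup>2) * ((if g = \<one> then of_nat (p * z) else 0) - (if g \<in> ?N then of_nat z else 0))" .
    show "(\<Sum>(k, m, \<rho>)\<leftarrow>?xs. of_nat k * cyc_trace m (mat_trace (\<rho> g))) = (if g = \<one> then of_nat (card (carrier G)) else 0)"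
      unfolding map_append sum_list_append tag_blocks_sum prod.case L1(5)[OF g] t2 cN
      using k(2) z by (simp add: algebra_simps)
  qed
  then show ?thesis unfolding types using L1(1) n(1) kZ by blast
qed

end

section \<open>Groups of class three\<close>

context group
begin

lemma subgroup_jump:
  assumes fin: "finite (carrier G)" and T: "subgroup T G" and K: "subgroup K G" and S: "subgroup S G"
    and sub: "T \<subseteq> K" "K \<subseteq> S" "T \<noteq> K" and p: "Factorial_Ring.prime (p::nat)" and card: "card S = p * card T"
  shows "K = S"
proof -
  have fS: "finite S" by (rule finite_subset[OF subgroup.subset[OF S] fin])
  have fK: "finite K" by (rule finite_subset[OF sub(2) fS])
  have T0: "card T > 0" using finite_subset[OF sub(1) fK] subgroup.one_closed[OF T] by (auto simp: card_gt_0_iff)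
  obtain j where j: "card K = card T * j" using subgroup_card_dvd[OF T K sub(1)] by blast
  have "card T * j dvd card T * p" using subgroup_card_dvd[OF K S sub(2)] j card by (simp add: mult.commute)
  then have "j dvd p" using T0 by simp
  moreover have "card T < card K" using sub fK by (intro psubset_card_mono) auto
  then have "j \<noteq> 1" using j by auto
  ultimately have "j = p" using p unfolding prime_nat_iff by blast
  then have "card K = card S" using j card by (simp add: mult.commute)
  then show ?thesis by (rule card_subset_eq[OF fS sub(2)])
qed

text \<open>An element \<open>a\<close> outside \<open>T\<close> has a centralizer in
  \<open>S\<close> that contains \<open>T\<close> and \<open>a\<close>; there is no room between
  \<open>T\<close> and \<open>S\<close>, so \<open>a\<close> centralises all of
  \<open>S\<close>.\<close>

lemma commutative_if_central_prime_index:
  assumes fin: "finite (carrier G)" and T: "subgroup T G" and S: "subgroup S G" and sub: "T \<subseteq> S"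
    and p: "Factorial_Ring.prime (p::nat)" and card: "card S = p * card T"
    and comm: "\<And>t s. t \<in> T \<Longrightarrow> s \<in> S \<Longrightarrow> t \<otimes> s = s \<otimes> t" and ab: "a \<in> S" "b \<in> S"
  shows "a \<otimes> b = b \<otimes> a"
proof (cases "a \<in> T")
  case True
  then show ?thesis using comm ab(2) by blast
next
  case False
  have ac: "a \<in> carrier G" by (rule subgroup.mem_carrier[OF S ab(1)])
  have C: "subgroup (centralizer a \<inter> S) G"
    by (rule subgroups_Inter_pair[OF centralizer_subgroup[OF fin ac] S])
  have "T \<subseteq> centralizer a \<inter> S"
    using comm[OF _ ab(1)] sub subgroup.mem_carrier[OF T] by (auto simp: centralizer_def)
  moreover have "a \<in> centralizer a \<inter> S" using ac ab(1) by (simp add: centralizer_def)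
  then have "T \<noteq> centralizer a \<inter> S" using False by blast
  ultimately have "centralizer a \<inter> S = S"
    using subgroup_jump[OF fin T C S _ _ _ p card] by blast
  then have "b \<in> centralizer a" using ab(2) by blast
  then show ?thesis by (simp add: centralizer_def)
qed

lemma commutator_swap:
  assumes "x \<in> carrier G" "y \<in> carrier G"
  shows "y \<otimes> x \<otimes> inv y \<otimes> inv x = inv (x \<otimes> y \<otimes> inv x \<otimes> inv y)"
  using assms by (simp add: inv_mult_group m_assoc)

lemma commutator_mult_left:
  assumes g: "g \<in> carrier G" and h: "h \<in> carrier G" and y: "y \<in> carrier G"
    and c: "h \<otimes> y \<otimes> inv h \<otimes> inv y \<in> grp_center G"
  shows "g \<otimes> h \<otimes> y \<otimes> inv (g \<otimes> h) \<otimes> inv y = (g \<otimes> y \<otimes> inv g \<otimes> inv y) \<otimes> (h \<otimes> y \<otimes> inv h \<otimes> inv y)"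
proof -
  let ?c = "h \<otimes> y \<otimes> inv h \<otimes> inv y"
  have cc: "?c \<in> carrier G" using h y by simp
  have "inv y \<otimes> (y \<otimes> (inv g \<otimes> inv y)) = inv g \<otimes> inv y" using g y by (simp add: m_assoc[symmetric])
  then have "g \<otimes> h \<otimes> y \<otimes> inv (g \<otimes> h) \<otimes> inv y = g \<otimes> ?c \<otimes> (y \<otimes> inv g \<otimes> inv y)"
    using g h y by (simp add: inv_mult_group m_assoc)
  also have "g \<otimes> ?c = ?c \<otimes> g" using center_commutes[OF c g] by simp
  also have "?c \<otimes> g \<otimes> (y \<otimes> inv g \<otimes> inv y) = ?c \<otimes> (g \<otimes> y \<otimes> inv g \<otimes> inv y)"
    using g y cc by (simp only: m_assoc m_closed inv_closed)
  also have "\<dots> = (g \<otimes> y \<otimes> inv g \<otimes> inv y) \<otimes> ?c" by (rule center_commutes[OF c]) (use g y in simp)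
  finally show ?thesis .
qed

text \<open>If all commutators with \<open>y\<close> are central, then \<open>g \<mapsto> [g, y]\<close> is a homomorphism into an abelian
  group, hence trivial on commutators.\<close>

lemma commutes_with_derived_of_central_commutators:
  assumes fin: "finite (carrier G)" and y: "y \<in> carrier G"
    and c: "\<And>g. g \<in> carrier G \<Longrightarrow> g \<otimes> y \<otimes> inv g \<otimes> inv y \<in> grp_center G"
    and n: "n \<in> derived G (carrier G)"
  shows "n \<otimes> y = y \<otimes> n"
proof -
  define \<beta> where "\<beta> = (\<lambda>g. g \<otimes> y \<otimes> inv g \<otimes> inv y)"
  have bc: "\<beta> g \<in> carrier G" if "g \<in> carrier G" for g using that y by (simp add: \<beta>_def)
  have by': "g \<otimes> y = \<beta> g \<otimes> (y \<otimes> g)" if g: "g \<in> carrier G" for g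
  proof -
    have "inv y \<otimes> (y \<otimes> g) = g" using g y by (simp add: m_assoc[symmetric])
    then show ?thesis using g y by (simp add: \<beta>_def m_assoc)
  qed
  have hom: "\<beta> (g \<otimes> h) = \<beta> g \<otimes> \<beta> h" if "g \<in> carrier G" "h \<in> carrier G" for g h
    unfolding \<beta>_def by (rule commutator_mult_left[OF that y c[OF that(2)]])
  have comm: "\<beta> g \<otimes> \<beta> h = \<beta> h \<otimes> \<beta> g" if "g \<in> carrier G" "h \<in> carrier G" for g h
    using center_commutes[OF c[OF that(1)] bc[OF that(2)]] by (simp add: \<beta>_def)
  have C: "subgroup (centralizer y) G" by (rule centralizer_subgroup[OF fin y])
  have "derived G (carrier G) \<subseteq> centralizer y"
    unfolding derived_def
  proof (rule generate_subgroup_incl[OF _ C], clarify)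
    fix a b assume a: "a \<in> carrier G" and b: "b \<in> carrier G"
    have one: "\<beta> \<one> = \<one>" using y by (simp add: \<beta>_def)
    have i: "\<beta> (inv g) = inv (\<beta> g)" if "g \<in> carrier G" for g
      using hom[of "inv g" g] that one bc[of g] bc[of "inv g"] inv_equality by simp
    have "\<beta> (a \<otimes> b \<otimes> inv a \<otimes> inv b) = \<beta> a \<otimes> \<beta> b \<otimes> inv (\<beta> a) \<otimes> inv (\<beta> b)"
      using a b by (simp add: hom i)
    also have "\<dots> = \<beta> b \<otimes> \<beta> a \<otimes> inv (\<beta> a) \<otimes> inv (\<beta> b)" using comm[OF a b] by simp
    also have "\<dots> = \<one>" using bc[OF a] bc[OF b] by (simp add: m_assoc)
    finally have "\<beta> (a \<otimes> b \<otimes> inv a \<otimes> inv b) = \<one>" .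
    then show "a \<otimes> b \<otimes> inv a \<otimes> inv b \<in> centralizer y"
      using by'[of "a \<otimes> b \<otimes> inv a \<otimes> inv b"] a b y by (simp add: centralizer_def)
  qed
  then show ?thesis using n by (auto simp: centralizer_def)
qed

section \<open>Quotients by central subgroups and the second centre\<close>

lemma central_subgroup_normal:
  assumes P: "subgroup P G" "P \<subseteq> grp_center G"
  shows "P \<lhd> G"
  unfolding normal_inv_iff
proof (intro conjI ballI P(1))
  fix x h assume x: "x \<in> carrier G" and h: "h \<in> P"
  have hc: "h \<in> carrier G" by (rule subgroup.mem_carrier[OF P(1) h])
  have "x \<otimes> h \<otimes> inv x = h \<otimes> x \<otimes> inv x" using center_commutes[OF subsetD[OF P(2) h] x] by simp
  also have "\<dots> = h" using x hc by (simp add: m_assoc)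
  finally show "x \<otimes> h \<otimes> inv x \<in> P" using h by simp
qed

lemma center_normal: "grp_center G \<lhd> G"
  by (rule central_subgroup_normal[OF center_subgroup order_refl])

text \<open>The preimage in \<open>G\<close> of the centre of \<open>G/Z(G)\<close>, written with
  commutators so that calculations stay in \<open>G\<close>.\<close>

definition second_center :: "'a set" where
  "second_center = {y \<in> carrier G. \<forall>g\<in>carrier G. g \<otimes> y \<otimes> inv g \<otimes> inv y \<in> grp_center G}"

lemma coset_in_center_iff:
  assumes N: "N \<lhd> G" and y: "y \<in> carrier G"
  shows "N #> y \<in> grp_center (G Mod N) \<longleftrightarrow> (\<forall>g\<in>carrier G. g \<otimes> y \<otimes> inv g \<otimes> inv y \<in> N)"
proof -
  interpret N: normal N G by (rule N)
  have "(N #> y) \<otimes>\<^bsub>G Mod N\<^esub> (N #> g) = (N #> g) \<otimes>\<^bsub>G Mod N\<^esub> (N #> y) \<longleftrightarrow> g \<otimes> y \<otimes> inv g \<otimes> inv y \<in> N" if g: "g \<in> carrier G" for g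
  proof -
    have "(N #> y) \<otimes>\<^bsub>G Mod N\<^esub> (N #> g) = (N #> g) \<otimes>\<^bsub>G Mod N\<^esub> (N #> y) \<longleftrightarrow> N #> (g \<otimes> y) = N #> (y \<otimes> g)"
      using N.rcos_mult[OF y g] N.rcos_mult[OF g y] by auto
    also have "\<dots> \<longleftrightarrow> g \<otimes> y \<otimes> inv (y \<otimes> g) \<in> N" using N.rcos_eq_iff[of "g \<otimes> y" "y \<otimes> g"] y g by simp
    also have "g \<otimes> y \<otimes> inv (y \<otimes> g) = g \<otimes> y \<otimes> inv g \<otimes> inv y" using y g by (simp add: inv_mult_group m_assoc)
    finally show ?thesis .
  qed
  moreover have "N #> y \<in> carrier (G Mod N)" using y by (auto simp: carrier_FactGroup)
  ultimately show ?thesis by (auto simp: grp_center_def carrier_FactGroup)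
qed

lemma preimage_subgroup:
  assumes fin: "finite (carrier G)" and N: "N \<lhd> G" and T: "subgroup T (G Mod N)"
  shows "subgroup {x \<in> carrier G. N #> x \<in> T} G" and "card {x \<in> carrier G. N #> x \<in> T} = card T * card N"
proof -
  interpret N: normal N G by (rule N)
  let ?S = "{x \<in> carrier G. N #> x \<in> T}"
  show S: "subgroup ?S G"
  proof (rule finite_subgroupI[OF fin])
    show "\<one> \<in> ?S" using subgroup.one_closed[OF T] N.subset by simp
    fix a b assume "a \<in> ?S" "b \<in> ?S"
    then show "a \<otimes> b \<in> ?S" using subgroup.m_closed[OF T, of "N #> a" "N #> b"] N.rcos_mult[of a b] by simp
  qed auto
  interpret S: group "G\<lparr>carrier := ?S\<rparr>" by (rule subgroup.subgroup_is_group[OF S is_group])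
  have NS: "N \<subseteq> ?S"
  proof
    fix x assume x: "x \<in> N"
    then have xc: "x \<in> carrier G" using N.subset by blast
    then have "N #> x = N" using N.rcos_eq_self_iff x by simp
    then show "x \<in> ?S" using subgroup.one_closed[OF T] xc by simp
  qed
  have "card (carrier (G\<lparr>carrier := ?S\<rparr>)) = card ((\<lambda>x. N #> x) ` carrier (G\<lparr>carrier := ?S\<rparr>)) * card N"
  proof (rule S.card_fibres)
    show "finite (carrier (G\<lparr>carrier := ?S\<rparr>))" using fin by simp
    show "subgroup N (G\<lparr>carrier := ?S\<rparr>)" by (rule subgroup_incl[OF N.subgroup_axioms S NS])
    fix x y assume "x \<in> carrier (G\<lparr>carrier := ?S\<rparr>)" "y \<in> carrier (G\<lparr>carrier := ?S\<rparr>)"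
    then have xy: "x \<in> ?S" "y \<in> ?S" by simp_all
    then show "N #> x = N #> y \<longleftrightarrow> x \<otimes>\<^bsub>G\<lparr>carrier := ?S\<rparr>\<^esub> inv\<^bsub>G\<lparr>carrier := ?S\<rparr>\<^esub> y \<in> N"
      using N.rcos_eq_iff[of x y] m_inv_consistent[OF S xy(2)] by simp
  qed
  moreover have "(\<lambda>x. N #> x) ` ?S = T"
    using subgroup.subset[OF T] by (auto simp: carrier_FactGroup)
  ultimately show "card ?S = card T * card N" by simp
qed

lemma second_center_commutators:
  assumes "y \<in> second_center" "g \<in> carrier G"
  shows "g \<otimes> y \<otimes> inv g \<otimes> inv y \<in> grp_center G" "y \<otimes> g \<otimes> inv y \<otimes> inv g \<in> grp_center G"
proof -
  have y: "y \<in> carrier G" using assms(1) by (simp add: second_center_def)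
  show c: "g \<otimes> y \<otimes> inv g \<otimes> inv y \<in> grp_center G" using assms by (simp add: second_center_def)
  show "y \<otimes> g \<otimes> inv y \<otimes> inv g \<in> grp_center G"
    unfolding commutator_swap[OF assms(2) y] by (rule subgroup.m_inv_closed[OF center_subgroup c])
qed

lemma second_center_pow:
  assumes Z: "card (grp_center G) = p" and y: "y \<in> second_center"
  shows "y [^] p \<in> grp_center G"
proof -
  have yc: "y \<in> carrier G" using y by (simp add: second_center_def)
  have "y [^] p \<otimes> g = g \<otimes> y [^] p" if g: "g \<in> carrier G" for g
    by (rule pow_commutes_of_commutator[OF yc g second_center_commutators(2)[OF y g]
          subgroup_prime_pow_eq_one[OF center_subgroup Z second_center_commutators(2)[OF y g]]])
  then show ?thesis using yc by (simp add: grp_center_def)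
qed

text \<open>\<open>commutes_with_derived_of_central_commutators\<close> puts \<open>G'\<close> into
  the centre of the second centre, and it has prime index there.\<close>

lemma second_center_commutative:
  assumes fin: "finite (carrier G)" and p: "Factorial_Ring.prime (p::nat)"
    and N: "derived G (carrier G) \<subseteq> second_center" "card second_center = p * card (derived G (carrier G))"
    and Y: "subgroup second_center G" and ab: "a \<in> second_center" "b \<in> second_center"
  shows "a \<otimes> b = b \<otimes> a"
proof (rule commutative_if_central_prime_index[OF fin derived_is_subgroup[OF order_refl] Y N(1) p N(2) _ ab])
  fix n y assume n: "n \<in> derived G (carrier G)" and y: "y \<in> second_center"
  have yc: "y \<in> carrier G" using y by (simp add: second_center_def)
  show "n \<otimes> y = y \<otimes> n"
    by (rule commutes_with_derived_of_central_commutators[OF fin yc second_center_commutators(1)[OF y] n])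
qed

text \<open>Suppose the common centralizer \<open>?C\<close> of the second centre is strictly larger
  than it. It is not all of \<open>G\<close>, so it has order \<open>p^4\<close>. For
  \<open>t\<close> outside \<open>?C\<close>, an element of the second centre that commutes with
  \<open>t\<close> is centralised by \<open>?C\<close> and \<open>t\<close>, hence by
  \<open>G\<close>; so at most \<open>p\<close> of them commute with \<open>t\<close>, and orbit
  counting bounds the second centre by \<open>p^2\<close>, against its order
  \<open>p^3\<close>.\<close>

lemma second_center_self_centralizing:
  assumes fin: "finite (carrier G)" and p: "Factorial_Ring.prime (p::nat)"
    and card: "card (carrier G) = p ^ 5" and Z: "card (grp_center G) = p"
    and Y: "subgroup second_center G" "card second_center = p ^ 3"
    and ab: "\<And>a b. a \<in> second_center \<Longrightarrow> b \<in> second_center \<Longrightarrow> a \<otimes> b = b \<otimes> a"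
    and g: "g \<in> carrier G" "\<And>y. y \<in> second_center \<Longrightarrow> g \<otimes> y = y \<otimes> g"
  shows "g \<in> second_center"
proof (rule ccontr)
  assume gY: "g \<notin> second_center"
  have p1: "p > 1" using prime_gt_1_nat[OF p] .
  let ?Y = second_center and ?Z = "grp_center G"
  let ?C = "\<Inter>y\<in>?Y. centralizer y"
  have Yc: "y \<in> carrier G" if "y \<in> ?Y" for y using that by (simp add: second_center_def)
  have finZ: "finite ?Z" by (rule finite_subset[OF subgroup.subset[OF center_subgroup] fin])
  have C: "subgroup ?C G"
    by (rule subgroups_Inter) (use centralizer_subgroup[OF fin Yc] subgroup.one_closed[OF Y(1)] in auto)
  have Ccar: "?C \<subseteq> carrier G" by (rule subgroup.subset[OF C])
  have YC: "?Y \<subseteq> ?C" using ab Yc by (auto simp: centralizer_def)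
  have gC: "g \<in> ?C" using g by (simp add: centralizer_def)
  have Cne: "?C \<noteq> carrier G"
  proof
    assume eq: "?C = carrier G"
    have "?Y \<subseteq> ?Z"
    proof
      fix y assume y: "y \<in> ?Y"
      have "y \<otimes> h = h \<otimes> y" if "h \<in> carrier G" for h
      proof -
        have "h \<in> ?C" using that eq by simp
        then have "h \<in> centralizer y" using y by blast
        then show ?thesis by (simp add: centralizer_def)
      qed
      then show "y \<in> ?Z" using Yc[OF y] by (simp add: grp_center_def)
    qed
    then have "p ^ 3 \<le> p" using card_mono[OF finZ] Y(2) Z by metis
    moreover have "p ^ 1 < p ^ 3" using p1 by (intro power_strict_increasing) simp_all
    ultimately show False by simp
  qed
  obtain e where e: "e \<le> 5" "card ?C = p ^ e"
    using subgroup_card_dvd[OF C subgroup_self Ccar] card divides_primepow_nat[OF p] by metis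
  have "?Y \<subset> ?C" using YC gC gY by blast
  then have "card ?Y < card ?C" using finite_subset[OF Ccar fin] by (rule psubset_card_mono[rotated])
  then have "p ^ 3 < p ^ e" using Y(2) e(2) by simp
  then have "3 < e" using p1 by simp
  have "card ?C \<noteq> p ^ 5" using Cne card card_subset_eq[OF fin Ccar] by metis
  then have "e \<noteq> 5" using e(2) by auto
  then have "e = 4" using e(1) \<open>3 < e\<close> by linarith
  then have cC: "card (carrier G) = p * card ?C" using e(2) card by (simp add: eval_nat_numeral)
  obtain t where t: "t \<in> carrier G" "t \<notin> ?C" using Cne Ccar by blast
  have "card ?Y \<le> card ?Z * card (centralizer t \<inter> ?Y)"
    by (rule card_centralizer_in_subgroup_bound[OF fin t(1) Y(1) subgroup.subset[OF center_subgroup] second_center_commutators(2)[OF _ t(1)]])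
  moreover have "centralizer t \<inter> ?Y \<subseteq> ?Z"
  proof
    fix u assume u: "u \<in> centralizer t \<inter> ?Y"
    then have uc: "u \<in> carrier G" using Yc by simp
    have Cu: "subgroup (centralizer u) G" by (rule centralizer_subgroup[OF fin uc])
    have "?C \<subseteq> centralizer u" using u by blast
    moreover have "t \<in> centralizer u" using u t(1) by (simp add: centralizer_def)
    then have "?C \<noteq> centralizer u" using t(2) by blast
    ultimately have cu: "centralizer u = carrier G"
      by (intro subgroup_jump[OF fin C Cu subgroup_self _ subgroup.subset[OF Cu] _ p cC])
    have "u \<otimes> h = h \<otimes> u" if "h \<in> carrier G" for h
    proof -
      have "h \<in> centralizer u" using that cu by simp
      then show ?thesis by (simp add: centralizer_def)
    qed
    then show "u \<in> ?Z" using uc by (simp add: grp_center_def)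
  qed
  then have "card (centralizer t \<inter> ?Y) \<le> p" using card_mono[OF finZ] Z by metis
  ultimately have "p ^ 3 \<le> p * p" using Y(2) Z by (metis mult_le_mono2 order_trans)
  then show False using p1 by (simp add: eval_nat_numeral)
qed

text \<open>The commutators of \<open>G\<close> do not all lie in the centre, so
  \<open>lin_chars_extend_same_field\<close> is applied in a subgroup of class two instead: the
  centralizer \<open>?H\<close> of an element \<open>y\<close> of order \<open>p\<close> in the
  second centre but outside \<open>Z\<close>. An extension to \<open>W\<close>, generated by
  \<open>Z\<close> and \<open>y\<close> and central in \<open>?H\<close>, followed by one step
  inside \<open>?H\<close>, gives \<open>A\<close> of order \<open>p^3\<close>.\<close>

lemma class3_extension:
  assumes fin: "finite (carrier G)" and p: "Factorial_Ring.prime (p::nat)" and odd: "odd p" and l: "l > 0"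
    and card: "card (carrier G) = p ^ 5" and Z: "card (grp_center G) = p"
    and N: "card (derived G (carrier G)) = p\<^sup>2" "grp_center G \<subseteq> derived G (carrier G)"
      "derived G (carrier G) \<subseteq> second_center"
    and Y: "subgroup second_center G" "card second_center = p ^ 3"
    and th: "\<theta> \<in> lin_chars G (grp_center G) {\<one>}" and root: "\<And>z. z \<in> grp_center G \<Longrightarrow> \<theta> z ^ (p ^ l) = 1"
  shows "\<exists>A \<mu>. subgroup A G \<and> grp_center G \<subseteq> A \<and> p\<^sup>2 * card A = card (carrier G) \<and> \<mu> \<in> lin_chars G A {\<one>} \<and>
        (\<forall>z\<in>grp_center G. \<mu> z = \<theta> z) \<and> (\<forall>a\<in>A. \<mu> a ^ (p ^ l) = 1)"
proof -
  let ?Z = "grp_center G" and ?N = "derived G (carrier G)" and ?Y = second_center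
  note Zs = center_subgroup
  have p1: "p > 1" using prime_gt_1_nat[OF p] .
  have Ycar: "y \<in> carrier G" if "y \<in> ?Y" for y using that by (simp add: second_center_def)
  note Yc = second_center_commutators(1) and Yc' = second_center_commutators(2)
  have Zp: "z [^] p = \<one>" if "z \<in> ?Z" for z by (rule subgroup_prime_pow_eq_one[OF Zs Z that])
  have ZY: "?Z \<subseteq> ?Y" using N(2,3) by blast
  have cYN: "card ?Y = p * card ?N" using Y(2) N(1) by (simp add: eval_nat_numeral)
  note Yab = second_center_commutative[OF fin p N(3) cYN Y(1)]
  note Yp = second_center_pow[OF Z]
  have finY: "finite ?Y" by (rule finite_subset[OF subgroup.subset[OF Y(1)] fin])
  \<comment> \<open>The \<open>p\<close>-th power map of the abelian second centre has values in
    \<open>Z\<close> of order \<open>p\<close>, so its kernel has at least \<open>p^2\<close>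
    elements and is not contained in \<open>Z\<close>.\<close>
  obtain y where y: "y \<in> ?Y" "y \<notin> ?Z" "y [^] p = \<one>"
  proof -
    interpret Y: comm_group "G\<lparr>carrier := ?Y\<rparr>" by (rule comm_group_subgroup[OF Y(1) Yab])
    have pw: "x [^]\<^bsub>G\<lparr>carrier := ?Y\<rparr>\<^esub> p = x [^] p" for x by (simp add: nat_pow_consistent[symmetric])
    let ?K = "{x \<in> ?Y. x [^] p = \<one>}"
    have K: "subgroup ?K (G\<lparr>carrier := ?Y\<rparr>)"
    proof (rule Y.finite_subgroupI)
      show "finite (carrier (G\<lparr>carrier := ?Y\<rparr>))" using finY by simp
      show "\<one>\<^bsub>G\<lparr>carrier := ?Y\<rparr>\<^esub> \<in> ?K" using subgroup.one_closed[OF Y(1)] by simp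
      fix a b assume "a \<in> ?K" "b \<in> ?K"
      then show "a \<otimes>\<^bsub>G\<lparr>carrier := ?Y\<rparr>\<^esub> b \<in> ?K"
        using subgroup.m_closed[OF Y(1), of a b] pow_mult_distrib[OF Yab[of a b] Ycar Ycar, of p] by simp
    qed auto
    have "card (carrier (G\<lparr>carrier := ?Y\<rparr>)) = card ((\<lambda>x. x [^] p) ` carrier (G\<lparr>carrier := ?Y\<rparr>)) * card ?K"
    proof (rule Y.card_fibres)
      show "finite (carrier (G\<lparr>carrier := ?Y\<rparr>))" using finY by simp
      fix a b assume "a \<in> carrier (G\<lparr>carrier := ?Y\<rparr>)" "b \<in> carrier (G\<lparr>carrier := ?Y\<rparr>)"
      then have ab: "a \<in> ?Y" "b \<in> ?Y" by simp_all
      have ib: "inv b \<in> ?Y" by (rule subgroup.m_inv_closed[OF Y(1) ab(2)])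
      have "(a \<otimes> inv b) [^] p = a [^] p \<otimes> inv (b [^] p)"
        using pow_mult_distrib[OF Yab[OF ab(1) ib] Ycar[OF ab(1)] Ycar[OF ib], of p] Ycar[OF ab(2)] by (simp add: nat_pow_inv)
      moreover have "a [^] p \<otimes> inv (b [^] p) = \<one> \<longleftrightarrow> a [^] p = b [^] p"
        using Ycar[OF ab(1)] Ycar[OF ab(2)] by (metis inv_closed inv_equality inv_inv nat_pow_closed r_inv)
      ultimately show "a [^] p = b [^] p \<longleftrightarrow> a \<otimes>\<^bsub>G\<lparr>carrier := ?Y\<rparr>\<^esub> inv\<^bsub>G\<lparr>carrier := ?Y\<rparr>\<^esub> b \<in> ?K"
        using subgroup.m_closed[OF Y(1) ab(1) ib] m_inv_consistent[OF Y(1) ab(2)] by simp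
    qed (rule K)
    then have "p ^ 3 = card ((\<lambda>x. x [^] p) ` ?Y) * card ?K" using Y(2) by simp
    also have "\<dots> \<le> p * card ?K"
    proof (rule mult_right_mono)
      have "(\<lambda>x. x [^] p) ` ?Y \<subseteq> ?Z" using Yp by blast
      then show "card ((\<lambda>x. x [^] p) ` ?Y) \<le> p"
        using card_mono[of ?Z] finite_subset[OF subgroup.subset[OF Zs] fin] Z by metis
    qed simp
    finally have "p\<^sup>2 \<le> card ?K" using p1 by (simp add: eval_nat_numeral)
    moreover have "p < p\<^sup>2" using p1 by (simp add: power2_eq_square)
    ultimately have "card ?Z < card ?K" using Z by simp
    then have "\<not> ?K \<subseteq> ?Z"
      using card_mono[of ?Z ?K] finite_subset[OF subgroup.subset[OF Zs] fin] by linarith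
    then show thesis using that by blast
  qed
  have yc: "y \<in> carrier G" by (rule Ycar[OF y(1)])
  obtain n where n: "n > 0" "\<And>i::nat. y [^] i \<in> ?Z \<longleftrightarrow> n dvd i"
    using relative_order[OF fin Zs yc] by blast
  have "n dvd p" using n(2)[of p] y(3) subgroup.one_closed[OF Zs] by simp
  moreover have "n \<noteq> 1" using n(2)[of 1] y(2) yc by auto
  ultimately have np: "n = p" using p unfolding prime_nat_iff by blast
  have yz: "y \<otimes> z = z \<otimes> y" if "z \<in> ?Z" for z using center_commutes[OF that yc] by simp
  \<comment> \<open>As \<open>y^p = \<one>\<close>, the extension may take the value 1 at
    \<open>y\<close>, which costs no new roots of unity.\<close>
  have c1: "1 ^ n = \<theta> (y [^] n)" using y(3) np lin_charsD(2)[OF th] by simp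
  obtain W \<mu> where W: "subgroup W G" "?Z \<subseteq> W" "y \<in> W" "card W = n * card ?Z"
    "W = {z \<otimes> y [^] i | z i. z \<in> ?Z \<and> i \<in> (UNIV :: nat set)}"
    "\<mu> \<in> lin_chars G W {\<one>}" "\<And>z. z \<in> ?Z \<Longrightarrow> \<mu> z = \<theta> z"
    "\<And>z i. z \<in> ?Z \<Longrightarrow> \<mu> (z \<otimes> y [^] (i::nat)) = \<theta> z * 1 ^ i"
    by (rule lin_chars_extend_step[OF fin Zs th yc yz n c1]) (assumption | rule that)+
  have cW: "card W = p\<^sup>2" using W(4) np Z by (simp add: power2_eq_square)
  have yi: "y [^] (i::nat) \<in> ?Y" for i
    using subgroup_int_pow_closed[OF Y(1) y(1), of "int i"] by (simp add: int_pow_int)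
  have WY: "W \<subseteq> ?Y"
  proof
    fix w assume "w \<in> W"
    then obtain z i where w: "z \<in> ?Z" "w = z \<otimes> y [^] (i::nat)" unfolding W(5) by blast
    then show "w \<in> ?Y" using ZY yi subgroup.m_closed[OF Y(1)] by blast
  qed
  have Wroot: "\<mu> w ^ (p ^ l) = 1" if wW: "w \<in> W" for w
  proof -
    obtain z i where w: "z \<in> ?Z" "w = z \<otimes> y [^] (i::nat)" using wW unfolding W(5) by blast
    then show ?thesis using W(8)[OF w(1), of i] root[OF w(1)] by simp
  qed
  let ?H = "centralizer y"
  have H: "subgroup ?H G" by (rule centralizer_subgroup[OF fin yc])
  have finH: "finite ?H" by (rule finite_subset[OF subgroup.subset[OF H] fin])
  have Hc: "h \<in> carrier G" if "h \<in> ?H" for h using that by (simp add: centralizer_def)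
  have YH: "?Y \<subseteq> ?H" using Yab[OF _ y(1)] Ycar by (auto simp: centralizer_def)
  have WH: "W \<subseteq> ?H" using WY YH by blast
  have comm: "h \<otimes> w = w \<otimes> h" if h: "h \<in> ?H" and wW: "w \<in> W" for h w
  proof -
    obtain z i where w: "z \<in> ?Z" "w = z \<otimes> y [^] (i::nat)" using wW unfolding W(5) by blast
    have zc: "z \<in> carrier G" using w(1) by (simp add: grp_center_def)
    have hy: "h \<otimes> y = y \<otimes> h" using h by (simp add: centralizer_def)
    have yh: "y [^] i \<otimes> h = h \<otimes> y [^] i" by (rule group_commutes_pow[OF hy[symmetric] yc Hc[OF h]])
    have "h \<otimes> (z \<otimes> y [^] i) = (h \<otimes> z) \<otimes> y [^] i" using Hc[OF h] zc yc by (simp add: m_assoc)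
    also have "\<dots> = z \<otimes> (h \<otimes> y [^] i)" using center_commutes[OF w(1) Hc[OF h]] Hc[OF h] zc yc by (simp add: m_assoc[symmetric])
    also have "\<dots> = (z \<otimes> y [^] i) \<otimes> h" using yh Hc[OF h] zc yc by (simp add: m_assoc)
    finally show ?thesis using w(2) by simp
  qed
  \<comment> \<open>Commutators with \<open>y\<close> are central, so the centralizer has index at
    most \<open>p\<close>; as \<open>y\<close> is not central, its order is exactly
    \<open>p^4\<close>.\<close>
  have "card (carrier G) \<le> card ?Z * card ?H"
    by (rule card_centralizer_bound[OF fin yc subgroup.subset[OF Zs] Yc[OF y(1)]])
  then have "p * p ^ 4 \<le> p * card ?H" using card Z by (simp add: eval_nat_numeral)
  then have cH_ge: "p ^ 4 \<le> card ?H" using p1 by simp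
  obtain e where e: "e \<le> 5" "card ?H = p ^ e"
    using subgroup_card_dvd[OF H subgroup_self subgroup.subset[OF H]] card divides_primepow_nat[OF p] by metis
  have Hne: "?H \<noteq> carrier G"
  proof
    assume eq: "?H = carrier G"
    have "y \<otimes> g = g \<otimes> y" if "g \<in> carrier G" for g
    proof -
      have "g \<in> ?H" using that eq by simp
      then show ?thesis by (simp add: centralizer_def)
    qed
    then show False using y(2) yc by (simp add: grp_center_def)
  qed
  have "card ?H \<noteq> p ^ 5" using Hne card card_subset_eq[OF fin subgroup.subset[OF H]] by metis
  then have "e \<noteq> 5" using e(2) by auto
  have "p ^ 4 \<le> p ^ e" using cH_ge e(2) by simp
  then have "4 \<le> e" using p1 by simp
  then have "e = 4" using \<open>e \<noteq> 5\<close> e(1) by linarith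
  then have cH: "card ?H = p ^ 4" using e(2) by simp
  have cHY: "card ?H = p * card ?Y" using cH Y(2) by (simp add: eval_nat_numeral)
  \<comment> \<open>For \<open>a\<close> outside the second centre, the \<open>g\<close> in
    \<open>?H\<close> with \<open>[a, g]\<close> central form a subgroup \<open>?C\<close> that
    contains the second centre and \<open>a\<close>; since the second centre has index
    \<open>p\<close> in \<open>?H\<close>, this is all of \<open>?H\<close>. Thus \<open>?H\<close>
    has class at most two.\<close>
  have HZ: "a \<otimes> b \<otimes> inv a \<otimes> inv b \<in> ?Z" if a: "a \<in> ?H" and b: "b \<in> ?H" for a b
  proof (cases "a \<in> ?Y")
    case True
    then show ?thesis using Yc'[OF True Hc[OF b]] by simp
  next
    case False
    let ?C = "{g \<in> ?H. a \<otimes> g \<otimes> inv a \<otimes> inv g \<in> ?Z}"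
    have ac: "a \<in> carrier G" by (rule Hc[OF a])
    have C: "subgroup ?C G"
    proof (rule finite_subgroupI[OF fin])
      show "?C \<subseteq> carrier G" using Hc by blast
      show "\<one> \<in> ?C" using subgroup.one_closed[OF H] subgroup.one_closed[OF Zs] ac by simp
      fix g h assume "g \<in> ?C" "h \<in> ?C"
      then have gh: "g \<in> ?H" "h \<in> ?H" "a \<otimes> g \<otimes> inv a \<otimes> inv g \<in> ?Z" "a \<otimes> h \<otimes> inv a \<otimes> inv h \<in> ?Z" by simp_all
      have gc: "g \<in> carrier G" "h \<in> carrier G" using Hc gh by simp_all
      let ?u = "a \<otimes> g \<otimes> inv a \<otimes> inv g" and ?v = "a \<otimes> h \<otimes> inv a \<otimes> inv h"
      have uc: "?u \<in> carrier G" "?v \<in> carrier G" using ac gc by simp_all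
      have "?u \<otimes> ?v = ?u \<otimes> (g \<otimes> ?v \<otimes> inv g)"
      proof -
        have "g \<otimes> ?v \<otimes> inv g = ?v \<otimes> g \<otimes> inv g" using center_commutes[OF gh(4) gc(1)] by simp
        also have "\<dots> = ?v" using gc(1) uc(2) by (simp only: m_assoc[OF uc(2) gc(1) inv_closed[OF gc(1)]] r_inv r_one)
        finally show ?thesis by simp
      qed
      also have "\<dots> = a \<otimes> (g \<otimes> h) \<otimes> inv a \<otimes> inv (g \<otimes> h)"
      proof -
        have "inv g \<otimes> (g \<otimes> (a \<otimes> (h \<otimes> (inv a \<otimes> (inv h \<otimes> inv g))))) = a \<otimes> (h \<otimes> (inv a \<otimes> (inv h \<otimes> inv g)))"
          using ac gc by (simp add: m_assoc[symmetric])
        moreover have "inv a \<otimes> (a \<otimes> (h \<otimes> (inv a \<otimes> (inv h \<otimes> inv g)))) = h \<otimes> (inv a \<otimes> (inv h \<otimes> inv g))"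
          using ac gc by (simp add: m_assoc[symmetric])
        ultimately show ?thesis using ac gc by (simp add: m_assoc inv_mult_group)
      qed
      finally have "a \<otimes> (g \<otimes> h) \<otimes> inv a \<otimes> inv (g \<otimes> h) \<in> ?Z" using subgroup.m_closed[OF Zs gh(3,4)] by simp
      then show "g \<otimes> h \<in> ?C" using subgroup.m_closed[OF H gh(1,2)] by simp
    qed
    have "?Y \<subseteq> ?C" using YH Yc[OF _ ac] by blast
    moreover have "a \<in> ?C" using a ac subgroup.one_closed[OF Zs] by (simp add: m_assoc)
    then have "?Y \<noteq> ?C" using False by blast
    ultimately have "?C = ?H" using subgroup_jump[OF fin Y(1) C H _ _ _ p cHY] by blast
    then show ?thesis using b by blast
  qed
  \<comment> \<open>An abelian \<open>?H\<close> would centralise the second centre and hence lie in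
    it, which has order only \<open>p^3\<close>.\<close>
  have Hnab: "\<not> (\<forall>a\<in>?H. \<forall>b\<in>?H. a \<otimes> b = b \<otimes> a)"
  proof
    assume ab: "\<forall>a\<in>?H. \<forall>b\<in>?H. a \<otimes> b = b \<otimes> a"
    have "?H \<subseteq> ?Y"
    proof
      fix h assume h: "h \<in> ?H"
      show "h \<in> ?Y"
        by (rule second_center_self_centralizing[OF fin p card Z Y Yab Hc[OF h]]) (use ab h YH in blast)+
    qed
    then have "p ^ 4 \<le> p ^ 3" using card_mono[OF finY] cH Y(2) by metis
    then show False using p1 by simp
  qed
  have Hcp: "(a \<otimes> b \<otimes> inv a \<otimes> inv b) [^] p = \<one>" if "a \<in> ?H" "b \<in> ?H" for a b
    by (rule Zp[OF HZ[OF that]])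
  \<comment> \<open>A power \<open>h^p\<close> is central in \<open>?H\<close>. If it missed
    \<open>W\<close>, the centre \<open>?C\<close> of \<open>?H\<close> would have order at least
    \<open>p^3\<close>, hence index at most \<open>p\<close>, and \<open>?H\<close> would be
    abelian.\<close>
  have pow: "h [^] p \<in> W" if h: "h \<in> ?H" for h
  proof (rule ccontr)
    assume hW: "h [^] p \<notin> W"
    let ?C = "{c \<in> ?H. \<forall>a\<in>?H. c \<otimes> a = a \<otimes> c}"
    have C: "subgroup ?C G"
    proof (rule finite_subgroupI[OF fin])
      show "?C \<subseteq> carrier G" using Hc by blast
      show "\<one> \<in> ?C" using subgroup.one_closed[OF H] Hc by simp
      fix u v assume "u \<in> ?C" "v \<in> ?C"
      then have uv: "u \<in> ?H" "v \<in> ?H" "\<And>a. a \<in> ?H \<Longrightarrow> u \<otimes> a = a \<otimes> u" "\<And>a. a \<in> ?H \<Longrightarrow> v \<otimes> a = a \<otimes> v" by simp_all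
      have "u \<otimes> v \<otimes> a = a \<otimes> (u \<otimes> v)" if a: "a \<in> ?H" for a
      proof -
        have c: "u \<in> carrier G" "v \<in> carrier G" "a \<in> carrier G" using Hc uv(1,2) a by blast+
        have "u \<otimes> v \<otimes> a = u \<otimes> (a \<otimes> v)" unfolding uv(4)[OF a, symmetric] using c by (simp add: m_assoc)
        also have "\<dots> = (a \<otimes> u) \<otimes> v" unfolding uv(3)[OF a, symmetric] using c by (simp add: m_assoc)
        finally show ?thesis using c by (simp add: m_assoc)
      qed
      then show "u \<otimes> v \<in> ?C" using subgroup.m_closed[OF H uv(1,2)] by simp
    qed
    have hp: "h [^] p \<in> ?C"
    proof -
      have "h [^] p \<otimes> a = a \<otimes> h [^] p" if "a \<in> ?H" for a
        by (rule pow_commutes_of_commutator[OF Hc[OF h] Hc[OF that] HZ[OF h that] Hcp[OF h that]])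
      moreover have "h [^] p \<in> ?H"
        using subgroup_int_pow_closed[OF H h, of "int p"] by (simp add: int_pow_int)
      ultimately show ?thesis by simp
    qed
    have WC: "W \<subseteq> ?C" using WH comm by auto
    have CH: "?C \<subseteq> ?H" by blast
    have "card ?C dvd p ^ 4" using subgroup_card_dvd[OF C H CH] cH by simp
    then obtain f where f: "f \<le> 4" "card ?C = p ^ f" using divides_primepow_nat[OF p] by blast
    have "W \<subset> ?C" using WC hp hW by blast
    then have "card W < card ?C" using finite_subset[OF CH finH] by (rule psubset_card_mono[rotated])
    then have "p ^ 2 < p ^ f" using f cW by simp
    then have "3 \<le> f" using p1 by simp
    have "?C = ?H \<or> card ?H = p * card ?C"
      using f \<open>3 \<le> f\<close> cH card_subset_eq[OF finH CH] by (cases "f = 4") (auto simp: eval_nat_numeral le_Suc_eq)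
    then have "\<forall>a\<in>?H. \<forall>b\<in>?H. a \<otimes> b = b \<otimes> a"
    proof
      assume "?C = ?H"
      then show ?thesis by blast
    next
      assume cc: "card ?H = p * card ?C"
      show ?thesis
        using commutative_if_central_prime_index[OF fin C H CH p cc] by blast
    qed
    then show False using Hnab by blast
  qed
  have HW: "a \<otimes> b \<otimes> inv a \<otimes> inv b \<in> W" if "a \<in> ?H" "b \<in> ?H" for a b
    using HZ[OF that] W(2) by blast
  have big: "p * card W < card ?H" using cW cH p1 by (simp add: eval_nat_numeral)
  obtain x A \<nu> where A: "x \<in> ?H" "x \<notin> W" "subgroup A G" "W \<subseteq> A" "A \<subseteq> ?H" "card A = p * card W" "x \<in> A"
    "A = {w \<otimes> x [^] i | w i. w \<in> W \<and> i \<in> (UNIV :: nat set)}"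
    "\<nu> \<in> lin_chars G A {\<one>}" "\<And>w. w \<in> W \<Longrightarrow> \<nu> w = \<mu> w" "\<And>a. a \<in> A \<Longrightarrow> \<nu> a ^ (p ^ l) = 1"
    by (rule lin_chars_extend_same_field[OF fin p odd l W(1) H WH comm pow HW Hcp big W(6) Wroot])
       (assumption | rule that)+
  have "p\<^sup>2 * card A = card (carrier G)" using A(6) cW card by (simp add: eval_nat_numeral)
  moreover have "?Z \<subseteq> A" using W(2) A(4) by blast
  moreover have "\<nu> z = \<theta> z" if "z \<in> ?Z" for z using A(10)[of z] W(2) W(7)[OF that] that by auto
  ultimately show ?thesis using A(3,9,11) by blast
qed

end

lemma (in normal) cyclo_rep_inflate:
  assumes "cyclo_rep (G Mod H) k m \<rho>"
  shows "cyclo_rep G k m (\<lambda>g. \<rho> (H #> g))"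
proof -
  have c: "H #> g \<in> carrier (G Mod H)" if "g \<in> carrier G" for g using that by (auto simp: carrier_FactGroup)
  have "\<rho> (H #> (g \<otimes> h)) = \<rho> (H #> g) * \<rho> (H #> h)" if "g \<in> carrier G" "h \<in> carrier G" for g h
    using assms c[OF that(1)] c[OF that(2)] rcos_mult[OF that] unfolding cyclo_rep_def is_rep_def by metis
  moreover have "\<rho> (H #> \<one>) = 1\<^sub>m k"
    using assms subset by (simp add: cyclo_rep_def is_rep_def)
  ultimately show ?thesis using assms c by (simp add: cyclo_rep_def is_rep_def)
qed

context group
begin

lemma level_one_eq:
  assumes "\<And>\<theta> x. \<theta> \<in> U \<Longrightarrow> x \<in> C \<Longrightarrow> \<theta> x ^ p = 1" "\<And>\<theta>. \<theta> \<in> U \<Longrightarrow> \<exists>x\<in>C. \<theta> x \<noteq> 1"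
  shows "level C p 1 U = U"
  using assms by (auto simp: level_def)

lemma nontrivial_chars_level_one:
  assumes Z: "subgroup Z G" and exp: "\<And>z. z \<in> Z \<Longrightarrow> z [^] p = \<one>" and M: "M \<subseteq> Z"
  shows "level Z p 1 (lin_chars G Z {\<one>} - lin_chars G Z M) = lin_chars G Z {\<one>} - lin_chars G Z M"
proof (rule level_one_eq)
  fix \<theta> assume th: "\<theta> \<in> lin_chars G Z {\<one>} - lin_chars G Z M"
  then have t: "\<theta> \<in> lin_chars G Z {\<one>}" "\<theta> \<notin> lin_chars G Z M" by simp_all
  show "\<theta> x ^ p = 1" if x: "x \<in> Z" for x
    using lin_chars_pow[OF Z t(1) _ x, of p] exp[OF x] lin_charsD(2)[OF t(1), of \<one>] by simp
  have "\<not> (\<forall>x\<in>M. \<theta> x = 1)" using t unfolding lin_chars_def by simp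
  then show "\<exists>x\<in>Z. \<theta> x \<noteq> 1" using M by blast
qed

text \<open>Regular characters telescope: with indicators \<open>1_N\<close> of \<open>G'\<close>,
  \<open>1_Z\<close> of the centre and \<open>delta\<close> of the identity, the contributions are
  \<open>p^3 1_N\<close> from \<open>G/G'\<close>, \<open>p^2 (p^2 1_Z - p 1_N)\<close> from
  \<open>G/Z\<close>, and \<open>p^4 (p delta - 1_Z)\<close> from the nontrivial characters of the
  centre; the sum is \<open>p^5 delta\<close>.\<close>

theorem class3_decomposition:
  assumes fin: "finite (carrier G)" and p: "Factorial_Ring.prime (p::nat)" and odd: "odd p"
    and card: "card (carrier G) = p ^ 5" and Z: "card (grp_center G) = p"
    and QZ: "card (grp_center (G Mod grp_center G)) = p\<^sup>2"
    and QN: "card (derived (G Mod grp_center G) (carrier (G Mod grp_center G))) = p"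
      "derived (G Mod grp_center G) (carrier (G Mod grp_center G)) \<subseteq> grp_center (G Mod grp_center G)"
  shows "\<exists>m. grp_exponent (G Mod derived G (carrier G)) = p ^ m
            \<and> QG_iso_blocks G
                (concat (map (\<lambda>l. replicate
                    (num_cyclic_subgroups (G Mod derived G (carrier G)) (p ^ l)) (1, p ^ l)) [0..<m+1])
                 @ replicate p (p, p) @ [(p ^ 2, p)])"
proof -
  let ?N = "derived G (carrier G)" and ?Z = "grp_center G" and ?Y = second_center
  let ?Q = "G Mod ?Z"
  have p0: "p > 0" and p1: "p > 1" using prime_gt_0_nat[OF p] prime_gt_1_nat[OF p] .
  have p5: "p ^ 5 = p ^ 4 * p" "p ^ 5 = p ^ 3 * p\<^sup>2" by (simp_all add: eval_nat_numeral)
  note Zs = center_subgroup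
  have Ns: "subgroup ?N G" by (rule derived_is_subgroup[OF order_refl])
  interpret Z: normal ?Z G by (rule center_normal)
  interpret Q: group ?Q by (rule Z.factorgroup_is_group)
  have finQ: "finite (carrier ?Q)" by (rule Z.finite_FactGroup[OF fin])
  have "card (rcosets ?Z) * card ?Z = card (carrier G)" using lagrange[OF Zs] by (simp add: Coset.order_def)
  then have "card (rcosets ?Z) * p = p ^ 4 * p" unfolding Z card p5(1) .
  then have cQ: "card (carrier ?Q) = p ^ 4" using p0 by (simp add: FactGroup_def)
  have Y_eq: "?Y = {x \<in> carrier G. ?Z #> x \<in> grp_center ?Q}"
    using coset_in_center_iff[OF center_normal] by (auto simp: second_center_def)
  have Y: "subgroup ?Y G" "card ?Y = p ^ 3"
    using preimage_subgroup[OF fin center_normal Q.center_subgroup] QZ Z unfolding Y_eq[symmetric]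
    by (simp_all add: eval_nat_numeral)
  let ?QN = "derived ?Q (carrier ?Q)"
  have QNs: "subgroup ?QN ?Q" by (rule Q.derived_is_subgroup[OF order_refl])
  have gh: "group_hom G ?Q (\<lambda>a. ?Z #> a)"
    by (intro group_hom.intro group_hom_axioms.intro is_group Q.is_group Z.r_coset_hom_Mod)
  have "derived ?Q ((\<lambda>a. ?Z #> a) ` carrier G) = (\<lambda>a. ?Z #> a) ` ?N"
    by (rule group_hom.derived_img[OF gh order_refl])
  then have QN_img: "?QN = (\<lambda>a. ?Z #> a) ` ?N" by (simp add: carrier_FactGroup)
  \<comment> \<open>The preimage of the commutator subgroup of \<open>G/Z\<close>, that is
    \<open>G' Z\<close>; it becomes \<open>G'\<close> itself once \<open>Z\<close> is known to lie
    in \<open>G'\<close>.\<close>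
  define S where "S = {x \<in> carrier G. ?Z #> x \<in> ?QN}"
  have cS: "card S = p\<^sup>2"
    using preimage_subgroup(2)[OF fin center_normal QNs] QN(1) Z by (simp add: S_def power2_eq_square)
  have NS: "?N \<subseteq> S" using QN_img subgroup.subset[OF Ns] by (auto simp: S_def)
  have SY: "S \<subseteq> ?Y" using QN(2) by (auto simp: S_def Y_eq)
  have NY: "?N \<subseteq> ?Y" using NS SY by blast
  \<comment> \<open>Otherwise \<open>G'\<close> meets the centre, of prime order, trivially. As
    \<open>G'\<close> lies in the second centre, its commutators with \<open>G\<close> are in that
    intersection, so \<open>G'\<close> is central and hence trivial, against
    \<open>QN\<close>.\<close>
  have ZN: "?Z \<subseteq> ?N"
  proof (rule ccontr)
    assume n: "\<not> ?Z \<subseteq> ?N"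
    have NZ: "subgroup (?N \<inter> ?Z) G" by (rule subgroups_Inter_pair[OF Ns Zs])
    have "card (?N \<inter> ?Z) dvd p" using subgroup_card_dvd[OF NZ Zs] Z by simp
    moreover have "card (?N \<inter> ?Z) \<noteq> p"
    proof
      assume "card (?N \<inter> ?Z) = p"
      then have "?N \<inter> ?Z = ?Z" using Z finite_subset[OF subgroup.subset[OF Zs] fin] by (intro card_subset_eq) auto
      then show False using n by blast
    qed
    ultimately have "card (?N \<inter> ?Z) = 1" using p unfolding prime_nat_iff by blast
    then obtain a where a: "?N \<inter> ?Z = {a}" using card_1_singletonE by blast
    then have "\<one> = a" using subgroup.one_closed[OF NZ] by (simp only: singleton_iff)
    then have triv: "?N \<inter> ?Z = {\<one>}" using a by simp
    have "?N \<subseteq> {\<one>}"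
    proof
      fix x assume x: "x \<in> ?N"
      then have xY: "x \<in> ?Y" and xc: "x \<in> carrier G" using NY subgroup.subset[OF Ns] by blast+
      have "x \<otimes> g = g \<otimes> x" if g: "g \<in> carrier G" for g
      proof -
        have "x \<otimes> g \<otimes> inv x \<otimes> inv g \<in> ?N \<inter> ?Z"
          using commutator_in_derived[OF xc g] second_center_commutators(2)[OF xY g] by blast
        then have "x \<otimes> g \<otimes> inv x \<otimes> inv g = \<one>" using triv by blast
        then show ?thesis using commutator_eq_one_iff[OF xc g] by blast
      qed
      then have "x \<in> ?Z" using xc unfolding grp_center_def by blast
      then show "x \<in> {\<one>}" using x triv by blast
    qed
    then have "?QN \<subseteq> {?Z #> \<one>}" unfolding QN_img by blast
    then have "card ?QN \<le> 1" using card_mono[of "{?Z #> \<one>}" ?QN] by simp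
    then show False using QN(1) p1 by simp
  qed
  have "S \<subseteq> ?N"
  proof
    fix x assume x: "x \<in> S"
    then have xc: "x \<in> carrier G" by (simp add: S_def)
    obtain a where a: "a \<in> ?N" "?Z #> x = ?Z #> a" using x QN_img by (auto simp: S_def)
    then have ac: "a \<in> carrier G" using subgroup.subset[OF Ns] by blast
    then have "x \<otimes> inv a \<in> ?N" using Z.rcos_eq_iff[OF xc ac] a(2) ZN by blast
    then have "(x \<otimes> inv a) \<otimes> a \<in> ?N" using a(1) by (rule subgroup.m_closed[OF Ns])
    then show "x \<in> ?N" using xc ac by (simp add: m_assoc)
  qed
  then have NS_eq: "?N = S" using NS by blast
  have cN: "card ?N = p\<^sup>2" using cS NS_eq by simp
  have "card (rcosets ?N) * card ?N = card (carrier G)" using lagrange[OF Ns] by (simp add: Coset.order_def)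
  then have "card (rcosets ?N) * p\<^sup>2 = p ^ 3 * p\<^sup>2" unfolding cN card p5(2) .
  moreover have "p\<^sup>2 \<noteq> 0" using p0 by simp
  ultimately have iN: "card (rcosets ?N) = p ^ 3" by (metis mult_cancel2)
  obtain m L1 where L1: "grp_exponent (G Mod ?N) = p ^ m"
    "\<And>l. length (L1 l) = num_cyclic_subgroups (G Mod ?N) (p ^ l)"
    "\<And>l \<rho>. \<rho> \<in> set (L1 l) \<Longrightarrow> cyclo_rep G 1 (p ^ l) \<rho>"
    "(\<Sum>l\<leftarrow>[0..<m + 1]. length (L1 l) * totient (p ^ l)) = card (rcosets ?N)"
    "\<And>g. g \<in> carrier G \<Longrightarrow> (\<Sum>l\<leftarrow>[0..<m + 1]. \<Sum>\<rho>\<leftarrow>L1 l. of_nat 1 * cyc_trace (p ^ l) (mat_trace (\<rho> g)))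
       = (if g \<in> ?N then of_nat (card (rcosets ?N)) else 0)"
    by (rule linear_blocks_derived[OF fin p card]) (assumption | rule that)+
  have tot: "totient (p ^ 1) = p - 1" using p by (simp add: totient_prime)

  define UQ where "UQ = lin_chars ?Q (grp_center ?Q) {\<one>\<^bsub>?Q\<^esub>} - lin_chars ?Q (grp_center ?Q) ?QN"
  have expQ: "u [^]\<^bsub>?Q\<^esub> p = \<one>\<^bsub>?Q\<^esub>" if u: "u \<in> grp_center ?Q" for u
  proof -
    have "u \<in> carrier ?Q" by (rule subgroup.mem_carrier[OF Q.center_subgroup u])
    then obtain y where y: "y \<in> carrier G" "u = ?Z #> y" unfolding carrier_FactGroup by blast
    then have "y \<in> ?Y" using u Y_eq by simp
    then have "y [^] p \<in> ?Z" by (rule second_center_pow[OF Z])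
    then show ?thesis using Z.FactGroup_pow[OF y(1), of p] Z.rcos_eq_self_iff[of "y [^] p"] y by simp
  qed
  have levelQ: "level (grp_center ?Q) p 1 UQ = UQ"
    unfolding UQ_def by (rule Q.nontrivial_chars_level_one[OF Q.center_subgroup expQ QN(2)])
  have QZc: "x \<otimes>\<^bsub>?Q\<^esub> y = y \<otimes>\<^bsub>?Q\<^esub> x" if "x \<in> grp_center ?Q" "y \<in> grp_center ?Q" for x y
    using Q.center_commutes[OF that(1)] subgroup.mem_carrier[OF Q.center_subgroup that(2)] by blast
  have divQ: "p\<^sup>2 div p = p" using p0 by (simp add: power2_eq_square)
  \<comment> \<open>The centre of \<open>G/Z\<close> has exponent \<open>p\<close>, so all
    \<open>p^2 - p\<close> characters nontrivial on the commutator subgroup of \<open>G/Z\<close>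
    sit at level one; orbits of length \<open>p - 1\<close> make \<open>p\<close> blocks.\<close>
  have cardUQ: "card UQ = p * (p - 1)"
    using Q.sum_over_nontrivial_chars(2)[OF finQ Q.center_subgroup QZc QNs QN(2)] QZ QN(1) divQ
    by (simp add: UQ_def power2_eq_square diff_mult_distrib2)
  have cQ': "card (carrier ?Q) = p\<^sup>2 * card (grp_center ?Q)" using cQ QZ by (simp add: eval_nat_numeral)
  have l1: "(0::nat) < 1" and kk: "p = p \<or> p = p\<^sup>2" by simp_all
  note blocksQ = Q.class2_nonlinear_blocks[OF finQ p odd l1 QNs QN Q.commutator_in_derived kk cQ']
  obtain LQ where LQ: "length LQ * totient (p ^ 1) = card UQ" "\<And>\<rho>. \<rho> \<in> set LQ \<Longrightarrow> cyclo_rep ?Q p (p ^ 1) \<rho>"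
    "\<And>u. u \<in> carrier ?Q \<Longrightarrow> (\<Sum>\<rho>\<leftarrow>LQ. of_nat p * cyc_trace (p ^ 1) (mat_trace (\<rho> u))) = of_nat (p\<^sup>2) * (\<Sum>\<theta>\<in>UQ. \<theta> u)"
    using blocksQ unfolding UQ_def[symmetric] levelQ by blast
  have lenQ: "length LQ = p" using LQ(1) tot cardUQ p1 by simp
  define L2 where "L2 = map (\<lambda>\<rho> g. \<rho> (?Z #> g)) LQ"

  define UF where "UF = lin_chars G ?Z {\<one>} - lin_chars G ?Z ?Z"
  have levelF: "level ?Z p 1 UF = UF"
    unfolding UF_def by (rule nontrivial_chars_level_one[OF Zs subgroup_prime_pow_eq_one[OF Zs Z] order_refl])
  have Zc: "x \<otimes> y = y \<otimes> x" if "x \<in> ?Z" "y \<in> ?Z" for x y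
    using center_commutes[OF that(1)] subgroup.mem_carrier[OF Zs that(2)] by blast
  have cardUF: "card UF = p - 1"
    using sum_over_nontrivial_chars(2)[OF fin Zs Zc Zs order_refl] Z p0 by (simp add: UF_def)
  have cYN: "card ?Y = p * card ?N" using Y(2) cN by (simp add: eval_nat_numeral)
  have Yab: "a \<otimes> b = b \<otimes> a" if "a \<in> ?Y" "b \<in> ?Y" for a b
    by (rule second_center_commutative[OF fin p NY cYN Y(1) that])
  \<comment> \<open>Inside the second centre every commutator is central; outside it,
    self-centralization provides a \<open>y\<close> in the second centre that does not commute with
    \<open>g\<close>, and that commutator is central too.\<close>
  have vanish: "\<exists>x\<in>carrier G. x \<otimes> g \<otimes> inv x \<otimes> inv g \<in> ?Z - {\<one>}" if g: "g \<in> carrier G" "g \<notin> ?Z" for g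
  proof (cases "g \<in> ?Y")
    case True
    obtain x where x: "x \<in> carrier G" "g \<otimes> x \<noteq> x \<otimes> g" using g unfolding grp_center_def by blast
    then have "x \<otimes> g \<otimes> inv x \<otimes> inv g \<noteq> \<one>" using commutator_eq_one_iff[OF x(1) g(1)] by auto
    then show ?thesis using second_center_commutators(1)[OF True x(1)] x(1) by blast
  next
    case False
    have "\<exists>y\<in>?Y. g \<otimes> y \<noteq> y \<otimes> g"
    proof (rule ccontr)
      assume "\<not> (\<exists>y\<in>?Y. g \<otimes> y \<noteq> y \<otimes> g)"
      then have gy: "g \<otimes> y = y \<otimes> g" if "y \<in> ?Y" for y using that by blast
      have "g \<in> ?Y"
        by (rule second_center_self_centralizing[OF fin p card Z Y Yab g(1) gy])
      then show False using False by blast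
    qed
    then obtain y where y: "y \<in> ?Y" "g \<otimes> y \<noteq> y \<otimes> g" by blast
    have yc: "y \<in> carrier G" using y(1) by (simp add: second_center_def)
    have "y \<otimes> g \<otimes> inv y \<otimes> inv g \<noteq> \<one>" using commutator_eq_one_iff[OF yc g(1)] y(2) by auto
    then show ?thesis using second_center_commutators(2)[OF y(1) g(1)] yc by blast
  qed
  obtain LF where LF: "length LF * totient (p ^ 1) = card UF" "\<And>\<rho>. \<rho> \<in> set LF \<Longrightarrow> cyclo_rep G (p\<^sup>2) (p ^ 1) \<rho>"
    "\<And>g. g \<in> carrier G \<Longrightarrow> (\<Sum>\<rho>\<leftarrow>LF. of_nat (p\<^sup>2) * cyc_trace (p ^ 1) (mat_trace (\<rho> g))) = of_nat ((p\<^sup>2)\<^sup>2) * (\<Sum>\<theta>\<in>UF. \<theta> g)"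
    using central_blocks[OF fin p l1 Zs center_commutes Zs order_refl Z vanish
        class3_extension[OF fin p odd l1 card Z cN ZN NY Y]]
    unfolding UF_def[symmetric] levelF by blast
  \<comment> \<open>The \<open>p - 1\<close> nontrivial characters of the centre form a single
    Galois orbit, whence one block of degree \<open>p^2\<close>.\<close>
  have "length LF = 1" using LF(1) tot cardUF p1 by simp
  then obtain \<rho>F where \<rho>F: "LF = [\<rho>F]" by (metis One_nat_def length_0_conv length_Suc_conv)

  let ?xs = "tag_blocks 1 p L1 [0..<m + 1] @ map (\<lambda>\<rho>. (p, p, \<rho>)) L2 @ [(p\<^sup>2, p, \<rho>F)]"
  have types: "map (\<lambda>(k, m, \<rho>). (k, m)) ?xs = concat (map (\<lambda>l. replicate
                    (num_cyclic_subgroups (G Mod ?N) (p ^ l)) (1, p ^ l)) [0..<m+1])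
                 @ replicate p (p, p) @ [(p ^ 2, p)]"
    unfolding map_append tag_blocks_types L1(2) by (simp add: comp_def map_replicate_const L2_def lenQ)
  have "QG_iso_blocks G (map (\<lambda>(k, m, \<rho>). (k, m)) ?xs)"
  proof (rule QG_iso_blocksI[OF fin p])
    fix k' m' \<rho> assume "(k', m', \<rho>) \<in> set ?xs"
    then consider "(k', m', \<rho>) \<in> set (tag_blocks 1 p L1 [0..<m + 1])"
      | "k' = p" "m' = p" "\<rho> \<in> set L2" | "k' = p\<^sup>2" "m' = p" "\<rho> = \<rho>F" by auto
    then show "(\<exists>l. m' = p ^ l) \<and> cyclo_rep G k' m' \<rho>"
    proof cases
      case 1
      then show ?thesis using L1(3) by (auto simp: set_tag_blocks)
    next
      case 2
      then show ?thesis using LQ(2) Z.cyclo_rep_inflate by (auto simp: L2_def intro: exI[of _ 1])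
    next
      case 3
      then show ?thesis using LF(2) \<rho>F by (auto intro: exI[of _ 1])
    qed
  next
    have a: "(\<Sum>(k, m, \<rho>)\<leftarrow>map (\<lambda>\<rho>. (p, p, \<rho>)) L2 @ [(p\<^sup>2, p, \<rho>F)]. k\<^sup>2 * totient m) = p * (p\<^sup>2 * (p - 1)) + p ^ 4 * (p - 1)"
      using tot by (simp add: comp_def sum_list_triv L2_def lenQ power_mult[symmetric])
    obtain q where q: "p = Suc q" using p0 by (cases p) auto
    have "p ^ 3 + (p * (p\<^sup>2 * (p - 1)) + p ^ 4 * (p - 1)) = p ^ 5"
      unfolding q by (simp add: eval_nat_numeral algebra_simps)
    then show "(\<Sum>(k, m, \<rho>)\<leftarrow>?xs. k\<^sup>2 * totient m) = card (carrier G)"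
      unfolding map_append[of _ "tag_blocks 1 p L1 [0..<m + 1]"] sum_list_append[of "map _ (tag_blocks 1 p L1 [0..<m + 1])"] tag_blocks_dim a L1(4) iN card by simp
  next
    fix g assume g: "g \<in> carrier G"
    have gQ: "?Z #> g \<in> carrier ?Q" using g by (auto simp: carrier_FactGroup)
    have gN: "?Z #> g \<in> ?QN \<longleftrightarrow> g \<in> ?N" using NS_eq g by (auto simp: S_def)
    have gZ: "?Z #> g = \<one>\<^bsub>?Q\<^esub> \<longleftrightarrow> g \<in> ?Z" using Z.rcos_eq_self_iff[OF g] by simp
    have "(\<Sum>\<theta>\<in>UQ. \<theta> (?Z #> g)) = (if ?Z #> g = \<one>\<^bsub>?Q\<^esub> then of_nat (p\<^sup>2) else 0) - (if ?Z #> g \<in> ?QN then of_nat p else 0)"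
      unfolding UQ_def using Q.sum_over_nontrivial_chars(1)[OF finQ Q.center_subgroup QZc QNs QN(2)] QZ QN(1) divQ by simp
    then have "(\<Sum>\<theta>\<in>UQ. \<theta> (?Z #> g)) = (if g \<in> ?Z then of_nat (p\<^sup>2) else 0) - (if g \<in> ?N then of_nat p else 0)"
      unfolding gN gZ .
    then have t2: "(\<Sum>\<rho>\<leftarrow>L2. of_nat p * cyc_trace p (mat_trace (\<rho> g))) = of_nat (p\<^sup>2) * ((if g \<in> ?Z then of_nat (p\<^sup>2) else 0) - (if g \<in> ?N then of_nat p else 0))"
      using LQ(3)[OF gQ] by (simp add: L2_def comp_def)
    have "(\<Sum>\<theta>\<in>UF. \<theta> g) = (if g = \<one> then of_nat p else 0) - (if g \<in> ?Z then 1 else 0)"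
      unfolding UF_def using sum_over_nontrivial_chars(1)[OF fin Zs Zc Zs order_refl] Z p0 by simp
    then have t3: "of_nat (p\<^sup>2) * cyc_trace p (mat_trace (\<rho>F g)) = of_nat ((p\<^sup>2)\<^sup>2) * ((if g = \<one> then of_nat p else 0) - (if g \<in> ?Z then 1 else 0))"
      using LF(3)[OF g] by (simp add: \<rho>F)
    have oneZ: "\<one> \<in> ?Z" by (rule subgroup.one_closed[OF Zs])
    have "(\<Sum>(k, m, \<rho>)\<leftarrow>?xs. of_nat k * cyc_trace m (mat_trace (\<rho> g)))
      = (\<Sum>(k, m, \<rho>)\<leftarrow>tag_blocks 1 p L1 [0..<m + 1]. of_nat k * cyc_trace m (mat_trace (\<rho> g)))
        + (\<Sum>\<rho>\<leftarrow>L2. of_nat p * cyc_trace p (mat_trace (\<rho> g))) + of_nat (p\<^sup>2) * cyc_trace p (mat_trace (\<rho>F g))"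
      by (simp add: comp_def)
    also have "\<dots> = (if g = \<one> then of_nat (card (carrier G)) else 0)"
      unfolding tag_blocks_sum prod.case L1(5)[OF g] t2 t3 iN card
      using oneZ ZN by (auto simp: eval_nat_numeral algebra_simps)
    finally show "(\<Sum>(k, m, \<rho>)\<leftarrow>?xs. of_nat k * cyc_trace m (mat_trace (\<rho> g))) = (if g = \<one> then of_nat (card (carrier G)) else 0)" .
  qed
  then show ?thesis unfolding types using L1(1) by blast
qed

end

section \<open>Nested GVZ groups of small order\<close>

text \<open>Equality in the triangle inequality: with \<open>u\<close> the direction of the sum, the
  real parts of \<open>z i * cnj u\<close> are at most 1 and add up to the number of terms, so each
  is 1 and \<open>z i = u\<close>.\<close>

lemma equal_if_cmod_sum_eq_card:
  fixes z :: "'i \<Rightarrow> complex"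
  assumes fin: "finite I" and unit: "\<And>i. i \<in> I \<Longrightarrow> cmod (z i) = 1"
    and eq: "cmod (\<Sum>i\<in>I. z i) = of_nat (card I)" and ij: "i \<in> I" "j \<in> I"
  shows "z i = z j"
proof -
  define n where "n = real (card I)"
  have n: "n > 0" using fin ij(1) by (auto simp: n_def card_gt_0_iff)
  define u where "u = (\<Sum>i\<in>I. z i) / of_real n"
  have u: "cmod u = 1" using eq n by (simp add: u_def norm_divide n_def)
  have su: "(\<Sum>i\<in>I. z i) = of_real n * u" using n by (simp add: u_def)
  have le: "Re (z i * cnj u) \<le> 1" if "i \<in> I" for i
    using complex_Re_le_cmod[of "z i * cnj u"] unit[OF that] u by (simp add: norm_mult)
  have "(\<Sum>i\<in>I. z i * cnj u) = of_real n * (u * cnj u)"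
    using su by (simp add: sum_distrib_right[symmetric])
  also have "u * cnj u = 1" using complex_norm_square[of u] u by simp
  finally have S: "(\<Sum>i\<in>I. z i * cnj u) = of_real n" by simp
  have "(\<Sum>i\<in>I. Re (z i * cnj u)) = Re (\<Sum>i\<in>I. z i * cnj u)" by (rule Re_sum[symmetric])
  then have "(\<Sum>i\<in>I. Re (z i * cnj u)) = n" unfolding S by simp
  then have s0: "(\<Sum>i\<in>I. 1 - Re (z i * cnj u)) = 0" by (simp add: sum_subtractf n_def)
  have "z i = u" if i: "i \<in> I" for i
  proof -
    have "1 - Re (z i * cnj u) = 0"
      using s0 le i fin sum_nonneg_eq_0_iff[of I "\<lambda>i. 1 - Re (z i * cnj u)"] by auto
    then have re: "Re (z i * cnj u) = 1" by simp
    have "cmod (z i * cnj u) = 1" using unit[OF i] u by (simp add: norm_mult)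
    then have "(Re (z i * cnj u))\<^sup>2 + (Im (z i * cnj u))\<^sup>2 = 1" by (simp add: cmod_def)
    then have "Im (z i * cnj u) = 0" unfolding re by simp
    then have "z i * cnj u = 1" using re by (simp add: complex_eq_iff)
    then have "z i * (cnj u * u) = u" by (simp add: mult.assoc[symmetric])
    moreover have "cnj u * u = 1" using complex_norm_square[of u] u by (simp add: mult.commute)
    ultimately show ?thesis by simp
  qed
  then show ?thesis using ij by simp
qed

lemma invariant_subspace_sum:
  assumes W: "invariant_subspace G d \<rho> W" and v: "\<And>a. a \<in> S \<Longrightarrow> v a \<in> W" and fin: "finite S"
  shows "vec d (\<lambda>i. \<Sum>a\<in>S. c a * v a $ i) \<in> W"
  using fin v
proof (induction S rule: finite_induct)
  case empty
  have "vec d (\<lambda>i. \<Sum>a\<in>{}. c a * v a $ i) = 0\<^sub>v d" by auto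
  then show ?case using W unfolding invariant_subspace_def by (metis (no_types, lifting))
next
  case (insert a S)
  have sub: "W \<subseteq> carrier_vec d" and add: "\<And>x y. x \<in> W \<Longrightarrow> y \<in> W \<Longrightarrow> x + y \<in> W" and sc: "\<And>c x. x \<in> W \<Longrightarrow> c \<cdot>\<^sub>v x \<in> W"
    using W unfolding invariant_subspace_def by blast+
  have va: "v a \<in> W" "v a \<in> carrier_vec d" using insert.prems sub by auto
  have "vec d (\<lambda>i. \<Sum>a\<in>insert a S. c a * v a $ i) = c a \<cdot>\<^sub>v v a + vec d (\<lambda>i. \<Sum>a\<in>S. c a * v a $ i)"
    using insert.hyps va(2) by (intro eq_vecI) auto
  moreover have "vec d (\<lambda>i. \<Sum>a\<in>S. c a * v a $ i) \<in> W" by (rule insert.IH) (use insert.prems in auto)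
  ultimately show ?case using add sc va(1) by simp
qed

text \<open>\<open>separated\<close> says that the conjugates of \<open>\<theta>\<close> by the
  transversal are pairwise distinct, which is Mackey's criterion for induction from a normal
  subgroup.\<close>

locale normal_induced_character = induced_character +
  assumes fin: "finite (carrier G)" and normal: "A \<lhd> G"
    and separated: "\<And>i j. i < k \<Longrightarrow> j < k \<Longrightarrow> i \<noteq> j \<Longrightarrow> \<exists>a\<in>A. \<theta> (inv (t i) \<otimes> a \<otimes> t i) \<noteq> \<theta> (inv (t j) \<otimes> a \<otimes> t j)"
    and k0: "k > 0"
begin

definition conj_char :: "nat \<Rightarrow> 'a \<Rightarrow> complex" where
  "conj_char i = (\<lambda>a. if a \<in> A then \<theta> (inv (t i) \<otimes> a \<otimes> t i) else 0)"

lemma A_carrier: "a \<in> A \<Longrightarrow> a \<in> carrier G"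
  by (rule subgroup.mem_carrier[OF A])

lemma conj_mem: "a \<in> A \<Longrightarrow> g \<in> carrier G \<Longrightarrow> inv g \<otimes> a \<otimes> g \<in> A"
  using normal normal_inv_iff[of A] by (metis inv_closed inv_inv)

lemma conj_mem_iff:
  assumes "a \<in> carrier G" "g \<in> carrier G"
  shows "inv g \<otimes> a \<otimes> g \<in> A \<longleftrightarrow> a \<in> A"
proof
  assume "inv g \<otimes> a \<otimes> g \<in> A"
  then have "inv (inv g) \<otimes> (inv g \<otimes> a \<otimes> g) \<otimes> inv g \<in> A" using conj_mem[of _ "inv g"] assms by simp
  moreover have "inv (inv g) \<otimes> (inv g \<otimes> a \<otimes> g) \<otimes> inv g = a"
  proof -
    have "g \<otimes> (inv g \<otimes> a) = a" using assms by (simp add: m_assoc[symmetric])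
    then show ?thesis using assms by (simp add: m_assoc)
  qed
  ultimately show "a \<in> A" by simp
qed (rule conj_mem[OF _ assms(2)])

lemma conj_char_mem:
  assumes i: "i < k"
  shows "conj_char i \<in> lin_chars G A {\<one>}"
  unfolding lin_chars_def
proof (intro CollectI conjI ballI allI impI)
  fix x y assume xy: "x \<in> A" "y \<in> A"
  have ti: "t i \<in> carrier G" by (rule t[OF i])
  have c: "x \<in> carrier G" "y \<in> carrier G" using A_carrier xy by blast+
  have "t i \<otimes> (inv (t i) \<otimes> (y \<otimes> t i)) = y \<otimes> t i" using ti c by (simp add: m_assoc[symmetric])
  then have "(inv (t i) \<otimes> x \<otimes> t i) \<otimes> (inv (t i) \<otimes> y \<otimes> t i) = inv (t i) \<otimes> (x \<otimes> y) \<otimes> t i"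
    using ti c by (simp add: m_assoc)
  then show "conj_char i (x \<otimes> y) = conj_char i x * conj_char i y"
    using lin_charsD(1)[OF th conj_mem[OF xy(1) ti] conj_mem[OF xy(2) ti]] xy subgroup.m_closed[OF A xy]
    by (simp add: conj_char_def)
next
  fix x assume "x \<in> {\<one>}"
  then show "conj_char i x = 1" using t[OF i] subgroup.one_closed[OF A] th_one by (simp add: conj_char_def)
qed (simp add: conj_char_def)

lemma ind_rep_diagonal:
  assumes a: "a \<in> A" and ij: "i < k" "j < k"
  shows "ind_rep k t \<theta> a $$ (i, j) = (if i = j then conj_char i a else 0)"
proof (cases "i = j")
  case False
  have c: "t i \<in> carrier G" "t j \<in> carrier G" "a \<in> carrier G" using t ij A_carrier[OF a] by simp_all
  have "inv (t i) \<otimes> a \<otimes> t j \<notin> A"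
  proof
    assume h: "inv (t i) \<otimes> a \<otimes> t j \<in> A"
    have "inv (inv (t i) \<otimes> a \<otimes> t i) \<otimes> (inv (t i) \<otimes> a \<otimes> t j) \<in> A"
      using h conj_mem[OF a c(1)] A by (simp add: subgroup.m_closed subgroup.m_inv_closed)
    moreover have "inv (inv (t i) \<otimes> a \<otimes> t i) \<otimes> (inv (t i) \<otimes> a \<otimes> t j) = inv (t i) \<otimes> t j"
    proof -
      have "t i \<otimes> (inv (t i) \<otimes> (a \<otimes> t j)) = a \<otimes> t j" "inv a \<otimes> (a \<otimes> t j) = t j" using c by (simp_all add: m_assoc[symmetric])
      then show ?thesis using c by (simp add: m_assoc inv_mult_group)
    qed
    ultimately show False using transversal_eq_iff[OF ij] False by simp
  qed
  then show ?thesis using False ij lin_charsD(3)[OF th] by (simp add: ind_rep_def)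
qed (use ij a in \<open>simp add: ind_rep_def conj_char_def\<close>)

lemma conj_char_orthogonal:
  assumes ij: "i < k" "j < k"
  shows "(\<Sum>a\<in>A. inverse (conj_char j a) * conj_char i a) = (if i = j then of_nat (card A) else 0)"
proof (cases "i = j")
  case True
  have "inverse (conj_char j a) * conj_char i a = 1" if "a \<in> A" for a
    using lin_chars_nz[OF A conj_char_mem[OF ij(2)] _ that] True by simp
  then show ?thesis using True by simp
next
  case False
  obtain a where a: "a \<in> A" "conj_char i a \<noteq> conj_char j a" using separated[OF ij False] by (auto simp: conj_char_def)
  have m: "(\<lambda>x. inverse (conj_char j x) * conj_char i x) \<in> lin_chars G A {\<one>}"
    by (rule lin_chars_mult[OF lin_chars_inverse[OF conj_char_mem[OF ij(2)]] conj_char_mem[OF ij(1)]])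
  have "conj_char j a \<noteq> 0" using lin_chars_nz[OF A conj_char_mem[OF ij(2)] _ a(1)] by simp
  then have "inverse (conj_char j a) * conj_char i a \<noteq> 1" using a(2) by (simp add: field_simps)
  then show ?thesis using lin_chars_sum_eq_0[OF A m a(1)] False by simp
qed

text \<open>On \<open>A\<close> the matrices are diagonal with distinct characters as entries, so
  averaging a vector against one of them isolates one coordinate; the transversal then carries this
  basis vector to all the others.\<close>

lemma ind_rep_irreducible: "irreducible_rep G k (ind_rep k t \<theta>)"
  unfolding irreducible_rep_def
proof (intro conjI allI impI ind_rep_is_rep k0)
  fix W assume W: "invariant_subspace G k (ind_rep k t \<theta>) W"
  let ?R = "ind_rep k t \<theta>"
  have sub: "W \<subseteq> carrier_vec k" and z: "0\<^sub>v k \<in> W"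
    and sc: "\<And>c x. x \<in> W \<Longrightarrow> c \<cdot>\<^sub>v x \<in> W" and inv: "\<And>g v. g \<in> carrier G \<Longrightarrow> v \<in> W \<Longrightarrow> ?R g *\<^sub>v v \<in> W"
    using W unfolding invariant_subspace_def by blast+
  have finA: "finite A" by (rule finite_subset[OF subgroup.subset[OF A] fin])
  have A0: "card A > 0" using finA subgroup.one_closed[OF A] by (auto simp: card_gt_0_iff)
  show "W = {0\<^sub>v k} \<or> W = carrier_vec k"
  proof (cases "W = {0\<^sub>v k}")
    case False
    then obtain v where v: "v \<in> W" "v \<noteq> 0\<^sub>v k" using z by blast
    have vk: "v \<in> carrier_vec k" using v(1) sub by blast
    obtain j where j: "j < k" "v $ j \<noteq> 0"
    proof -
      have "\<not> (\<forall>j<k. v $ j = 0)"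
      proof
        assume "\<forall>j<k. v $ j = 0"
        then have "v = 0\<^sub>v k" using vk by (intro eq_vecI) auto
        then show False using v(2) by simp
      qed
      then show thesis using that by blast
    qed
    have Rv: "(?R a *\<^sub>v v) $ i = conj_char i a * v $ i" if a: "a \<in> A" and i: "i < k" for a i
    proof -
      have "(?R a *\<^sub>v v) $ i = (\<Sum>l<k. ?R a $$ (i, l) * v $ l)"
        using i vk by (simp add: ind_rep_def scalar_prod_def atLeast0LessThan)
      also have "\<dots> = (\<Sum>l<k. if i = l then conj_char i a * v $ l else 0)"
        by (intro sum.cong refl) (simp add: ind_rep_diagonal[OF a i])
      also have "\<dots> = conj_char i a * v $ i" using i by simp
      finally show ?thesis .
    qed
    \<comment> \<open>The projection of \<open>v\<close> to the \<open>j\<close>-th coordinate up to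
      the factor \<open>card A\<close>, obtained as a combination of images of \<open>v\<close> and
      hence in \<open>W\<close>.\<close>
    define u where "u = vec k (\<lambda>i. \<Sum>a\<in>A. inverse (conj_char j a) * (?R a *\<^sub>v v) $ i)"
    have uW: "u \<in> W"
      unfolding u_def by (rule invariant_subspace_sum[OF W inv[OF A_carrier v(1)] finA])
    have "u = (of_nat (card A) * v $ j) \<cdot>\<^sub>v unit_vec k j"
    proof (rule eq_vecI)
      fix i assume "i < dim_vec ((of_nat (card A) * v $ j) \<cdot>\<^sub>v unit_vec k j :: complex vec)"
      then have i: "i < k" by simp
      have "u $ i = (\<Sum>a\<in>A. inverse (conj_char j a) * conj_char i a) * v $ i"
        using i by (simp add: u_def Rv sum_distrib_right mult.assoc)
      then show "u $ i = ((of_nat (card A) * v $ j) \<cdot>\<^sub>v unit_vec k j) $ i"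
        using i j(1) conj_char_orthogonal[OF i j(1)] by (simp add: unit_vec_def)
    qed (simp add: u_def)
    moreover have "inverse c \<cdot>\<^sub>v (c \<cdot>\<^sub>v unit_vec k j) = (unit_vec k j :: complex vec)" if "c \<noteq> 0" for c
      using that by (simp add: smult_smult_assoc)
    moreover have "of_nat (card A) * v $ j \<noteq> 0" using A0 j(2) by simp
    ultimately have "inverse (of_nat (card A) * v $ j) \<cdot>\<^sub>v u = unit_vec k j" by metis
    then have ej: "unit_vec k j \<in> W" using sc[OF uW] by metis
    have ei: "unit_vec k i \<in> W" if i: "i < k" for i
    proof -
      have c: "t i \<in> carrier G" "t j \<in> carrier G" using t i j(1) by simp_all
      \<comment> \<open>Left multiplication by \<open>t i * inv (t j)\<close> sends the coset of
        \<open>t j\<close> to that of \<open>t i\<close>, with coefficient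
        \<open>\<theta> \<one> = 1\<close>.\<close>
      have "?R (t i \<otimes> inv (t j)) *\<^sub>v unit_vec k j = unit_vec k i"
      proof (rule eq_vecI)
        fix l assume "l < dim_vec (unit_vec k i :: complex vec)"
        then have l: "l < k" by simp
        have tl: "t l \<in> carrier G" by (rule t[OF l])
        have "(?R (t i \<otimes> inv (t j)) *\<^sub>v unit_vec k j) $ l = \<theta> (inv (t l) \<otimes> (t i \<otimes> inv (t j)) \<otimes> t j)"
          using l j(1) by (simp add: ind_rep_def)
        also have "inv (t l) \<otimes> (t i \<otimes> inv (t j)) \<otimes> t j = inv (t l) \<otimes> t i" using c tl by (simp add: m_assoc)
        also have "\<theta> (inv (t l) \<otimes> t i) = (if l = i then 1 else 0)"
          using transversal_eq_iff[OF l i] lin_charsD(3)[OF th, of "inv (t l) \<otimes> t i"] c th_one by auto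
        finally show "(?R (t i \<otimes> inv (t j)) *\<^sub>v unit_vec k j) $ l = unit_vec k i $ l" using l i by (simp add: unit_vec_def)
      qed (simp add: ind_rep_def)
      then show ?thesis using inv[OF _ ej, of "t i \<otimes> inv (t j)"] c by simp
    qed
    have "w \<in> W" if w: "w \<in> carrier_vec k" for w
    proof -
      have "vec k (\<lambda>i. \<Sum>l\<in>{..<k}. w $ l * unit_vec k l $ i) \<in> W"
        by (rule invariant_subspace_sum[OF W]) (use ei in auto)
      moreover have "vec k (\<lambda>i. \<Sum>l\<in>{..<k}. w $ l * unit_vec k l $ i) = w"
      proof (rule eq_vecI)
        fix i assume "i < dim_vec w"
        then have i: "i < k" using w by simp
        have "(\<Sum>l\<in>{..<k}. w $ l * unit_vec k l $ i) = (\<Sum>l\<in>{..<k}. if l = i then w $ l else 0)"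
          using i by (intro sum.cong refl) (simp add: unit_vec_def)
        then show "vec k (\<lambda>i. \<Sum>l\<in>{..<k}. w $ l * unit_vec k l $ i) $ i = w $ i" using i by simp
      qed (use w in simp)
      ultimately show ?thesis by simp
    qed
    then show ?thesis using sub by blast
  qed simp
qed

definition ind_char :: "'a \<Rightarrow> complex" where
  "ind_char = (\<lambda>g. if g \<in> carrier G then mat_trace (ind_rep k t \<theta> g) else 0)"

lemma ind_char_irr: "ind_char \<in> irr_chars G"
  unfolding irr_chars_def ind_char_def
  by (intro CollectI exI[of _ k] exI[of _ "ind_rep k t \<theta>"] conjI ind_rep_irreducible refl)

lemma ind_char_on_A: "a \<in> A \<Longrightarrow> ind_char a = (\<Sum>i<k. conj_char i a)"
  using A_carrier by (simp add: ind_char_def ind_rep_trace conj_char_def)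

lemma ind_char_off_A:
  assumes "g \<notin> A"
  shows "ind_char g = 0"
proof (cases "g \<in> carrier G")
  case True
  have "\<theta> (inv (t i) \<otimes> g \<otimes> t i) = 0" if "i < k" for i
    using conj_mem_iff[OF True t[OF that]] assms lin_charsD(3)[OF th] by simp
  then show ?thesis by (simp add: ind_char_def ind_rep_trace)
qed (simp add: ind_char_def)

lemma ind_char_one: "ind_char \<one> = of_nat k"
  by (simp add: ind_char_def ind_rep_one mat_trace_def)

text \<open>On \<open>A\<close> the character is a sum of \<open>k\<close> numbers of modulus 1, and
  absolute value \<open>k\<close> is the equality case of the triangle inequality; outside
  \<open>A\<close> it is 0.\<close>

lemma char_center_conj_chars_equal:
  assumes a: "a \<in> char_center G ind_char" and ij: "i < k" "j < k"
  shows "a \<in> A" "conj_char i a = conj_char j a"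
proof -
  have n: "cmod (ind_char a) = of_nat k" using a ind_char_one by (simp add: char_center_def)
  show aA: "a \<in> A"
  proof (rule ccontr)
    assume "a \<notin> A"
    then show False using ind_char_off_A n k0 by simp
  qed
  show "conj_char i a = conj_char j a"
  proof (rule equal_if_cmod_sum_eq_card[of "{..<k}"])
    show "cmod (conj_char i a) = 1" if "i \<in> {..<k}" for i
      using lin_chars_norm[OF fin A conj_char_mem _ aA] that by simp
    show "cmod (\<Sum>i<k. conj_char i a) = of_nat (card {..<k})" using n ind_char_on_A[OF aA] by simp
  qed (use ij in auto)
qed

text \<open>The squared norm of the character over \<open>A\<close> is computed twice: orthogonality
  of the conjugates gives \<open>k * card A\<close>, while vanishing off its centre leaves
  \<open>k^2\<close> for each element of the centre. Inverses stand for complex conjugates of roots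
  of unity.\<close>

lemma card_char_center:
  assumes gvz: "\<And>g. g \<in> carrier G \<Longrightarrow> g \<notin> char_center G ind_char \<Longrightarrow> ind_char g = 0"
  shows "card A = k * card (char_center G ind_char)"
proof -
  let ?C = "char_center G ind_char"
  have finA: "finite A" by (rule finite_subset[OF subgroup.subset[OF A] fin])
  have CA: "?C \<subseteq> A" using char_center_conj_chars_equal(1)[OF _ k0 k0] by blast
  define S where "S = (\<Sum>a\<in>A. (\<Sum>j<k. inverse (conj_char j a)) * (\<Sum>i<k. conj_char i a))"
  have "S = (\<Sum>a\<in>A. \<Sum>j<k. \<Sum>i<k. inverse (conj_char j a) * conj_char i a)"
    unfolding S_def by (simp add: sum_product)
  also have "\<dots> = (\<Sum>j<k. \<Sum>i<k. \<Sum>a\<in>A. inverse (conj_char j a) * conj_char i a)"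
    by (subst sum.swap, subst (2) sum.swap) (rule refl)
  also have "\<dots> = (\<Sum>j<k. \<Sum>i<k. if i = j then of_nat (card A) else 0)"
    by (intro sum.cong refl) (simp add: conj_char_orthogonal)
  also have "\<dots> = of_nat (k * card A)" by simp
  finally have S1: "S = of_nat (k * card A)" .
  have "S = (\<Sum>a\<in>A. if a \<in> ?C then of_nat (k * k) else 0)"
    unfolding S_def
  proof (rule sum.cong[OF refl])
    fix a assume a: "a \<in> A"
    show "(\<Sum>j<k. inverse (conj_char j a)) * (\<Sum>i<k. conj_char i a) = (if a \<in> ?C then of_nat (k * k) else 0)"
    proof (cases "a \<in> ?C")
      case True
      have e: "conj_char i a = conj_char 0 a" if "i < k" for i
        by (rule char_center_conj_chars_equal(2)[OF True that k0])
      have "(\<Sum>j<k. inverse (conj_char j a)) = (\<Sum>j<k. inverse (conj_char 0 a))"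
        by (rule sum.cong[OF refl]) (metis e lessThan_iff)
      moreover have "(\<Sum>j<k. conj_char j a) = (\<Sum>j<k. conj_char 0 a)"
        by (rule sum.cong[OF refl]) (metis e lessThan_iff)
      moreover have "conj_char 0 a \<noteq> 0" using lin_chars_nz[OF A conj_char_mem[OF k0] _ a] by simp
      ultimately show ?thesis using True by simp
    next
      case False
      then have "ind_char a = 0" using gvz[OF A_carrier[OF a]] by blast
      then show ?thesis using False ind_char_on_A[OF a] by simp
    qed
  qed
  also have "\<dots> = of_nat (k * k * card ?C)"
    using finA CA by (simp add: sum.If_cases Int_absorb1)
  finally have "of_nat (k * card A) = (of_nat (k * k * card ?C) :: complex)" using S1 by simp
  then have "k * card A = k * k * card ?C" by (simp only: of_nat_eq_iff)
  then show ?thesis using k0 by simp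
qed

end

section \<open>Centre indices forced by nestedness\<close>

context group
begin

lemma card_prime_power_subgroup:
  assumes p: "Factorial_Ring.prime (p::nat)" and card: "card (carrier G) = p ^ e" and S: "subgroup S G"
  obtains f where "f \<le> e" "card S = p ^ f"
  using subgroup_card_dvd[OF S subgroup_self subgroup.subset[OF S]] card divides_primepow_nat[OF p] by metis

text \<open>A centre of index 1 or \<open>p\<close> would make the group commutative, the latter by
  \<open>commutative_if_central_prime_index\<close>.\<close>

lemma not_commutative_imp_center_index:
  assumes fin: "finite (carrier G)" and p: "Factorial_Ring.prime (p::nat)" and card: "card (carrier G) = p ^ e"
    and nc: "\<not> comm_group G" and f: "card (grp_center G) = p ^ f"
  shows "f + 2 \<le> e"
proof -
  have p1: "p > 1" using prime_gt_1_nat[OF p] .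
  have "f \<le> e"
    using card_mono[OF fin subgroup.subset[OF center_subgroup]] card f p1 by simp
  have comm: "comm_group G" if "\<And>x y. x \<in> carrier G \<Longrightarrow> y \<in> carrier G \<Longrightarrow> x \<otimes> y = y \<otimes> x"
    by (rule group_comm_groupI) (rule that)
  have "f \<noteq> e"
  proof
    assume "f = e"
    then have "grp_center G = carrier G"
      using card_subset_eq[OF fin subgroup.subset[OF center_subgroup]] card f by simp
    then have "x \<otimes> y = y \<otimes> x" if "x \<in> carrier G" "y \<in> carrier G" for x y
      using center_commutes[of x y] that by blast
    then show False using comm nc by blast
  qed
  moreover have "e \<noteq> Suc f"
  proof
    assume "e = Suc f"
    then have "card (carrier G) = p * card (grp_center G)" using card f by simp
    then have "x \<otimes> y = y \<otimes> x" if "x \<in> carrier G" "y \<in> carrier G" for x y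
      by (rule commutative_if_central_prime_index[OF fin center_subgroup subgroup_self subgroup.subset[OF center_subgroup] p _ center_commutes that])
    then show False using comm nc by blast
  qed
  ultimately show ?thesis using \<open>f \<le> e\<close> by linarith
qed

text \<open>A noninvariant character of an abelian normal subgroup \<open>A\<close> of index \<open>p\<close> induces irreducibly, and
  the center of the induced character has index \<open>p\<close> in \<open>A\<close>. By nestedness all these centers coincide;
  as the characters of \<open>A\<close> separate points, the common center is central in \<open>G\<close>.\<close>

lemma nested_GVZ_abelian_prime_index:
  assumes fin: "finite (carrier G)" and p: "Factorial_Ring.prime (p::nat)" and card: "card (carrier G) = p ^ e"
    and nc: "\<not> comm_group G" and gvz: "nested_GVZ G"
    and A: "A \<lhd> G" "card (carrier G) = p * card A"
    and comm: "\<And>a b. a \<in> A \<Longrightarrow> b \<in> A \<Longrightarrow> a \<otimes> b = b \<otimes> a"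
  shows "card (carrier G) = p\<^sup>2 * card (grp_center G)"
proof -
  have p0: "p > 0" and p1: "p > 1" using prime_gt_0_nat[OF p] prime_gt_1_nat[OF p] .
  have As: "subgroup A G" by (rule normal_imp_subgroup[OF A(1)])
  note Ac = subgroup.mem_carrier[OF As]
  have conjA: "inv g \<otimes> a \<otimes> g \<in> A" if "a \<in> A" "g \<in> carrier G" for a g
    using A(1) normal_inv_iff[of A] that by (metis inv_closed inv_inv)
  obtain t :: "nat \<Rightarrow> 'a" where t: "\<And>j. j < p \<Longrightarrow> t j \<in> carrier G"
    "\<And>g. g \<in> carrier G \<Longrightarrow> \<exists>!j. j < p \<and> inv (t j) \<otimes> g \<in> A"
    by (rule left_transversal_exists[OF fin As A(2)[symmetric]]) (assumption | rule that)+
  let ?L = "lin_chars G A {\<one>}"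
  define noninv where "noninv = (\<lambda>\<theta>. \<theta> \<in> ?L \<and> (\<exists>g\<in>carrier G. \<exists>a\<in>A. \<theta> (inv g \<otimes> a \<otimes> g) \<noteq> \<theta> a))"
  have main: "\<exists>\<chi>\<in>irr_chars G. card A = p * card (char_center G \<chi>) \<and>
      (\<forall>z\<in>char_center G \<chi>. z \<in> A \<and> (\<forall>g\<in>carrier G. \<theta> (inv g \<otimes> z \<otimes> g) = \<theta> z))" if ni: "noninv \<theta>" for \<theta>
  proof -
    have th: "\<theta> \<in> ?L" using ni by (simp add: noninv_def)
    interpret ind: induced_character G A p t \<theta>
      by (intro induced_character.intro induced_character_axioms.intro is_group As t th)
    have conj_A: "\<theta> (inv b \<otimes> a \<otimes> b) = \<theta> a" if a: "a \<in> A" and b: "b \<in> A" for a b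
    proof -
      have "inv b \<otimes> a \<otimes> b = a" using comm[OF a b] Ac[OF a] Ac[OF b] by (simp add: m_assoc) (simp add: m_assoc[symmetric])
      then show ?thesis by simp
    qed
    \<comment> \<open>The inertia group of \<open>\<theta>\<close>. It contains \<open>A\<close>
      because \<open>A\<close> is abelian, and is not \<open>G\<close> because
      \<open>\<theta>\<close> is not invariant, so the prime index leaves only
      \<open>A\<close>.\<close>
    define S where "S = {g \<in> carrier G. \<forall>a\<in>A. \<theta> (inv g \<otimes> a \<otimes> g) = \<theta> a}"
    have conj2: "inv (g \<otimes> h) \<otimes> a \<otimes> (g \<otimes> h) = inv h \<otimes> (inv g \<otimes> a \<otimes> g) \<otimes> h"
      if "g \<in> carrier G" "h \<in> carrier G" "a \<in> carrier G" for g h a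
      using that by (simp add: inv_mult_group m_assoc)
    have S: "subgroup S G"
    proof (rule finite_subgroupI[OF fin])
      show "S \<subseteq> carrier G" by (auto simp: S_def)
      show "\<one> \<in> S" using Ac by (simp add: S_def)
      fix g h assume "g \<in> S" "h \<in> S"
      then have gh: "g \<in> carrier G" "h \<in> carrier G" "\<And>a. a \<in> A \<Longrightarrow> \<theta> (inv g \<otimes> a \<otimes> g) = \<theta> a" "\<And>a. a \<in> A \<Longrightarrow> \<theta> (inv h \<otimes> a \<otimes> h) = \<theta> a"
        by (simp_all add: S_def)
      have "\<theta> (inv (g \<otimes> h) \<otimes> a \<otimes> (g \<otimes> h)) = \<theta> a" if a: "a \<in> A" for a
        unfolding conj2[OF gh(1,2) Ac[OF a]] gh(4)[OF conjA[OF a gh(1)]] by (rule gh(3)[OF a])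
      then show "g \<otimes> h \<in> S" using gh(1,2) by (simp add: S_def)
    qed
    have AS: "A \<subseteq> S" using conj_A Ac by (auto simp: S_def)
    have "S \<noteq> carrier G" using ni by (auto simp: S_def noninv_def)
    then have SA: "A = S"
      using subgroup_jump[OF fin As S subgroup_self AS subgroup.subset[OF S] _ p A(2)] by blast
    \<comment> \<open>Equal conjugates by \<open>t i\<close> and \<open>t j\<close> put
      \<open>inv (t i) * t j\<close> into the inertia group \<open>A\<close>, which the transversal
      permits only for \<open>i = j\<close>.\<close>
    have sep: "\<exists>a\<in>A. \<theta> (inv (t i) \<otimes> a \<otimes> t i) \<noteq> \<theta> (inv (t j) \<otimes> a \<otimes> t j)"
      if ij: "i < p" "j < p" "i \<noteq> j" for i j
    proof (rule ccontr)
      assume "\<not> (\<exists>a\<in>A. \<theta> (inv (t i) \<otimes> a \<otimes> t i) \<noteq> \<theta> (inv (t j) \<otimes> a \<otimes> t j))"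
      then have eq: "\<theta> (inv (t i) \<otimes> a \<otimes> t i) = \<theta> (inv (t j) \<otimes> a \<otimes> t j)" if "a \<in> A" for a using that by blast
      have c: "t i \<in> carrier G" "t j \<in> carrier G" using t(1) ij by simp_all
      have "\<theta> (inv (inv (t i) \<otimes> t j) \<otimes> b \<otimes> (inv (t i) \<otimes> t j)) = \<theta> b" if b: "b \<in> A" for b
      proof -
        let ?a = "inv (inv (t i)) \<otimes> b \<otimes> inv (t i)"
        have aA: "?a \<in> A" by (rule conjA[OF b inv_closed[OF c(1)]])
        have "inv (t i) \<otimes> ?a \<otimes> t i = b"
        proof -
          have "inv (t i) \<otimes> (t i \<otimes> b) = b" using c(1) Ac[OF b] by (simp add: m_assoc[symmetric])
          then show ?thesis using c(1) Ac[OF b] by (simp add: m_assoc)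
        qed
        moreover have "inv (t j) \<otimes> ?a \<otimes> t j = inv (inv (t i) \<otimes> t j) \<otimes> b \<otimes> (inv (t i) \<otimes> t j)"
          using c Ac[OF b] by (simp add: inv_mult_group m_assoc)
        ultimately show ?thesis using eq[OF aA] by simp
      qed
      then have "inv (t i) \<otimes> t j \<in> S" using c by (simp add: S_def)
      then show False using SA ind.transversal_eq_iff[OF ij(1,2)] ij(3) by simp
    qed
    interpret ind: normal_induced_character G A p t \<theta>
      by (intro normal_induced_character.intro normal_induced_character_axioms.intro ind.induced_character_axioms fin A(1) sep p0)
    let ?\<chi> = "ind.ind_char"
    have vanish: "?\<chi> g = 0" if "g \<in> carrier G" "g \<notin> char_center G ?\<chi>" for g
      using gvz ind.ind_char_irr that unfolding nested_GVZ_def by blast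
    have "\<theta> (inv g \<otimes> z \<otimes> g) = \<theta> z" if z: "z \<in> char_center G ?\<chi>" and g: "g \<in> carrier G" for z g
    proof -
      have zA: "z \<in> A" by (rule ind.char_center_conj_chars_equal(1)[OF z p0 p0])
      \<comment> \<open>A conjugate of \<open>\<theta>\<close> depends only on the coset, so
        conjugation by any \<open>h\<close> amounts to one by some \<open>t i\<close>, and on the
        centre of the induced character these all agree.\<close>
      have coset: "\<exists>i<p. \<theta> (inv h \<otimes> z \<otimes> h) = ind.conj_char i z" if h: "h \<in> carrier G" for h
      proof -
        obtain i where i: "i < p" "inv (t i) \<otimes> h \<in> A" using t(2)[OF h] by blast
        have c: "t i \<in> carrier G" by (rule t(1)[OF i(1)])
        have "h = t i \<otimes> (inv (t i) \<otimes> h)" using c h by (simp add: m_assoc[symmetric])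
        then have "inv h \<otimes> z \<otimes> h = inv (inv (t i) \<otimes> h) \<otimes> (inv (t i) \<otimes> z \<otimes> t i) \<otimes> (inv (t i) \<otimes> h)"
          using conj2[OF c Ac[OF i(2)] Ac[OF zA]] by simp
        then have "\<theta> (inv h \<otimes> z \<otimes> h) = \<theta> (inv (t i) \<otimes> z \<otimes> t i)" using conj_A[OF conjA[OF zA c] i(2)] by simp
        then show ?thesis using i(1) zA by (auto simp: ind.conj_char_def)
      qed
      obtain i where i: "i < p" "\<theta> (inv g \<otimes> z \<otimes> g) = ind.conj_char i z" using coset[OF g] by blast
      obtain j where j: "j < p" "\<theta> (inv \<one> \<otimes> z \<otimes> \<one>) = ind.conj_char j z" using coset[OF one_closed] by blast
      have "ind.conj_char i z = ind.conj_char j z" by (rule ind.char_center_conj_chars_equal(2)[OF z i(1) j(1)])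
      then show ?thesis using i(2) j(2) Ac[OF zA] by simp
    qed
    moreover have "z \<in> A" if "z \<in> char_center G ?\<chi>" for z
      by (rule ind.char_center_conj_chars_equal(1)[OF that p0 p0])
    ultimately show ?thesis using ind.card_char_center[OF vanish] ind.ind_char_irr by (intro bexI[of _ ?\<chi>]) auto
  qed
  have finA: "finite A" by (rule finite_subset[OF subgroup.subset[OF As] fin])
  interpret K: comm_group "G\<lparr>carrier := A\<rparr>" by (rule comm_group_subgroup[OF As comm])
  have separate: "x = y" if xy: "x \<in> A" "y \<in> A" and all: "\<And>\<theta>. \<theta> \<in> ?L \<Longrightarrow> \<theta> x = \<theta> y" for x y
  proof (rule ccontr)
    assume ne: "x \<noteq> y"
    have iy: "inv y \<in> A" by (rule subgroup.m_inv_closed[OF As xy(2)])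
    have xyA: "x \<otimes> inv y \<in> A" by (rule subgroup.m_closed[OF As xy(1) iy])
    have "x \<otimes> inv y \<noteq> \<one>"
    proof
      assume "x \<otimes> inv y = \<one>"
      then have "x = inv (inv y)" using inv_equality Ac xy(1) Ac iy by metis
      then show False using ne Ac[OF xy(2)] by simp
    qed
    then obtain \<theta> where th: "\<theta> \<in> ?L" "\<theta> (x \<otimes> inv y) \<noteq> 1"
      using K.lin_chars_separate[of "x \<otimes> inv y"] finA xyA by (auto simp: lin_chars_subgroup_eq)
    have "\<theta> (x \<otimes> inv y) = \<theta> x * inverse (\<theta> y)"
      using lin_charsD(1)[OF th(1) xy(1) iy] lin_chars_inv[OF As th(1) _ xy(2)] by simp
    also have "\<dots> = 1" using all[OF th(1)] lin_chars_nz[OF As th(1) _ xy(2)] by simp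
    finally show False using th(2) by simp
  qed
  have "\<exists>\<theta>. noninv \<theta>"
  proof (rule ccontr)
    \<comment> \<open>If all characters of \<open>A\<close> were invariant, separation of points
      would make \<open>A\<close> central, and a central subgroup of prime index makes the group
      commutative.\<close>
    assume none: "\<not> (\<exists>\<theta>. noninv \<theta>)"
    have "a \<otimes> g = g \<otimes> a" if a: "a \<in> A" and g: "g \<in> carrier G" for a g
    proof -
      have "inv g \<otimes> a \<otimes> g = a"
        by (rule separate[OF conjA[OF a g] a]) (use none a g in \<open>auto simp: noninv_def\<close>)
      then have "g \<otimes> (inv g \<otimes> a \<otimes> g) = g \<otimes> a" by simp
      moreover have "g \<otimes> (inv g \<otimes> a \<otimes> g) = a \<otimes> g" using Ac[OF a] g by (simp add: m_assoc[symmetric])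
      ultimately show ?thesis by simp
    qed
    then have "x \<otimes> y = y \<otimes> x" if "x \<in> carrier G" "y \<in> carrier G" for x y
      using commutative_if_central_prime_index[OF fin As subgroup_self subgroup.subset[OF As] p A(2) _ that] by blast
    then have "comm_group G" by (intro group_comm_groupI) blast
    then show False using nc by blast
  qed
  then obtain \<theta>0 where n0: "noninv \<theta>0" by blast
  obtain \<chi>0 where c0: "\<chi>0 \<in> irr_chars G" "card A = p * card (char_center G \<chi>0)"
    "\<And>z. z \<in> char_center G \<chi>0 \<Longrightarrow> z \<in> A" using main[OF n0] by blast
  let ?C = "char_center G \<chi>0"
  have finC: "finite (char_center G \<chi>)" for \<chi> using fin by (simp add: char_center_def)
  have "?C \<subseteq> grp_center G"
  proof
    fix z assume z: "z \<in> ?C"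
    have zA: "z \<in> A" by (rule c0(3)[OF z])
    have "inv g \<otimes> z \<otimes> g = z" if g: "g \<in> carrier G" for g
    proof (rule separate[OF conjA[OF zA g] zA])
      fix \<theta> assume th: "\<theta> \<in> ?L"
      show "\<theta> (inv g \<otimes> z \<otimes> g) = \<theta> z"
      proof (cases "noninv \<theta>")
        case True
        obtain \<chi> where c: "\<chi> \<in> irr_chars G" "card A = p * card (char_center G \<chi>)"
          "\<And>z g. z \<in> char_center G \<chi> \<Longrightarrow> g \<in> carrier G \<Longrightarrow> \<theta> (inv g \<otimes> z \<otimes> g) = \<theta> z" using main[OF True] by blast
        \<comment> \<open>All these centres have index \<open>p\<close> in \<open>A\<close>;
          comparable finite sets of equal size coincide, so \<open>\<theta>\<close> is invariant on
          the common centre \<open>?C\<close>.\<close>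
        have "card (char_center G \<chi>) = card ?C" using c(2) c0(2) p0 by simp
        moreover have "char_center G \<chi> \<subseteq> ?C \<or> ?C \<subseteq> char_center G \<chi>"
          using gvz c(1) c0(1) unfolding nested_GVZ_def by blast
        ultimately have "char_center G \<chi> = ?C" using finC card_subset_eq by metis
        then show ?thesis using c(3)[of z g] z g by simp
      next
        case False
        then show ?thesis using th zA g by (auto simp: noninv_def)
      qed
    qed
    then have "g \<otimes> (inv g \<otimes> z \<otimes> g) = g \<otimes> z" if "g \<in> carrier G" for g using that by simp
    moreover have "g \<otimes> (inv g \<otimes> z \<otimes> g) = z \<otimes> g" if "g \<in> carrier G" for g using Ac[OF zA] that by (simp add: m_assoc[symmetric])
    ultimately show "z \<in> grp_center G" using Ac[OF zA] unfolding grp_center_def by simp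
  qed
  then have le: "card ?C \<le> card (grp_center G)"
    using card_mono finite_subset[OF subgroup.subset[OF center_subgroup] fin] by blast
  obtain f where f: "f \<le> e" "card (grp_center G) = p ^ f" by (rule card_prime_power_subgroup[OF p card center_subgroup])
  have fe: "f + 2 \<le> e" by (rule not_commutative_imp_center_index[OF fin p card nc f(2)])
  \<comment> \<open>The central \<open>?C\<close> already has index \<open>p^2\<close> in
    \<open>G\<close>, and the centre of a noncommutative group has no smaller index.\<close>
  have "p ^ e = p\<^sup>2 * card ?C" using A(2) c0(2) card by (simp add: power2_eq_square)
  also have "\<dots> \<le> p\<^sup>2 * p ^ f" using le f(2) by simp
  also have "\<dots> = p ^ (f + 2)" by (simp add: power_add power2_eq_square)
  finally have "p ^ e \<le> p ^ (f + 2)" .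
  then have "e \<le> f + 2" by (rule power_le_imp_le_exp[OF p1])
  then have "e = f + 2" using fe by linarith
  then show ?thesis using card f(2) by (simp only: power_add mult.commute)
qed

text \<open>The class equation: the class of a noncentral element has size a power of
  \<open>p\<close> other than 1, so \<open>p\<close> divides the number of noncentral elements as
  well as the order of the group.\<close>

lemma prime_dvd_card_center:
  assumes fin: "finite (carrier G)" and p: "Factorial_Ring.prime (p::nat)" and card: "card (carrier G) = p ^ e" and e: "e > 0"
  shows "p dvd card (grp_center G)"
proof -
  let ?Z = "grp_center G"
  define cl where "cl = (\<lambda>x. {g \<otimes> x \<otimes> inv g | g. g \<in> carrier G})"
  have self: "x \<in> cl x" if "x \<in> carrier G" for x
  proof -
    have "x = \<one> \<otimes> x \<otimes> inv \<one>" using that by simp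
    then show ?thesis unfolding cl_def by blast
  qed
  have sub: "cl y \<subseteq> cl x" if x: "x \<in> carrier G" and y: "y \<in> cl x" for x y
  proof
    fix w assume "w \<in> cl y"
    then obtain g h where gh: "g \<in> carrier G" "h \<in> carrier G" "w = g \<otimes> y \<otimes> inv g" "y = h \<otimes> x \<otimes> inv h"
      using y unfolding cl_def by blast
    then have "w = (g \<otimes> h) \<otimes> x \<otimes> inv (g \<otimes> h)" using x by (simp add: inv_mult_group m_assoc)
    then show "w \<in> cl x" using gh unfolding cl_def by blast
  qed
  have sym: "x \<in> cl y" if x: "x \<in> carrier G" and y: "y \<in> cl x" for x y
  proof -
    obtain h where h: "h \<in> carrier G" "y = h \<otimes> x \<otimes> inv h" using y unfolding cl_def by blast
    have "inv h \<otimes> (h \<otimes> x) = x" using h(1) x by (simp add: m_assoc[symmetric])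
    then have "x = inv h \<otimes> y \<otimes> inv (inv h)" using h x by (simp add: m_assoc)
    then show ?thesis using h(1) unfolding cl_def by blast
  qed
  have clc: "cl x \<subseteq> carrier G" if "x \<in> carrier G" for x using that by (auto simp: cl_def)
  have cl_eq: "cl y = cl x" if "x \<in> carrier G" "y \<in> cl x" for x y
    using sub[OF that] sub[OF _ sym[OF that]] clc[OF that(1)] that(2) by blast
  have card_cl: "card (carrier G) = card (cl x) * card (centralizer x)" if x: "x \<in> carrier G" for x
  proof -
    define f where "f = (\<lambda>g. inv g \<otimes> x \<otimes> g)"
    have "f ` carrier G = cl x"
    proof
      show "f ` carrier G \<subseteq> cl x"
      proof
        fix y assume "y \<in> f ` carrier G"
        then obtain g where g: "g \<in> carrier G" "y = inv g \<otimes> x \<otimes> inv (inv g)" by (auto simp: f_def)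
        then show "y \<in> cl x" unfolding cl_def using inv_closed by blast
      qed
      show "cl x \<subseteq> f ` carrier G"
      proof
        fix y assume "y \<in> cl x"
        then obtain g where g: "g \<in> carrier G" "y = f (inv g)" by (auto simp: f_def cl_def)
        then show "y \<in> f ` carrier G" using inv_closed by blast
      qed
    qed
    moreover have "card (carrier G) = card (f ` carrier G) * card (centralizer x)"
    proof (rule card_fibres[OF fin centralizer_subgroup[OF fin x]])
      fix g h assume g: "g \<in> carrier G" and h: "h \<in> carrier G"
      have "f g = f h \<longleftrightarrow> g \<otimes> (inv g \<otimes> x \<otimes> g) \<otimes> inv h = g \<otimes> (inv h \<otimes> x \<otimes> h) \<otimes> inv h"
        using g h x unfolding f_def by (metis inv_closed l_cancel m_closed r_cancel)
      also have "g \<otimes> (inv g \<otimes> x \<otimes> g) \<otimes> inv h = x \<otimes> (g \<otimes> inv h)"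
      proof -
        have "g \<otimes> (inv g \<otimes> (x \<otimes> (g \<otimes> inv h))) = x \<otimes> (g \<otimes> inv h)" using g h x by (simp add: m_assoc[symmetric])
        then show ?thesis using g h x by (simp add: m_assoc)
      qed
      also have "g \<otimes> (inv h \<otimes> x \<otimes> h) \<otimes> inv h = g \<otimes> inv h \<otimes> x" using g h x by (simp add: m_assoc)
      finally show "f g = f h \<longleftrightarrow> g \<otimes> inv h \<in> centralizer x"
        using g h by (auto simp: centralizer_def)
    qed
    ultimately show ?thesis by simp
  qed
  have dvd: "p dvd card (cl x)" if x: "x \<in> carrier G" "x \<notin> ?Z" for x
  proof -
    have "card (cl x) dvd p ^ e" using card_cl[OF x(1)] card by (metis dvd_triv_left)
    then obtain i where i: "card (cl x) = p ^ i" using divides_primepow_nat[OF p] by blast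
    have "i \<noteq> 0"
    proof
      assume "i = 0"
      then have "card (centralizer x) = card (carrier G)" using card_cl[OF x(1)] i by simp
      then have "centralizer x = carrier G"
        using card_subset_eq[OF fin subgroup.subset[OF centralizer_subgroup[OF fin x(1)]]] by blast
      have "x \<otimes> g = g \<otimes> x" if "g \<in> carrier G" for g
      proof -
        have "g \<in> centralizer x" using that \<open>centralizer x = carrier G\<close> by simp
        then show ?thesis by (simp add: centralizer_def)
      qed
      then show False using x unfolding grp_center_def by blast
    qed
    then show ?thesis using i by simp
  qed
  let ?D = "carrier G - ?Z"
  have finD: "finite ?D" using fin by simp
  have D_cl: "cl x \<subseteq> ?D" if x: "x \<in> ?D" for x
  proof
    fix y assume y: "y \<in> cl x"
    have "y \<in> carrier G" using clc[of x] x y by blast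
    moreover have "y \<notin> ?Z"
    proof
      assume yZ: "y \<in> ?Z"
      obtain g where g: "g \<in> carrier G" "x = g \<otimes> y \<otimes> inv g" using sym[OF _ y] x unfolding cl_def by blast
      have "x = y \<otimes> g \<otimes> inv g" using g center_commutes[OF yZ g(1)] by simp
      also have "\<dots> = y" using g(1) \<open>y \<in> carrier G\<close> by (simp add: m_assoc)
      finally show False using x yZ by blast
    qed
    ultimately show "y \<in> ?D" by blast
  qed
  have "card ?D = (\<Sum>x\<in>?D. 1)" by simp
  also have "\<dots> = (\<Sum>c\<in>cl ` ?D. \<Sum>x\<in>{x \<in> ?D. cl x = c}. 1)" using finD by (rule sum.image_gen)
  also have "\<dots> = (\<Sum>c\<in>cl ` ?D. card c)"
  proof (rule sum.cong[OF refl])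
    fix c assume "c \<in> cl ` ?D"
    then obtain y where y: "y \<in> ?D" "c = cl y" by blast
    have "{x \<in> ?D. cl x = c} = c"
    proof
      show "{x \<in> ?D. cl x = c} \<subseteq> c" using self by blast
      show "c \<subseteq> {x \<in> ?D. cl x = c}" using D_cl[OF y(1)] cl_eq[of y] y by blast
    qed
    then show "(\<Sum>x\<in>{x \<in> ?D. cl x = c}. 1) = card c" by simp
  qed
  finally have "card ?D = (\<Sum>c\<in>cl ` ?D. card c)" .
  moreover have "p dvd (\<Sum>c\<in>cl ` ?D. card c)" by (rule dvd_sum) (use dvd in auto)
  ultimately have "p dvd card ?D" by simp
  moreover have "card (carrier G) = card ?Z + card ?D"
    using card_Un_disjoint[of ?Z ?D] finite_subset[OF subgroup.subset[OF center_subgroup] fin] finD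
      subgroup.subset[OF center_subgroup] by (simp add: Un_absorb1)
  moreover have "p dvd card (carrier G)" using card e by simp
  ultimately show ?thesis by (simp add: dvd_add_left_iff)
qed

end

lemma (in normal) card_FactGroup: "card (carrier (G Mod H)) * card H = card (carrier G)"
  using lagrange[OF subgroup_axioms] by (simp add: Coset.order_def FactGroup_def)

context group
begin

lemma comm_group_if_card_dvd_prime_square:
  assumes fin: "finite (carrier G)" and p: "Factorial_Ring.prime (p::nat)" and card: "card (carrier G) = p ^ e" and e: "e \<le> 2"
  shows "comm_group G"
proof (rule ccontr)
  assume nc: "\<not> comm_group G"
  obtain f where f: "f \<le> e" "card (grp_center G) = p ^ f" by (rule card_prime_power_subgroup[OF p card center_subgroup])
  have "f + 2 \<le> e" by (rule not_commutative_imp_center_index[OF fin p card nc f(2)])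
  then have "f = 0" "e > 0" using e by linarith+
  then have "p dvd 1" using prime_dvd_card_center[OF fin p card] f(2) by simp
  then show False using p by (simp add: prime_nat_iff)
qed

lemma comm_group_iff_center: "comm_group G \<longleftrightarrow> carrier G \<subseteq> grp_center G"
proof
  assume "comm_group G"
  then interpret C: comm_group G .
  show "carrier G \<subseteq> grp_center G" by (auto simp: grp_center_def C.m_comm)
next
  assume "carrier G \<subseteq> grp_center G"
  then show "comm_group G" by (intro group_comm_groupI) (use center_commutes in blast)
qed

lemma derived_subsetI:
  assumes S: "subgroup S G" and "\<And>a b. a \<in> carrier G \<Longrightarrow> b \<in> carrier G \<Longrightarrow> a \<otimes> b \<otimes> inv a \<otimes> inv b \<in> S"
  shows "derived G (carrier G) \<subseteq> S"
  unfolding derived_def by (rule generate_subgroup_incl[OF _ S]) (use assms(2) in blast)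

lemma derived_subset_if_quotient_commutative:
  assumes N: "N \<lhd> G" and comm: "comm_group (G Mod N)"
  shows "derived G (carrier G) \<subseteq> N"
proof (rule derived_subsetI[OF normal_imp_subgroup[OF N]])
  interpret Q: group "G Mod N" by (rule normal.factorgroup_is_group[OF N])
  fix a b assume a: "a \<in> carrier G" and b: "b \<in> carrier G"
  have "N #> b \<in> carrier (G Mod N)" using b by (auto simp: carrier_FactGroup)
  then have "N #> b \<in> grp_center (G Mod N)" using comm Q.comm_group_iff_center by blast
  then show "a \<otimes> b \<otimes> inv a \<otimes> inv b \<in> N" using coset_in_center_iff[OF N b] a by blast
qed

lemma comm_group_if_derived_trivial:
  assumes "derived G (carrier G) \<subseteq> {\<one>}"
  shows "comm_group G"
  by (rule group_comm_groupI) (use commutator_in_derived commutator_eq_one_iff assms in blast)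

lemma derived_eq_if_card_le_prime:
  assumes fin: "finite (carrier G)" and p: "Factorial_Ring.prime (p::nat)" and card: "card (carrier G) = p ^ e"
    and nc: "\<not> comm_group G" and P: "P \<subseteq> carrier G" "derived G (carrier G) \<subseteq> P" "card P \<le> p"
  shows "card (derived G (carrier G)) = p"
proof -
  let ?N = "derived G (carrier G)"
  have Ns: "subgroup ?N G" by (rule derived_is_subgroup[OF order_refl])
  obtain f where f: "f \<le> e" "card ?N = p ^ f" by (rule card_prime_power_subgroup[OF p card Ns])
  have "card ?N \<le> p ^ 1" using card_mono[OF finite_subset[OF P(1) fin] P(2)] P(3) by simp
  then have "f \<le> 1" unfolding f(2) by (rule power_le_imp_le_exp[OF prime_gt_1_nat[OF p]])
  moreover have "f \<noteq> 0"
  proof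
    assume "f = 0"
    then have "card ?N = 1" using f(2) by simp
    then obtain a where a: "?N = {a}" by (rule card_1_singletonE)
    then have "\<one> = a" using subgroup.one_closed[OF Ns] by (simp only: singleton_iff)
    then have "?N \<subseteq> {\<one>}" using a by simp
    then show False using comm_group_if_derived_trivial nc by blast
  qed
  ultimately show ?thesis using f(2) by (cases f) auto
qed

text \<open>For a noncentral \<open>x\<close>, taking commutators with \<open>x\<close> is a
  homomorphism whose kernel, the centralizer of \<open>x\<close>, is larger than the centre; so its
  image \<open>P\<close> has order at most \<open>p\<close>. Modulo \<open>P\<close> both
  \<open>x\<close> and the old centre become central, which leaves an index too small for a
  noncommutative group. Hence \<open>G'\<close> lies in \<open>P\<close>.\<close>

lemma derived_of_center_index_prime_square:
  assumes fin: "finite (carrier G)" and p: "Factorial_Ring.prime (p::nat)" and card: "card (carrier G) = p ^ e"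
    and nc: "\<not> comm_group G" and Z: "card (carrier G) = p\<^sup>2 * card (grp_center G)"
  shows "derived G (carrier G) \<subseteq> grp_center G" and "card (derived G (carrier G)) = p"
proof -
  let ?Z = "grp_center G"
  have p0: "p > 0" and p1: "p > 1" using prime_gt_0_nat[OF p] prime_gt_1_nat[OF p] .
  have Zc: "?Z \<subseteq> carrier G" by (rule subgroup.subset[OF center_subgroup])
  have finZ: "finite ?Z" by (rule finite_subset[OF Zc fin])
  have Z0: "card ?Z > 0" using finZ subgroup.one_closed[OF center_subgroup] by (auto simp: card_gt_0_iff)
  interpret Z: normal ?Z G by (rule center_normal)
  interpret Q: group "G Mod ?Z" by (rule Z.factorgroup_is_group)
  have "card (carrier (G Mod ?Z)) = p\<^sup>2" using Z.card_FactGroup Z Z0 by simp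
  then have Qc: "comm_group (G Mod ?Z)" by (rule Q.comm_group_if_card_dvd_prime_square[OF Z.finite_FactGroup[OF fin] p _ order_refl])
  show NZ: "derived G (carrier G) \<subseteq> ?Z" by (rule derived_subset_if_quotient_commutative[OF center_normal Qc])
  obtain x where x: "x \<in> carrier G" "x \<notin> ?Z" using nc comm_group_iff_center by blast
  define \<beta> where "\<beta> = (\<lambda>g. g \<otimes> x \<otimes> inv g \<otimes> inv x)"
  have bZ: "\<beta> g \<in> ?Z" if "g \<in> carrier G" for g
    using commutator_in_derived[OF that x(1)] NZ unfolding \<beta>_def by blast
  have hom: "\<beta> (g \<otimes> h) = \<beta> g \<otimes> \<beta> h" if "g \<in> carrier G" "h \<in> carrier G" for g h
    using commutator_mult_left[OF that x(1)] bZ[OF that(2)] by (simp add: \<beta>_def)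
  define P where "P = \<beta> ` carrier G"
  have PZ: "P \<subseteq> ?Z" using bZ by (auto simp: P_def)
  have P: "subgroup P G"
  proof (rule finite_subgroupI[OF fin])
    show "P \<subseteq> carrier G" using PZ Zc by blast
    have "\<beta> \<one> = \<one>" using x(1) by (simp add: \<beta>_def)
    then show "\<one> \<in> P" unfolding P_def by (metis imageI one_closed)
    fix a b assume "a \<in> P" "b \<in> P"
    then obtain g h where "g \<in> carrier G" "h \<in> carrier G" "a = \<beta> g" "b = \<beta> h" by (auto simp: P_def)
    then show "a \<otimes> b \<in> P" unfolding P_def using hom[of g h] m_closed by (metis imageI)
  qed
  have C: "subgroup (centralizer x) G" by (rule centralizer_subgroup[OF fin x(1)])
  have "card (carrier G) = card P * card (centralizer x)"
    unfolding P_def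
  proof (rule card_fibres[OF fin C])
    fix g h assume g: "g \<in> carrier G" and h: "h \<in> carrier G"
    have "\<beta> g = \<beta> (g \<otimes> inv h) \<otimes> \<beta> h" using hom[of "g \<otimes> inv h" h] g h by (simp add: m_assoc)
    moreover have "\<beta> h \<in> carrier G" "\<beta> (g \<otimes> inv h) \<in> carrier G" using g h x(1) by (simp_all add: \<beta>_def)
    ultimately have "\<beta> g = \<beta> h \<longleftrightarrow> \<beta> (g \<otimes> inv h) = \<one>" by simp
    also have "\<dots> \<longleftrightarrow> g \<otimes> inv h \<in> centralizer x"
      using commutator_eq_one_iff[of "g \<otimes> inv h" x] g h x(1) by (simp add: \<beta>_def centralizer_def)
    finally show "\<beta> g = \<beta> h \<longleftrightarrow> g \<otimes> inv h \<in> centralizer x" .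
  qed
  moreover have "card (centralizer x) \<ge> p * card ?Z"
  proof -
    have sub: "?Z \<subseteq> centralizer x" by (rule center_subset_centralizer[OF x(1)])
    have "x \<in> centralizer x" using x(1) by (simp add: centralizer_def)
    then have ne: "?Z \<subset> centralizer x" using x(2) sub by blast
    have lt: "card ?Z < card (centralizer x)"
      by (rule psubset_card_mono[OF finite_subset[OF subgroup.subset[OF C] fin] ne])
    obtain f where f: "card ?Z = p ^ f" by (rule card_prime_power_subgroup[OF p card center_subgroup])
    obtain c where c: "card (centralizer x) = p ^ c" by (rule card_prime_power_subgroup[OF p card C])
    have "f < c" using lt p1 unfolding f c by simp
    then have "p ^ Suc f \<le> p ^ c" using p0 by (intro power_increasing) auto
    then show ?thesis using f c by simp
  qed
  ultimately have "card P * (p * card ?Z) \<le> p * (p * card ?Z)"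
    using Z by (metis mult_le_mono2 power2_eq_square mult.assoc)
  then have cP: "card P \<le> p" using Z0 p0 by simp
  have PN: "P \<lhd> G" by (rule central_subgroup_normal[OF P PZ])
  interpret PN: normal P G by (rule PN)
  interpret QP: group "G Mod P" by (rule PN.factorgroup_is_group)
  have finQP: "finite (carrier (G Mod P))" by (rule PN.finite_FactGroup[OF fin])
  have "comm_group (G Mod P)"
  proof (rule ccontr)
    assume nQ: "\<not> comm_group (G Mod P)"
    let ?S = "{g \<in> carrier G. P #> g \<in> grp_center (G Mod P)}"
    have S: "subgroup ?S G" "card ?S = card (grp_center (G Mod P)) * card P"
      by (rule preimage_subgroup[OF fin PN QP.center_subgroup])+
    have "?Z \<subseteq> ?S"
    proof
      fix z assume z: "z \<in> ?Z"
      have zc: "z \<in> carrier G" using z Zc by blast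
      have "g \<otimes> z \<otimes> inv g \<otimes> inv z \<in> P" if g: "g \<in> carrier G" for g
        using commutator_eq_one_iff[OF g zc] center_commutes[OF z g] subgroup.one_closed[OF P] by simp
      then show "z \<in> ?S" using coset_in_center_iff[OF PN zc] zc by blast
    qed
    moreover have "x \<in> ?S" using coset_in_center_iff[OF PN x(1)] x(1) by (auto simp: P_def \<beta>_def)
    ultimately have "?Z \<subset> ?S" using x(2) by blast
    then have lt: "card ?Z < card ?S" by (rule psubset_card_mono[rotated]) (use fin in simp)
    have P0: "card P > 0" using finite_subset[OF PZ finZ] subgroup.one_closed[OF P] card_gt_0_iff by blast
    have "card (carrier (G Mod P)) dvd p ^ e" using PN.card_FactGroup card by (metis dvd_triv_left)
    then obtain q where q: "card (carrier (G Mod P)) = p ^ q" using divides_primepow_nat[OF p] by blast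
    obtain s where s: "card (grp_center (G Mod P)) = p ^ s"
      by (rule QP.card_prime_power_subgroup[OF p q QP.center_subgroup])
    \<comment> \<open>A noncommutative \<open>G/P\<close> has centre of index at least
      \<open>p^2\<close>, but the preimage \<open>?S\<close> of that centre strictly contains the
      centre of \<open>G\<close>, which has index exactly \<open>p^2\<close>.\<close>
    have "s + 2 \<le> q" by (rule QP.not_commutative_imp_center_index[OF finQP p q nQ s])
    then have "p ^ (s + 2) \<le> p ^ q" using p0 by (intro power_increasing) auto
    then have "p ^ (s + 2) * card P \<le> p ^ q * card P" by simp
    also have "p ^ q * card P = p\<^sup>2 * card ?Z" using PN.card_FactGroup q Z by simp
    also have "p ^ (s + 2) * card P = p\<^sup>2 * card ?S" unfolding S(2) s by (simp only: power_add mult_ac)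
    finally show False using lt p0 by simp
  qed
  then have NP: "derived G (carrier G) \<subseteq> P" by (rule derived_subset_if_quotient_commutative[OF PN])
  show "card (derived G (carrier G)) = p"
    by (rule derived_eq_if_card_le_prime[OF fin p card nc subgroup.subset[OF P] NP cP])
qed

text \<open>The centre of \<open>?C\<close> contains the centre of \<open>G\<close> and
  \<open>y\<close>, so its order is at least \<open>p^(f+1)\<close>, while \<open>?C\<close> has
  order \<open>p^(e-1)\<close> with \<open>e - 1 \<le> f + 2\<close>. Its centre thus has index at
  most \<open>p\<close>.\<close>

lemma centralizer_commutative:
  assumes fin: "finite (carrier G)" and p: "Factorial_Ring.prime (p::nat)" and card: "card (carrier G) = p ^ e"
    and Z: "card (grp_center G) = p ^ f" "e \<le> f + 3" and y: "y \<in> carrier G" "y \<notin> grp_center G"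
    and C: "card (carrier G) = p * card (centralizer y)" and ab: "a \<in> centralizer y" "b \<in> centralizer y"
  shows "a \<otimes> b = b \<otimes> a"
proof -
  let ?C = "centralizer y"
  have p1: "p > 1" using prime_gt_1_nat[OF p] .
  have Cs: "subgroup ?C G" by (rule centralizer_subgroup[OF fin y(1)])
  interpret H: group "G\<lparr>carrier := ?C\<rparr>" by (rule subgroup.subgroup_is_group[OF Cs is_group])
  have finC: "finite ?C" by (rule finite_subset[OF subgroup.subset[OF Cs] fin])
  obtain c where c: "card ?C = p ^ c" by (rule card_prime_power_subgroup[OF p card Cs])
  have "p ^ e = p ^ Suc c" using C card c by simp
  then have ec: "e = Suc c" using p1 by (simp only: power_inject_exp)
  have "comm_group (G\<lparr>carrier := ?C\<rparr>)"
  proof (rule ccontr)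
    assume nH: "\<not> comm_group (G\<lparr>carrier := ?C\<rparr>)"
    let ?ZC = "grp_center (G\<lparr>carrier := ?C\<rparr>)"
    have cH: "card (carrier (G\<lparr>carrier := ?C\<rparr>)) = p ^ c" and fH: "finite (carrier (G\<lparr>carrier := ?C\<rparr>))" using c finC by simp_all
    obtain h where h: "card ?ZC = p ^ h" by (rule H.card_prime_power_subgroup[OF p cH H.center_subgroup])
    have hc: "h + 2 \<le> c" by (rule H.not_commutative_imp_center_index[OF fH p cH nH h])
    have "insert y (grp_center G) \<subseteq> ?ZC"
      using y(1) center_subset_centralizer[OF y(1)] by (auto simp: grp_center_def centralizer_def)
    moreover have "finite ?ZC" using finC by (simp add: grp_center_def)
    ultimately have "card (insert y (grp_center G)) \<le> card ?ZC" by (rule card_mono[rotated])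
    moreover have "finite (grp_center G)" by (rule finite_subset[OF subgroup.subset[OF center_subgroup] fin])
    ultimately have "p ^ f < p ^ h" using Z(1) h y(2) by simp
    then have "f < h" using p1 by simp
    then show False using hc ec Z(2) by linarith
  qed
  then interpret HC: comm_group "G\<lparr>carrier := ?C\<rparr>" .
  show ?thesis using HC.m_comm ab by simp
qed

text \<open>An element which is central modulo a central subgroup of order \<open>p\<close> has a normal centralizer of
  index \<open>p\<close>, and this centralizer is abelian for lack of space.\<close>

lemma nested_GVZ_center_index:
  assumes fin: "finite (carrier G)" and p: "Factorial_Ring.prime (p::nat)" and card: "card (carrier G) = p ^ e"
    and nc: "\<not> comm_group G" and gvz: "nested_GVZ G" and Z: "card (grp_center G) = p ^ f" "e \<le> f + 3"
    and N: "subgroup N G" "N \<subseteq> grp_center G" "card N = p"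
    and big: "card (grp_center G) < card (grp_center (G Mod N)) * p"
  shows "e = f + 2"
proof -
  have p0: "p > 0" and p1: "p > 1" using prime_gt_0_nat[OF p] prime_gt_1_nat[OF p] .
  have NN: "N \<lhd> G" by (rule central_subgroup_normal[OF N(1,2)])
  interpret NN: normal N G by (rule NN)
  interpret Q: group "G Mod N" by (rule NN.factorgroup_is_group)
  let ?S = "{g \<in> carrier G. N #> g \<in> grp_center (G Mod N)}"
  have "card ?S = card (grp_center (G Mod N)) * p"
    using preimage_subgroup(2)[OF fin NN Q.center_subgroup] N(3) by simp
  \<comment> \<open>By \<open>big\<close> more elements are central modulo \<open>N\<close> than in
    \<open>G\<close>; this provides \<open>y\<close>.\<close>
  then have "\<not> ?S \<subseteq> grp_center G"
    using big card_mono[OF finite_subset[OF subgroup.subset[OF center_subgroup] fin]] by (metis not_le)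
  then obtain y where y: "y \<in> carrier G" "y \<notin> grp_center G" "N #> y \<in> grp_center (G Mod N)" by blast
  have yN: "g \<otimes> y \<otimes> inv g \<otimes> inv y \<in> N" if "g \<in> carrier G" for g
    using coset_in_center_iff[OF NN y(1)] y(3) that by blast
  let ?C = "centralizer y"
  have C: "subgroup ?C G" by (rule centralizer_subgroup[OF fin y(1)])
  obtain c where c: "c \<le> e" "card ?C = p ^ c" by (rule card_prime_power_subgroup[OF p card C])
  have "?C \<noteq> carrier G"
  proof
    assume eq: "?C = carrier G"
    have "y \<otimes> g = g \<otimes> y" if "g \<in> carrier G" for g
    proof -
      have "g \<in> ?C" using that eq by simp
      then show ?thesis by (simp add: centralizer_def)
    qed
    then show False using y(1,2) unfolding grp_center_def by blast
  qed
  then have "card ?C \<noteq> p ^ e" using card_subset_eq[OF fin subgroup.subset[OF C]] card by metis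
  then have "c < e" using c by (metis le_neq_implies_less)
  \<comment> \<open>Commutators with \<open>y\<close> lie in \<open>N\<close> of order
    \<open>p\<close>, so the centralizer has index at most \<open>p\<close>.\<close>
  moreover have "p ^ e \<le> p ^ Suc c"
    using card_centralizer_bound[OF fin y(1) subgroup.subset[OF N(1)] yN] card c(2) N(3) by simp
  then have "e \<le> Suc c" by (rule power_le_imp_le_exp[OF p1])
  ultimately have "e = Suc c" by linarith
  then have cC: "card (carrier G) = p * card ?C" using card c(2) by simp
  have "?C \<lhd> G"
    unfolding normal_inv_iff
  proof (intro conjI ballI C)
    fix g h assume g: "g \<in> carrier G" and h: "h \<in> ?C"
    have hc: "h \<in> carrier G" using h by (simp add: centralizer_def)
    \<comment> \<open>As the commutators with \<open>y\<close> are central, \<open>G'\<close>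
      centralises \<open>y\<close>, and a subgroup containing \<open>G'\<close> is normal.\<close>
    have "g \<otimes> h \<otimes> inv g \<otimes> inv h \<otimes> y = y \<otimes> (g \<otimes> h \<otimes> inv g \<otimes> inv h)"
      by (rule commutes_with_derived_of_central_commutators[OF fin y(1) _ commutator_in_derived[OF g hc]])
         (use yN N(2) in blast)
    then have "g \<otimes> h \<otimes> inv g \<otimes> inv h \<in> ?C" using g hc by (simp add: centralizer_def)
    then have "(g \<otimes> h \<otimes> inv g \<otimes> inv h) \<otimes> h \<in> ?C" by (rule subgroup.m_closed[OF C _ h])
    then show "g \<otimes> h \<otimes> inv g \<in> ?C" using g hc by (simp add: m_assoc)
  qed
  then have "card (carrier G) = p\<^sup>2 * card (grp_center G)"
    by (rule nested_GVZ_abelian_prime_index[OF fin p card nc gvz _ cC])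
       (rule centralizer_commutative[OF fin p card Z y(1,2) cC])
  then have "p ^ e = p ^ (f + 2)" unfolding card Z(1) by (simp only: power_add mult.commute)
  then show ?thesis using p1 by (simp only: power_inject_exp)
qed

text \<open>An irreducible representation of the quotient inflates to one with the same invariant
  subspaces, and the centre of the inflated character is the full preimage, so vanishing and
  comparability both descend.\<close>

lemma nested_GVZ_quotient:
  assumes N: "N \<lhd> G" and gvz: "nested_GVZ G"
  shows "nested_GVZ (G Mod N)"
proof -
  interpret N: normal N G by (rule N)
  interpret Q: group "G Mod N" by (rule N.factorgroup_is_group)
  have cl: "N #> g \<in> carrier (G Mod N)" if "g \<in> carrier G" for g using that by (auto simp: carrier_FactGroup)
  have ex: "\<exists>g\<in>carrier G. s = N #> g" if "s \<in> carrier (G Mod N)" for s using that by (auto simp: carrier_FactGroup)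
  have one: "N #> \<one> = \<one>\<^bsub>G Mod N\<^esub>" using N.subset by (simp add: coset_mult_one)
  have irr: "inflate N \<chi> \<in> irr_chars G" if "\<chi> \<in> irr_chars (G Mod N)" for \<chi>
  proof -
    obtain d \<rho> where r: "irreducible_rep (G Mod N) d \<rho>"
      and c: "\<chi> = (\<lambda>g. if g \<in> carrier (G Mod N) then mat_trace (\<rho> g) else 0)"
      using \<open>\<chi> \<in> irr_chars (G Mod N)\<close> unfolding irr_chars_def by blast
    have rep: "is_rep (G Mod N) d \<rho>" using r by (simp add: irreducible_rep_def)
    have "is_rep G d (\<lambda>g. \<rho> (N #> g))"
      unfolding is_rep_def
    proof (intro conjI ballI)
      fix g assume g: "g \<in> carrier G"
      show "\<rho> (N #> g) \<in> carrier_mat d d" using rep cl[OF g] unfolding is_rep_def by blast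
      fix h assume h: "h \<in> carrier G"
      show "\<rho> (N #> (g \<otimes> h)) = \<rho> (N #> g) * \<rho> (N #> h)"
        using rep cl[OF g] cl[OF h] unfolding is_rep_def N.rcos_mult[OF g h, symmetric] by blast
    next
      show "\<rho> (N #> \<one>) = 1\<^sub>m d" using rep unfolding is_rep_def one by blast
    qed
    moreover have "invariant_subspace (G Mod N) d \<rho> W" if "invariant_subspace G d (\<lambda>g. \<rho> (N #> g)) W" for W
      using that ex unfolding invariant_subspace_def by metis
    ultimately have "irreducible_rep G d (\<lambda>g. \<rho> (N #> g))" using r unfolding irreducible_rep_def by blast
    moreover have "inflate N \<chi> = (\<lambda>g. if g \<in> carrier G then mat_trace (\<rho> (N #> g)) else 0)"
      using cl by (auto simp: inflate_def c)
    ultimately show ?thesis unfolding irr_chars_def by blast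
  qed
  have mem: "N #> g \<in> char_center (G Mod N) \<chi> \<longleftrightarrow> g \<in> char_center G (inflate N \<chi>)" if "g \<in> carrier G" for g \<chi>
    using that cl[OF that] by (simp add: char_center_def inflate_def one)
  have sub: "char_center (G Mod N) \<chi> \<subseteq> char_center (G Mod N) \<psi>"
    if "char_center G (inflate N \<chi>) \<subseteq> char_center G (inflate N \<psi>)" for \<chi> \<psi>
  proof
    fix s assume s: "s \<in> char_center (G Mod N) \<chi>"
    then have "s \<in> carrier (G Mod N)" by (simp add: char_center_def)
    then obtain g where g: "g \<in> carrier G" "s = N #> g" using ex by blast
    then show "s \<in> char_center (G Mod N) \<psi>" using mem[OF g(1)] s that by blast
  qed
  show ?thesis
    unfolding nested_GVZ_def
  proof (intro conjI ballI)
    fix \<chi> s assume c: "\<chi> \<in> irr_chars (G Mod N)" and s: "s \<in> carrier (G Mod N) - char_center (G Mod N) \<chi>"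
    obtain g where g: "g \<in> carrier G" "s = N #> g" using ex s by blast
    then have "g \<in> carrier G - char_center G (inflate N \<chi>)" using mem[OF g(1)] s by blast
    then have "inflate N \<chi> g = 0" using gvz irr[OF c] unfolding nested_GVZ_def by blast
    then show "\<chi> s = 0" using g by (simp add: inflate_def)
  next
    fix \<chi> \<psi> assume "\<chi> \<in> irr_chars (G Mod N)" "\<psi> \<in> irr_chars (G Mod N)"
    then have "char_center G (inflate N \<chi>) \<subseteq> char_center G (inflate N \<psi>) \<or> char_center G (inflate N \<psi>) \<subseteq> char_center G (inflate N \<chi>)"
      using gvz irr unfolding nested_GVZ_def by blast
    then show "char_center (G Mod N) \<chi> \<subseteq> char_center (G Mod N) \<psi> \<or> char_center (G Mod N) \<psi> \<subseteq> char_center (G Mod N) \<chi>"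
      using sub by blast
  qed
qed

text \<open>The centre has index at least \<open>p^2\<close> and order at least \<open>p\<close>, so
  the case to exclude is order \<open>p^4\<close> with centre of order \<open>p\<close>. There
  \<open>N = Z\<close> fits \<open>nested_GVZ_center_index\<close>, because the
  \<open>p\<close>-group \<open>G/Z\<close> has a centre of order at least \<open>p\<close>.\<close>

lemma nested_GVZ_small:
  assumes fin: "finite (carrier G)" and p: "Factorial_Ring.prime (p::nat)" and card: "card (carrier G) = p ^ e" "e \<le> 4"
    and nc: "\<not> comm_group G" and gvz: "nested_GVZ G"
  shows "card (grp_center G) = p ^ (e - 2)" and "e \<ge> 2"
proof -
  have p0: "p > 0" and p1: "p > 1" using prime_gt_0_nat[OF p] prime_gt_1_nat[OF p] .
  obtain f where f: "f \<le> e" "card (grp_center G) = p ^ f" by (rule card_prime_power_subgroup[OF p card(1) center_subgroup])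
  have fe: "f + 2 \<le> e" by (rule not_commutative_imp_center_index[OF fin p card(1) nc f(2)])
  have "p dvd p ^ f" using prime_dvd_card_center[OF fin p card(1)] fe f(2) by simp
  then have f0: "f \<noteq> 0" using p1 by (intro notI) simp
  have "e = f + 2"
  proof (rule ccontr)
    assume "e \<noteq> f + 2"
    then have f1: "f = 1" and e4: "e = 4" using fe f0 card(2) by linarith+
    have cZ: "card (grp_center G) = p" using f(2) f1 by simp
    interpret Z: normal "grp_center G" G by (rule center_normal)
    interpret Q: group "G Mod grp_center G" by (rule Z.factorgroup_is_group)
    have finQ: "finite (carrier (G Mod grp_center G))" by (rule Z.finite_FactGroup[OF fin])
    have p4: "p ^ 4 = p ^ 3 * p" by (simp add: eval_nat_numeral)
    have "card (carrier (G Mod grp_center G)) * p = p ^ 3 * p"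
      using Z.card_FactGroup unfolding card(1) e4 cZ p4 .
    then have cQ: "card (carrier (G Mod grp_center G)) = p ^ 3" using p0 by (metis mult_cancel2 not_less0)
    have "p dvd card (grp_center (G Mod grp_center G))" by (rule Q.prime_dvd_card_center[OF finQ p cQ]) simp
    moreover have "card (grp_center (G Mod grp_center G)) > 0"
      using finite_subset[OF subgroup.subset[OF Q.center_subgroup] finQ] subgroup.one_closed[OF Q.center_subgroup]
        card_gt_0_iff by blast
    ultimately have "p \<le> card (grp_center (G Mod grp_center G))" by (rule dvd_imp_le)
    then have "p * p \<le> card (grp_center (G Mod grp_center G)) * p" by (rule mult_le_mono1)
    moreover have "p * 1 < p * p" using p0 p1 by (intro mult_strict_left_mono)
    ultimately have "card (grp_center G) < card (grp_center (G Mod grp_center G)) * p" using cZ by linarith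
    then have "e = f + 2"
      using nested_GVZ_center_index[OF fin p card(1) nc gvz f(2) _ center_subgroup order_refl cZ] f1 e4 by linarith
    then show False using \<open>e \<noteq> f + 2\<close> by simp
  qed
  then show "card (grp_center G) = p ^ (e - 2)" "e \<ge> 2" using f(2) by simp_all
qed

text \<open>If the centre does not have index \<open>p^2\<close>, the order is \<open>p^5\<close> by
  \<open>nested_GVZ_small\<close> and the centre has order \<open>p\<close> or \<open>p^2\<close>.
  Order \<open>p^2\<close> is excluded through a central \<open>N\<close> of order \<open>p\<close>:
  the group \<open>G/N\<close> of order \<open>p^4\<close> is commutative or has centre of order
  \<open>p^2\<close>, so \<open>nested_GVZ_center_index\<close> would give index \<open>p^2\<close>
  after all. For order \<open>p\<close> the outcome depends on whether \<open>G/Z\<close> is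
  commutative, and then \<open>k = p^2\<close>.\<close>

lemma nested_GVZ_cases:
  assumes fin: "finite (carrier G)" and p: "Factorial_Ring.prime (p::nat)" and card: "card (carrier G) = p ^ e" "e \<le> 5"
    and nc: "\<not> comm_group G" and gvz: "nested_GVZ G"
  obtains k where "card (derived G (carrier G)) = p" "derived G (carrier G) \<subseteq> grp_center G"
      "k = p \<or> k = p\<^sup>2" "card (carrier G) = k\<^sup>2 * card (grp_center G)"
  | "card (carrier G) = p ^ 5" "card (grp_center G) = p" "card (grp_center (G Mod grp_center G)) = p\<^sup>2"
      "card (derived (G Mod grp_center G) (carrier (G Mod grp_center G))) = p"
      "derived (G Mod grp_center G) (carrier (G Mod grp_center G)) \<subseteq> grp_center (G Mod grp_center G)"
proof -
  let ?Z = "grp_center G"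
  have p0: "p > 0" and p1: "p > 1" using prime_gt_0_nat[OF p] prime_gt_1_nat[OF p] .
  obtain f where f: "f \<le> e" "card ?Z = p ^ f" by (rule card_prime_power_subgroup[OF p card(1) center_subgroup])
  have fe: "f + 2 \<le> e" by (rule not_commutative_imp_center_index[OF fin p card(1) nc f(2)])
  show thesis
  proof (cases "e = f + 2")
    case True
    then have Z: "card (carrier G) = p\<^sup>2 * card ?Z" unfolding card(1) f(2) True by (simp only: power_add mult.commute)
    show thesis
      by (rule that(1)[OF derived_of_center_index_prime_square(2)[OF fin p card(1) nc Z]
            derived_of_center_index_prime_square(1)[OF fin p card(1) nc Z] disjI1[OF refl] Z])
  next
    case False
    have "\<not> e \<le> 4"
    proof
      assume e4: "e \<le> 4"
      have "p ^ f = p ^ (e - 2)" "e \<ge> 2" using nested_GVZ_small[OF fin p card(1) e4 nc gvz] f(2) by simp_all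
      then have "f = e - 2" using p1 by (simp only: power_inject_exp)
      then show False using False fe by simp
    qed
    then have e5: "e = 5" using card(2) by linarith
    have "p dvd p ^ f" using prime_dvd_card_center[OF fin p card(1)] fe f(2) by simp
    then have f0: "f \<noteq> 0" using p1 by (intro notI) simp
    have f2: "e \<le> f + 3" if "f \<noteq> 1" using that f0 e5 by linarith
    have finZ: "finite ?Z" by (rule finite_subset[OF subgroup.subset[OF center_subgroup] fin])
    \<comment> \<open>Sylow's theorem inside the centre, in the form that provides subgroups of
      every prime power order dividing the group order, yields a central subgroup of order
      \<open>p\<close>.\<close>
    have "p ^ f = p ^ 1 * p ^ (f - 1)" unfolding power_add[symmetric] using f0 by simp
    then have ord: "Coset.order (G\<lparr>carrier := ?Z\<rparr>) = p ^ 1 * p ^ (f - 1)"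
      by (simp add: Coset.order_def f(2))
    have "finite (carrier (G\<lparr>carrier := ?Z\<rparr>))" using finZ by simp
    then obtain N where N0: "subgroup N (G\<lparr>carrier := ?Z\<rparr>)" "card N = p ^ 1"
      using sylow_thm[OF p subgroup.subgroup_is_group[OF center_subgroup is_group] ord] by blast
    have N: "subgroup N G" "N \<subseteq> ?Z" "card N = p"
      using incl_subgroup[OF center_subgroup N0(1)] subgroup.subset[OF N0(1)] N0(2) by simp_all
    have NN: "N \<lhd> G" by (rule central_subgroup_normal[OF N(1,2)])
    interpret NN: normal N G by (rule NN)
    let ?Q = "G Mod N"
    interpret Q: group ?Q by (rule NN.factorgroup_is_group)
    have finQ: "finite (carrier ?Q)" by (rule NN.finite_FactGroup[OF fin])
    have p5: "p ^ 5 = p ^ 4 * p" by (simp add: eval_nat_numeral)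
    have "card (carrier ?Q) * p = p ^ 4 * p"
      using NN.card_FactGroup unfolding card(1) e5 N(3) p5 .
    then have cQ: "card (carrier ?Q) = p ^ 4" using p0 by (metis mult_cancel2 not_less0)
    have gvzQ: "nested_GVZ ?Q" by (rule nested_GVZ_quotient[OF NN gvz])
    have cZQ: "card (grp_center ?Q) = p\<^sup>2" if "\<not> comm_group ?Q"
      using Q.nested_GVZ_small(1)[OF finQ p cQ order_refl that gvzQ] by simp
    have f1: "f = 1"
    proof (rule ccontr)
      assume "f \<noteq> 1"
      have "f \<le> 2" using False fe e5 by linarith
      have "p\<^sup>2 \<le> card (grp_center ?Q)"
      proof (cases "comm_group ?Q")
        case True
        then have "grp_center ?Q = carrier ?Q"
          using Q.comm_group_iff_center subgroup.subset[OF Q.center_subgroup] by blast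
        then show ?thesis using cQ p0 by (simp add: power_increasing)
      next
        case False
        then show ?thesis using cZQ by simp
      qed
      then have "p\<^sup>2 * p \<le> card (grp_center ?Q) * p" by (rule mult_le_mono1)
      moreover have "p ^ f < p ^ 3" using \<open>f \<le> 2\<close> p1 by (intro power_strict_increasing) simp_all
      moreover have "p ^ 3 = p\<^sup>2 * p" by (simp add: eval_nat_numeral)
      ultimately have "card ?Z < card (grp_center ?Q) * p" using f(2) by linarith
      then have "e = f + 2"
        by (rule nested_GVZ_center_index[OF fin p card(1) nc gvz f(2) f2[OF \<open>f \<noteq> 1\<close>] N])
      then show False using False by simp
    qed
    then have cZ: "card ?Z = p" using f(2) by simp
    have NZ: "N = ?Z" using card_subset_eq[OF finZ N(2)] N(3) cZ by simp
    have c5: "card (carrier G) = p ^ 5" using card(1) e5 by simp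
    show thesis
    proof (cases "comm_group ?Q")
      case True
      have DN: "derived G (carrier G) \<subseteq> N" by (rule derived_subset_if_quotient_commutative[OF NN True])
      have cD: "card (derived G (carrier G)) = p"
        by (rule derived_eq_if_card_le_prime[OF fin p card(1) nc NN.subset DN]) (simp add: N(3))
      have "card (carrier G) = (p\<^sup>2)\<^sup>2 * card ?Z" using c5 cZ by (simp add: eval_nat_numeral)
      then show thesis by (rule that(1)[OF cD subset_trans[OF DN N(2)] disjI2[OF refl]])
    next
      case False
      have "card (carrier ?Q) = p\<^sup>2 * card (grp_center ?Q)"
        unfolding cZQ[OF False] cQ by (simp add: eval_nat_numeral)
      note D = Q.derived_of_center_index_prime_square[OF finQ p cQ False this]
      show thesis by (rule that(2)[OF c5 cZ]) (use cZQ[OF False] D NZ in simp_all)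
    qed
  qed
qed

section \<open>Lower central series and nilpotency class\<close>

lemma lcs_carrier: "lcs G i \<subseteq> carrier G"
proof (induction i)
  case (Suc i)
  show ?case
    unfolding lcs.simps
  proof (rule generate_incl, clarify)
    fix x y assume "x \<in> lcs G i" "y \<in> carrier G"
    moreover then have "x \<in> carrier G" using Suc by blast
    ultimately show "x \<otimes> y \<otimes> inv x \<otimes> inv y \<in> carrier G" by simp
  qed
qed simp

lemma lcs_1: "lcs G 1 = derived G (carrier G)"
  by (simp add: derived_def)

lemma lcs_Suc_subset:
  assumes "subgroup S G" and "\<And>x y. x \<in> lcs G i \<Longrightarrow> y \<in> carrier G \<Longrightarrow> x \<otimes> y \<otimes> inv x \<otimes> inv y \<in> S"
  shows "lcs G (Suc i) \<subseteq> S"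
  by (simp, rule generate_subgroup_incl[OF _ assms(1)]) (use assms(2) in blast)

lemma lcs_Suc_trivial_iff: "lcs G (Suc i) = {\<one>} \<longleftrightarrow> lcs G i \<subseteq> grp_center G"
proof
  assume t: "lcs G (Suc i) = {\<one>}"
  show "lcs G i \<subseteq> grp_center G"
  proof
    fix x assume x: "x \<in> lcs G i"
    have xc: "x \<in> carrier G" using x lcs_carrier by blast
    have "x \<otimes> g = g \<otimes> x" if g: "g \<in> carrier G" for g
    proof -
      have "x \<otimes> g \<otimes> inv x \<otimes> inv g \<in> lcs G (Suc i)" unfolding lcs.simps by (rule generate.incl) (use x g in blast)
      then show ?thesis using commutator_eq_one_iff[OF xc g] unfolding t by blast
    qed
    then show "x \<in> grp_center G" using xc by (simp add: grp_center_def)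
  qed
next
  assume c: "lcs G i \<subseteq> grp_center G"
  have "x \<otimes> y \<otimes> inv x \<otimes> inv y \<in> {\<one>}" if "x \<in> lcs G i" "y \<in> carrier G" for x y
    using commutator_eq_one_iff[of x y] center_commutes[of x y] c lcs_carrier that by blast
  then have "lcs G (Suc i) \<subseteq> {\<one>}" by (rule lcs_Suc_subset[OF triv_subgroup])
  moreover have "\<one> \<in> lcs G (Suc i)" by (simp add: generate.one)
  ultimately show "lcs G (Suc i) = {\<one>}" by blast
qed

lemma lcs_0_1_not_trivial:
  assumes "\<not> comm_group G"
  shows "lcs G 0 \<noteq> {\<one>}" "lcs G 1 \<noteq> {\<one>}"
proof -
  show "lcs G 1 \<noteq> {\<one>}" using assms comm_group_iff_center lcs_Suc_trivial_iff[of 0] by simp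
  show "lcs G 0 \<noteq> {\<one>}"
    using assms subgroup.one_closed[OF center_subgroup] comm_group_iff_center by auto
qed

lemma nil_class_eq_2:
  assumes "\<not> comm_group G" "derived G (carrier G) \<subseteq> grp_center G"
  shows "nil_class G = 2"
  unfolding nil_class_def
proof (rule Least_equality)
  show "lcs G 2 = {\<one>}" using lcs_Suc_trivial_iff[of 1] assms(2) by (simp only: lcs_1 Suc_1)
  fix c assume "lcs G c = {\<one>}"
  then have "c \<noteq> 0" "c \<noteq> 1" using lcs_0_1_not_trivial[OF assms(1)] by (metis)+
  then show "2 \<le> c" by linarith
qed

lemma nil_class_eq_3:
  assumes "\<not> comm_group G" "\<not> derived G (carrier G) \<subseteq> grp_center G" "derived G (carrier G) \<subseteq> second_center"
  shows "nil_class G = 3"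
  unfolding nil_class_def
proof (rule Least_equality)
  have "lcs G (Suc 1) \<subseteq> grp_center G"
    by (rule lcs_Suc_subset[OF center_subgroup]) (use assms(3) second_center_commutators(2) in \<open>unfold lcs_1, blast\<close>)
  then have "lcs G (Suc (Suc 1)) = {\<one>}" using lcs_Suc_trivial_iff[of "Suc 1"] by blast
  moreover have "Suc (Suc 1) = 3" by simp
  ultimately show "lcs G 3 = {\<one>}" by (simp only:)
  fix c assume c: "lcs G c = {\<one>}"
  then have "c \<noteq> 0" "c \<noteq> 1" using lcs_0_1_not_trivial[OF assms(1)] by (metis)+
  moreover have "c \<noteq> 2" using c lcs_Suc_trivial_iff[of 1] assms(2) by (metis Suc_1 lcs_1)
  ultimately show "3 \<le> c" by linarith
qed

lemma derived_subset_second_center: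
  assumes "derived (G Mod grp_center G) (carrier (G Mod grp_center G)) \<subseteq> grp_center (G Mod grp_center G)"
  shows "derived G (carrier G) \<subseteq> second_center"
proof
  fix x assume x: "x \<in> derived G (carrier G)"
  let ?Z = "grp_center G"
  interpret Z: normal ?Z G by (rule center_normal)
  have gh: "group_hom G (G Mod ?Z) (\<lambda>a. ?Z #> a)"
    by (intro group_hom.intro group_hom_axioms.intro is_group Z.factorgroup_is_group Z.r_coset_hom_Mod)
  have xc: "x \<in> carrier G" using x subgroup.subset[OF derived_is_subgroup[OF order_refl]] by blast
  have "derived (G Mod ?Z) ((\<lambda>a. ?Z #> a) ` carrier G) = (\<lambda>a. ?Z #> a) ` derived G (carrier G)"
    by (rule group_hom.derived_img[OF gh order_refl])
  moreover have "(\<lambda>a. ?Z #> a) ` carrier G = carrier (G Mod ?Z)" by (simp add: carrier_FactGroup)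
  ultimately have "?Z #> x \<in> grp_center (G Mod ?Z)" using x assms by auto
  then show "x \<in> second_center" using coset_in_center_iff[OF center_normal xc] xc by (auto simp: second_center_def)
qed

lemma comm_group_quotient_if_derived_subset:
  assumes N: "N \<lhd> G" and D: "derived G (carrier G) \<subseteq> N"
  shows "comm_group (G Mod N)"
proof -
  interpret Q: group "G Mod N" by (rule normal.factorgroup_is_group[OF N])
  have "N #> x \<in> grp_center (G Mod N)" if x: "x \<in> carrier G" for x
    using coset_in_center_iff[OF N x] commutator_in_derived[OF _ x] D by blast
  then show ?thesis unfolding Q.comm_group_iff_center by (auto simp: carrier_FactGroup)
qed

end

theorem theorem6p3:
  fixes G :: "'a monoid" and p :: nat
  assumes "group G" and "finite (carrier G)"
    and "Factorial_Ring.prime p" and "odd p"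
    and "\<exists>k. card (carrier G) = p ^ k" and "card (carrier G) \<le> p ^ 5"
    and "\<not> comm_group G"
    and "nested_GVZ G"
  shows "nil_class G \<in> {2, 3}
    \<and> (nil_class G = 2 \<longrightarrow>
         (\<exists>m n k. grp_exponent (G Mod derived G (carrier G)) = p ^ m
            \<and> grp_exponent (G\<lparr>carrier := grp_center G\<rparr>) = p ^ n
            \<and> k ^ 2 = card (rcosets\<^bsub>G\<^esub> grp_center G)
            \<and> QG_iso_blocks G
                (concat (map (\<lambda>l. replicate
                    (num_cyclic_subgroups (G Mod derived G (carrier G)) (p ^ l)) (1, p ^ l)) [0..<m+1])
                 @ concat (map (\<lambda>l. replicate
                    (num_cyclic_subgroups (G\<lparr>carrier := grp_center G\<rparr>) (p ^ l)
                     - num_cyclic_subgroups (G\<lparr>carrier := grp_center G\<rparr> Mod derived G (carrier G)) (p ^ l))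
                    (k, p ^ l)) [1..<n+1]))))
    \<and> (nil_class G = 3 \<longrightarrow>
         (\<exists>m. grp_exponent (G Mod derived G (carrier G)) = p ^ m
            \<and> QG_iso_blocks G
                (concat (map (\<lambda>l. replicate
                    (num_cyclic_subgroups (G Mod derived G (carrier G)) (p ^ l)) (1, p ^ l)) [0..<m+1])
                 @ replicate p (p, p) @ [(p ^ 2, p)])))"
proof -
  interpret group G by (rule assms(1))
  note fin = assms(2) and p = assms(3) and odd = assms(4) and nc = assms(7) and gvz = assms(8)
  obtain e where card: "card (carrier G) = p ^ e" using assms(5) by blast
  have e: "e \<le> 5" using assms(6) unfolding card by (rule power_le_imp_le_exp[OF prime_gt_1_nat[OF p]])
  show ?thesis
  proof (rule nested_GVZ_cases[OF fin p card e nc gvz])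
    fix k assume D: "card (derived G (carrier G)) = p" "derived G (carrier G) \<subseteq> grp_center G"
      and k: "k = p \<or> k = p\<^sup>2" "card (carrier G) = k\<^sup>2 * card (grp_center G)"
    have c2: "nil_class G = 2" by (rule nil_class_eq_2[OF nc D(2)])
    show ?thesis
      by (intro conjI impI class2_decomposition[OF fin p odd card D k]) (use c2 in simp_all)
  next
    assume c5: "card (carrier G) = p ^ 5" and Z: "card (grp_center G) = p"
      and Q: "card (grp_center (G Mod grp_center G)) = p\<^sup>2"
        "card (derived (G Mod grp_center G) (carrier (G Mod grp_center G))) = p"
        "derived (G Mod grp_center G) (carrier (G Mod grp_center G)) \<subseteq> grp_center (G Mod grp_center G)"
    \<comment> \<open>A central \<open>G'\<close> would make \<open>G/Z\<close> commutative, hence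
      equal to its centre of order \<open>p^2\<close>, whereas \<open>G/Z\<close> has order
      \<open>p^4\<close>.\<close>
    have "\<not> derived G (carrier G) \<subseteq> grp_center G"
    proof
      assume "derived G (carrier G) \<subseteq> grp_center G"
      then have "comm_group (G Mod grp_center G)" by (rule comm_group_quotient_if_derived_subset[OF center_normal])
      interpret Z: normal "grp_center G" G by (rule center_normal)
      interpret Q: group "G Mod grp_center G" by (rule Z.factorgroup_is_group)
      have "grp_center (G Mod grp_center G) = carrier (G Mod grp_center G)"
        using \<open>comm_group (G Mod grp_center G)\<close> Q.comm_group_iff_center subgroup.subset[OF Q.center_subgroup] by blast
      then have "p\<^sup>2 * p = p ^ 5" using Z.card_FactGroup Q(1) Z c5 by simp
      then have "p ^ 3 = p ^ 5" by (simp add: eval_nat_numeral)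
      then have "3 = (5::nat)" using prime_gt_1_nat[OF p] by (simp only: power_inject_exp)
      then show False by simp
    qed
    then have c3: "nil_class G = 3"
      by (rule nil_class_eq_3[OF nc _ derived_subset_second_center[OF Q(3)]])
    show ?thesis
      by (intro conjI impI class3_decomposition[OF fin p odd c5 Z Q]) (use c3 in simp_all)
  qed
qed

end
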